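(* Let $T>0$ and let $Q^0\in H^2(\Omega)$ satisfy the prescribed boundary condition, with $r^0=r(Q^0)$. For the solutions of the numerical scheme with time step $\Delta t$, define for $n\ge1$ $$W_n=\frac L2\|\Delta Q^n\|^2+\frac1{2M}\sum_{k=0}^{n-1}\left\|\frac{\nabla Q^{k+1}-\nabla Q^k}{\Delta t}\right\|^2\Delta t ,$$ and $W_0=\frac L2\|\Delta Q^0\|^2$. Then, for all small enough $\Delta t$ (i.e. there is $\tau>0$ such that for all $0<\Delta t\le\tau$), one has $$W_n\le C(W_0,T)\qquad\text{for every integer } 1\le n\le\lfloor T/\Delta t\rfloor,$$ where $C(W_0,T)$ is a constant depending on $W_0$ and $T$ (and on the fixed data of the problem), but not on $n$ or $\Delta t$.
   Context: Let $d\in\{2,3\}$, let $\Omega\subset\mathbb{R}^d$ be a bounded open set with $C^2$ boundary, and let $M>0$, $L>0$, $a,b\in\mathbb{R}$, $c>0$ be constants. A Q-tensor is a symmetric trace-free real $d\times d$ matrix (or a function on $\Omega$ with such values). $\|\cdot\|$ is the $L^2(\Omega)$ norm, $A:B=\sum_{i,j}A_{ij}B_{ij}$ is the Frobenius inner product, $I$ is the $d\times d$ identity matrix. For Q-tensors $Q$ define $$\mathcal{F}_B(Q)=\frac a2\operatorname{tr}(Q^2)-\frac b3\operatorname{tr}(Q^3)+\frac c4\left(\operatorname{tr}(Q^2)\right)^2,\qquad r(Q)=\sqrt{2\mathcal{F}_B(Q)+A_0},$$ $$S(Q)=aQ-b\left(Q^2-\frac1d\operatorname{tr}(Q^2)I\right)+c\operatorname{tr}(Q^2)Q,\qquad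 P(Q)=\frac{S(Q)}{r(Q)},$$ where $A_0>0$ is a fixed constant, large enough that $2\mathcal{F}_B(Q)+A_0>0$ for every Q-tensor $Q$. Numerical scheme: given a time step $\Delta t>0$, a Q-tensor valued $Q^0\in H^2(\Omega)$ satisfying the boundary condition, and $r^0=r(Q^0)$, the Q-tensor valued functions $Q^{n+1}\in H^2(\Omega)$ and scalar functions $r^{n+1}$, $n\ge0$, are the (unique) solutions of $$\frac{Q^{n+1}-Q^n}{\Delta t}=M H^{n+1},\qquad r^{n+1}-r^n=P(Q^n):(Q^{n+1}-Q^n),\qquad H^{n+1}=L\Delta Q^{n+1}-r^{n+1}P(Q^n),$$ subject to one of the following boundary conditions, fixed once and for all and imposed for all $n$: $Q^n|_{\partial\Omega}=0$ (Dirichlet), or $\partial_nQ^n|_{\partial\Omega}=0$ (Neumann, normal derivative). The "fixed data of the problem" are $\Omega,d,M,L,a,b,c,A_0$, the boundary condition and the initial datum $Q^0$. *)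

theory Defs
  imports "HOL-Analysis.Analysis"
begin

primrec C_k :: "nat \<Rightarrow> (real^'n \<Rightarrow> 'b::euclidean_space) \<Rightarrow> bool" where
  "C_k 0 f \<longleftrightarrow> continuous_on UNIV f"
| "C_k (Suc k) f \<longleftrightarrow>
     (\<exists>D. (\<forall>x. (f has_derivative (\<lambda>h. \<Sum>i\<in>UNIV. (h $ i) *\<^sub>R D i x)) (at x)) \<and> (\<forall>i. C_k k (D i)))"

definition smooth :: "(real^'n \<Rightarrow> 'b::euclidean_space) \<Rightarrow> bool" where
  "smooth f \<longleftrightarrow> (\<forall>k. C_k k f)"

definition pderiv_at :: "'n \<Rightarrow> (real^'n \<Rightarrow> 'b::euclidean_space) \<Rightarrow> real^'n \<Rightarrow> 'b" where
  "pderiv_at k f x = frechet_derivative f (at x) (axis k 1)"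

(* Near each boundary point the set lies strictly above the graph of a C^2 function, in a rotated
   coordinate system whose last axis is the unit vector e. The graph function lives on the
   hyperplane orthogonal to e; it is represented by a C^2 function on the whole space that is only
   evaluated at the projection of x onto that hyperplane. *)
definition C2_boundary :: "(real^'n) set \<Rightarrow> bool" where
  "C2_boundary \<Omega> \<longleftrightarrow>
     (\<forall>p\<in>frontier \<Omega>. \<exists>\<rho>>0. \<exists>e (\<gamma> :: real^'n \<Rightarrow> real). norm e = 1 \<and> C_k 2 \<gamma> \<and>
        \<Omega> \<inter> ball p \<rho> = {x \<in> ball p \<rho>. x \<bullet> e > \<gamma> (x - (x \<bullet> e) *\<^sub>R e)})"

(* A unit vector, orthogonal to the boundary at x, pointing out of the set. It exists and is unique
   at every boundary point of a set with C^2 boundary in dimension at least 2. *)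
definition outward_unit_normal :: "(real^'n) set \<Rightarrow> real^'n \<Rightarrow> real^'n" where
  "outward_unit_normal \<Omega> x =
     (THE \<nu>. norm \<nu> = 1 \<and>
        ((\<lambda>y. ((y - x) \<bullet> \<nu>) / norm (y - x)) \<longlongrightarrow> 0) (at x within frontier \<Omega>) \<and>
        (\<forall>\<^sub>F t in at_right 0. x - t *\<^sub>R \<nu> \<in> \<Omega> \<and> x + t *\<^sub>R \<nu> \<notin> closure \<Omega>))"

(* Outer Hausdorff measure of dimension s >= 1, normalised so that it agrees with Lebesgue measure
   on s-dimensional subspaces. Covering sets are required to be bounded because diameter is
   meaningless on unbounded sets. *)
definition hausdorff_outer :: "nat \<Rightarrow> (real^'n) set \<Rightarrow> ennreal" where
  "hausdorff_outer s A =
     (SUP \<delta>\<in>{0<..}. INF U\<in>{U :: nat \<Rightarrow> (real^'n) set.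
          A \<subseteq> (\<Union>i. U i) \<and> (\<forall>i. bounded (U i) \<and> diameter (U i) \<le> (\<delta>::real))}.
        (\<Sum>i. ennreal (unit_ball_vol (real s) * (diameter (U i) / 2) ^ s)))"

definition hausdorff_measure :: "nat \<Rightarrow> (real^'n) measure" where
  "hausdorff_measure s = measure_of UNIV (sets borel) (hausdorff_outer s)"

definition surface_measure :: "(real^'n) set \<Rightarrow> (real^'n) measure" where
  "surface_measure \<Omega> = restrict_space (hausdorff_measure (CARD('n) - 1)) (frontier \<Omega>)"

definition L2_on :: "(real^'n) set \<Rightarrow> (real^'n \<Rightarrow> 'b::euclidean_space) \<Rightarrow> bool" where
  "L2_on \<Omega> u \<longleftrightarrow>
     u \<in> borel_measurable (lebesgue_on \<Omega>) \<and> integrable (lebesgue_on \<Omega>) (\<lambda>x. (norm (u x))\<^sup>2)"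

definition L2_norm :: "(real^'n) set \<Rightarrow> (real^'n \<Rightarrow> 'b::euclidean_space) \<Rightarrow> real" where
  "L2_norm \<Omega> u = sqrt (LINT x|lebesgue_on \<Omega>. (norm (u x))\<^sup>2)"

definition loc_integrable :: "(real^'n) set \<Rightarrow> (real^'n \<Rightarrow> 'b::euclidean_space) \<Rightarrow> bool" where
  "loc_integrable \<Omega> u \<longleftrightarrow> (\<forall>K. compact K \<and> K \<subseteq> \<Omega> \<longrightarrow> integrable (lebesgue_on K) u)"

definition test_function :: "(real^'n) set \<Rightarrow> (real^'n \<Rightarrow> real) \<Rightarrow> bool" where
  "test_function \<Omega> \<phi> \<longleftrightarrow>
     smooth \<phi> \<and> compact (closure {x. \<phi> x \<noteq> 0}) \<and> closure {x. \<phi> x \<noteq> 0} \<subseteq> \<Omega>"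

definition has_weak_pderiv ::
    "(real^'n) set \<Rightarrow> 'n \<Rightarrow> (real^'n \<Rightarrow> 'b::euclidean_space) \<Rightarrow> (real^'n \<Rightarrow> 'b) \<Rightarrow> bool" where
  "has_weak_pderiv \<Omega> k u g \<longleftrightarrow> loc_integrable \<Omega> u \<and> loc_integrable \<Omega> g \<and>
     (\<forall>\<phi>. test_function \<Omega> \<phi> \<longrightarrow>
        (LINT x|lebesgue_on \<Omega>. pderiv_at k \<phi> x *\<^sub>R u x) = - (LINT x|lebesgue_on \<Omega>. \<phi> x *\<^sub>R g x))"

(* Weak derivatives are unique up to null sets; this picks a representative. *)
definition weak_pderiv ::
    "(real^'n) set \<Rightarrow> 'n \<Rightarrow> (real^'n \<Rightarrow> 'b::euclidean_space) \<Rightarrow> real^'n \<Rightarrow> 'b" where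
  "weak_pderiv \<Omega> k u = (SOME g. has_weak_pderiv \<Omega> k u g)"

definition weak_grad ::
    "(real^'n) set \<Rightarrow> (real^'n \<Rightarrow> 'b::euclidean_space) \<Rightarrow> real^'n \<Rightarrow> 'b^'n" where
  "weak_grad \<Omega> u x = (\<chi> k. weak_pderiv \<Omega> k u x)"

definition weak_laplacian ::
    "(real^'n) set \<Rightarrow> (real^'n \<Rightarrow> 'b::euclidean_space) \<Rightarrow> real^'n \<Rightarrow> 'b" where
  "weak_laplacian \<Omega> u x = (\<Sum>k\<in>UNIV. weak_pderiv \<Omega> k (weak_pderiv \<Omega> k u) x)"

definition H1 :: "(real^'n) set \<Rightarrow> (real^'n \<Rightarrow> 'b::euclidean_space) \<Rightarrow> bool" where
  "H1 \<Omega> u \<longleftrightarrow> L2_on \<Omega> u \<and> (\<forall>k. \<exists>g. has_weak_pderiv \<Omega> k u g \<and> L2_on \<Omega> g)"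

definition H2 :: "(real^'n) set \<Rightarrow> (real^'n \<Rightarrow> 'b::euclidean_space) \<Rightarrow> bool" where
  "H2 \<Omega> u \<longleftrightarrow> L2_on \<Omega> u \<and> (\<forall>k. \<exists>g. has_weak_pderiv \<Omega> k u g \<and> H1 \<Omega> g)"

(* The trace operator is the continuous extension, from H^1 of the domain to L^2 of its boundary,
   of the restriction of smooth functions to the boundary. *)
definition has_trace ::
    "(real^'n) set \<Rightarrow> (real^'n \<Rightarrow> 'b::euclidean_space) \<Rightarrow> (real^'n \<Rightarrow> 'b) \<Rightarrow> bool" where
  "has_trace \<Omega> u g \<longleftrightarrow> H1 \<Omega> u \<and> g \<in> borel_measurable (surface_measure \<Omega>) \<and>
     (\<exists>\<phi> :: nat \<Rightarrow> real^'n \<Rightarrow> 'b. (\<forall>m. smooth (\<phi> m)) \<and>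
        (\<lambda>m. L2_norm \<Omega> (\<lambda>x. \<phi> m x - u x)) \<longlonglongrightarrow> 0 \<and>
        (\<forall>k. (\<lambda>m. L2_norm \<Omega> (\<lambda>x. pderiv_at k (\<phi> m) x - weak_pderiv \<Omega> k u x)) \<longlonglongrightarrow> 0) \<and>
        (\<lambda>m. \<integral>\<^sup>+x. ennreal ((norm (\<phi> m x - g x))\<^sup>2) \<partial>surface_measure \<Omega>) \<longlonglongrightarrow> 0)"

datatype bdry_cond = Dirichlet | Neumann

(* Intended for u in H^2, so that u and its first weak derivatives have traces. *)
fun satisfies_bc ::
    "(real^'n) set \<Rightarrow> bdry_cond \<Rightarrow> (real^'n \<Rightarrow> 'b::euclidean_space) \<Rightarrow> bool" where
  "satisfies_bc \<Omega> Dirichlet u \<longleftrightarrow> has_trace \<Omega> u (\<lambda>_. 0)"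
| "satisfies_bc \<Omega> Neumann u \<longleftrightarrow>
     (\<exists>G. (\<forall>k. has_trace \<Omega> (weak_pderiv \<Omega> k u) (G k)) \<and>
        (AE x in surface_measure \<Omega>. (\<Sum>k\<in>UNIV. (outward_unit_normal \<Omega> x $ k) *\<^sub>R G k x) = 0))"

definition Q_tensor :: "real^'n^'n \<Rightarrow> bool" where
  "Q_tensor A \<longleftrightarrow> transpose A = A \<and> trace A = 0"

definition F_B :: "real \<Rightarrow> real \<Rightarrow> real \<Rightarrow> real^'n^'n \<Rightarrow> real" where
  "F_B a b c Q = a/2 * trace (Q ** Q) - b/3 * trace (Q ** Q ** Q) + c/4 * (trace (Q ** Q))\<^sup>2"

definition r_aux :: "real \<Rightarrow> real \<Rightarrow> real \<Rightarrow> real \<Rightarrow> real^'n^'n \<Rightarrow> real" where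
  "r_aux a b c A0 Q = sqrt (2 * F_B a b c Q + A0)"

definition S_bulk :: "real \<Rightarrow> real \<Rightarrow> real \<Rightarrow> real^'n^'n \<Rightarrow> real^'n^'n" where
  "S_bulk a b c Q =
     a *\<^sub>R Q - b *\<^sub>R (Q ** Q - (1 / real CARD('n) * trace (Q ** Q)) *\<^sub>R mat 1)
       + (c * trace (Q ** Q)) *\<^sub>R Q"

definition P_bulk :: "real \<Rightarrow> real \<Rightarrow> real \<Rightarrow> real \<Rightarrow> real^'n^'n \<Rightarrow> real^'n^'n" where
  "P_bulk a b c A0 Q = (1 / r_aux a b c A0 Q) *\<^sub>R S_bulk a b c Q"

(* On matrices, the inner product of the library is the Frobenius product and norm is the
   Frobenius norm. *)
definition scheme_solution ::
    "(real^'n) set \<Rightarrow> bdry_cond \<Rightarrow> real \<Rightarrow> real \<Rightarrow> real \<Rightarrow> real \<Rightarrow> real \<Rightarrow> real \<Rightarrow>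
     (real^'n \<Rightarrow> real^'n^'n) \<Rightarrow> real \<Rightarrow>
     (nat \<Rightarrow> real^'n \<Rightarrow> real^'n^'n) \<Rightarrow> (nat \<Rightarrow> real^'n \<Rightarrow> real) \<Rightarrow> (nat \<Rightarrow> real^'n \<Rightarrow> real^'n^'n) \<Rightarrow> bool"
  where
  "scheme_solution \<Omega> bc M L a b c A0 Q0 dt Q r H \<longleftrightarrow>
     Q 0 = Q0 \<and> (AE x in lebesgue_on \<Omega>. r 0 x = r_aux a b c A0 (Q0 x)) \<and>
     (\<forall>n. H2 \<Omega> (Q n) \<and> (AE x in lebesgue_on \<Omega>. Q_tensor (Q n x)) \<and> satisfies_bc \<Omega> bc (Q n)) \<and>
     (\<forall>n. AE x in lebesgue_on \<Omega>.
        (1 / dt) *\<^sub>R (Q (Suc n) x - Q n x) = M *\<^sub>R H (Suc n) x \<and>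
        r (Suc n) x - r n x = P_bulk a b c A0 (Q n x) \<bullet> (Q (Suc n) x - Q n x) \<and>
        H (Suc n) x = L *\<^sub>R weak_laplacian \<Omega> (Q (Suc n)) x - r (Suc n) x *\<^sub>R P_bulk a b c A0 (Q n x))"

definition W_quantity ::
    "(real^'n) set \<Rightarrow> real \<Rightarrow> real \<Rightarrow> real \<Rightarrow> (nat \<Rightarrow> real^'n \<Rightarrow> real^'n^'n) \<Rightarrow> nat \<Rightarrow> real" where
  "W_quantity \<Omega> M L dt Q n =
     L/2 * (L2_norm \<Omega> (weak_laplacian \<Omega> (Q n)))\<^sup>2
     + 1 / (2*M) * (\<Sum>k<n. (L2_norm \<Omega> (\<lambda>x. (1 / dt) *\<^sub>R
           (weak_grad \<Omega> (Q (Suc k)) x - weak_grad \<Omega> (Q k) x)))\<^sup>2 * dt)"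

end

theory Submission
 imports Defs
begin

text \<open>The discrete energy law bounds \<open>Q\<^sup>n\<close> in \<open>H\<^sup>1\<close>, hence by Sobolev in \<open>L\<^sup>6\<close>, uniformly up to time \<open>T\<close>.
Testing the scheme with the increment of the Laplacian and summing by parts in time leaves only
increments of the nonlinearity. They are estimated by Hoelder's inequality, because \<open>r\<^sup>n\<close> deviates
from \<open>r(Q\<^sup>n)\<close> only by a sum of squared increments, and a discrete Gronwall argument concludes.
Green's formula, which both tests need, is obtained by mollifying in the directions of an inner cone and
comparing graph integrals with the Hausdorff measure of the boundary.\<close>

text \<open>The quartic growth of the potential makes \<open>r_aux\<close> comparable to (1 + |Q|)^2
  on Q-tensors, so \<open>P_bulk\<close> is Lipschitz with linear growth and \<open>r_aux\<close>
  has a quadratic Taylor remainder. Every nonlinear integrand is then a product of three factors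
  such as |Q|^2, |e|^2 or r, each estimated in L^3; squares of H^1 functions lie in L^3 by the
  embedding into L^6, available in dimensions 2 and 3. The obstacle is a circle: the L^3 bound of r
  contains the sum of the squared H^1 increments, itself controlled only through dt times the
  quantity to be estimated. The Gronwall induction therefore carries the bound dt * Y <= 1 along,
  and closing it forces dt to be small. In Green's formula the boundary condition is known only
  through smooth fields that approach a trace. The defect of integration by parts against such a
  field is bounded by the H^1 norm of the other factor times the L^2 distance, on the boundary, of
  the field from one with vanishing normal component; this distance tends to zero.\<close>

abbreviation nn_lborel :: "('a::euclidean_space => ennreal) => ennreal" (binder "NI " 10) where
 "nn_lborel f == nn_integral lborel f"

abbreviation scale_real :: "real => 'a::real_vector => 'a" (infixr "*R" 75) where
 "a *R x == a *\<^sub>R x"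

abbreviation seq_limit :: "(nat => 'a::topological_space) => 'a => bool" (infixr "---->" 60) where
 "X ----> l == X \<longlonglongrightarrow> l"

section \<open>Calculus of \<open>C_k\<close> functions and smooth bumps\<close>

lemma C_k_SucI:
 "(!!x. (f has_derivative (%h. \<Sum>i\<in>UNIV. (h $ i) *R D i x)) (at x)) ==>
  (!!i. C_k k (D i)) ==> C_k (Suc k) f"
 unfolding C_k.simps by (intro exI[of _ D]) simp

lemma C_k_SucE:
 assumes "C_k (Suc k) f"
 obtains D where "!!x. (f has_derivative (%h. \<Sum>i\<in>UNIV. (h $ i) *R D i x)) (at x)"
  and "!!i. C_k k (D i)"
proof -
 from assms obtain D where D: "(\<forall>x. (f has_derivative (%h. \<Sum>i\<in>UNIV. (h $ i) *R D i x)) (at x)) \<and>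
   (\<forall>i. C_k k (D i))" unfolding C_k.simps(2) by (rule exE)
 show ?thesis by (rule that) (rule D[THEN conjunct1, THEN spec], rule D[THEN conjunct2, THEN spec])
qed

lemma C_k_SucD: "C_k (Suc k) f ==> C_k k f"
proof (induction k arbitrary: f)
 case 0
 then show ?case
  by (auto intro!: continuous_at_imp_continuous_on dest: has_derivative_continuous)
next
 case (Suc k)
 obtain D where D: "!!x. (f has_derivative (%h. \<Sum>i\<in>UNIV. (h $ i) *R D i x)) (at x)"
  and D2: "!!i. C_k (Suc k) (D i)" by (rule C_k_SucE[OF Suc.prems(1)]) (rule that)
 from C_k_SucI[OF D Suc.IH[OF D2]] show ?case .
qed

lemma C_k_bounded_linear:
 assumes L: "bounded_linear L" shows "C_k k f ==> C_k k (%x. L (f x))"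
proof (induction k arbitrary: f)
 case 0
 then show ?case using bounded_linear.continuous_on[OF L] by simp
next
 case (Suc k)
 obtain D where D: "!!x. (f has_derivative (%h. \<Sum>i\<in>UNIV. (h $ i) *R D i x)) (at x)"
  and D2: "!!i. C_k k (D i)" by (rule C_k_SucE[OF Suc.prems(1)]) (rule that)
 interpret L: bounded_linear L by fact
 have "((%x. L (f x)) has_derivative (%h. \<Sum>i\<in>UNIV. (h $ i) *R L (D i x))) (at x)" for x
  using L.has_derivative[OF D[of x]] by (simp only: L.sum L.scaleR)
 from C_k_SucI[OF this Suc.IH[OF D2]] show ?case .
qed

lemma C_k_add: "C_k k f ==> C_k k g ==> C_k k (%x. f x + g x)"
proof (induction k arbitrary: f g)
 case 0
 then show ?case by (simp add: continuous_on_add)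
next
 case (Suc k)
 obtain D where D: "!!x. (f has_derivative (%h. \<Sum>i\<in>UNIV. (h $ i) *R D i x)) (at x)"
  and D2: "!!i. C_k k (D i)" by (rule C_k_SucE[OF Suc.prems(1)]) (rule that)
 obtain E where E: "!!x. (g has_derivative (%h. \<Sum>i\<in>UNIV. (h $ i) *R E i x)) (at x)"
  and E2: "!!i. C_k k (E i)" by (rule C_k_SucE[OF Suc.prems(2)]) (rule that)
 have "((%x. f x + g x) has_derivative (%h. \<Sum>i\<in>UNIV. (h $ i) *R (D i x + E i x))) (at x)" for x
  using has_derivative_add[OF D[of x] E[of x]] by (simp add: scaleR_add_right sum.distrib)
 from C_k_SucI[OF this Suc.IH[OF D2 E2]] show ?case .
qed

text \<open>Induction by the product rule. The new partial derivatives again contain the factors f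
  and g themselves, so their order has to be lowered by \<open>C_k_SucD\<close> before the induction
  hypothesis applies.\<close>

lemma C_k_mult:
 fixes f g :: "real^'n => real"
 shows "C_k k f ==> C_k k g ==> C_k k (%x. f x * g x)"
proof (induction k arbitrary: f g)
 case 0
 then show ?case by (simp add: continuous_on_mult)
next
 case (Suc k)
 obtain D where D: "!!x. (f has_derivative (%h. \<Sum>i\<in>UNIV. (h $ i) *R D i x)) (at x)"
  and D2: "!!i. C_k k (D i)" by (rule C_k_SucE[OF Suc.prems(1)]) (rule that)
 obtain E where E: "!!x. (g has_derivative (%h. \<Sum>i\<in>UNIV. (h $ i) *R E i x)) (at x)"
  and E2: "!!i. C_k k (E i)" by (rule C_k_SucE[OF Suc.prems(2)]) (rule that)
 have "((%x. f x * g x) has_derivative (%h. \<Sum>i\<in>UNIV. (h $ i) *R (f x * E i x + D i x * g x))) (at x)" for x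
 proof -
  have "(%h. f x * (\<Sum>i\<in>UNIV. (h $ i) *R E i x) + (\<Sum>i\<in>UNIV. (h $ i) *R D i x) * g x) =
    (%h. \<Sum>i\<in>UNIV. (h $ i) *R (f x * E i x + D i x * g x))"
   by (simp add: sum_distrib_left sum_distrib_right distrib_left sum.distrib mult_ac)
  from has_derivative_mult[OF D[of x] E[of x], unfolded this] show ?thesis .
 qed
 moreover have "C_k k (%x. f x * E i x + D i x * g x)" for i
  by (intro C_k_add Suc.IH C_k_SucD[OF Suc.prems(1)] C_k_SucD[OF Suc.prems(2)] D2 E2)
 ultimately show ?case by (rule C_k_SucI)
qed

lemma C_k_const: "C_k k (%x. c)"
proof (induction k arbitrary: c)
 case (Suc k)
 have "((%x. c) has_derivative (%h. \<Sum>i\<in>UNIV. (h $ i) *R 0)) (at x)" for x :: "real^'n"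
  by simp
 from C_k_SucI[OF this Suc] show ?case .
qed simp

lemma C_k_affine: "C_k k f ==> C_k k (%x. f (s *R x + a))"
proof (induction k arbitrary: f)
 case 0
 then show ?case by (auto intro!: continuous_intros continuous_on_compose2[of UNIV f])
next
 case (Suc k)
 obtain D where D: "!!x. (f has_derivative (%h. \<Sum>i\<in>UNIV. (h $ i) *R D i x)) (at x)"
  and D2: "!!i. C_k k (D i)" by (rule C_k_SucE[OF Suc.prems(1)]) (rule that)
 have "((%x. f (s *R x + a)) has_derivative (%h. \<Sum>i\<in>UNIV. (h $ i) *R (s *R D i (s *R x + a)))) (at x)" for x
 proof -
  have "((%x. s *R x + a) has_derivative (%h. s *R h)) (at x)"
   by (auto intro!: derivative_eq_intros)
  from has_derivative_compose[OF this D] show ?thesis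
   by (simp only: scaleR_scaleR vector_scaleR_component real_scaleR_def mult.commute)
 qed
 from C_k_SucI[OF this C_k_bounded_linear[OF bounded_linear_scaleR_right Suc.IH[OF D2]]] show ?case .
qed

text \<open>Bridge between gradients as vectors, used by \<open>C1\<close>, and the coordinate sums
  used by \<open>C_k\<close>.\<close>

lemma has_derivative_coords:
 fixes f :: "real^'n => real"
 shows "(f has_derivative (%h. h \<bullet> g)) F \<longleftrightarrow> (f has_derivative (%h. \<Sum>i\<in>UNIV. (h $ i) *R (g $ i))) F"
 by (simp add: inner_vec_def)

lemma C_k_coord: "C_k k (%x::real^'n. x $ i)"
proof (cases k)
 case (Suc m)
 have "((%x::real^'n. x $ i) has_derivative (%h. \<Sum>j\<in>UNIV. (h $ j) *R (if j = i then 1 else 0))) (at x)" for x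
 proof -
  have "(%h::real^'n. \<Sum>j\<in>UNIV. (h $ j) *R (if j = i then 1 else 0)) = (%h. h $ i)"
   by (simp add: if_distrib cong: if_cong)
  then show ?thesis
   using bounded_linear_imp_has_derivative[OF bounded_linear_vec_nth[of i]] by metis
 qed
 from C_k_SucI[OF this C_k_const] show ?thesis unfolding Suc .
qed (simp add: continuous_intros)

text \<open>The classical smooth functions built from \<open>exp (-1/t)\<close>; the family is closed under derivation.\<close>

definition bump_exp :: "nat => real => real" where
 "bump_exp m t = (if t <= 0 then 0 else (1/t)^m * exp (- (1/t)))"

text \<open>With s = 1/t the right-hand limit is that of s^m exp(-s) at infinity; on the left the
  function is constantly 0.\<close>

lemma bump_exp_tendsto_0: "(bump_exp m \<longlongrightarrow> 0) (at 0)"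
proof -
 have "((%t::real. (1/t)^m * exp (- (1/t))) \<longlongrightarrow> 0) (at_right 0)"
 proof -
  have "filterlim (%t::real. 1/t) at_top (at_right 0)"
   using filterlim_inverse_at_top_right by (simp add: inverse_eq_divide)
  from filterlim_compose[OF tendsto_power_div_exp_0[of m] this]
  show ?thesis by (simp add: exp_minus divide_inverse)
 qed
 then have "(bump_exp m \<longlongrightarrow> 0) (at_right 0)"
  by (rule Lim_transform_eventually) (auto simp: bump_exp_def eventually_at_filter)
 moreover have "(bump_exp m \<longlongrightarrow> 0) (at_left 0)"
  by (rule Lim_transform_eventually[OF tendsto_const]) (auto simp: bump_exp_def eventually_at_filter)
 ultimately show ?thesis using filterlim_split_at by blast
qed

lemma bump_exp_deriv:
 "(bump_exp m has_real_derivative (bump_exp (m+2) t - real m * bump_exp (m+1) t)) (at t)"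
proof -
 consider "t < 0" | "t = 0" | "t > 0" by linarith
 then show ?thesis
 proof cases
  case 1
  have "(bump_exp m has_real_derivative 0) (at t)"
   by (rule has_field_derivative_transform_within_open[OF DERIV_const[of 0 "at t"], of "{..<0}"])
    (use 1 in \<open>auto simp: bump_exp_def\<close>)
  then show ?thesis using 1 by (simp add: bump_exp_def)
 next
  case 2
  \<comment> \<open>At 0 the difference quotient of \<open>bump_exp m\<close> is
    \<open>bump_exp (Suc m)\<close>, which tends to 0.\<close>
  have "((%h. (bump_exp m (0 + h) - bump_exp m 0) / h) \<longlongrightarrow> 0) (at 0)"
   by (rule Lim_transform_eventually[OF bump_exp_tendsto_0[of "Suc m"]])
    (auto simp: bump_exp_def eventually_at_filter)
  then have "(bump_exp m has_real_derivative 0) (at 0)"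
   unfolding DERIV_def .
  then show ?thesis using 2 by (simp add: bump_exp_def)
 next
  case 3
  have "((%t. (1/t)^m * exp (- (1/t))) has_real_derivative
    (1/t)^(m+2) * exp (- (1/t)) - real m * ((1/t)^(m+1) * exp (- (1/t)))) (at t)"
  proof -
   have u: "((%t::real. 1/t) has_real_derivative - ((1/t)^2)) (at t)"
    using 3 by (auto intro!: derivative_eq_intros simp: power2_eq_square field_simps)
   have "((%t. (1/t)^m * exp (- (1/t))) has_real_derivative
     (real m * ((1/t)^(m - 1) * - ((1/t)^2))) * exp (- (1/t)) + (exp (- (1/t)) * - (- ((1/t)^2))) * (1/t)^m) (at t)"
    using DERIV_mult[OF DERIV_power[OF u, of m] DERIV_fun_exp[OF DERIV_minus[OF u]]]
    by (simp add: mult_ac)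
   then show ?thesis
    by (cases m) (simp_all add: power_add power2_eq_square algebra_simps)
  qed
  then have "(bump_exp m has_real_derivative
    (1/t)^(m+2) * exp (- (1/t)) - real m * ((1/t)^(m+1) * exp (- (1/t)))) (at t)"
   by (rule has_field_derivative_transform_within_open[of _ _ t "{0<..}"])
    (use 3 in \<open>auto simp: bump_exp_def\<close>)
  then show ?thesis using 3 by (simp add: bump_exp_def)
 qed
qed

text \<open>The induction runs over all \<open>m\<close> at once, because every derivative raises
  the index by one or two.\<close>

lemma C_k_bump_exp_ball: "C_k k (%x::real^'n. bump_exp m (1 - x \<bullet> x))"
proof (induction k arbitrary: m)
 case 0
 have "continuous_on UNIV (bump_exp m)"
  by (meson DERIV_isCont bump_exp_deriv continuous_at_imp_continuous_on)
 then show ?case by (auto intro!: continuous_intros continuous_on_compose2[of UNIV "bump_exp m"])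
next
 case (Suc k)
 let ?D = "%i x::real^'n. (bump_exp (m+2) (1 - x \<bullet> x) + (- real m) * bump_exp (m+1) (1 - x \<bullet> x)) * ((-2) * x $ i)"
 have "((%x::real^'n. bump_exp m (1 - x \<bullet> x)) has_derivative (%h. \<Sum>i\<in>UNIV. (h $ i) *R ?D i x)) (at x)" for x
 proof -
  have a: "((%x::real^'n. 1 - x \<bullet> x) has_derivative (%h. - 2 * (x \<bullet> h))) (at x)"
   by (auto intro!: derivative_eq_intros simp: inner_commute)
  have eq: "(%h. c * (- 2 * (x \<bullet> h))) = (%h. \<Sum>i\<in>UNIV. (h $ i) *R (c * ((-2) * x $ i)))" for c
   by (auto simp: inner_vec_def sum_distrib_left fun_eq_iff intro!: sum.cong)
  from has_derivative_compose[where g="bump_exp m" and f="%x::real^'n. 1 - x \<bullet> x",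
    OF a bump_exp_deriv[of m "1 - x \<bullet> x", unfolded has_field_derivative_def], unfolded eq]
  show ?thesis by simp
 qed
 moreover have "C_k k (?D i)" for i
  by (intro C_k_mult C_k_add C_k_const C_k_coord Suc.IH)
 ultimately show ?case by (rule C_k_SucI)
qed

section \<open>Translation in the mean\<close>

lemma lborel_integrable_translate:
 fixes f :: "'a::euclidean_space => 'b::{banach, second_countable_topology}"
 assumes f: "integrable lborel f" shows "integrable lborel (%x. f (x + h))"
proof -
 have "integrable (distr lborel borel ((+) h)) f" using f by (simp add: lborel_distr_plus)
 then have "integrable lborel (%x. f (h + x))" by (subst (asm) integrable_distr_eq) (use f in auto)
 then show ?thesis by (simp add: add.commute)
qed

lemma lborel_integral_translate:
 fixes f :: "'a::euclidean_space => 'b::{banach, second_countable_topology}"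
 assumes [measurable]: "f \<in> borel_measurable borel"
 shows "(LBINT x. f (x + h)) = (LBINT x. f x)"
proof -
 have "(LBINT x. f x) = (\<integral>x. f x \<partial>distr lborel borel ((+) h))" by (simp add: lborel_distr_plus)
 also have "... = (LBINT x. f (h + x))" by (subst integral_distr) auto
 finally show ?thesis by (simp add: add.commute)
qed

lemma lborel_nn_integral_translate:
 fixes f :: "'a::euclidean_space => ennreal"
 assumes [measurable]: "f \<in> borel_measurable borel"
 shows "(NI x. f (x + h)) = (NI x. f x)"
proof -
 have "(NI x. f x) = (\<integral>\<^sup>+x. f x \<partial>distr lborel borel ((+) h))" by (simp add: lborel_distr_plus)
 also have "... = (NI x. f (h + x))" by (subst nn_integral_distr) auto
 finally show ?thesis by (simp add: add.commute)
qed

text \<open>The indicators of the translates converge pointwise on S, but not necessarily on its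
  boundary, which may have positive measure. Writing |1(x+h) - 1(x)| as 1(x+h) + 1(x) - 2 * 1(x+h) *
  1(x) leaves only the product to pass to the limit, and that product is supported in S.\<close>

lemma translation_L1_open:
 fixes S :: "'a::euclidean_space set"
 assumes S: "open S" and fin: "emeasure lborel S < \<infinity>" and h: "h ----> 0"
 shows "(%i. LBINT x. \<bar>indicator S (x + h i) - indicator S x\<bar>) ----> (0::real)"
proof -
 have [measurable]: "S \<in> sets borel" using S by auto
 let ?i = "indicator S :: 'a => real"
 have int: "integrable lborel ?i" using fin by simp
 have eq: "(LBINT x. \<bar>?i (x + h) - ?i x\<bar>) = 2 * (LBINT x. ?i x) - 2 * (LBINT x. ?i (x + h) * ?i x)" for h
 proof -
  have i2: "integrable lborel (%x. ?i (x + h) * ?i x)"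
   by (rule Bochner_Integration.integrable_bound[OF int]) (auto simp: indicator_def)
  have "(LBINT x. \<bar>?i (x + h) - ?i x\<bar>) = (LBINT x. ?i (x + h) + ?i x - 2 * (?i (x + h) * ?i x))"
   by (rule Bochner_Integration.integral_cong) (auto simp: indicator_def)
  also have "... = 2 * (LBINT x. ?i x) - 2 * (LBINT x. ?i (x + h) * ?i x)"
   using int i2 lborel_integrable_translate[OF int, of h] lborel_integral_translate[of ?i h] by simp
  finally show ?thesis .
 qed
 have "(%j. LBINT x. ?i (x + h j) * ?i x) ----> (LBINT x. ?i x)"
 proof (rule integral_dominated_convergence[where w = ?i])
  show "AE x in lborel. (%j. ?i (x + h j) * ?i x) ----> ?i x"
  proof (intro AE_I2)
   fix x
   show "(%j. ?i (x + h j) * ?i x) ----> ?i x"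
   proof (cases "x \<in> S")
    case True
    have "(%j. x + h j) ----> x" using tendsto_add[OF tendsto_const h, of x] by simp
    then have "\<forall>\<^sub>F j in sequentially. x + h j \<in> S" using S True by (rule topological_tendstoD)
    then have "\<forall>\<^sub>F j in sequentially. 1 = ?i (x + h j) * ?i x"
     by eventually_elim (use True in auto)
    from Lim_transform_eventually[OF tendsto_const this] True show ?thesis by simp
   qed auto
  qed
 qed (use int in \<open>auto simp: indicator_def\<close>)
 from tendsto_diff[OF tendsto_const[of "2 * (LBINT x. ?i x)"] tendsto_mult_left[OF this, of 2]]
 show ?thesis unfolding eq by simp
qed

text \<open>Outer regularity gives an open S around A with S - A of measure below e/4. Replacing A
  by S costs the indicator of S - A at x and at x + h, and both have the same integral; the total is
  below 3/4 of e.\<close>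

lemma translation_L1_set:
 fixes A :: "'a::euclidean_space set"
 assumes A: "A \<in> sets borel" and fin: "emeasure lborel A < \<infinity>" and h: "h ----> 0"
 shows "(%i. LBINT x. \<bar>indicator A (x + h i) - indicator A x\<bar>) ----> (0::real)"
proof (rule LIMSEQ_I)
 fix e :: real assume e: "0 < e"
 note [measurable] = A
 obtain S where S: "open S" "A \<subseteq> S" and SA: "S - A \<in> lmeasurable" "emeasure lebesgue (S - A) < ennreal (e/4)"
  using sets_lebesgue_outer_open[of A "e/4"] A e by auto
 have [measurable]: "S \<in> sets borel" using S by auto
 have SA': "emeasure lborel (S - A) < ennreal (e/4)" using SA(2) by simp
 have finD: "emeasure lborel (S - A) < \<infinity>" using SA' by (rule less_trans) simp
 have "emeasure lborel S <= emeasure lborel A + emeasure lborel (S - A)"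
  using emeasure_subadditive[of A lborel "S - A"] A S(2) by (simp add: Un_absorb1)
 also have "... < \<infinity>" using fin finD by (simp add: ennreal_add_less_top)
 finally have finS: "emeasure lborel S < \<infinity>" .
 let ?i = "indicator :: 'a set => 'a => real"
 have iS: "integrable lborel (?i S)" and iA: "integrable lborel (?i A)" using finS fin by simp_all
 have iD: "integrable lborel (?i (S - A))" 
  using finD by simp
 have D: "(LBINT x. ?i (S - A) x) < e/4"
  using SA' finD e by (simp add: emeasure_eq_ennreal_measure less_top ennreal_less_iff)
 from order_tendstoD(2)[OF translation_L1_open[OF S(1) finS h], of "e/4"] e
 obtain N where N: "!!j. j >= N ==> (LBINT x. \<bar>?i S (x + h j) - ?i S x\<bar>) < e/4"
  by (auto simp: eventually_sequentially)
 have "(LBINT x. \<bar>?i A (x + h j) - ?i A x\<bar>) < e" if "j >= N" for j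
 proof -
  have pt: "\<bar>?i A (x + h j) - ?i A x\<bar> <= \<bar>?i S (x + h j) - ?i S x\<bar> + (?i (S - A) (x + h j) + ?i (S - A) x)" for x
   using S(2) by (auto simp: indicator_def)
  have "(LBINT x. \<bar>?i A (x + h j) - ?i A x\<bar>) <=
    (LBINT x. \<bar>?i S (x + h j) - ?i S x\<bar> + (?i (S - A) (x + h j) + ?i (S - A) x))"
   using iA iS iD lborel_integrable_translate[OF iA, of "h j"] lborel_integrable_translate[OF iS, of "h j"]
    lborel_integrable_translate[OF iD, of "h j"]
   by (intro integral_mono Bochner_Integration.integrable_add integrable_abs Bochner_Integration.integrable_diff pt)
  also have "... = (LBINT x. \<bar>?i S (x + h j) - ?i S x\<bar>) + 2 * (LBINT x. ?i (S - A) x)"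
   using iA iS iD lborel_integrable_translate[OF iA, of "h j"] lborel_integrable_translate[OF iS, of "h j"]
    lborel_integrable_translate[OF iD, of "h j"]
   by (subst Bochner_Integration.integral_add) (auto simp: lborel_integral_translate)
  also have "... < e" using N[OF that] D e by simp
  finally show ?thesis .
 qed
 then show "\<exists>N. \<forall>j\<ge>N. norm ((LBINT x. \<bar>?i A (x + h j) - ?i A x\<bar>) - 0) < e"
  by (auto intro!: exI[of _ N])
qed

text \<open>Approximation by simple functions. In the limit case translation preserves the L^1
  distance between f and its approximant, so an e/3 argument works.\<close>

proposition translation_L1:
 fixes f :: "'a::euclidean_space => 'b::{banach, second_countable_topology}"
 assumes "integrable lborel f" and h: "h ----> 0"
 shows "(%i. LBINT x. norm (f (x + h i) - f x)) ----> 0"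
 using assms(1)
proof (induction f rule: integrable_induct)
 case (base A c)
 have "norm (indicator A (x + h i) *R c - indicator A x *R c) = \<bar>indicator A (x + h i) - indicator A x\<bar> * norm c" for i x
  by (metis norm_scaleR scaleR_left_diff_distrib)
 then show ?case using tendsto_mult_left_zero[OF translation_L1_set[OF _ base(2) h], of "norm c"] base(1) by simp
next
 case (add f g)
 note [measurable] = borel_measurable_integrable[OF add(1)] borel_measurable_integrable[OF add(2)]
 note i = add(1,2) lborel_integrable_translate[OF add(1)] lborel_integrable_translate[OF add(2)]
 show ?case
 proof (rule tendsto_sandwich[OF _ _ tendsto_const])
  show "\<forall>\<^sub>F i in sequentially. (LBINT x. norm (f (x + h i) + g (x + h i) - (f x + g x))) <=
   (LBINT x. norm (f (x + h i) - f x)) + (LBINT x. norm (g (x + h i) - g x))"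
  proof (intro always_eventually allI)
   fix j
   have "(LBINT x. norm (f (x + h j) + g (x + h j) - (f x + g x))) <=
    (LBINT x. norm (f (x + h j) - f x) + norm (g (x + h j) - g x))"
    using i by (intro integral_mono) (auto intro: norm_diff_triangle_ineq)
   then show "(LBINT x. norm (f (x + h j) + g (x + h j) - (f x + g x))) <=
    (LBINT x. norm (f (x + h j) - f x)) + (LBINT x. norm (g (x + h j) - g x))"
    using i by simp
  qed
  show "(%i. (LBINT x. norm (f (x + h i) - f x)) + (LBINT x. norm (g (x + h i) - g x))) ----> 0"
   using tendsto_add[OF add.IH] by simp
 qed auto
next
 case (lim f s)
 \<comment> \<open>The induction rule supplies |s_j| <= 2 |f|, hence the dominating function 3
   |f|.\<close>
 have "(%j. LBINT x. norm (s j x - f x)) ----> integral\<^sup>L lborel (%x::'a. 0 :: real)"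
 proof (rule integral_dominated_convergence[where w = "%x. 3 * norm (f x)"])
  show "AE x in lborel. (%j. norm (s j x - f x)) ----> 0"
   using LIM_zero[OF lim.hyps(2)] by (auto intro!: AE_I2 tendsto_norm_zero)
  show "AE x in lborel. norm (norm (s j x - f x)) <= 3 * norm (f x)" for j
  proof (intro AE_I2)
   fix x show "norm (norm (s j x - f x)) <= 3 * norm (f x)"
    using norm_triangle_ineq4[of "s j x" "f x"] lim.hyps(3)[of x j] by simp
  qed
 qed (use lim in \<open>auto intro!: borel_measurable_integrable\<close>)
 then have cs: "(%j. LBINT x. norm (s j x - f x)) ----> 0" by simp
 show ?case
 proof (rule LIMSEQ_I)
  fix e :: real assume e: "0 < e"
  from order_tendstoD(2)[OF cs, of "e/3"] e obtain k where k: "(LBINT x. norm (s k x - f x)) < e/3"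
   by (auto simp: eventually_sequentially)
  from order_tendstoD(2)[OF lim.IH[of k], of "e/3"] e
  obtain N where N: "!!j. j >= N ==> (LBINT x. norm (s k (x + h j) - s k x)) < e/3"
   by (auto simp: eventually_sequentially)
  note i = lim.hyps(1)[of k] lim.hyps(4)
  have "(LBINT x. norm (f (x + h j) - f x)) < e" if "j >= N" for j
  proof -
   note i' = i i[THEN lborel_integrable_translate, of "h j"]
   have i3: "integrable lborel (%x. norm (s k x - f x))" using i by simp
   have "norm (f (x + h j) - f x) <= norm (s k (x + h j) - f (x + h j)) + norm (s k (x + h j) - s k x) + norm (s k x - f x)" for x
    using norm_triangle_ineq[of "s k (x + h j) - s k x" "s k x - f x"]
     norm_triangle_ineq4[of "s k (x + h j) - f x" "s k (x + h j) - f (x + h j)"] by simp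
   then have "(LBINT x. norm (f (x + h j) - f x)) <=
    (LBINT x. norm (s k (x + h j) - f (x + h j)) + norm (s k (x + h j) - s k x) + norm (s k x - f x))"
    using i' by (intro integral_mono) auto
   also have "... = (LBINT x. norm (s k (x + h j) - f (x + h j))) + (LBINT x. norm (s k (x + h j) - s k x)) + (LBINT x. norm (s k x - f x))"
    using i' by simp
   also have "(LBINT x. norm (s k (x + h j) - f (x + h j))) = (LBINT x. norm (s k x - f x))"
    using borel_measurable_integrable[OF i3] by (intro lborel_integral_translate[of "%x. norm (s k x - f x)"]) simp
   finally show ?thesis using k N[OF that] by linarith
  qed
  then show "\<exists>N. \<forall>j\<ge>N. norm ((LBINT x. norm (f (x + h j) - f x)) - 0) < e"
   by (auto intro!: exI[of _ N])
 qed
qed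

section \<open>Continuously differentiable scalar functions\<close>

text \<open>The gradient is an explicit argument, so that the closure rules below compute it by a
  formula and no derivative has to be chosen anew.\<close>

definition C1 :: "(real^'n => real) => (real^'n => real^'n) => bool" where
 "C1 f g \<longleftrightarrow> (\<forall>x. (f has_derivative (%h. h \<bullet> g x)) (at x)) \<and> continuous_on UNIV g"

lemma C1_deriv: "C1 f g ==> (f has_derivative (%h. h \<bullet> g x)) (at x)"
 by (simp add: C1_def)

lemma C1_cont_grad: "C1 f g ==> continuous_on UNIV g"
 by (simp add: C1_def)

lemma C1_cont: "C1 f g ==> continuous_on UNIV f"
 unfolding C1_def by (meson continuous_at_imp_continuous_on has_derivative_continuous)

lemma C1_borel: "C1 f g ==> f \<in> borel_measurable borel"
 using C1_cont borel_measurable_continuous_onI by blast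

lemma C1_borel_grad: "C1 f g ==> g \<in> borel_measurable borel"
 using C1_cont_grad borel_measurable_continuous_onI by blast

lemma C1_const: "C1 (%x. c) (%x. 0)"
 by (simp add: C1_def)

lemma C1_add:
 assumes "C1 f f'" "C1 g g'" shows "C1 (%x. f x + g x) (%x. f' x + g' x)"
 using has_derivative_add[OF C1_deriv[OF assms(1)] C1_deriv[OF assms(2)]]
  continuous_on_add[OF C1_cont_grad[OF assms(1)] C1_cont_grad[OF assms(2)]]
 by (simp add: C1_def inner_add_right)

lemma C1_mult:
 assumes "C1 f f'" "C1 g g'" shows "C1 (%x. f x * g x) (%x. f x *R g' x + g x *R f' x)"
 unfolding C1_def
proof (intro conjI allI)
 fix x
 show "((%x. f x * g x) has_derivative (%h. h \<bullet> (f x *R g' x + g x *R f' x))) (at x)"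
  using has_derivative_mult[OF C1_deriv[OF assms(1), of x] C1_deriv[OF assms(2), of x]]
  by (simp add: inner_add_right mult.commute)
 show "continuous_on UNIV (%x. f x *R g' x + g x *R f' x)"
  using assms by (intro continuous_intros C1_cont C1_cont_grad)
qed

lemma C1_cmult:
 assumes "C1 f f'" shows "C1 (%x. c * f x) (%x. c *R f' x)"
 using C1_mult[OF C1_const[of c] assms] by simp

lemma C1_compose:
 assumes "C1 f f'" and d: "!!t. (F has_real_derivative F' t) (at t)" and c: "continuous_on UNIV F'"
 shows "C1 (%x. F (f x)) (%x. F' (f x) *R f' x)"
 unfolding C1_def
proof (intro conjI allI)
 fix x
 show "((%x. F (f x)) has_derivative (%h. h \<bullet> (F' (f x) *R f' x))) (at x)"
  using has_derivative_compose[OF C1_deriv[OF assms(1), of x] d[of "f x", unfolded has_field_derivative_def]]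
  by simp
 show "continuous_on UNIV (%x. F' (f x) *R f' x)"
  using assms by (intro continuous_intros C1_cont_grad continuous_on_compose2[OF c]) (auto intro: C1_cont)
qed

lemma C1_line:
 assumes "C1 f g"
 shows "((%t. f (x + t *R v)) has_real_derivative (v \<bullet> g (x + t *R v))) (at t)"
proof -
 have "((%t. x + t *R v) has_derivative (%h. h *R v)) (at t)"
  by (auto intro!: derivative_eq_intros)
 from has_derivative_compose[OF this C1_deriv[OF assms]]
 show ?thesis by (simp add: has_field_derivative_def mult.commute[of _ "v \<bullet> _"])
qed

lemma C1_affine:
 assumes "C1 f f'" shows "C1 (%x. f (s *R x + a)) (%x. s *R f' (s *R x + a))"
 unfolding C1_def
proof (intro conjI allI)
 fix x
 have "((%x. s *R x + a) has_derivative (%h. s *R h)) (at x)"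
  by (auto intro!: derivative_eq_intros)
 from has_derivative_compose[OF this C1_deriv[OF assms]]
 show "((%x. f (s *R x + a)) has_derivative (%h. h \<bullet> (s *R f' (s *R x + a)))) (at x)" by simp
 show "continuous_on UNIV (%x. s *R f' (s *R x + a))"
  by (intro continuous_intros continuous_on_compose2[OF C1_cont_grad[OF assms]]) auto
qed

lemma C1_pderiv_at: "C1 f g ==> pderiv_at k f x = g x $ k"
 unfolding pderiv_at_def C1_def using frechet_derivative_at[of f _ x]
 by (metis inner_axis' mult_1 inner_real_def)

lemma C1_unique: "C1 f g ==> C1 f g' ==> g = g'"
 by (metis C1_pderiv_at vec_eq_iff ext)

lemma C_k_1_imp_C1:
 assumes "C_k (Suc k) (f :: real^'n => real)" shows "\<exists>g. C1 f g \<and> (\<forall>i. C_k k (%x. g x $ i))"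
proof -
 obtain D where D: "!!x. (f has_derivative (%h. \<Sum>i\<in>UNIV. (h $ i) *R D i x)) (at x)"
  and D2: "!!i. C_k k (D i)" by (rule C_k_SucE[OF assms]) (rule that)
 have "C_k 0 g" if "C_k k g" for g :: "real^'n => real" using that
  by (induction k) (auto dest: C_k_SucD simp del: C_k.simps)
 then have "C1 f (%x. \<chi> i. D i x)"
  unfolding C1_def using D D2 by (auto simp: has_derivative_coords intro!: continuous_intros)
 then show ?thesis using D2 by auto
qed

lemma smooth_imp_C1: "smooth (f :: real^'n => real) ==> C1 f (%x. \<chi> k. pderiv_at k f x)"
proof -
 assume "smooth f"
 then obtain g where g: "C1 f g" using C_k_1_imp_C1 unfolding smooth_def by blast
 then have "g = (%x. \<chi> k. pderiv_at k f x)" using C1_pderiv_at[OF g] by (auto simp: vec_eq_iff)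
 then show ?thesis using g by simp
qed

lemma C1_grad_zero:
 assumes f: "C1 f g" and S: "open S" "x \<in> S" and z: "!!y. y \<in> S ==> f y = 0" shows "g x = 0"
proof -
 have "((%x. 0) has_derivative (%h. h \<bullet> g x)) (at x)"
  by (rule has_derivative_transform_within_open[OF C1_deriv[OF f] S]) (use z in auto)
 then have "(%h. h \<bullet> g x) = (%h. 0)" using has_derivative_unique has_derivative_const by blast
 then show ?thesis by (metis inner_eq_zero_iff)
qed

lemma compact_support_uniformly_continuous:
 fixes g :: "'a::euclidean_space => 'b::real_normed_vector"
 assumes c: "continuous_on UNIV g" and z: "!!x. norm x > R ==> g x = 0"
 shows "uniformly_continuous_on UNIV g"
 unfolding uniformly_continuous_on_def
proof (intro allI impI)
 fix e :: real assume e: "e > 0"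
 have "uniformly_continuous_on (cball 0 (R + 1)) g"
  by (rule compact_uniformly_continuous[OF continuous_on_subset[OF c]]) auto
 then obtain d where d: "d > 0" "!!x x'. x \<in> cball 0 (R+1) ==> x' \<in> cball 0 (R+1) ==> dist x' x < d ==> dist (g x') (g x) < e"
  using e unfolding uniformly_continuous_on_def by metis
 \<comment> \<open>The bound 1 on the distance serves the case in which one point leaves the ball of
   radius R + 1: then both lie outside radius R, where g vanishes.\<close>
 have "dist (g x') (g x) < e" if "dist x' x < min d 1" for x x'
 proof (cases "norm x <= R + 1 \<and> norm x' <= R + 1")
  case True then show ?thesis using d(2)[of x x'] that by auto
 next
  case False
  have "norm x <= norm x' + dist x' x" "norm x' <= norm x + dist x' x"
   using norm_triangle_ineq3[of x x'] by (auto simp: dist_norm norm_minus_commute)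
  then have "norm x > R" "norm x' > R" using False that by auto
  then show ?thesis using z e by simp
 qed
 then show "\<exists>d>0. \<forall>x\<in>UNIV. \<forall>x'\<in>UNIV. dist x' x < d --> dist (g x') (g x) < e"
  using d(1) by (intro exI[of _ "min d 1"]) auto
qed

lemma compact_support_bounded:
 fixes g :: "'a::euclidean_space => 'b::real_normed_vector"
 assumes c: "continuous_on UNIV g" and z: "!!x. norm x > R ==> g x = 0"
 obtains B where "B > 0" "!!x. norm (g x) <= B"
proof -
 have "compact (g ` cball 0 R)"
  by (intro compact_continuous_image continuous_on_subset[OF c]) auto
 then obtain B where B: "B > 0" "!!y. y \<in> g ` cball 0 R ==> norm y <= B"
  using compact_imp_bounded bounded_pos by metis
 have "norm (g x) <= B" for x
  using B z[of x] by (cases "norm x <= R") auto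
 with B(1) show ?thesis by (rule that)
qed

lemma C1_grad_compact_support:
 assumes f: "C1 f g" and z: "!!x. norm x > R ==> f x = 0" and x: "norm x > R" shows "g x = 0"
 by (rule C1_grad_zero[OF f, of "- cball 0 R"]) (use z x in auto)

text \<open>Mean value theorem along the segment plus uniform continuity of the gradient. Uniformity
  in x allows the remainder to be integrated against an arbitrary L^1 function in
  \<open>C1_convolution\<close>.\<close>

lemma C1_uniform:
 fixes f :: "real^'n => real"
 assumes f: "C1 f g" and z: "!!x. norm x > R ==> f x = 0" and e: "e > 0"
 obtains d where "d > 0" "!!x h. norm h < d ==> \<bar>f (x + h) - f x - h \<bullet> g x\<bar> <= e * norm h"
proof -
 have "uniformly_continuous_on UNIV g"
  by (rule compact_support_uniformly_continuous[OF C1_cont_grad[OF f]]) (rule C1_grad_compact_support[OF f z])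
 then obtain d where d: "d > 0" "!!x x'. dist x' x < d ==> dist (g x') (g x) < e"
  using e unfolding uniformly_continuous_on_def by (metis UNIV_I)
 have "\<bar>f (x + h) - f x - h \<bullet> g x\<bar> <= e * norm h" if h: "norm h < d" for x h
 proof -
  have "\<exists>t\<in>{0<..<1}. f (x + 1 *R h) - f (x + 0 *R h) = (1 - 0) * (h \<bullet> g (x + t *R h))"
   using mvt_simple[of 0 1 "%t. f (x + t *R h)" "%t s. s * (h \<bullet> g (x + t *R h))"]
    C1_line[OF f, of x h] by (auto simp: has_field_derivative_def mult.commute[of _ "_ \<bullet> _"] intro: has_derivative_at_withinI)
  then obtain t where t: "0 < t" "t < 1" "f (x + h) - f x = h \<bullet> g (x + t *R h)" by auto
  have "norm (t *R h) <= norm h" using t by (simp add: mult_left_le_one_le)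
  then have "dist (g (x + t *R h)) (g x) < e"
   using d(2)[of "x + t *R h" x] h by (simp add: dist_norm)
  then have "norm h * norm (g (x + t *R h) - g x) <= norm h * e"
   by (intro mult_left_mono) (auto simp: dist_norm)
  moreover have "\<bar>h \<bullet> (g (x + t *R h) - g x)\<bar> <= norm h * norm (g (x + t *R h) - g x)"
   by (rule Cauchy_Schwarz_ineq2)
  ultimately show ?thesis using t by (simp add: inner_diff_right mult.commute)
 qed
 with d(1) show ?thesis by (rule that)
qed

lemma integrable_bounded_scale:
 fixes g :: "'a => 'b::{banach, second_countable_topology}"
 assumes f: "integrable M (f :: _ => real)" and [measurable]: "g \<in> borel_measurable M" and b: "!!x. norm (g x) <= B"
 shows "integrable M (%x. f x *R g x)"
proof (rule Bochner_Integration.integrable_bound)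
 show "integrable M (%x. B *R f x)" using f by simp
 have "\<bar>f x\<bar> * norm (g x) <= \<bar>f x\<bar> * \<bar>B\<bar>" for x
  using b[of x] by (intro mult_left_mono) auto
 then show "AE x in M. norm (f x *R g x) <= norm (B *R f x)" by (simp add: abs_mult mult.commute)
qed (use f in measurable)

lemma Bochner_norm_bound_integral:
 fixes f :: "'a => 'b::{banach, second_countable_topology}"
 assumes "integrable M f" "integrable M g" "!!x. norm (f x) <= g x"
 shows "norm (integral\<^sup>L M f) <= integral\<^sup>L M g"
 by (rule order_trans[OF integral_norm_bound integral_mono]) (use assms in auto)

text \<open>All regularity is taken from the kernel; f is only integrable. The kernel is evaluated
  at z - x, so that for fixed x it can serve directly as a test function of z; this is the origin of
  the minus sign in the gradient.\<close>

proposition C1_convolution: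
 fixes f :: "real^'n => real"
 assumes K: "C1 K K'" and z: "!!x. norm x > R ==> K x = 0" and f: "integrable lborel f"
 shows "C1 (%x. LBINT z. K (z - x) * f z) (%x. - (LBINT z. f z *R K' (z - x)))"
proof -
 have zg: "K' x = 0" if "norm x > R" for x using C1_grad_compact_support[OF K z that] .
 note [measurable] = C1_borel[OF K] C1_borel_grad[OF K] borel_measurable_integrable[OF f]
 obtain B where B: "!!x. norm (K x) <= B" using compact_support_bounded[OF C1_cont[OF K] z] by metis
 obtain B' where B': "!!x. norm (K' x) <= B'" using compact_support_bounded[OF C1_cont_grad[OF K] zg] by metis
 have i1: "integrable lborel (%z. f z * K (z - x))" for x
  using integrable_bounded_scale[OF f, of "%z. K (z - x)" B] B by simp
 have i2: "integrable lborel (%z. f z *R K' (z - x))" for x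
  by (rule integrable_bounded_scale[OF f _ B']) measurable
 \<comment> \<open>The summand 1 keeps A positive, since the tolerance is divided by it.\<close>
 define A where "A = (LBINT z. \<bar>f z\<bar>) + 1"
 have A: "A > 0" "(LBINT z. \<bar>f z\<bar>) <= A" unfolding A_def by (auto simp: add_nonneg_pos)
 have iabs: "integrable lborel (%z. \<bar>f z\<bar>)" using f by simp
 show ?thesis unfolding C1_def
 proof (intro conjI allI)
  fix x
  let ?G = "- (LBINT z. f z *R K' (z - x))"
  show "((%x. LBINT z. K (z - x) * f z) has_derivative (%h. h \<bullet> ?G)) (at x)"
   unfolding has_derivative_within_alt
  proof (intro conjI allI impI)
   fix e :: real assume e: "0 < e"
   obtain d where d: "d > 0" "!!x h. norm h < d ==> \<bar>K (x + h) - K x - h \<bullet> K' x\<bar> <= (e / A) * norm h"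
    using C1_uniform[OF K z divide_pos_pos[OF e A(1)]] by metis
   have "norm ((LBINT z. K (z - y) * f z) - (LBINT z. K (z - x) * f z) - (y - x) \<bullet> ?G) <= e * norm (y - x)"
    if y: "norm (y - x) < d" for y
   proof -
    have "(y - x) \<bullet> ?G = - (LBINT z. f z * ((y - x) \<bullet> K' (z - x)))"
     using integral_inner_right[OF i2[of x], of "y - x"] by simp
    then have "(LBINT z. K (z - y) * f z) - (LBINT z. K (z - x) * f z) - (y - x) \<bullet> ?G =
     (LBINT z. f z * K (z - y) - f z * K (z - x) + f z * ((y - x) \<bullet> K' (z - x)))"
     using i1[of x] i1[of y] integrable_inner_right[OF i2[of x], of "y - x"] by (simp add: mult.commute)
    also have "norm ... <= (LBINT z. (e / A) * norm (y - x) * \<bar>f z\<bar>)"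
    proof (rule Bochner_norm_bound_integral)
     show "integrable lborel (%z. f z * K (z - y) - f z * K (z - x) + f z * ((y - x) \<bullet> K' (z - x)))"
      using i1[of x] i1[of y] integrable_inner_right[OF i2[of x], of "y - x"] by simp
     show "integrable lborel (%z. (e / A) * norm (y - x) * \<bar>f z\<bar>)" using iabs by simp
     fix z
     have "\<bar>K (z - y) - K (z - x) + (y - x) \<bullet> K' (z - x)\<bar> <= (e / A) * norm (y - x)"
      using d(2)[of "x - y" "z - x"] y by (simp add: norm_minus_commute inner_diff_left)
     then have "\<bar>f z\<bar> * \<bar>K (z - y) - K (z - x) + (y - x) \<bullet> K' (z - x)\<bar> <= \<bar>f z\<bar> * ((e / A) * norm (y - x))"
      by (intro mult_left_mono) auto
     then show "norm (f z * K (z - y) - f z * K (z - x) + f z * ((y - x) \<bullet> K' (z - x))) <= (e / A) * norm (y - x) * \<bar>f z\<bar>"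
      by (simp add: abs_mult[symmetric] algebra_simps)
    qed
    also have "... = (e / A) * norm (y - x) * (LBINT z. \<bar>f z\<bar>)" by simp
    also have "... <= (e / A) * norm (y - x) * A" using A e by (intro mult_left_mono) auto
    also have "... = e * norm (y - x)" using A by simp
    finally show ?thesis .
   qed
   then show "\<exists>d>0. \<forall>y\<in>UNIV. norm (y - x) < d --> norm ((LBINT z. K (z - y) * f z) - (LBINT z. K (z - x) * f z) - (y - x) \<bullet> ?G) <= e * norm (y - x)"
    using d(1) by auto
  qed (rule bounded_linear_inner_left)
 next
  have uc: "uniformly_continuous_on UNIV K'" by (rule compact_support_uniformly_continuous[OF C1_cont_grad[OF K] zg])
  show "continuous_on UNIV (%x. - (LBINT z. f z *R K' (z - x)))"
   unfolding continuous_on_iff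
  proof (intro ballI allI impI)
   fix x and e :: real assume e: "0 < e"
   obtain d where d: "d > 0" "!!x x'. dist x' x < d ==> dist (K' x') (K' x) < e / (2 * A)"
    using e A uc unfolding uniformly_continuous_on_def by (metis UNIV_I divide_pos_pos mult_pos_pos zero_less_numeral)
   have "dist (- (LBINT z. f z *R K' (z - y))) (- (LBINT z. f z *R K' (z - x))) < e" if y: "dist y x < d" for y
   proof -
    have "norm ((LBINT z. f z *R K' (z - y)) - (LBINT z. f z *R K' (z - x))) =
      norm (LBINT z. f z *R K' (z - y) - f z *R K' (z - x))"
     using i2 by simp
    also have "... <= (LBINT z. e / (2 * A) * \<bar>f z\<bar>)"
    proof (rule Bochner_norm_bound_integral)
     fix z
     have "norm (K' (z - y) - K' (z - x)) <= e / (2 * A)"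
      using d(2)[of "z - y" "z - x"] y by (simp add: dist_norm norm_minus_commute)
     then have "\<bar>f z\<bar> * norm (K' (z - y) - K' (z - x)) <= \<bar>f z\<bar> * (e / (2 * A))"
      by (intro mult_left_mono) auto
     then show "norm (f z *R K' (z - y) - f z *R K' (z - x)) <= e / (2 * A) * \<bar>f z\<bar>"
      by (simp flip: scaleR_diff_right add: mult.commute)
    qed (use i2 iabs in auto)
    also have "... = e / (2 * A) * (LBINT z. \<bar>f z\<bar>)" by simp
    also have "... <= e / (2 * A) * A" using A e by (intro mult_left_mono) auto
    also have "... < e" using A e by simp
    finally show ?thesis by (simp add: dist_norm norm_minus_commute)
   qed
   then show "\<exists>d>0. \<forall>x'\<in>UNIV. dist x' x < d --> dist (- (LBINT z. f z *R K' (z - x'))) (- (LBINT z. f z *R K' (z - x))) < e"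
    using d(1) by auto
  qed
 qed
qed

section \<open>Mollification\<close>

definition eta :: "real^'n => real" where
 "eta x = bump_exp 0 (1 - x \<bullet> x) / (\<integral>y. bump_exp 0 (1 - y \<bullet> y) \<partial>(lborel :: (real^'n) measure))"

lemma bump_exp_nonneg: "0 <= bump_exp m t"
 by (simp add: bump_exp_def)

lemma continuous_compact_support_integrable:
 fixes g :: "'a::euclidean_space => 'b::{banach, second_countable_topology}"
 assumes c: "continuous_on UNIV g" and z: "!!x. norm x > R ==> g x = 0"
 shows "integrable lborel g"
proof -
 have [measurable]: "g \<in> borel_measurable borel" using c by (rule borel_measurable_continuous_onI)
 obtain B where B: "!!x. norm (g x) <= B" using compact_support_bounded[OF c z] by metis
 have "integrable lborel (%x. indicator (cball 0 R) x *R g x)"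
  by (rule integrable_bounded_scale[OF integrable_real_indicator _ B]) (simp_all add: emeasure_bounded_finite[unfolded infinity_ennreal_def])
 moreover have "indicator (cball 0 R) x *R g x = g x" for x
  using z[of x] by (auto simp: indicator_def)
 ultimately show ?thesis by simp
qed

lemma bump_int_pos: "0 < (\<integral>y. bump_exp 0 (1 - y \<bullet> y) \<partial>(lborel :: (real^'n) measure))"
 and bump_integrable: "integrable lborel (%y::real^'n. bump_exp 0 (1 - y \<bullet> y))"
proof -
 let ?b = "%y::real^'n. bump_exp 0 (1 - y \<bullet> y)"
 have c: "continuous_on UNIV ?b" using C_k_bump_exp_ball[of 0 0] by simp
 have z: "?b y = 0" if "norm y > 1" for y
  using that by (auto simp: bump_exp_def dot_square_norm)
 show i: "integrable lborel ?b" by (rule continuous_compact_support_integrable[OF c z])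
 have "(LBINT y. ?b y) \<noteq> 0"
 proof
  assume "(LBINT y. ?b y) = 0"
  then have "AE y in lborel. ?b y = 0"
   using integral_nonneg_eq_0_iff_AE[OF i] bump_exp_nonneg by auto
  moreover have "?b y \<noteq> 0" if "y \<in> ball 0 1" for y
  proof -
   have "y \<bullet> y < 1" using that by (simp add: dot_square_norm abs_square_less_1)
   then show ?thesis by (simp add: bump_exp_def)
  qed
  ultimately have "AE y in lborel. y \<notin> ball (0::real^'n) 1" by (auto elim!: eventually_mono)
  then have "emeasure lborel (ball (0::real^'n) 1) = 0" by (subst (asm) AE_iff_measurable[OF _ refl]) (auto simp: ball_def)
  then show False using content_ball_pos[of 1 "0::real^'n"] by (simp add: measure_def)
 qed
 then show "0 < (LBINT y. ?b y)"
  by (simp add: less_le integral_nonneg bump_exp_nonneg)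
qed

lemma eta_nonneg: "0 <= eta x"
 unfolding eta_def by (intro divide_nonneg_nonneg bump_exp_nonneg less_imp_le[OF bump_int_pos])

lemma eta_zero: "norm x >= 1 ==> eta x = 0"
 unfolding eta_def by (auto simp: bump_exp_def dot_square_norm)

lemma eta_integrable: "integrable lborel eta"
 unfolding eta_def[abs_def] by (intro integrable_divide_zero bump_integrable)

lemma eta_integral: "(\<integral>y. eta y \<partial>(lborel :: (real^'n) measure)) = 1"
 unfolding eta_def using bump_int_pos[where 'n='n] by simp

lemma eta_smooth: "smooth eta"
 unfolding smooth_def eta_def divide_inverse
 by (intro allI C_k_bounded_linear[OF bounded_linear_mult_left] C_k_bump_exp_ball)

lemma eta_C1: "C1 eta (%x. \<chi> k. pderiv_at k eta x)"
 by (rule smooth_imp_C1[OF eta_smooth])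

lemma eta_borel [measurable]: "eta \<in> borel_measurable borel"
 using C1_borel[OF eta_C1] .

text \<open>The average of f over the ball of radius \<open>eps\<close> centred at x + eps a. For a
  = 0 it is the usual mollification; if a points into the domain, the ball stays inside even for x
  close to the boundary.\<close>

definition moll :: "real => real^'n => (real^'n => 'b::euclidean_space) => real^'n => 'b" where
 "moll eps a f x = (LBINT y. eta y *R f (x + eps *R (a + y)))"

lemma lborel_integral_affine:
 fixes f :: "'a::euclidean_space => 'b::{banach, second_countable_topology}"
 assumes [measurable]: "f \<in> borel_measurable borel" and c: "c > 0"
 shows "(LBINT x. f x) = c ^ DIM('a) *R (LBINT x. f (t + c *R x))"
proof -
 have "(LBINT x. f x) = (\<integral>x. f x \<partial>density (distr lborel borel (%x. t + c *R x)) (%_. \<bar>c\<bar>^DIM('a)))"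
  using c by (intro arg_cong[where f="%M. integral\<^sup>L M f"] lborel_affine) simp
 also have "... = (\<integral>x. c ^ DIM('a) *R f x \<partial>distr lborel borel (%x. t + c *R x))"
  using c by (subst integral_density) (auto simp: ennreal_power)
 also have "... = c ^ DIM('a) *R (LBINT x. f (t + c *R x))"
  by (subst integral_distr) auto
 finally show ?thesis .
qed

lemma lborel_integrable_affine:
 fixes f :: "'a::euclidean_space => 'b::{banach, second_countable_topology}"
 assumes f: "integrable lborel f" and c: "c > 0"
 shows "integrable lborel (%x. f (t + c *R x))"
proof -
 have [measurable]: "f \<in> borel_measurable borel" using f by auto
 have "integrable (density (distr lborel borel (%x. t + c *R x)) (%_. \<bar>c\<bar>^DIM('a))) f"
  using f by (subst lborel_affine[of c t, symmetric]) (use c in auto)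
 then have "integrable (distr lborel borel (%x. t + c *R x)) (%x. c ^ DIM('a) *R f x)"
  using c by (subst (asm) integrable_density) (auto simp: ennreal_power)
 then have "integrable lborel (%x. c ^ DIM('a) *R f (t + c *R x))"
  by (subst (asm) integrable_distr_eq) auto
 from integrable_scaleR_right[OF this, of "inverse (c ^ DIM('a))"] show ?thesis using c by simp
qed

text \<open>The substitution z = x + eps (a + y) turns \<open>moll\<close> into integration against
  this kernel evaluated at z - x.\<close>

definition mkern :: "real => real^'n => real^'n => real" where
 "mkern eps a w = inverse (eps ^ CARD('n)) * eta ((1/eps) *R w + (- a))"

lemma mkern_C1: "\<exists>K'. C1 (mkern eps a) K'"
 unfolding mkern_def[abs_def] using C1_cmult[OF C1_affine[OF eta_C1]] by blast

lemma mkern_zero: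
 fixes w :: "real^'n"
 assumes "eps > 0" "norm (w - eps *R a) >= eps" shows "mkern eps a w = 0"
proof -
 have "norm ((1/eps) *R u) = norm u / eps" for u :: "real^'n" using assms by simp
 then have "norm ((1/eps) *R (w - eps *R a)) >= 1" using assms by (simp only:) (simp add: field_simps)
 moreover have "(1/eps) *R (w - eps *R a) = (1/eps) *R w + (- a)" using assms by (simp add: algebra_simps)
 ultimately show ?thesis unfolding mkern_def by (simp only: eta_zero mult_zero_right)
qed

lemma moll_kernel:
 fixes f :: "real^'n => 'b::euclidean_space"
 assumes e: "eps > 0" and [measurable]: "f \<in> borel_measurable borel"
 shows "moll eps a f x = (LBINT z. mkern eps a (z - x) *R f z)"
proof -
 obtain K' where "C1 (mkern eps a) K'" using mkern_C1 by blast
 note [measurable] = C1_borel[OF this]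
 have "(LBINT z. mkern eps a (z - x) *R f z) =
   eps ^ CARD('n) *R (LBINT y. mkern eps a ((x + eps *R a) + eps *R y - x) *R f ((x + eps *R a) + eps *R y))"
  using lborel_integral_affine[of "%z. mkern eps a (z - x) *R f z" eps "x + eps *R a"] e by simp
 also have "... = moll eps a f x"
  unfolding moll_def integral_scaleR_right[symmetric]
 proof (rule Bochner_Integration.integral_cong)
  fix y
  have "(1 / eps) *R (x + eps *R a + eps *R y - x) + - a = y" using e by (simp add: algebra_simps)
  then show "eps ^ CARD('n) *R mkern eps a ((x + eps *R a) + eps *R y - x) *R f ((x + eps *R a) + eps *R y) = eta y *R f (x + eps *R (a + y))"
   using e by (simp add: mkern_def algebra_simps)
 qed simp
 finally show ?thesis by simp
qed

text \<open>This is what makes the kernel admissible in the definition of the weak gradient: its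
  support is exactly the shifted ball over which \<open>moll\<close> averages.\<close>

lemma mkern_test_function:
 fixes x :: "real^'n"
 assumes e: "eps > 0" and sub: "cball (x + eps *R a) eps \<subseteq> U"
 shows "test_function U (%z. mkern eps a (z - x))"
proof -
 have eq: "mkern eps a (z - x) = inverse (eps ^ CARD('n)) * eta ((1/eps) *R z + (- a - (1/eps) *R x))" for z :: "real^'n"
  by (simp add: mkern_def algebra_simps)
 have "smooth (%z. mkern eps a (z - x))"
  using eta_smooth unfolding smooth_def eq
  by (intro allI C_k_bounded_linear[OF bounded_linear_mult_right] C_k_affine) auto
 moreover have "{z. mkern eps a (z - x) \<noteq> 0} \<subseteq> cball (x + eps *R a) eps"
 proof
  fix z assume "z \<in> {z. mkern eps a (z - x) \<noteq> 0}"
  then have "norm (z - x - eps *R a) < eps" using mkern_zero[OF e, of "z - x" a] by force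
  then show "z \<in> cball (x + eps *R a) eps" by (simp add: dist_norm norm_minus_commute algebra_simps)
 qed
 then have cl: "closure {z. mkern eps a (z - x) \<noteq> 0} \<subseteq> cball (x + eps *R a) eps"
  by (rule closure_minimal) simp
 moreover have "compact (closure {z. mkern eps a (z - x) \<noteq> 0})"
  using bounded_subset[OF bounded_cball cl] by (simp add: compact_eq_bounded_closed)
 ultimately show ?thesis unfolding test_function_def using sub by auto
qed

text \<open>Functions of class \<open>H\<^sup>1\<close> with their weak gradient, as Borel functions on the whole space
 that vanish outside the domain.\<close>

definition wgrad :: "(real^'n) set => (real^'n => real) => (real^'n => real^'n) => bool" where
 "wgrad U f g \<longleftrightarrow> integrable lborel f \<and> integrable lborel g \<and>
   integrable lborel (%x. (f x)^2) \<and> integrable lborel (%x. (norm (g x))^2) \<and>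
   (\<forall>x. x \<notin> U --> f x = 0 \<and> g x = 0) \<and>
   (\<forall>\<phi> \<phi>'. test_function U \<phi> \<and> C1 \<phi> \<phi>' -->
    (LBINT x. f x *R \<phi>' x) = - (LBINT x. \<phi> x *R g x))"

definition H1_mass :: "(real^'n => real) => (real^'n => real^'n) => real" where
 "H1_mass f g = (LBINT x. (f x)^2) + (LBINT x. (norm (g x))^2)"

lemma H1_mass_nonneg: "H1_mass f g >= 0"
 unfolding H1_mass_def by (intro add_nonneg_nonneg integral_nonneg_AE) auto

text \<open>The mollified function is C1 on the whole space, but its gradient is the mollified weak
  gradient only where the shifted ball lies in U. Elsewhere the kernel is no test function,
  reflecting the jump of the extension of f by zero.\<close>

lemma moll_C1:
 fixes f :: "real^'n => real"
 assumes e: "eps > 0" and w: "wgrad U f g"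
 obtains G where "C1 (moll eps a f) G" "!!x. cball (x + eps *R a) eps \<subseteq> U ==> G x = moll eps a g x"
proof -
 have f: "integrable lborel f" and [measurable]: "f \<in> borel_measurable borel" "g \<in> borel_measurable borel"
  using w by (auto simp: wgrad_def)
 obtain K' where K: "C1 (mkern eps a) K'" using mkern_C1 by blast
 have z: "mkern eps a w = 0" if "norm w > eps + norm (eps *R a)" for w
 proof -
  have "norm w <= norm (w - eps *R a) + norm (eps *R a)" by (metis diff_add_cancel norm_triangle_ineq)
  then show ?thesis using mkern_zero[OF e, of w a] that by linarith
 qed
 have eq: "moll eps a f = (%x. LBINT z. mkern eps a (z - x) * f z)"
  using moll_kernel[OF e, of f a] by auto
 define G where "G = (%x. - (LBINT z. f z *R K' (z - x)))"
 have "C1 (moll eps a f) G"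
  unfolding eq G_def by (rule C1_convolution[OF K z f])
 moreover have "G x = moll eps a g x" if "cball (x + eps *R a) eps \<subseteq> U" for x
 proof -
  have "C1 (%z. mkern eps a (z - x)) (%z. K' (z - x))"
   using C1_affine[OF K, of 1 "- x"] by simp
  then have "(LBINT z. f z *R K' (z - x)) = - (LBINT z. mkern eps a (z - x) *R g z)"
   using w mkern_test_function[OF e that] unfolding wgrad_def by blast
  then show ?thesis unfolding G_def by (simp add: moll_kernel[OF e])
 qed
 ultimately show ?thesis by (rule that)
qed

section \<open>Convergence and boundedness of mollification in L^1 and L^2\<close>

lemma moll_integrable_y:
 fixes f :: "real^'n => 'b::euclidean_space"
 assumes e: "eps > 0" and f: "integrable lborel f"
 shows "integrable lborel (%y. eta y *R f (x + eps *R (a + y)))"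
proof -
 have z: "(eta :: real^'n => real) x = 0" if "norm x > 1" for x using that eta_zero by force
 obtain B where B: "B > 0" "!!x. norm ((eta :: real^'n => real) x) <= B" using compact_support_bounded[OF C1_cont[OF eta_C1] z] by metis
 have i: "integrable lborel (%y. f (x + eps *R (a + y)))"
  using lborel_integrable_affine[OF f e, of "x + eps *R a"] by (simp add: algebra_simps)
 then have [measurable]: "(%y. f (x + eps *R (a + y))) \<in> borel_measurable lborel" by auto
 show ?thesis
 proof (rule Bochner_Integration.integrable_bound)
  show "integrable lborel (%y. B *R f (x + eps *R (a + y)))" using i by simp
  show "AE y in lborel. norm (eta y *R f (x + eps *R (a + y))) <= norm (B *R f (x + eps *R (a + y)))"
   using B by (auto intro!: AE_I2 mult_right_mono)
 qed measurable
qed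

lemma moll_measurable [measurable]:
 assumes [measurable]: "f \<in> borel_measurable borel" shows "moll eps a f \<in> borel_measurable borel"
 unfolding moll_def[abs_def] by measurable

lemma moll_diff_le:
 fixes f :: "real^'n => 'b::euclidean_space"
 assumes e: "eps > 0" and f: "integrable lborel f"
 shows "ennreal (norm (moll eps a f x - c)) <= (NI y. ennreal (eta y * norm (f (x + eps *R (a + y)) - c)))"
proof -
 have [measurable]: "f \<in> borel_measurable borel" using f by auto
 have ic: "integrable lborel (%y::real^'n. eta y *R c)"
  by (intro integrable_scaleR_left eta_integrable)
 have "moll eps a f x - c = (LBINT y. eta y *R f (x + eps *R (a + y)) - eta y *R c)"
  unfolding moll_def using moll_integrable_y[OF e f, of x a] ic
  by (subst Bochner_Integration.integral_diff) (simp_all add: eta_integral eta_integrable)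
 also have "ennreal (norm ...) <= (NI y. ennreal (norm (eta y *R f (x + eps *R (a + y)) - eta y *R c)))"
  by (rule integral_norm_bound_ennreal) (use moll_integrable_y[OF e f] eta_integrable in auto)
 also have "... = (NI y. ennreal (eta y * norm (f (x + eps *R (a + y)) - c)))"
  by (intro nn_integral_cong) (simp flip: scaleR_diff_right add: eta_nonneg)
 finally show ?thesis .
qed

text \<open>The factor \<open>s\<close> unifies two uses: the value 0 gives integrability of the
  mollification, the value 1 its convergence to f.\<close>

lemma moll_diff_L1_le:
 fixes f :: "real^'n => 'b::euclidean_space"
 assumes e: "eps > 0" and f: "integrable lborel f"
 shows "(NI x. norm (moll eps a f x - s *R f x)) <=
   (NI y. eta y * ennreal (LBINT x. norm (f (x + eps *R (a + y)) - s *R f x)))"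
proof -
 have [measurable]: "f \<in> borel_measurable borel" using f by auto
 have "(NI x. norm (moll eps a f x - s *R f x)) <=
  (NI x. (NI y. ennreal (eta y * norm (f (x + eps *R (a + y)) - s *R f x))))"
  by (intro nn_integral_mono moll_diff_le[OF e f])
 also have "... = (NI y. (NI x. ennreal (eta y * norm (f (x + eps *R (a + y)) - s *R f x))))"
  by (rule lborel_pair.Fubini') measurable
 also have "... = (NI y. eta y * ennreal (LBINT x. norm (f (x + eps *R (a + y)) - s *R f x)))"
 proof (intro nn_integral_cong)
  fix y
  have i: "integrable lborel (%x. f (x + eps *R (a + y)) - s *R f x)"
   using f lborel_integrable_translate[OF f] by simp
  have "(NI x. ennreal (eta y * norm (f (x + eps *R (a + y)) - s *R f x))) =
   eta y * (NI x. ennreal (norm (f (x + eps *R (a + y)) - s *R f x)))"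
   by (simp add: ennreal_mult' eta_nonneg nn_integral_cmult)
  also have "(NI x. ennreal (norm (f (x + eps *R (a + y)) - s *R f x))) =
   ennreal (LBINT x. norm (f (x + eps *R (a + y)) - s *R f x))"
   by (rule nn_integral_eq_integral) (use i in auto)
  finally show "(NI x. ennreal (eta y * norm (f (x + eps *R (a + y)) - s *R f x))) =
   eta y * ennreal (LBINT x. norm (f (x + eps *R (a + y)) - s *R f x))" .
 qed
 finally show ?thesis .
qed

lemma moll_integrable:
 fixes f :: "real^'n => 'b::euclidean_space"
 assumes e: "eps > 0" and f: "integrable lborel f"
 shows "integrable lborel (moll eps a f)"
proof (rule integrableI_bounded)
 have [measurable]: "f \<in> borel_measurable borel" using f by auto
 show "moll eps a f \<in> borel_measurable lborel" by measurable
 have "(NI x. norm (moll eps a f x)) <= (NI y. eta y * ennreal (LBINT x. norm (f (x + eps *R (a + y)))))"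
  using moll_diff_L1_le[OF e f, of a 0] by simp
 also have "... = (\<integral>\<^sup>+y. eta y * ennreal (LBINT x. norm (f x)) \<partial>(lborel :: (real^'n) measure))"
  using lborel_integral_translate[of "%x. norm (f x)"] by simp
 also have "... = ennreal (LBINT x. norm (f x))"
  by (simp add: nn_integral_multc nn_integral_eq_integral eta_integrable eta_nonneg eta_integral)
 finally show "(NI x. norm (moll eps a f x)) < \<infinity>"
  by (rule le_less_trans) simp
qed

text \<open>For each y the L^1 distance of f from its translate by eps (a + y) tends to 0 and is at
  most twice the norm of f. Averaging these distances over y with weight \<open>eta\<close> permits
  dominated convergence.\<close>

proposition moll_tendsto_L1:
 fixes f :: "real^'n => 'b::euclidean_space"
 assumes f: "integrable lborel f" and e: "!!i. eps i > 0" "eps ----> 0"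
 shows "(%i. LBINT x. norm (moll (eps i) a f x - f x)) ----> 0"
proof -
 have [measurable]: "f \<in> borel_measurable borel" using f by auto
 define T where "T i y = (LBINT x. norm (f (x + eps i *R (a + y)) - f x))" for i y
 have [measurable]: "T i \<in> borel_measurable borel" for i unfolding T_def[abs_def] by measurable
 have T0: "0 <= T i y" for i y unfolding T_def by simp
 have TB: "T i y <= 2 * (LBINT x. norm (f x))" for i y
 proof -
  have "T i y <= (LBINT x. norm (f (x + eps i *R (a + y))) + norm (f x))"
   unfolding T_def using f lborel_integrable_translate[OF f]
   by (intro integral_mono) (auto intro: norm_triangle_ineq4)
  also have "... = 2 * (LBINT x. norm (f x))"
   using f lborel_integrable_translate[OF f] lborel_integral_translate[of "%x. norm (f x)"] by simp
  finally show ?thesis .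
 qed
 have Tlim: "(%i. T i y) ----> 0" for y
  unfolding T_def by (rule translation_L1[OF f]) (use tendsto_scaleR[OF e(2) tendsto_const] in simp)
 have dom: "integrable lborel (%y::real^'n. eta y * (2 * (LBINT x. norm (f x))) :: real)"
  by (intro integrable_mult_left eta_integrable)
 have bd: "norm (eta y * T i y) <= eta y * (2 * (LBINT x. norm (f x)))" for i y
  using TB[of i y] T0[of i y] eta_nonneg[of y] by (simp add: abs_mult mult_left_mono)
 have lim: "(%i. LBINT y. eta y * T i y) ----> integral\<^sup>L lborel (%y::real^'n. 0 :: real)"
  by (rule integral_dominated_convergence[OF _ _ dom])
   (use tendsto_mult_left[OF Tlim] bd in auto)
 have le: "(LBINT x. norm (moll (eps i) a f x - f x)) <= (LBINT y. eta y * T i y)" for i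
 proof -
  have it: "integrable lborel (%y. eta y * T i y)"
   by (rule Bochner_Integration.integrable_bound[OF dom]) (auto intro!: AE_I2 order_trans[OF bd[unfolded real_norm_def] abs_ge_self])
  have "ennreal (LBINT x. norm (moll (eps i) a f x - f x)) = (NI x. norm (moll (eps i) a f x - f x))"
   using moll_integrable[OF e(1) f, of i a] f by (intro nn_integral_eq_integral[symmetric]) auto
  also have "... <= (NI y. eta y * ennreal (T i y))"
   using moll_diff_L1_le[OF e(1) f, of i a 1] unfolding T_def by simp
  also have "... = ennreal (LBINT y. eta y * T i y)"
   using it by (subst nn_integral_eq_integral[symmetric]) (auto simp: ennreal_mult' eta_nonneg T0)
  finally show ?thesis by (simp add: eta_nonneg T0)
 qed
 show ?thesis
  by (rule tendsto_sandwich[OF _ _ tendsto_const]) (use le lim in auto)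
qed

text \<open>Cauchy-Schwarz for the probability density \<open>eta\<close>, split into two square
  roots, bounds the square pointwise by the average of the squares; Fubini and translation
  invariance do the rest.\<close>

lemma moll_L2:
 fixes f :: "real^'n => 'b::euclidean_space"
 assumes e: "eps > 0" and f: "integrable lborel f" and f2: "integrable lborel (%x. (norm (f x))^2)"
 shows "integrable lborel (%x. (norm (moll eps a f x))^2)"
  and "(LBINT x. (norm (moll eps a f x))^2) <= (LBINT x. (norm (f x))^2)"
proof -
 have [measurable]: "f \<in> borel_measurable borel" using f by auto
 have pt: "ennreal ((norm (moll eps a f x))^2) <= (NI y. ennreal (eta y * (norm (f (x + eps *R (a + y))))^2))" for x
 proof -
  let ?F = "%y. norm (f (x + eps *R (a + y)))"
  have "ennreal (norm (moll eps a f x)) <= (NI y. ennreal (eta y * ?F y))"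
   using moll_diff_le[OF e f, of a x 0] by simp
  also have "... = (NI y. ennreal (sqrt (eta y)) * ennreal (sqrt (eta y) * ?F y))"
   by (intro nn_integral_cong) (simp flip: ennreal_mult' add: eta_nonneg mult.assoc[symmetric])
  finally have "(ennreal (norm (moll eps a f x)))^2 <= (NI y. ennreal (sqrt (eta y)) * ennreal (sqrt (eta y) * ?F y))^2"
   by (rule power_mono) simp
  also have "... <= (\<integral>\<^sup>+y. (ennreal (sqrt (eta y)))^2 \<partial>(lborel :: (real^'n) measure)) * (NI y. (ennreal (sqrt (eta y) * ?F y))^2)"
   by (rule Cauchy_Schwarz_nn_integral) measurable
  also have "(\<integral>\<^sup>+y. (ennreal (sqrt (eta y)))^2 \<partial>(lborel :: (real^'n) measure)) = 1"
   by (simp add: ennreal_power eta_nonneg nn_integral_eq_integral eta_integrable eta_integral)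
  also have "(NI y. (ennreal (sqrt (eta y) * ?F y))^2) = (NI y. ennreal (eta y * (?F y)^2))"
   by (simp add: ennreal_power eta_nonneg power_mult_distrib)
  finally show ?thesis by (simp add: ennreal_power)
 qed
 have "(NI x. ennreal ((norm (moll eps a f x))^2)) <=
  (NI x. (NI y. ennreal (eta y * (norm (f (x + eps *R (a + y))))^2)))"
  by (intro nn_integral_mono pt)
 also have "... = (NI y. (NI x. ennreal (eta y * (norm (f (x + eps *R (a + y))))^2)))"
  by (rule lborel_pair.Fubini') measurable
 also have "... = (\<integral>\<^sup>+y. eta y * (NI x. ennreal ((norm (f x))^2)) \<partial>(lborel :: (real^'n) measure))"
  by (intro nn_integral_cong) (simp add: ennreal_mult' eta_nonneg nn_integral_cmult
   lborel_nn_integral_translate[of "%x. ennreal ((norm (f x))^2)"])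
 also have "... = (NI x. ennreal ((norm (f x))^2))"
  by (simp add: nn_integral_multc nn_integral_eq_integral[OF eta_integrable] eta_nonneg eta_integral)
 also have "... = ennreal (LBINT x. (norm (f x))^2)"
  by (rule nn_integral_eq_integral[OF f2]) simp
 finally have le: "(NI x. ennreal ((norm (moll eps a f x))^2)) <= ennreal (LBINT x. (norm (f x))^2)" .
 show i: "integrable lborel (%x. (norm (moll eps a f x))^2)"
  by (rule integrableI_bounded) (use le_less_trans[OF le] in auto)
 show "(LBINT x. (norm (moll eps a f x))^2) <= (LBINT x. (norm (f x))^2)"
  using le nn_integral_eq_integral[OF i] by simp
qed

section \<open>Cut-off functions, charts and cones\<close>

definition step :: "real => real" where
 "step t = bump_exp 0 t / (bump_exp 0 t + bump_exp 0 (1 - t))"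

lemma step_denom_pos: "0 < bump_exp 0 t + bump_exp 0 (1 - t)"
 by (cases "t <= 0") (auto simp: bump_exp_def add_pos_nonneg)

lemma step_range: "0 <= step t" "step t <= 1"
 using step_denom_pos[of t] bump_exp_nonneg[of 0 t] bump_exp_nonneg[of 0 "1 - t"]
 by (auto simp: step_def divide_le_eq_1)

lemma step_0: "t <= 0 ==> step t = 0"
 by (simp add: step_def bump_exp_def)

lemma step_1: "t >= 1 ==> step t = 1"
 using step_denom_pos[of t] by (simp add: step_def bump_exp_def)

lemma step_deriv:
 obtains step' where "!!t. (step has_real_derivative step' t) (at t)" "continuous_on UNIV step'"
proof -
 let ?E = "bump_exp 0" and ?E' = "%t. bump_exp 2 t - real 0 * bump_exp 1 t"
 let ?D = "%t. ?E t + ?E (1 - t)"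
 have d: "(?E has_real_derivative ?E' t) (at t)" for t
  using bump_exp_deriv[of 0 t] by (simp add: numeral_2_eq_2)
 have c: "continuous_on UNIV (bump_exp m)" for m
  by (meson DERIV_isCont bump_exp_deriv continuous_at_imp_continuous_on)
 have nz: "?D t \<noteq> 0" for t using step_denom_pos[of t] by simp
 have d1: "((%t. ?E (1 - t)) has_real_derivative - ?E' (1 - t)) (at t)" for t
 proof -
  have "((%t::real. 1 - t) has_real_derivative - 1) (at t)" by (auto intro!: derivative_eq_intros)
  from DERIV_chain2[OF d this] show ?thesis by simp
 qed
 let ?s = "%t. (?E' t * ?D t - ?E t * (?E' t + - ?E' (1 - t))) / (?D t * ?D t)"
 have "(step has_real_derivative ?s t) (at t)" for t
  unfolding step_def[abs_def] by (rule DERIV_divide[OF d DERIV_add[OF d d1] nz])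
 moreover have "continuous_on UNIV ?s"
  using nz by (intro continuous_intros continuous_on_compose2[OF c]) auto
 ultimately show ?thesis by (rule that)
qed

lemma C1_inner_self: "C1 (%x::real^'n. (x - p) \<bullet> (x - p)) (%x. 2 *R (x - p))"
 unfolding C1_def
 by (auto intro!: derivative_eq_intros continuous_intros simp: inner_commute)

lemma C1_bump:
 fixes p :: "real^'n"
 assumes r: "r > 0"
 obtains b b' where "C1 b b'" "!!x. 0 <= b x" "!!x. b x <= 1" "!!x. x \<in> cball p (r/2) ==> b x = 1"
  "!!x. x \<notin> ball p r ==> b x = 0"
proof -
 obtain step' where s: "!!t. (step has_real_derivative step' t) (at t)" "continuous_on UNIV step'"
  using step_deriv by metis
 let ?q = "%x. (r^2 + (-1) * ((x - p) \<bullet> (x - p)))"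
 \<comment> \<open>On \<open>cball p (r/2)\<close> the quantity r^2 - |x - p|^2 is at least 3/4 of
   r^2, so the factor 4 / (3 r^2) lifts it to at least 1; outside \<open>ball p r\<close> it is at
   most 0.\<close>
 have q: "C1 (%x. (4 / (3 * r^2)) * ?q x) (%x. (4 / (3 * r^2)) *R (0 + (-1) *R (2 *R (x - p))))"
  by (intro C1_cmult C1_add C1_const C1_inner_self)
 have n: "(x - p) \<bullet> (x - p) = (dist p x)^2" for x
  by (simp add: dot_square_norm dist_norm norm_minus_commute)
 show ?thesis
 proof (rule that[OF C1_compose[OF q s]])
  fix x assume "x \<in> cball p (r/2)"
  then have "(dist p x)^2 <= (r/2)^2" by (intro power_mono) auto
  then show "step ((4 / (3 * r^2)) * ?q x) = 1"
   using r by (intro step_1) (simp add: n field_simps power2_eq_square)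
 next
  fix x assume "x \<notin> ball p r"
  then have "r^2 <= (dist p x)^2" using r by (intro power_mono) auto
  then show "step ((4 / (3 * r^2)) * ?q x) = 0"
   using r by (intro step_0) (simp add: n field_simps)
 qed (simp_all add: step_range)
qed

text \<open>Near \<open>p\<close> the set is the positivity set of \<open>y\<close>, the height above the boundary graph in
 direction \<open>e\<close>.\<close>

definition chart :: "(real^'n) set => real^'n => real => real^'n => (real^'n => real) => (real^'n => real^'n) => bool" where
 "chart U p \<rho> e y y' \<longleftrightarrow> \<rho> > 0 \<and> norm e = 1 \<and> C1 y y' \<and> (\<forall>x t. y (x + t *R e) = y x + t) \<and>
   U \<inter> ball p \<rho> = {x \<in> ball p \<rho>. y x > 0}"

text \<open>A local uniform inner cone condition, stated in the form needed for mollification: the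
  ball contained in U is the one over which \<open>moll t a\<close> averages at x.\<close>

definition cone_at :: "(real^'n) set => real^'n => real => real^'n => real => bool" where
 "cone_at U p \<rho> a t0 \<longleftrightarrow> \<rho> > 0 \<and> t0 > 0 \<and>
   (\<forall>x\<in>U \<inter> ball p \<rho>. \<forall>t. 0 < t \<and> t <= t0 --> cball (x + t *R a) t \<subseteq> U)"

section \<open>Charts, inner cones and bases of cone directions\<close>

lemma C2_boundary_chart:
 fixes U :: "(real^'n) set"
 assumes "C2_boundary U" "p \<in> frontier U"
 obtains \<rho> e y y' where "chart U p \<rho> e y y'"
proof -
 from bspec[OF assms(1)[unfolded C2_boundary_def] assms(2)]
 obtain \<rho> e \<gamma> where r: "\<rho> > 0" and e: "norm e = 1" and g: "C_k 2 (\<gamma> :: real^'n => real)"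
  and eq: "U \<inter> ball p \<rho> = {x \<in> ball p \<rho>. x \<bullet> e > \<gamma> (x - (x \<bullet> e) *R e)}"
  by (elim exE conjE) (rule that)
 obtain g' where g': "C1 \<gamma> g'" using C_k_1_imp_C1[of 1 \<gamma>] g by (auto simp: numeral_2_eq_2)
 define pr where "pr x = x - (x \<bullet> e) *R e" for x
 define y where "y x = x \<bullet> e - \<gamma> (pr x)" for x
 define y' where "y' x = e - (g' (pr x) - (g' (pr x) \<bullet> e) *R e)" for x
 have "C1 y y'"
  unfolding C1_def
 proof (intro conjI allI)
  fix x
  have "(pr has_derivative pr) (at x)"
   unfolding pr_def[abs_def] by (auto intro!: derivative_eq_intros)
  from has_derivative_compose[OF this C1_deriv[OF g']]
  have "((%x. \<gamma> (pr x)) has_derivative (%h. pr h \<bullet> g' (pr x))) (at x)" .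
  then show "(y has_derivative (%h. h \<bullet> y' x)) (at x)"
   unfolding y_def[abs_def] y'_def
   by (auto intro!: derivative_eq_intros simp: pr_def inner_diff_left inner_diff_right inner_commute)
  have "continuous_on UNIV pr" unfolding pr_def[abs_def] by (intro continuous_intros)
  then show "continuous_on UNIV y'" unfolding y'_def[abs_def]
   by (intro continuous_intros continuous_on_compose2[OF C1_cont_grad[OF g']]) auto
 qed
 moreover have "y (x + t *R e) = y x + t" for x t
 proof -
  have ee: "e \<bullet> e = 1" using e by (simp add: dot_square_norm)
  have "pr (x + t *R e) = pr x" by (simp add: pr_def inner_add_left ee algebra_simps)
  then show ?thesis by (simp add: y_def inner_add_left ee)
 qed
 ultimately have "chart U p \<rho> e y y'"
  using r e eq unfolding chart_def y_def pr_def by auto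
 then show ?thesis by (rule that)
qed

lemma C1_lipschitz_ball:
 assumes f: "C1 f f'"
 obtains L where "L > 0" "!!x z. x \<in> cball p r ==> z \<in> cball p r ==> \<bar>f x - f z\<bar> <= L * norm (x - z)"
proof -
 have "compact (f' ` cball p r)"
  by (intro compact_continuous_image continuous_on_subset[OF C1_cont_grad[OF f]]) auto
 then obtain L where L: "L > 0" "!!x. x \<in> cball p r ==> norm (f' x) <= L"
  using compact_imp_bounded bounded_pos by (metis imageI)
 have "\<bar>f x - f z\<bar> <= L * norm (x - z)" if "x \<in> cball p r" "z \<in> cball p r" for x z
 proof -
  have "norm (f x - f z) <= L * norm (x - z)"
  proof (rule differentiable_bound[OF convex_cball _ _ that, of f "%x h. h \<bullet> f' x"])
   fix w assume w: "w \<in> cball p r"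
   show "(f has_derivative (%h. h \<bullet> f' w)) (at w within cball p r)"
    by (rule has_derivative_at_withinI[OF C1_deriv[OF f]])
   show "onorm (%h. h \<bullet> f' w) <= L"
   proof (rule onorm_le)
    fix h
    have "\<bar>h \<bullet> f' w\<bar> <= norm h * norm (f' w)" by (rule Cauchy_Schwarz_ineq2)
    also have "... <= norm h * L" using L(2)[OF w] by (intro mult_left_mono) auto
    finally show "norm (h \<bullet> f' w) <= L * norm h" by (simp add: mult.commute)
   qed
  qed
  then show ?thesis by simp
 qed
 with L(1) show ?thesis by (rule that)
qed

text \<open>If L is a Lipschitz constant of the height, moving by t (L + 1) along e raises the
  height by t (L + 1), while a perturbation of length t lowers it by at most L t.\<close>

lemma chart_cone:
 assumes c: "chart U p \<rho> e y y'"
 obtains \<rho>' a t0 where "\<rho>' < \<rho>" "cone_at U p \<rho>' a t0"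
proof -
 have r: "\<rho> > 0" and e: "norm e = 1" and y: "C1 y y'" and ye: "!!x t. y (x + t *R e) = y x + t"
  and eq: "!!x. x \<in> ball p \<rho> ==> x \<in> U \<longleftrightarrow> y x > 0"
  using c unfolding chart_def by auto
 obtain L where L: "L > 0" "!!x z. x \<in> cball p \<rho> ==> z \<in> cball p \<rho> ==> \<bar>y x - y z\<bar> <= L * norm (x - z)"
  using C1_lipschitz_ball[OF y] by metis
 define l where "l = L + 1"
 \<comment> \<open>Small enough that a point of the half ball, displaced by at most t (l + 1),
   remains in the chart ball.\<close>
 define t0 where "t0 = \<rho> / (2 * (l + 2))"
 have t0: "t0 > 0" "t0 * (l + 1) < \<rho> / 2" using r L by (auto simp: t0_def l_def field_simps)
 have "cone_at U p (\<rho>/2) (l *R e) t0"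
  unfolding cone_at_def
 proof (intro conjI ballI allI impI subsetI)
  fix x t z assume x: "x \<in> U \<inter> ball p (\<rho>/2)" and t: "0 < t \<and> t <= t0" and z: "z \<in> cball (x + t *R l *R e) t"
  define w where "w = z - (t * l) *R e"
  have wx: "norm (w - x) <= t" using z by (simp add: w_def dist_norm norm_minus_commute algebra_simps)
  have zw: "z = w + (t * l) *R e" by (simp add: w_def)
  have tl1: "t * l + t <= t0 * (l + 1)"
   using t mult_right_mono[of t t0 "l + 1"] L by (simp add: algebra_simps l_def)
  have tl2: "0 <= t * l" using t L by (simp add: l_def)
  note tl = tl1 tl2 order_trans[OF _ tl1, of t]
  have px: "norm (x - p) < \<rho>/2" using x by (simp add: dist_norm norm_minus_commute)
  have "norm (w - p) <= norm (w - x) + norm (x - p)" by (rule norm_diff_triangle_le[OF order_refl order_refl])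
  then have wp: "w \<in> ball p \<rho>" and wp': "norm (w - p) <= t + norm (x - p)"
   using wx px tl t0 t by (auto simp: dist_norm norm_minus_commute)
  have "norm (z - p) <= norm (w - p) + norm ((t * l) *R e)"
   unfolding zw using norm_triangle_ineq[of "w - p" "(t * l) *R e"] by (simp add: algebra_simps)
  then have zp: "z \<in> ball p \<rho>" using wp' px tl t0 e by (simp add: dist_norm norm_minus_commute)
  have xp: "x \<in> ball p \<rho>" using px r by (simp add: dist_norm norm_minus_commute)
  have "\<bar>y w - y x\<bar> <= L * norm (w - x)" using wp xp by (intro L) auto
  also have "... <= L * t" using wx L by (intro mult_left_mono) auto
  finally have "y w >= y x - L * t" by linarith
  moreover have "y x > 0" using eq[OF xp] x by auto
  moreover have "t * l > L * t" using t by (simp add: l_def algebra_simps)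
  ultimately have "y z > 0" unfolding zw ye by linarith
  then show "z \<in> U" using eq[OF zp] by simp
 qed (use r t0 in auto)
 then show ?thesis using r by (intro that[of "\<rho>/2"]) auto
qed

lemma interior_cone:
 assumes "open U" "p \<in> U"
 obtains \<rho> t0 where "cone_at U p \<rho> 0 t0" "ball p \<rho> \<subseteq> U"
proof -
 obtain d where d: "d > 0" "ball p d \<subseteq> U" using assms open_contains_ball by blast
 have "cone_at U p (d/2) 0 (d/3)"
  unfolding cone_at_def
 proof (intro conjI ballI allI impI)
  fix x t assume "x \<in> U \<inter> ball p (d/2)" "0 < t \<and> t <= d/3"
  then have "dist p z < d" if "dist x z <= t" for z
   using dist_triangle[of p z x] that by simp
  then have "cball (x + t *R 0) t \<subseteq> ball p d" by (simp add: subset_eq)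
  then show "cball (x + t *R 0) t \<subseteq> U" using d by auto
 qed (use d in auto)
 moreover have "ball p (d/2) \<subseteq> U" using d by (auto simp: subset_eq)
 ultimately show ?thesis by (rule that)
qed

text \<open>Because v_i is within distance 1 of a, the point x + t v_i lies in the ball of radius t
  around x + t a, so a cone with axis a contains segments in n independent directions. The matrix
  with columns v_i is a rank-one perturbation of s times the identity, and w is its inverse by the
  Sherman-Morrison formula.\<close>

lemma dual_basis_near:
 fixes a :: "real^'n"
 obtains v w :: "'n => real^'n" where "!!i. norm (v i - a) <= 1"
  "!!i j. w i \<bullet> v j = (if i = j then 1 else 0)" "!!x. x = (\<Sum>i\<in>UNIV. (w i \<bullet> x) *R v i)"
proof -
 define \<sigma> where "\<sigma> = (\<Sum>j\<in>UNIV. a $ j)"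
 \<comment> \<open>The perturbed matrix is invertible exactly if s and s + \<sigma> are nonzero; one
   of the two signs always achieves this.\<close>
 define s :: real where "s = (if 1 + \<sigma> = 0 then -1 else 1)"
 have s: "s \<noteq> 0" "s + \<sigma> \<noteq> 0" "\<bar>s\<bar> = 1" by (auto simp: s_def)
 define v where "v i = a + s *R axis i 1" for i :: 'n
 define w :: "'n => real^'n" where "w i = (1/s) *R (axis i 1 - (a $ i / (s + \<sigma>)) *R (\<chi> k. 1))" for i
 have one: "(\<chi> k. 1) \<bullet> x = (\<Sum>j\<in>UNIV. x $ j)" for x :: "real^'n"
  by (simp add: inner_vec_def)
 have w: "w i \<bullet> x = (x $ i - a $ i / (s + \<sigma>) * (\<Sum>j\<in>UNIV. x $ j)) / s" for i x
  by (simp add: w_def inner_diff_left inner_axis' one)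
 have sv: "(\<Sum>k\<in>UNIV. v j $ k) = \<sigma> + s" for j
 proof -
  have "v j $ k = a $ k + s * (if k = j then 1 else 0)" for k by (simp add: v_def axis_def)
  then show ?thesis by (simp only: sum.distrib sum_distrib_left[symmetric] \<sigma>_def) simp
 qed
 show ?thesis
 proof (rule that)
  show "norm (v i - a) <= 1" for i using s by (simp add: v_def)
  show "w i \<bullet> v j = (if i = j then 1 else 0)" for i j
   unfolding w sv using s by (simp add: v_def axis_def add.commute)
  fix x :: "real^'n"
  let ?X = "\<Sum>j\<in>UNIV. x $ j"
  have "(\<Sum>i\<in>UNIV. (w i \<bullet> x) *R v i) $ k = x $ k" for k
  proof -
   have "(\<Sum>i\<in>UNIV. (w i \<bullet> x) *R v i) $ k = (\<Sum>i\<in>UNIV. (w i \<bullet> x)) * a $ k + (\<Sum>i\<in>UNIV. (w i \<bullet> x) * (s * (if k = i then 1 else 0)))"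
    by (simp add: v_def algebra_simps sum.distrib sum_distrib_left sum_distrib_right axis_def)
   also have "(\<Sum>i\<in>UNIV. (w i \<bullet> x) * (s * (if k = i then 1 else 0))) = (w k \<bullet> x) * s"
    by (simp add: if_distrib cong: if_cong)
   also have "(\<Sum>i\<in>UNIV. (w i \<bullet> x)) = (?X - \<sigma> / (s + \<sigma>) * ?X) / s"
    unfolding w \<sigma>_def by (simp add: sum_divide_distrib[symmetric] sum_subtractf sum_distrib_right[symmetric])
   also have "... * a $ k + (w k \<bullet> x) * s = x $ k"
   proof -
    have "(?X - \<sigma> / (s + \<sigma>) * ?X) / s = ?X / (s + \<sigma>)" 
    proof -
     have "1 - \<sigma> / (s + \<sigma>) = s / (s + \<sigma>)" using s(2) by (simp add: field_simps)
     moreover have "?X - \<sigma> / (s + \<sigma>) * ?X = (1 - \<sigma> / (s + \<sigma>)) * ?X" by (simp add: algebra_simps)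
     ultimately show ?thesis using s(1) by simp
    qed
    then show ?thesis unfolding w using s(1) by simp
   qed
   finally show ?thesis .
  qed
  then show "x = (\<Sum>i\<in>UNIV. (w i \<bullet> x) *R v i)" by (simp add: vec_eq_iff)
 qed
qed

section \<open>A Loomis--Whitney inequality in skew coordinates\<close>

definition esqrt :: "ennreal => ennreal" where
 "esqrt x = (if x = top then top else ennreal (sqrt (enn2real x)))"

lemma ennreal_top_power2: "(top::ennreal)^2 = top"
 by (simp add: power2_eq_square ennreal_top_mult)

lemma esqrt_power2: "(esqrt x)^2 = x"
 by (cases x) (auto simp: esqrt_def ennreal_power ennreal_top_power2)

lemma esqrt_mult_self: "esqrt x * esqrt x = x"
 using esqrt_power2[of x] by (simp add: power2_eq_square)

lemma ennreal_power2_le_imp_le: "a^2 <= b^2 ==> a <= (b::ennreal)"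
 by (cases a; cases b) (auto simp: ennreal_power power2_le_iff_abs_le ennreal_top_power2 top_unique abs_le_square_iff[symmetric])

lemma le_esqrt: "a^2 <= b ==> a <= esqrt b"
 by (rule ennreal_power2_le_imp_le) (simp add: esqrt_power2)

lemma esqrt_borel [measurable]: "esqrt \<in> borel_measurable borel"
 unfolding esqrt_def[abs_def] by measurable

lemma nn_integral_esqrt_le:
 assumes [measurable]: "f \<in> borel_measurable M" "g \<in> borel_measurable M"
 shows "(\<integral>\<^sup>+x. esqrt (f x) * esqrt (g x) \<partial>M) <= esqrt (\<integral>\<^sup>+x. f x \<partial>M) * esqrt (\<integral>\<^sup>+x. g x \<partial>M)"
proof (rule ennreal_power2_le_imp_le)
 have "(\<integral>\<^sup>+x. esqrt (f x) * esqrt (g x) \<partial>M)^2 <= (\<integral>\<^sup>+x. (esqrt (f x))^2 \<partial>M) * (\<integral>\<^sup>+x. (esqrt (g x))^2 \<partial>M)"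
  by (rule Cauchy_Schwarz_nn_integral) measurable
 then show "(\<integral>\<^sup>+x. esqrt (f x) * esqrt (g x) \<partial>M)^2 <= (esqrt (\<integral>\<^sup>+x. f x \<partial>M) * esqrt (\<integral>\<^sup>+x. g x \<partial>M))^2"
  by (simp add: esqrt_power2 power_mult_distrib)
qed

section \<open>Line integrals and Fubini's theorem in skew directions\<close>

definition lineint :: "'a::euclidean_space => ('a => ennreal) => 'a => ennreal" where
 "lineint v F x = (\<integral>\<^sup>+t. F (x + t *R v) \<partial>(lborel :: real measure))"

lemma lineint_measurable [measurable]:
 assumes [measurable]: "F \<in> borel_measurable borel" shows "lineint v F \<in> borel_measurable borel"
 unfolding lineint_def[abs_def] by measurable

lemma lineint_mono: "(!!x. F x <= G x) ==> lineint v F x <= lineint v G x"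
 unfolding lineint_def by (intro nn_integral_mono)

lemma lineint_self:
 assumes [measurable]: "F \<in> borel_measurable borel"
 shows "lineint v F (x + s *R v) = lineint v F x"
 unfolding lineint_def using lborel_nn_integral_translate[of "%t. F (x + t *R v)" s]
 by (simp add: algebra_simps)

lemma lineint_invariant:
 fixes H :: "'a::euclidean_space => ennreal"
 assumes "!!x s. H (x + s *R u) = H x" shows "lineint v H (x + s *R u) = lineint v H x"
 unfolding lineint_def using assms[of "x + _ *R v"] by (simp add: add_ac)

lemma lineint_commute:
 assumes [measurable]: "F \<in> borel_measurable borel"
 shows "lineint v (lineint w F) = lineint w (lineint v F)"
proof
 fix x
 have "lineint v (lineint w F) x = (NI s. (NI t. F (x + t *R v + s *R w)))"
  unfolding lineint_def by (rule lborel_pair.Fubini') measurable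
 also have "... = lineint w (lineint v F) x"
  unfolding lineint_def by (simp add: add.commute add.left_commute)
 finally show "lineint v (lineint w F) x = lineint w (lineint v F) x" .
qed

lemma lineint_cmult:
 assumes "!!x t. F (x + t *R v) = F x" and [measurable]: "G \<in> borel_measurable borel"
 shows "lineint v (%x. F x * G x) x = F x * lineint v G x"
 unfolding lineint_def assms(1) by (rule nn_integral_cmult) measurable

lemma lineint_esqrt_le:
 assumes [measurable]: "F \<in> borel_measurable borel" "G \<in> borel_measurable borel"
 shows "lineint v (%x. esqrt (F x) * esqrt (G x)) x <= esqrt (lineint v F x) * esqrt (lineint v G x)"
 unfolding lineint_def by (rule nn_integral_esqrt_le) measurable

text \<open>After exchanging the integrals and translating by t v, each point x is counted with the
  measure of those t for which w . x - t lies in [0,1], which is 1. The slab thus stands in for a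
  hyperplane transversal to v.\<close>

lemma nn_integral_lineint:
 fixes F :: "'a::euclidean_space => ennreal"
 assumes [measurable]: "F \<in> borel_measurable borel" and wv: "w \<bullet> v = 1"
 shows "(NI x. F x) = (NI x. indicator {0..1::real} (w \<bullet> x) * lineint v F x)"
proof -
 have "(NI x. indicator {0..1::real} (w \<bullet> x) * lineint v F x) =
  (NI x. (NI t. indicator {0..1} (w \<bullet> x) * F (x + t *R v)))"
  unfolding lineint_def by (intro nn_integral_cong nn_integral_cmult[symmetric]) measurable
 also have "... = (NI t. (NI x. indicator {0..1} (w \<bullet> x) * F (x + t *R v)))"
  by (rule lborel_pair.Fubini') measurable
 also have "... = (NI t. (NI x. indicator {0..1} (w \<bullet> x - t) * F x))"
 proof (rule nn_integral_cong)
  fix t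
  show "(NI x. indicator {0..1} (w \<bullet> x) * F (x + t *R v)) = (NI x. indicator {0..1} (w \<bullet> x - t) * F x)"
   using lborel_nn_integral_translate[of "%x. indicator {0..1} (w \<bullet> x - t) * F x" "t *R v"]
   by (simp add: inner_add_right wv)
 qed
 also have "... = (NI x. (NI t. indicator {0..1} (w \<bullet> x - t) * F x))"
  by (rule lborel_pair.Fubini') measurable
 also have "... = (NI x. F x)"
 proof (intro nn_integral_cong)
  fix x
  have "(NI t. indicator {0..1} (w \<bullet> x - t)) = (NI t. indicator {w \<bullet> x - 1..w \<bullet> x} t)"
   by (intro nn_integral_cong) (auto simp: indicator_def)
  also have "... = 1" by simp
  finally show "(NI t. indicator {0..1} (w \<bullet> x - t) * F x) = F x"
   by (simp add: nn_integral_multc)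
 qed
 finally show ?thesis by simp
qed

text \<open>Integrating along all vectors of a basis gives a constant function, proportional to the
 integral over the space; \<open>\<kappa>\<close> is the volume of the fundamental parallelepiped.\<close>

lemma nn_integral_scale_pos_finite:
 fixes \<kappa> :: ennreal and J :: "('a::euclidean_space => ennreal) => ennreal"
 assumes "!!F. F \<in> borel_measurable borel ==> (NI x. F x) = \<kappa> * J F"
 shows "\<kappa> \<noteq> 0" "\<kappa> \<noteq> top"
proof -
 \<comment> \<open>The unit cube has volume 1, which excludes both extreme values: with an infinite
   factor the product could only be 0 or infinite.\<close>
 have "emeasure lborel (cbox 0 (One::'a)) = 1"
  by (subst emeasure_lborel_cbox) (auto simp: inner_Basis)
 then have *: "\<kappa> * J (indicator (cbox 0 One)) = 1"
  using assms[of "indicator (cbox 0 One)"] by simp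
 from * show "\<kappa> \<noteq> 0" by auto
 show "\<kappa> \<noteq> top"
 proof
  assume "\<kappa> = top" with * show False
   by (cases "J (indicator (cbox 0 One)) = 0") (auto simp: ennreal_top_mult)
 qed
qed

lemma lineint3:
 fixes v1 v2 v3 :: "'a::euclidean_space"
 assumes w: "w1 \<bullet> v1 = 1" "w1 \<bullet> v2 = 0" "w1 \<bullet> v3 = 0" "w2 \<bullet> v2 = 1" "w2 \<bullet> v3 = 0" "w3 \<bullet> v3 = 1"
  and span: "!!x. \<exists>c1 c2 c3. x = c1 *R v1 + c2 *R v2 + c3 *R v3"
 obtains \<kappa> where "\<kappa> \<noteq> 0" "\<kappa> \<noteq> top"
  "\<forall>F\<in>borel_measurable borel. \<forall>x. (NI x. F x) = \<kappa> * lineint v3 (lineint v2 (lineint v1 F)) x"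
proof -
 let ?c = "%w (x::'a). indicator {0..1::real} (w \<bullet> x) :: ennreal"
 define \<kappa> where "\<kappa> = (NI x. ?c w3 x * (?c w2 x * ?c w1 x))"
 have main: "(NI x. F x) = \<kappa> * lineint v3 (lineint v2 (lineint v1 F)) x"
  if [measurable]: "F \<in> borel_measurable borel" for F x
 proof -
  let ?J = "lineint v3 (lineint v2 (lineint v1 F))"
  have c1: "?J (x + s *R v1) = ?J x" for x s
   by (intro lineint_invariant lineint_self that)
  have c2: "?J (x + s *R v2) = ?J x" for x s
   by (intro lineint_invariant lineint_self) measurable
  have c3: "?J (x + s *R v3) = ?J x" for x s
   by (intro lineint_self) measurable
  have const: "?J z = ?J x" for z
  proof -
   obtain a b c where "z - x = a *R v1 + b *R v2 + c *R v3" using span by blast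
   then have "z = x + a *R v1 + b *R v2 + c *R v3" by (simp add: algebra_simps)
   then show ?thesis by (simp only: c1 c2 c3)
  qed
  have "(NI x. F x) = (NI x. ?c w1 x * lineint v1 F x)"
   by (rule nn_integral_lineint[OF that w(1)])
  also have "... = (NI x. ?c w2 x * lineint v2 (%x. ?c w1 x * lineint v1 F x) x)"
   by (rule nn_integral_lineint[OF _ w(4)]) measurable
  \<comment> \<open>Since w1 . v2 = 0, the slab weight of w1 is constant along v2 and leaves the
    line integral.\<close>
  also have "... = (NI x. ?c w2 x * ?c w1 x * lineint v2 (lineint v1 F) x)"
   by (subst lineint_cmult) (auto simp: inner_add_right w mult.assoc)
  also have "... = (NI x. ?c w3 x * lineint v3 (%x. ?c w2 x * ?c w1 x * lineint v2 (lineint v1 F) x) x)"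
   by (rule nn_integral_lineint[OF _ w(6)]) measurable
  also have "... = (NI x. ?c w3 x * (?c w2 x * ?c w1 x) * ?J x)"
   by (subst lineint_cmult) (auto simp: inner_add_right w mult.assoc)
  also have "... = (NI z. ?c w3 z * (?c w2 z * ?c w1 z) * ?J x)"
   by (rule nn_integral_cong) (metis const)
  also have "... = \<kappa> * ?J x" unfolding \<kappa>_def by (rule nn_integral_multc) measurable
  finally show ?thesis .
 qed
 have nz: "\<kappa> \<noteq> 0" "\<kappa> \<noteq> top" by (rule nn_integral_scale_pos_finite[OF main], assumption)+
 show ?thesis by (rule that[OF nz]) (intro ballI allI, rule main)
qed

lemma lineint2:
 fixes v1 v2 :: "'a::euclidean_space"
 assumes w: "w1 \<bullet> v1 = 1" "w1 \<bullet> v2 = 0" "w2 \<bullet> v2 = 1"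
  and span: "!!x. \<exists>c1 c2. x = c1 *R v1 + c2 *R v2"
 obtains \<kappa> where "\<kappa> \<noteq> 0" "\<kappa> \<noteq> top"
  "\<forall>F\<in>borel_measurable borel. \<forall>x. (NI x. F x) = \<kappa> * lineint v2 (lineint v1 F) x"
proof -
 let ?c = "%w (x::'a). indicator {0..1::real} (w \<bullet> x) :: ennreal"
 define \<kappa> where "\<kappa> = (NI x. ?c w2 x * ?c w1 x)"
 have main: "(NI x. F x) = \<kappa> * lineint v2 (lineint v1 F) x"
  if [measurable]: "F \<in> borel_measurable borel" for F x
 proof -
  let ?J = "lineint v2 (lineint v1 F)"
  have c1: "?J (x + s *R v1) = ?J x" for x s
   by (intro lineint_invariant lineint_self that)
  have c2: "?J (x + s *R v2) = ?J x" for x s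
   by (intro lineint_self) measurable
  have const: "?J z = ?J x" for z
  proof -
   obtain a b where "z - x = a *R v1 + b *R v2" using span by blast
   then have "z = x + a *R v1 + b *R v2" by (simp add: algebra_simps)
   then show ?thesis by (simp only: c1 c2)
  qed
  have "(NI x. F x) = (NI x. ?c w1 x * lineint v1 F x)"
   by (rule nn_integral_lineint[OF that w(1)])
  also have "... = (NI x. ?c w2 x * lineint v2 (%x. ?c w1 x * lineint v1 F x) x)"
   by (rule nn_integral_lineint[OF _ w(3)]) measurable
  also have "... = (NI x. ?c w2 x * ?c w1 x * ?J x)"
   by (subst lineint_cmult) (auto simp: inner_add_right w mult.assoc)
  also have "... = (NI z. ?c w2 z * ?c w1 z * ?J x)"
   by (rule nn_integral_cong) (metis const)
  also have "... = \<kappa> * ?J x" unfolding \<kappa>_def by (rule nn_integral_multc) measurable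
  finally show ?thesis .
 qed
 have nz: "\<kappa> \<noteq> 0" "\<kappa> \<noteq> top" by (rule nn_integral_scale_pos_finite[OF main], assumption)+
 show ?thesis by (rule that[OF nz]) (intro ballI allI, rule main)
qed

text \<open>The Gagliardo-Nirenberg argument. Bound m^3 by three square roots of line integrals and
  integrate one direction at a time: the factor already integrated in that direction is constant
  along it, and Cauchy-Schwarz treats the other two. In the application m is u^2.\<close>

lemma gagliardo3:
 fixes v1 v2 v3 :: "'a::euclidean_space"
 assumes [measurable]: "G \<in> borel_measurable borel" "m \<in> borel_measurable borel"
  and le: "!!x. (m x)^2 <= lineint v1 G x" "!!x. (m x)^2 <= lineint v2 G x" "!!x. (m x)^2 <= lineint v3 G x"
 shows "(lineint v3 (lineint v2 (lineint v1 (%x. (m x)^3))) x)^2 <= (lineint v3 (lineint v2 (lineint v1 G)) x)^3"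
proof -
 let ?I1 = "lineint v1" and ?I2 = "lineint v2" and ?I3 = "lineint v3"
 have m1: "m x <= esqrt (?I1 G x)" "m x <= esqrt (?I2 G x)" "m x <= esqrt (?I3 G x)" for x
  using le by (auto intro: le_esqrt)
 have s1: "?I1 (%x. (m x)^3) x <= esqrt (?I1 G x) * (esqrt (?I1 (?I2 G) x) * esqrt (?I1 (?I3 G) x))" for x
 proof -
  have "?I1 (%x. (m x)^3) x <= ?I1 (%x. esqrt (?I1 G x) * (esqrt (?I2 G x) * esqrt (?I3 G x))) x"
   unfolding power3_eq_cube mult.assoc by (intro lineint_mono mult_mono m1) auto
  also have "... = esqrt (?I1 G x) * ?I1 (%x. (esqrt (?I2 G x) * esqrt (?I3 G x))) x"
   by (rule lineint_cmult) (auto simp: lineint_self)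
  also have "... <= esqrt (?I1 G x) * (esqrt (?I1 (?I2 G) x) * esqrt (?I1 (?I3 G) x))"
   by (intro mult_left_mono lineint_esqrt_le) auto
  finally show ?thesis .
 qed
 have s2: "?I2 (?I1 (%x. (m x)^3)) x <= ?I2 (?I1 G) x * esqrt (?I3 (?I2 (?I1 G)) x)" for x
 proof -
  have "?I2 (?I1 (%x. (m x)^3)) x <= ?I2 (%x. esqrt (?I2 (?I1 G) x) * (esqrt (?I1 G x) * esqrt (?I3 (?I1 G) x))) x"
   using s1 by (intro lineint_mono) (simp add: lineint_commute[of G v1] mult_ac)
  also have "... = esqrt (?I2 (?I1 G) x) * ?I2 (%x. (esqrt (?I1 G x) * esqrt (?I3 (?I1 G) x))) x"
   by (rule lineint_cmult) (auto simp: lineint_self)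
  also have "... <= esqrt (?I2 (?I1 G) x) * (esqrt (?I2 (?I1 G) x) * esqrt (?I2 (?I3 (?I1 G)) x))"
   by (intro mult_left_mono lineint_esqrt_le) auto
  also have "... = ?I2 (?I1 G) x * esqrt (?I3 (?I2 (?I1 G)) x)"
   by (simp add: mult.assoc[symmetric] esqrt_mult_self lineint_commute[of "?I1 G" v2])
  finally show ?thesis .
 qed
 have "?I3 (?I2 (?I1 (%x. (m x)^3))) x <= ?I3 (%x. esqrt (?I3 (?I2 (?I1 G)) x) * ?I2 (?I1 G) x) x"
  using s2 by (intro lineint_mono) (simp add: mult.commute)
 also have "... = esqrt (?I3 (?I2 (?I1 G)) x) * ?I3 (?I2 (?I1 G)) x"
  by (rule lineint_cmult) (auto simp: lineint_self)
 finally have "(?I3 (?I2 (?I1 (%x. (m x)^3))) x)^2 <= (esqrt (?I3 (?I2 (?I1 G)) x) * ?I3 (?I2 (?I1 G)) x)^2"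
  by (rule power_mono) simp
 also have "... = (?I3 (?I2 (?I1 G)) x)^3"
  by (simp only: power_mult_distrib esqrt_power2) (simp add: power2_eq_square power3_eq_cube mult.assoc)
 finally show ?thesis .
qed

text \<open>In the plane m^4 is a product of two squares, each bounded by the line integral in one
  direction, and each factor is constant along its own direction.\<close>

lemma gagliardo2:
 fixes v1 v2 :: "'a::euclidean_space"
 assumes [measurable]: "G \<in> borel_measurable borel" "m \<in> borel_measurable borel"
  and le: "!!x. (m x)^2 <= lineint v1 G x" "!!x. (m x)^2 <= lineint v2 G x"
 shows "lineint v2 (lineint v1 (%x. (m x)^4)) x <= (lineint v2 (lineint v1 G) x)^2"
proof -
 let ?I1 = "lineint v1" and ?I2 = "lineint v2"
 have s1: "?I1 (%x. (m x)^4) x <= ?I1 G x * ?I2 (?I1 G) x" for x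
 proof -
  have p4: "a ^ 4 = a^2 * a^2" for a :: ennreal by (simp flip: power_add)
  have "?I1 (%x. (m x)^4) x <= ?I1 (%x. ?I1 G x * ?I2 G x) x"
   unfolding p4 by (intro lineint_mono mult_mono le) auto
  also have "... = ?I1 G x * ?I1 (?I2 G) x"
   by (rule lineint_cmult) (auto simp: lineint_self)
  finally show ?thesis by (simp add: lineint_commute[of G v1])
 qed
 have "?I2 (?I1 (%x. (m x)^4)) x <= ?I2 (%x. ?I2 (?I1 G) x * ?I1 G x) x"
  using s1 by (intro lineint_mono) (simp add: mult.commute)
 also have "... = ?I2 (?I1 G) x * ?I2 (?I1 G) x"
  by (rule lineint_cmult) (auto simp: lineint_self)
 finally show ?thesis by (simp add: power2_eq_square)
qed

section \<open>The Sobolev inequality\<close>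

lemma loomis_whitney:
 fixes v w :: "'n::finite => real^'n"
 assumes card: "CARD('n) = 2 \<or> CARD('n) = 3"
  and dual: "!!i j. w i \<bullet> v j = (if i = j then 1 else 0)" 
  and span: "!!x. x = (\<Sum>i\<in>UNIV. (w i \<bullet> x) *R v i)"
 obtains k :: real where "k > 0" and "\<forall>G\<in>borel_measurable borel. \<forall>m\<in>borel_measurable borel.
  (\<forall>i x. (m x)^2 <= lineint (v i) G x) -->
  (CARD('n) = 3 --> ennreal k * (NI x. (m x)^3)^2 <= (NI x. G x)^3) \<and>
  (CARD('n) = 2 --> ennreal k * (NI x. (m x)^4) <= (NI x. G x)^2)"
proof (cases "CARD('n) = 3")
 case True
 obtain i j k :: 'n where ijk: "UNIV = {i,j,k}" "i \<noteq> j" "j \<noteq> k" "i \<noteq> k"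
  using True unfolding card_3_iff by auto
 have D: "w i \<bullet> v i = 1" "w i \<bullet> v j = 0" "w i \<bullet> v k = 0" "w j \<bullet> v j = 1" "w j \<bullet> v k = 0" "w k \<bullet> v k = 1"
  using ijk(2-4) by (simp_all add: dual)
 have S: "\<exists>c1 c2 c3. x = c1 *R v i + c2 *R v j + c3 *R v k" for x
 proof -
  have "(\<Sum>i\<in>UNIV. (w i \<bullet> x) *R v i) = (w i \<bullet> x) *R v i + (w j \<bullet> x) *R v j + (w k \<bullet> x) *R v k"
   using ijk(2-4) by (simp add: ijk(1) add.assoc)
  from trans[OF span this] show ?thesis by blast
 qed
 obtain \<kappa> where \<kappa>: "\<kappa> \<noteq> 0" "\<kappa> \<noteq> top" and
  eq0: "\<forall>F\<in>borel_measurable borel. \<forall>x. (NI x. F x) = \<kappa> * lineint (v k) (lineint (v j) (lineint (v i) F)) x"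
  by (rule lineint3[OF D S]) (rule that)
 note eq = eq0[rule_format]
 obtain c where c: "\<kappa> = ennreal c" "c > 0" using \<kappa> by (cases \<kappa>) (auto simp: less_le)
 show ?thesis
 proof (rule that[OF c(2)], intro ballI impI)
  fix G m assume [measurable]: "G \<in> borel_measurable borel" "m \<in> borel_measurable borel"
   and le0: "\<forall>i x. (m x)^2 <= lineint (v i) G x"
  note le = le0[rule_format]
  have [measurable]: "(%x. (m x)^3) \<in> borel_measurable borel" by measurable
  let ?J = "%F. lineint (v k) (lineint (v j) (lineint (v i) F)) 0"
  \<comment> \<open>Two integrals stand on the left and three on the right; the extra factor
    \<kappa> balances the powers.\<close>
  have "\<kappa> * (NI x. (m x)^3)^2 = \<kappa>^3 * (?J (%x. (m x)^3))^2"
   by (subst eq[of _ 0]) (auto simp: power2_eq_square power3_eq_cube mult_ac)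
  also have "... <= \<kappa>^3 * (?J G)^3"
   by (intro mult_left_mono gagliardo3 le) auto
  also have "... = (NI x. G x)^3"
   by (subst eq[of G 0]) (auto simp: power_mult_distrib)
  finally show "(CARD('n) = 3 --> ennreal c * (NI x. (m x)^3)^2 <= (NI x. G x)^3) \<and>
   (CARD('n) = 2 --> ennreal c * (NI x. (m x)^4) <= (NI x. G x)^2)"
   using True c by auto
 qed
next
 case False
 then have card2: "CARD('n) = 2" using card by auto
 then obtain i j :: 'n where ij: "UNIV = {i,j}" "i \<noteq> j"
  unfolding card_2_iff by auto
 have D: "w i \<bullet> v i = 1" "w i \<bullet> v j = 0" "w j \<bullet> v j = 1"
  using ij(2) by (simp_all add: dual)
 have S: "\<exists>c1 c2. x = c1 *R v i + c2 *R v j" for x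
 proof -
  have "(\<Sum>i\<in>UNIV. (w i \<bullet> x) *R v i) = (w i \<bullet> x) *R v i + (w j \<bullet> x) *R v j"
   using ij(2) by (simp add: ij(1))
  from trans[OF span this] show ?thesis by blast
 qed
 obtain \<kappa> where \<kappa>: "\<kappa> \<noteq> 0" "\<kappa> \<noteq> top" and
  eq0: "\<forall>F\<in>borel_measurable borel. \<forall>x. (NI x. F x) = \<kappa> * lineint (v j) (lineint (v i) F) x"
  by (rule lineint2[OF D S]) (rule that)
 note eq = eq0[rule_format]
 obtain c where c: "\<kappa> = ennreal c" "c > 0" using \<kappa> by (cases \<kappa>) (auto simp: less_le)
 show ?thesis
 proof (rule that[OF c(2)], intro ballI impI)
  fix G m assume [measurable]: "G \<in> borel_measurable borel" "m \<in> borel_measurable borel"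
   and le0: "\<forall>i x. (m x)^2 <= lineint (v i) G x"
  note le = le0[rule_format]
  let ?J = "%F. lineint (v j) (lineint (v i) F) 0"
  have "\<kappa> * (NI x. (m x)^4) = \<kappa>^2 * (?J (%x. (m x)^4))"
   by (subst eq[of _ 0]) (auto simp: power2_eq_square mult_ac)
  also have "... <= \<kappa>^2 * (?J G)^2"
   by (intro mult_left_mono gagliardo2 le) auto
  also have "... = (NI x. G x)^2"
   by (subst eq[of G 0]) (auto simp: power_mult_distrib)
  finally show "(CARD('n) = 3 --> ennreal c * (NI x. (m x)^3)^2 <= (NI x. G x)^3) \<and>
   (CARD('n) = 2 --> ennreal c * (NI x. (m x)^4) <= (NI x. G x)^2)"
   using False card2 c by auto
 qed
qed

lemma integral_Cauchy_Schwarz: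
 fixes f g :: "'a => real"
 assumes [measurable]: "f \<in> borel_measurable M" "g \<in> borel_measurable M"
  and f: "integrable M (%x. (f x)^2)" and g: "integrable M (%x. (g x)^2)"
 shows "integrable M (%x. f x * g x)" "(\<integral>x. \<bar>f x * g x\<bar> \<partial>M)^2 <= (\<integral>x. (f x)^2 \<partial>M) * (\<integral>x. (g x)^2 \<partial>M)"
  "(\<integral>x. f x * g x \<partial>M)^2 <= (\<integral>x. (f x)^2 \<partial>M) * (\<integral>x. (g x)^2 \<partial>M)"
proof -
 show i: "integrable M (%x. f x * g x)"
 proof (rule Bochner_Integration.integrable_bound)
  show "integrable M (%x. (f x)^2 + (g x)^2)" using f g by simp
  have "\<bar>a * b\<bar> <= a^2 + b^2" for a b :: real
  proof -
   have "2 * \<bar>a\<bar> * \<bar>b\<bar> <= a^2 + b^2" using sum_squares_bound[of "\<bar>a\<bar>" "\<bar>b\<bar>"] by simp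
   moreover have "0 <= \<bar>a\<bar> * \<bar>b\<bar>" by simp
   ultimately show ?thesis unfolding abs_mult by linarith
  qed
  then show "AE x in M. norm (f x * g x) <= norm ((f x)^2 + (g x)^2)" by (auto intro!: AE_I2 order_trans[OF _ abs_ge_self])
 qed measurable
 have "(\<integral>\<^sup>+x. ennreal \<bar>f x\<bar> * ennreal \<bar>g x\<bar> \<partial>M)^2 <= (\<integral>\<^sup>+x. (ennreal \<bar>f x\<bar>)^2 \<partial>M) * (\<integral>\<^sup>+x. (ennreal \<bar>g x\<bar>)^2 \<partial>M)"
  by (rule Cauchy_Schwarz_nn_integral) measurable
 moreover have "(\<integral>\<^sup>+x. ennreal \<bar>f x\<bar> * ennreal \<bar>g x\<bar> \<partial>M) = ennreal (\<integral>x. \<bar>f x * g x\<bar> \<partial>M)"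
  using i by (simp add: ennreal_mult'[symmetric] abs_mult[symmetric] nn_integral_eq_integral)
 moreover have "(\<integral>\<^sup>+x. (ennreal \<bar>h x\<bar>)^2 \<partial>M) = ennreal (\<integral>x. (h x)^2 \<partial>M)" if "integrable M (%x. (h x)^2)" for h :: "'a => real"
  using nn_integral_eq_integral[OF that] by (simp add: ennreal_power)
 ultimately have "ennreal ((\<integral>x. \<bar>f x * g x\<bar> \<partial>M)^2) <= ennreal ((\<integral>x. (f x)^2 \<partial>M) * (\<integral>x. (g x)^2 \<partial>M))"
  using f g by (simp add: ennreal_power ennreal_mult)
 then show *: "(\<integral>x. \<bar>f x * g x\<bar> \<partial>M)^2 <= (\<integral>x. (f x)^2 \<partial>M) * (\<integral>x. (g x)^2 \<partial>M)"
  by (subst (asm) ennreal_le_iff) (auto intro!: mult_nonneg_nonneg)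
 have "\<bar>\<integral>x. f x * g x \<partial>M\<bar> <= (\<integral>x. \<bar>f x * g x\<bar> \<partial>M)" by (rule integral_abs_bound)
 then have "(\<integral>x. f x * g x \<partial>M)^2 <= (\<integral>x. \<bar>f x * g x\<bar> \<partial>M)^2" by (rule abs_le_square_iff[THEN iffD1, OF order_trans]) simp
 with * show "(\<integral>x. f x * g x \<partial>M)^2 <= (\<integral>x. (f x)^2 \<partial>M) * (\<integral>x. (g x)^2 \<partial>M)" by linarith
qed

lemma power_div_le:
 assumes "X ^ Suc n <= A * X ^ n" "0 <= (X::real)" "0 <= A" shows "X <= A"
proof (cases "X = 0")
 case False
 then have "X ^ n > 0" using assms by simp
 then show ?thesis using assms(1) by (simp add: mult.commute)
qed (use assms in simp)

text \<open>X, Y, Z are the integrals of u^6, u^4, u^8. In dimension 3, k X^2 <= (B g)^3 together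
  with g^2 <= X D bounds X. In dimension 2 the argument yields Z, and X follows by interpolation
  from X^2 <= Y Z and Y^2 <= U X. The numbers R and N guarantee that these integrals are finite, so
  that powers of X may be cancelled, and do not enter the constant.\<close>

lemma sobolev_core:
 fixes v w :: "'n::finite => real^'n"
 assumes card: "CARD('n) = 2 \<or> CARD('n) = 3" and B: "B >= 0"
  and dual: "!!i j. w i \<bullet> v j = (if i = j then 1 else 0)" 
  and span: "!!x. x = (\<Sum>i\<in>UNIV. (w i \<bullet> x) *R v i)"
 obtains C :: real where "C >= 0" and "\<forall>u p (R::real) (N::real). u \<in> borel_measurable borel --> p \<in> borel_measurable borel -->
  (\<forall>x. norm x > R --> u x = 0) --> (\<forall>x. \<bar>u x\<bar> <= N) --> (\<forall>x. 0 <= p x) -->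
  integrable lborel (%x. (p x)^2) -->
  (\<forall>i x. ennreal ((u x)^4) <= lineint (v i) (%x. ennreal (B * \<bar>u x\<bar>^3 * p x)) x) -->
  (LBINT x. (u x)^6) <= C * ((LBINT x. (u x)^2) + (LBINT x. (p x)^2))^3"
proof -
 obtain k :: real where k: "k > 0" and lw: "\<forall>G\<in>borel_measurable borel. \<forall>m\<in>borel_measurable borel.
  (\<forall>i x. (m x)^2 <= lineint (v i) G x) -->
  (CARD('n) = 3 --> ennreal k * (NI x. (m x)^3)^2 <= (NI x. G x)^3) \<and>
  (CARD('n) = 2 --> ennreal k * (NI x. (m x)^4) <= (NI x. G x)^2)"
  by (rule loomis_whitney[OF card dual span]) (rule that)
 \<comment> \<open>The sum of the constants found for dimension 3 and for dimension 2.\<close>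
 define C where "C = B^6 / k^2 + B^4 / k^2"
 have C0: "C >= 0" "B^6 / k^2 <= C" "B^4 / k^2 <= C" using B k by (auto simp: C_def)
 show ?thesis
 proof (rule that[OF C0(1)], intro allI impI)
  fix u p :: "real^'n => real" and R N :: real
  assume [measurable]: "u \<in> borel_measurable borel" "p \<in> borel_measurable borel"
   and z0: "\<forall>x. norm x > R --> u x = 0" and N0: "\<forall>x. \<bar>u x\<bar> <= N" and p00: "\<forall>x. 0 <= p x"
   and p2: "integrable lborel (%x. (p x)^2)"
   and le: "\<forall>i x. ennreal ((u x)^4) <= lineint (v i) (%x. ennreal (B * \<bar>u x\<bar>^3 * p x)) x"
  note z = z0[rule_format] and N = N0[rule_format] and p0 = p00[rule_format]
  have iu: "integrable lborel (%x. (u x)^n)" if "n > 0" for n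
  proof -
   have "integrable lborel (%x. indicator (cball 0 R) x *R (u x)^n)"
   proof (rule integrable_bounded_scale)
    show "integrable lborel (indicator (cball 0 R) :: real^'n => real)"
     by (rule integrable_real_indicator) (simp_all add: emeasure_bounded_finite[unfolded infinity_ennreal_def])
    show "norm ((u x)^n) <= N^n" for x using power_mono[OF N[of x], of n] by (simp add: power_abs)
   qed measurable
   moreover have "indicator (cball 0 R) x *R (u x)^n = (u x)^n" for x
    using z[of x] that by (auto simp: indicator_def)
   ultimately show ?thesis by (simp only:)
  qed
  define X where "X = (LBINT x. (u x)^6)"
  define Y where "Y = (LBINT x. (u x)^4)"
  define Z where "Z = (LBINT x. (u x)^8)"
  define U where "U = (LBINT x. (u x)^2)"
  define D where "D = (LBINT x. (p x)^2)"
  define g where "g = (LBINT x. \<bar>u x\<bar>^3 * p x)"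
  have nn: "0 <= X" "0 <= Y" "0 <= Z" "0 <= U" "0 <= D" "0 <= g"
   unfolding X_def Y_def Z_def U_def D_def g_def using p0 by (auto intro!: integral_nonneg)
  have pw: "(\<bar>a\<bar>^3)^2 = a^6" "(a^3)^2 = a^6" "(a^2)^2 = a^4" "(a^4)^2 = a^8" "(a^2)^3 = a^6" "(a^2)^4 = a^8"
   "a^2 * a^4 = a^6" for a :: real
   by (simp_all flip: power_mult power_add)
  have pw': "a * a^3 = a^4" for a :: real by (simp add: eval_nat_numeral)
  have u62: "integrable lborel (%x. (\<bar>u x\<bar>^3)^2)" using iu[of 6] by (simp only: pw) simp
  have ig: "integrable lborel (%x. \<bar>u x\<bar>^3 * p x)" and g2: "g^2 <= X * D"
   using integral_Cauchy_Schwarz(1,3)[OF _ _ u62 p2] unfolding g_def X_def D_def pw by simp_all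
  have Gint: "(NI x. ennreal (B * \<bar>u x\<bar>^3 * p x)) = ennreal (B * g)"
   unfolding g_def using ig B p0
   by (subst nn_integral_eq_integral) (auto simp: mult.assoc)
  have mm: "(ennreal ((u x)^2))^2 = ennreal ((u x)^4)" for x by (simp only: ennreal_power zero_le_power2 pw)
  have lw': "(CARD('n) = 3 --> ennreal k * (NI x. (ennreal ((u x)^2))^3)^2 <= (ennreal (B * g))^3) \<and>
   (CARD('n) = 2 --> ennreal k * (NI x. (ennreal ((u x)^2))^4) <= (ennreal (B * g))^2)"
   using lw[THEN bspec, THEN bspec, of "%x. ennreal (B * \<bar>u x\<bar>^3 * p x)" "%x. ennreal ((u x)^2)"] le
   unfolding mm Gint by simp
  have m3: "(NI x. (ennreal ((u x)^2))^3) = ennreal X"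
   unfolding X_def using iu[of 6] by (subst nn_integral_eq_integral[symmetric]) (auto simp: ennreal_power pw)
  have m4: "(NI x. (ennreal ((u x)^2))^4) = ennreal Z"
   unfolding Z_def using iu[of 8] by (subst nn_integral_eq_integral[symmetric]) (auto simp: ennreal_power pw)
  have Bg: "0 <= B * g" using B nn by simp
  show "(LBINT x. (u x)^6) <= C * ((LBINT x. (u x)^2) + (LBINT x. (p x)^2))^3"
   unfolding X_def[symmetric] U_def[symmetric] D_def[symmetric]
  proof (cases "CARD('n) = 3")
   case True
   then have "ennreal (k * X^2) <= ennreal ((B * g)^3)"
    using lw' m3 k nn Bg by (simp add: ennreal_power ennreal_mult)
   then have "k * X^2 <= (B * g)^3" using Bg by (subst (asm) ennreal_le_iff) auto
   then have "(k * X^2)^2 <= ((B * g)^3)^2" using k by (intro power_mono) auto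
   also have "... = B^6 * (g^2)^3" by (simp add: power_mult_distrib flip: power_mult)
   also have "... <= B^6 * (X * D)^3" using B g2 by (intro mult_left_mono power_mono) auto
   finally have "k^2 * X^4 <= B^6 * D^3 * X^3" by (simp add: power_mult_distrib mult_ac flip: power_mult)
   then have "X ^ Suc 3 <= (B^6 / k^2 * D^3) * X^3" using k by (simp add: field_simps eval_nat_numeral)
   then have "X <= B^6 / k^2 * D^3" by (rule power_div_le) (use nn B in auto)
   also have "... <= C * (U + D)^3" using C0 nn by (intro mult_mono power_mono) auto
   finally show "X <= C * (U + D)^3" .
  next
   case False
   then have "ennreal (k * Z) <= ennreal ((B * g)^2)"
    using lw' m4 k nn Bg card by (simp add: ennreal_power ennreal_mult)
   then have "k * Z <= (B * g)^2" using Bg by (subst (asm) ennreal_le_iff) auto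
   also have "... <= B^2 * (X * D)" using g2 by (simp add: power_mult_distrib mult_left_mono)
   finally have Z: "k * Z <= B^2 * D * X" by (simp add: mult_ac)
   have X2: "X^2 <= Y * Z"
    using integral_Cauchy_Schwarz(3)[of "%x. (u x)^2" lborel "%x. (u x)^4"] iu[of 4] iu[of 8]
    unfolding pw X_def Y_def Z_def by simp
   have Y2: "Y^2 <= U * X"
    using integral_Cauchy_Schwarz(3)[of "%x. (u x)" lborel "%x. (u x)^3"] iu[of 2] iu[of 6]
    unfolding pw pw' X_def Y_def U_def by simp
   have "k * X^2 <= Y * (k * Z)" using X2 k by (simp add: mult_left_mono mult.left_commute)
   also have "... <= Y * (B^2 * D * X)" using Z nn by (intro mult_left_mono) auto
   finally have "X ^ Suc 1 <= (B^2 * D * Y / k) * X ^ 1" using k by (simp add: field_simps power2_eq_square)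
   then have "X <= B^2 * D * Y / k" by (rule power_div_le) (use nn B k in auto)
   then have "X^2 <= (B^2 * D * Y / k)^2" using nn by (intro power_mono) auto
   also have "... = B^4 / k^2 * D^2 * Y^2" by (simp add: power_mult_distrib power_divide flip: power_mult)
   also have "... <= B^4 / k^2 * D^2 * (U * X)" using Y2 B nn by (intro mult_left_mono) auto
   finally have "X ^ Suc 1 <= (B^4 / k^2 * (U * D^2)) * X ^ 1" by (simp add: power2_eq_square mult_ac)
   then have "X <= B^4 / k^2 * (U * D^2)" by (rule power_div_le) (use nn B k in auto)
   also have "... <= C * ((U + D) * (U + D)^2)" using C0 nn by (intro mult_mono power_mono) auto
   finally show "X <= C * (U + D)^3" by (simp add: power2_eq_square power3_eq_cube)
  qed
 qed
qed

text \<open>The fundamental theorem for the fourth power. Its derivative is a cube times a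
  derivative, so that the integral is controlled by the sixth power of the function and the square
  of the derivative.\<close>

lemma line_bound:
 fixes \<phi> \<phi>' :: "real => real"
 assumes d: "!!t. (\<phi> has_real_derivative \<phi>' t) (at t)" and c: "continuous_on UNIV \<phi>'" and h: "h > 0" "\<phi> h = 0"
 shows "ennreal ((\<phi> 0)^4) <= (NI t. ennreal (4 * \<bar>\<phi> t\<bar>^3 * \<bar>\<phi>' t\<bar> * indicator {0..h} t))"
proof -
 have c\<phi>: "continuous_on UNIV \<phi>" using d by (meson DERIV_isCont continuous_at_imp_continuous_on)
 have b: "has_bochner_integral lborel (%t. (4 * (\<phi> t)^3 * \<phi>' t) * indicator {0..h} t) ((\<phi> h)^4 - (\<phi> 0)^4)"
 proof (rule has_bochner_integral_FTC_Icc_real)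
  show "((%t. (\<phi> t)^4) has_real_derivative 4 * (\<phi> t)^3 * \<phi>' t) (at t)" for t
   using DERIV_power[OF d, of 4 t] by (simp add: mult_ac)
  have "continuous_on UNIV (%t. 4 * (\<phi> t)^3 * \<phi>' t)" by (intro continuous_intros c c\<phi>)
  then show "isCont (%t. 4 * (\<phi> t)^3 * \<phi>' t) t" for t by (simp add: continuous_on_eq_continuous_at)
 qed (use h in auto)
 have "ennreal ((\<phi> 0)^4) = ennreal (norm (LBINT t. (4 * (\<phi> t)^3 * \<phi>' t) * indicator {0..h} t))"
  using has_bochner_integral_integral_eq[OF b] h by simp
 also have "... <= (NI t. ennreal (norm ((4 * (\<phi> t)^3 * \<phi>' t) * indicator {0..h} t)))"
  by (rule integral_norm_bound_ennreal) (use b in \<open>auto simp: has_bochner_integral_iff\<close>)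
 also have "... = (NI t. ennreal (4 * \<bar>\<phi> t\<bar>^3 * \<bar>\<phi>' t\<bar> * indicator {0..h} t))"
  by (simp add: abs_mult power_abs)
 finally show ?thesis .
qed

text \<open>A mollification along the cone axis, cut off near p, is C1 with controlled gradient in
  D. From a point x of D one integrates along the basis directions, which belong to the cone, so the
  segments up to time t0 never leave D and end outside the support of the cut-off. Fatou's lemma
  removes the mollification.\<close>

lemma sobolev_local:
 fixes D :: "(real^'n) set"
 assumes card: "CARD('n) = 2 \<or> CARD('n) = 3" and op: "open D" and cone: "cone_at D p \<rho> a t0"
 obtains r C where "r > 0" "C >= 0" "\<forall>f g. wgrad D f g -->
  (NI x. indicator (ball p r) x * ennreal ((f x)^6)) <=
   ennreal (C * H1_mass f g^3)"
proof -
 have \<rho>: "\<rho> > 0" and t0: "t0 > 0" and cone': "!!x t. x \<in> D ==> x \<in> ball p \<rho> ==> 0 < t ==> t <= t0 ==> cball (x + t *R a) t \<subseteq> D"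
  using cone unfolding cone_at_def by auto
 have [measurable]: "D \<in> sets borel" using op by auto
 obtain v w :: "'n => real^'n" where va: "!!i. norm (v i - a) <= 1" and
  dual: "!!i j. w i \<bullet> v j = (if i = j then 1 else 0)" and span: "!!x. x = (\<Sum>i\<in>UNIV. (w i \<bullet> x) *R v i)"
  by (rule dual_basis_near[of a]) (rule that)
 define c where "c = Min (range (%i. norm (v i)))"
 have v0: "v i \<noteq> 0" for i using dual[of i i] by auto
 have c: "c > 0" "!!i. c <= norm (v i)" unfolding c_def using v0 by (auto simp: Min_gr_iff)
 \<comment> \<open>Here 2 r <= t0 |v_i|, so a segment that starts in \<open>ball p r\<close> has
   left this ball at time t0.\<close>
 define r where "r = min \<rho> (t0 * c / 2)"
 have r: "r > 0" "r <= \<rho>" "2 * r <= t0 * c" using \<rho> t0 c by (auto simp: r_def)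
 define B where "B = 4 * (\<Sum>i\<in>UNIV. norm (v i))"
 have B: "B >= 0" "!!i. 4 * norm (v i) <= B"
  unfolding B_def by (auto intro!: sum_nonneg member_le_sum)
 obtain b b' where b: "C1 b b'" and b01: "!!x. 0 <= b x" "!!x. b x <= 1" and
  b1: "!!x. x \<in> cball p (r/2/2) ==> b x = 1" and b0: "!!x. x \<notin> ball p (r/2) ==> b x = 0"
  by (rule C1_bump[of "r/2" p]) (use r in auto)
 have b0': "b' x = 0" if "x \<notin> ball p r" for x
  by (rule C1_grad_zero[OF b, of "- cball p (r/2)"]) (use that r b0 in auto)
 have far: "x \<notin> ball p r" if "norm x > norm p + r" for x
  using that norm_triangle_ineq2[of x p] by (simp add: dist_norm norm_minus_commute)
 obtain B' where B': "B' > 0" "!!x. norm (b' x) <= B'"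
  by (rule compact_support_bounded[OF C1_cont_grad[OF b], of "norm p + r"]) (use b0' far in auto)
 obtain C where C: "C >= 0" and core: "\<forall>u p (R::real) (N::real). u \<in> borel_measurable borel --> p \<in> borel_measurable borel -->
  (\<forall>x. norm x > R --> u x = 0) --> (\<forall>x. \<bar>u x\<bar> <= N) --> (\<forall>x. 0 <= p x) -->
  integrable lborel (%x. (p x)^2) -->
  (\<forall>i x. ennreal ((u x)^4) <= lineint (v i) (%x. ennreal (B * \<bar>u x\<bar>^3 * p x)) x) -->
  (LBINT x. (u x)^6) <= C * ((LBINT x. (u x)^2) + (LBINT x. (p x)^2))^3"
  by (rule sobolev_core[OF card B(1) dual span]) (rule that)
 \<comment> \<open>Collects the coefficients of the squared norms: 1 + 2 B'^2 in front of f and 2 in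
   front of g.\<close>
 define A where "A = 2 * B'^2 + 2"
 have A: "A >= 2" by (simp add: A_def)
 define C' where "C' = C * A^3"
 show ?thesis
 proof (rule that[of "r/2/2" C'], goal_cases)
  case 3
  show ?case
  proof (intro allI impI)
   fix f :: "real^'n => real" and g :: "real^'n => real^'n" assume wg: "wgrad D f g"
   have f: "integrable lborel f" and g: "integrable lborel g" and f2: "integrable lborel (%x. (norm (f x))^2)"
    and g2: "integrable lborel (%x. (norm (g x))^2)" and f0: "!!x. x \<notin> D ==> f x = 0"
    using wg unfolding wgrad_def by auto
   have [measurable]: "f \<in> borel_measurable borel" "g \<in> borel_measurable borel" using f g by auto
   define eps where "eps j = t0 / real (Suc j)" for j
   have eps: "eps j > 0" "eps j <= t0" for j using t0 by (auto simp: eps_def field_simps)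
   have eps0: "eps ----> 0" unfolding eps_def by (rule LIMSEQ_Suc[of "%j. t0 / real j"]) (rule lim_const_over_n)
   define NN where "NN = H1_mass f g"
   have NN: "(LBINT x. (f x)^2) <= NN" "(LBINT x. (norm (g x))^2) <= NN" "NN >= 0"
    by (auto simp: NN_def H1_mass_def)
   have bound: "(NI x. indicator D x * ennreal ((b x * moll (eps j) a f x)^6)) <= ennreal (C' * NN^3)" for j
   proof -
    define F where "F = moll (eps j) a f"
    obtain G where G: "C1 F G" and GF: "!!x. cball (x + eps j *R a) (eps j) \<subseteq> D ==> G x = moll (eps j) a g x"
     by (rule moll_C1[OF eps(1)[of j] wg, of a, folded F_def]) (rule that)
    define u where "u x = b x * F x" for x
    define u' where "u' x = b x *R G x + F x *R b' x" for x
    have u: "C1 u u'" unfolding u_def[abs_def] u'_def[abs_def] by (rule C1_mult[OF b G])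
    have u0: "u x = 0" if "x \<notin> ball p (r/2)" for x using b0[OF that] by (simp add: u_def)
    have u0': "u' x = 0" if "x \<notin> ball p r" for x
     by (rule C1_grad_zero[OF u, of "- cball p (r/2)"]) (use that r u0 in auto)
    have u0r: "u x = 0" if "x \<notin> ball p r" for x by (rule u0) (use that r in auto)
    \<comment> \<open>The product u is C1 across the boundary, but its gradient is controlled only
      in D. The cut by the indicator is harmless because the segments of integration stay in
      D.\<close>
    define U where "U x = indicator D x * u x" for x
    define P where "P x = indicator D x * norm (u' x)" for x
    note [measurable] = C1_borel[OF u] C1_borel_grad[OF u] C1_borel[OF G] C1_borel_grad[OF G]
    have [measurable]: "U \<in> borel_measurable borel" "P \<in> borel_measurable borel"
     unfolding U_def[abs_def] P_def[abs_def] by measurable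
    have "u x = 0" if "norm x > norm p + r" for x using u0r far[OF that] by blast
    then obtain N where N: "!!x. norm (u x) <= N" using compact_support_bounded[OF C1_cont[OF u]] by metis
    have F2: "integrable lborel (%x. (F x)^2)" "(LBINT x. (F x)^2) <= (LBINT x. (f x)^2)"
     using moll_L2[OF eps(1) f f2, of j a] unfolding F_def by simp_all
    have G2: "integrable lborel (%x. (norm (moll (eps j) a g x))^2)" "(LBINT x. (norm (moll (eps j) a g x))^2) <= (LBINT x. (norm (g x))^2)"
     by (rule moll_L2[OF eps(1) g g2])+
    have Ple: "(P x)^2 <= 2 * (norm (moll (eps j) a g x))^2 + 2 * B'^2 * (F x)^2" for x
    proof (cases "x \<in> D \<and> x \<in> ball p r")
     case True
     then have "G x = moll (eps j) a g x" using r by (intro GF cone' eps) auto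
     then have "norm (u' x) <= norm (b x *R moll (eps j) a g x) + norm (F x *R b' x)"
      unfolding u'_def by (metis norm_triangle_ineq)
     also have "... <= norm (moll (eps j) a g x) + B' * norm (F x)"
      using b01[of x] mult_right_mono[OF B'(2)[of x], of "\<bar>F x\<bar>"] by (auto intro!: add_mono mult_left_le_one_le simp: mult.commute)
     finally have "(norm (u' x))^2 <= (norm (moll (eps j) a g x) + B' * norm (F x))^2" by (rule power_mono) simp
     also have "... <= 2 * (norm (moll (eps j) a g x))^2 + 2 * (B' * norm (F x))^2"
      using sum_squares_bound[of "norm (moll (eps j) a g x)" "B' * norm (F x)"] by (simp add: power2_sum)
     finally show ?thesis using True by (simp add: P_def power_mult_distrib)
    next
     case False
     then have "P x = 0" using u0' by (auto simp: P_def indicator_def)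
     then show ?thesis by simp
    qed
    have P2: "integrable lborel (%x. (P x)^2)"
     by (rule Bochner_Integration.integrable_bound[of _ "%x. 2 * (norm (moll (eps j) a g x))^2 + 2 * B'^2 * (F x)^2"])
      (use F2(1) G2(1) in \<open>auto intro!: AE_I2 Ple\<close>)
    have "(LBINT x. (P x)^2) <= (LBINT x. 2 * (norm (moll (eps j) a g x))^2 + 2 * B'^2 * (F x)^2)"
     using F2(1) G2(1) P2 by (intro integral_mono Ple) auto
    also have "... = 2 * (LBINT x. (norm (moll (eps j) a g x))^2) + 2 * B'^2 * (LBINT x. (F x)^2)"
     using F2(1) G2(1) by simp
    also have "... <= 2 * (LBINT x. (norm (g x))^2) + 2 * B'^2 * (LBINT x. (f x)^2)"
     using F2(2) G2(2) by (intro add_mono mult_left_mono) auto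
    finally have PD: "(LBINT x. (P x)^2) <= 2 * (LBINT x. (norm (g x))^2) + 2 * B'^2 * (LBINT x. (f x)^2)" by simp
    have "(U x)^2 <= (F x)^2" for x
     using b01[of x] by (auto simp: U_def u_def indicator_def power_mult_distrib mult_left_le_one_le power_le_one)
    moreover have "integrable lborel (%x. (U x)^2)"
     by (rule Bochner_Integration.integrable_bound[OF F2(1)]) (use calculation in auto)
    ultimately have UD: "(LBINT x. (U x)^2) <= (LBINT x. (f x)^2)"
     using integral_mono[of lborel "%x. (U x)^2" "%x. (F x)^2"] F2 by simp
    have line: "ennreal ((U x)^4) <= lineint (v i) (%x. ennreal (B * \<bar>U x\<bar>^3 * P x)) x" for i x
    proof (cases "x \<in> D \<and> x \<in> ball p r")
     case True
     have inD: "x + t *R v i \<in> D" if "0 <= t" "t <= t0" for t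
     proof (cases "t = 0")
      case False
      have "norm (t *R (v i - a)) <= t" using va[of i] that by (simp add: mult_left_le)
      then have "x + t *R v i \<in> cball (x + t *R a) t"
       by (simp add: dist_norm norm_minus_commute algebra_simps)
      then show ?thesis using cone'[of x t] True r False that by auto
     qed (use True in simp)
     have "u (x + t0 *R v i) = 0"
     proof (rule u0r)
      have "2 * r <= t0 * norm (v i)" using r(3) c(2)[of i] t0 mult_left_mono[of c "norm (v i)" t0] by linarith
      moreover have "t0 * norm (v i) <= norm (x + t0 *R v i - p) + norm (x - p)"
       using norm_triangle_ineq4[of "x + t0 *R v i - p" "x - p"] t0 by simp
      ultimately show "x + t0 *R v i \<notin> ball p r" using True by (simp add: dist_norm norm_minus_commute)
     qed
     moreover have "continuous_on UNIV (%t. v i \<bullet> u' (x + t *R v i))"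
      by (intro continuous_intros continuous_on_compose2[OF C1_cont_grad[OF u]]) auto
     ultimately have "ennreal ((u (x + 0 *R v i))^4) <=
      (NI t. ennreal (4 * \<bar>u (x + t *R v i)\<bar>^3 * \<bar>v i \<bullet> u' (x + t *R v i)\<bar> * indicator {0..t0} t))"
      by (intro line_bound C1_line[OF u] t0)
     also have "... <= (NI t. ennreal (B * \<bar>U (x + t *R v i)\<bar>^3 * P (x + t *R v i)))"
     proof (intro nn_integral_mono ennreal_leI)
      fix t
      show "4 * \<bar>u (x + t *R v i)\<bar>^3 * \<bar>v i \<bullet> u' (x + t *R v i)\<bar> * indicator {0..t0} t <= B * \<bar>U (x + t *R v i)\<bar>^3 * P (x + t *R v i)"
      proof (cases "t \<in> {0..t0}")
       case True
       let ?z = "x + t *R v i"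
       have "4 * \<bar>v i \<bullet> u' ?z\<bar> <= 4 * (norm (v i) * norm (u' ?z))" by (intro mult_left_mono Cauchy_Schwarz_ineq2) auto
       also have "... <= B * norm (u' ?z)" using B(2)[of i] by (simp add: mult_right_mono flip: mult.assoc)
       finally have "\<bar>u ?z\<bar>^3 * (4 * \<bar>v i \<bullet> u' ?z\<bar>) <= \<bar>u ?z\<bar>^3 * (B * norm (u' ?z))" by (intro mult_left_mono) auto
       then show ?thesis using inD[of t] True by (simp add: U_def P_def mult_ac)
      qed (use B in \<open>auto simp: P_def\<close>)
     qed
     finally show ?thesis using True by (simp add: U_def lineint_def)
    next
     case False
     then have "U x = 0" using u0r by (auto simp: U_def indicator_def)
     then show ?thesis by simp
    qed
    have U0: "U x = 0" if "norm x > norm p + r" for x using u0r[OF far[OF that]] by (simp add: U_def)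
    have UN: "\<bar>U x\<bar> <= N" for x using N[of x] order_trans[OF abs_ge_zero[of "u x"], of N] by (auto simp: U_def indicator_def)
    have "(LBINT x. (U x)^6) <= C * ((LBINT x. (U x)^2) + (LBINT x. (P x)^2))^3"
     by (rule core[rule_format, of U P "norm p + r" N]) (use line U0 UN P2 in \<open>auto simp: P_def\<close>)
    also have "... <= C * (A * NN)^3"
    proof (intro mult_left_mono power_mono C)
     have "(LBINT x. (U x)^2) + (LBINT x. (P x)^2) <=
      (LBINT x. (f x)^2) + (2 * (LBINT x. (norm (g x))^2) + 2 * B'^2 * (LBINT x. (f x)^2))"
      using UD PD by simp
     also have "... <= A * NN"
      unfolding A_def NN_def H1_mass_def by (simp add: algebra_simps)
     finally show "(LBINT x. (U x)^2) + (LBINT x. (P x)^2) <= A * NN" .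
    qed (auto intro!: add_nonneg_nonneg)
    finally have le: "(LBINT x. (U x)^6) <= C' * NN^3" by (simp add: C'_def power_mult_distrib mult_ac)
    have "integrable lborel (%x. (U x)^6)"
    proof -
     have "integrable lborel (%x. indicator (cball 0 (norm p + r)) x *R (U x)^6)"
     proof (rule integrable_bounded_scale)
      show "integrable lborel (indicator (cball 0 (norm p + r)) :: real^'n => real)"
       by (rule integrable_real_indicator) (simp_all add: emeasure_bounded_finite[unfolded infinity_ennreal_def])
      show "norm ((U x)^6) <= N^6" for x using power_mono[OF UN[of x], of 6] by (simp add: power_abs)
     qed measurable
     moreover have "indicator (cball 0 (norm p + r)) x *R (U x)^6 = (U x)^6" for x
      using U0[of x] by (auto simp: indicator_def)
     ultimately show ?thesis by (simp only:)
    qed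
    from nn_integral_eq_integral[OF this] le
    have "(NI x. ennreal ((U x)^6)) <= ennreal (C' * NN^3)" by (simp add: ennreal_leI)
    moreover have "ennreal ((U x)^6) = indicator D x * ennreal ((b x * moll (eps j) a f x)^6)" for x
     by (auto simp: U_def u_def F_def indicator_def)
    ultimately show ?thesis by (simp only:)
   qed
   \<comment> \<open>Mollifications converge in L^1; a subsequence converges almost everywhere, as
     Fatou's lemma requires.\<close>
   have "\<exists>s. strict_mono s \<and> (AE x in lborel. (%n. moll (eps (s n)) a f x - f x) ----> 0)"
    by (rule tendsto_L1_AE_subseq[of _ "%j x. moll (eps j) a f x - f x"])
     (use moll_integrable[OF eps(1) f] f moll_tendsto_L1[OF f eps(1) eps0] in auto)
   then obtain s where s: "AE x in lborel. (%n. moll (eps (s n)) a f x - f x) ----> 0" by blast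
   note [measurable] = C1_borel[OF b]
   have "(NI x. indicator (ball p (r/2/2)) x * ennreal ((f x)^6)) <=
    (NI x. liminf (%n. indicator D x * ennreal ((b x * moll (eps (s n)) a f x)^6)))"
   proof (rule nn_integral_mono_AE)
    show "AE x in lborel. indicator (ball p (r/2/2)) x * ennreal ((f x)^6) <=
     liminf (%n. indicator D x * ennreal ((b x * moll (eps (s n)) a f x)^6))"
     using s
    proof eventually_elim
     case (elim x)
     show ?case
     proof (cases "x \<in> ball p (r/2/2) \<and> x \<in> D")
      case True
      then have bx: "b x = 1" using b1 by auto
      have "(%n. moll (eps (s n)) a f x) ----> f x" using elim by (simp add: LIM_zero_iff)
      then have "(%n. ennreal ((b x * moll (eps (s n)) a f x)^6)) ----> ennreal ((f x)^6)"
       unfolding bx by (auto intro!: tendsto_intros)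
      then have "liminf (%n. ennreal ((b x * moll (eps (s n)) a f x)^6)) = ennreal ((f x)^6)"
       by (intro lim_imp_Liminf) auto
      then show ?thesis using True by simp
     next
      case False
      then have "indicator (ball p (r/2/2)) x * ennreal ((f x)^6) = 0" using f0[of x] by (auto simp: indicator_def)
      then show ?thesis by (simp only: zero_le)
     qed
    qed
   qed
   also have "... <= liminf (%n. NI x. indicator D x * ennreal ((b x * moll (eps (s n)) a f x)^6))"
    by (rule nn_integral_liminf) measurable
   also have "... <= ennreal (C' * NN^3)"
    using bound by (intro Liminf_le) auto
   finally show "(NI x. indicator (ball p (r/2/2)) x * ennreal ((f x)^6)) <=
    ennreal (C' * H1_mass f g^3)" unfolding NN_def .
  qed
 qed (use r C A in \<open>auto simp: C'_def\<close>)
qed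

proposition sobolev:
 fixes U :: "(real^'n) set"
 assumes card: "CARD('n) = 2 \<or> CARD('n) = 3" and op: "open U" and bd: "bounded U" and C2: "C2_boundary U"
 obtains C where "C >= 0" "\<forall>f g. wgrad U f g --> integrable lborel (%x. (f x)^6) \<and>
  (LBINT x. (f x)^6) <= C * H1_mass f g^3"
proof -
 define Q where "Q p r C \<longleftrightarrow> r > 0 \<and> C >= 0 \<and> (\<forall>f g. wgrad U f g -->
  (NI x. indicator (ball p r) x * ennreal ((f x)^6)) <=
   ennreal (C * H1_mass f g^3))" for p r C
 have loc: "\<exists>r C. Q p r C" if cone: "cone_at U p \<rho> a t0" for p \<rho> a t0
  by (rule sobolev_local[OF card op cone]) (unfold Q_def, blast)
 have "\<exists>r C. Q p r C" if "p \<in> closure U" for p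
 proof (cases "p \<in> U")
  case True
  obtain \<rho> t0 where "cone_at U p \<rho> 0 t0" by (rule interior_cone[OF op True]) (rule that)
  from loc[OF this] show ?thesis .
 next
  case False
  then have "p \<in> frontier U" using that op by (simp add: frontier_def interior_open)
  then obtain \<rho> e y y' where "chart U p \<rho> e y y'" by (rule C2_boundary_chart[OF C2])
  then obtain \<rho>' a t0 where "cone_at U p \<rho>' a t0" by (rule chart_cone)
  from loc[OF this] show ?thesis .
 qed
 then obtain r C where "!!p. p \<in> closure U ==> Q p (r p) (C p)" by metis
 then have rC: "!!p. p \<in> closure U ==> r p > 0 \<and> C p >= 0 \<and> (\<forall>f g. wgrad U f g -->
  (NI x. indicator (ball p (r p)) x * ennreal ((f x)^6)) <=
   ennreal (C p * H1_mass f g^3))" unfolding Q_def .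
 have "compact (closure U)" using bd by (simp add: compact_closure)
 then obtain D where D: "D \<subseteq> closure U" "finite D" "closure U \<subseteq> (\<Union>p\<in>D. ball p (r p))"
  by (rule compactE_image[of _ "closure U" "%p. ball p (r p)"]) (use rC in auto)
 define CC where "CC = (\<Sum>p\<in>D. C p)"
 have Cp: "C p >= 0" if "p \<in> D" for p using rC D that by auto
 show ?thesis
 proof (rule that[of CC])
  show "CC >= 0" unfolding CC_def by (intro sum_nonneg Cp)
  show "\<forall>f g. wgrad U f g --> integrable lborel (%x. (f x)^6) \<and>
   (LBINT x. (f x)^6) <= CC * H1_mass f g^3"
  proof (intro allI impI)
   fix f :: "real^'n => real" and g :: "real^'n => real^'n" assume wg: "wgrad U f g"
   have [measurable]: "f \<in> borel_measurable borel" and f0: "!!x. x \<notin> U ==> f x = 0"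
    using wg unfolding wgrad_def by auto
   define NN where "NN = H1_mass f g"
   have NN: "NN >= 0" by (simp add: NN_def H1_mass_nonneg)
   have "(NI x. ennreal ((f x)^6)) <= (NI x. (\<Sum>p\<in>D. indicator (ball p (r p)) x * ennreal ((f x)^6)))"
   proof (rule nn_integral_mono)
    fix x
    show "ennreal ((f x)^6) <= (\<Sum>p\<in>D. indicator (ball p (r p)) x * ennreal ((f x)^6))"
    proof (cases "x \<in> U")
     case True
     then obtain p where p: "p \<in> D" "x \<in> ball p (r p)" using D(3) closure_subset by blast
     have "indicator (ball p (r p)) x * ennreal ((f x)^6) <= (\<Sum>p\<in>D. indicator (ball p (r p)) x * ennreal ((f x)^6))"
      by (rule member_le_sum) (use p D in auto)
     then show ?thesis using p by simp
    qed (use f0[of x] in simp)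
   qed
   also have "... = (\<Sum>p\<in>D. NI x. indicator (ball p (r p)) x * ennreal ((f x)^6))"
   proof (rule nn_integral_sum)
    fix p
    have [measurable]: "ball p (r p) \<in> sets borel" by simp
    show "(%x. indicator (ball p (r p)) x * ennreal ((f x)^6)) \<in> borel_measurable lborel" by measurable
   qed
   also have "... <= (\<Sum>p\<in>D. ennreal (C p * NN^3))"
    unfolding NN_def using rC D(1) wg by (intro sum_mono) blast
   also have "... = ennreal (CC * NN^3)"
    unfolding CC_def using Cp NN by (subst sum_ennreal) (auto simp: sum_distrib_right)
   finally have le: "(NI x. ennreal ((f x)^6)) <= ennreal (CC * NN^3)" .
   have i: "integrable lborel (%x. (f x)^6)"
    by (rule integrableI_bounded) (use le_less_trans[OF le ennreal_less_top] in auto)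
   have "(LBINT x. (f x)^6) <= CC * NN^3"
    using le nn_integral_eq_integral[OF i] \<open>CC >= 0\<close> NN by simp
   with i show "integrable lborel (%x. (f x)^6) \<and>
    (LBINT x. (f x)^6) <= CC * H1_mass f g^3"
    unfolding NN_def by blast
  qed
 qed
qed

section \<open>The divergence theorem over a graph\<close>

text \<open>The signed counterpart of \<open>nn_integral_lineint\<close> for a unit direction; the
  nonnegative version applied to |H| supplies integrability on the product space.\<close>

lemma line_Fubini:
 fixes H :: "'a::euclidean_space => real"
 assumes H: "integrable lborel H" and e: "e \<bullet> e = 1"
 shows "(LBINT x. H x) = (LBINT x. indicator {0..1::real} (e \<bullet> x) * (LBINT s. H (x + s *R e)))"
proof -
 have [measurable]: "H \<in> borel_measurable borel" using H by auto
 let ?c = "indicator {0..1::real} :: real => real"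
 have fin: "(NI x. ennreal (norm (H x))) < \<infinity>"
  using H by (simp add: integrable_iff_bounded)
 have i1: "integrable (lborel \<Otimes>\<^sub>M lborel) (%(x, s). ?c (e \<bullet> x) * H (x + s *R e))"
 proof (rule integrableI_bounded)
  show "(%(x, s). ?c (e \<bullet> x) * H (x + s *R e)) \<in> borel_measurable (lborel \<Otimes>\<^sub>M lborel)" by measurable
  have "(\<integral>\<^sup>+z. ennreal (norm (case z of (x, s) => ?c (e \<bullet> x) * H (x + s *R e))) \<partial>(lborel \<Otimes>\<^sub>M lborel)) =
   (NI x. (NI s. ennreal (norm (?c (e \<bullet> x) * H (x + s *R e)))))"
   by (subst lborel.nn_integral_fst[symmetric]) auto
  also have "... = (NI x. indicator {0..1} (e \<bullet> x) * lineint e (%x. ennreal (norm (H x))) x)"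
   unfolding lineint_def
   by (intro nn_integral_cong, subst nn_integral_cmult[symmetric])
    (auto intro!: nn_integral_cong simp: abs_mult ennreal_mult' indicator_def)
  also have "... = (NI x. ennreal (norm (H x)))"
   by (rule nn_integral_lineint[symmetric]) (auto simp: e)
  finally show "(\<integral>\<^sup>+z. ennreal (norm (case z of (x, s) => ?c (e \<bullet> x) * H (x + s *R e))) \<partial>(lborel \<Otimes>\<^sub>M lborel)) < \<infinity>"
   using fin by simp
 qed
 have i2: "integrable (lborel \<Otimes>\<^sub>M lborel) (%(x, s). ?c (e \<bullet> x - s) * H x)"
 proof (rule integrableI_bounded)
  show "(%(x, s). ?c (e \<bullet> x - s) * H x) \<in> borel_measurable (lborel \<Otimes>\<^sub>M lborel)" by measurable
  have "(\<integral>\<^sup>+z. ennreal (norm (case z of (x, s) => ?c (e \<bullet> x - s) * H x)) \<partial>(lborel \<Otimes>\<^sub>M lborel)) =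
   (NI x. (NI s. ennreal (norm (?c (e \<bullet> x - s) * H x))))"
   by (subst lborel.nn_integral_fst[symmetric]) auto
  also have "... = (NI x. ennreal (norm (H x)) * (NI s. indicator {e \<bullet> x - 1..e \<bullet> x} s))"
   by (intro nn_integral_cong, subst nn_integral_cmult[symmetric])
    (auto intro!: nn_integral_cong simp: abs_mult ennreal_mult' indicator_def)
  finally show "(\<integral>\<^sup>+z. ennreal (norm (case z of (x, s) => ?c (e \<bullet> x - s) * H x)) \<partial>(lborel \<Otimes>\<^sub>M lborel)) < \<infinity>"
   using fin by simp
 qed
 have "(LBINT x. ?c (e \<bullet> x) * (LBINT s. H (x + s *R e))) = (LBINT x. (LBINT s. ?c (e \<bullet> x) * H (x + s *R e)))"
  by simp
 also have "... = (LBINT s. (LBINT x. ?c (e \<bullet> x) * H (x + s *R e)))"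
  by (rule lborel_pair.Fubini_integral[symmetric]) (use i1 in simp)
 also have "... = (LBINT s. (LBINT x. ?c (e \<bullet> x - s) * H x))"
 proof (rule Bochner_Integration.integral_cong)
  fix s
  show "(LBINT x. ?c (e \<bullet> x) * H (x + s *R e)) = (LBINT x. ?c (e \<bullet> x - s) * H x)"
   using lborel_integral_translate[of "%x. ?c (e \<bullet> x - s) * H x" "s *R e"]
   by (simp add: inner_add_right e)
 qed simp
 also have "... = (LBINT x. (LBINT s. ?c (e \<bullet> x - s) * H x))"
  by (rule lborel_pair.Fubini_integral) (use i2 in simp)
 also have "... = (LBINT x. H x)"
 proof (rule Bochner_Integration.integral_cong)
  fix x
  have "(%s. ?c (e \<bullet> x - s)) = indicator {e \<bullet> x - 1..e \<bullet> x}" by (auto simp: indicator_def fun_eq_iff)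
  then have "(LBINT s. ?c (e \<bullet> x - s)) = 1" by simp
  then show "(LBINT s. ?c (e \<bullet> x - s) * H x) = H x" by simp
 qed simp
 finally show ?thesis by simp
qed

lemma FTC_compact_support:
 fixes \<phi> \<phi>' :: "real => real"
 assumes d: "!!t. (\<phi> has_real_derivative \<phi>' t) (at t)" and c: "continuous_on UNIV \<phi>'"
  and z: "!!t. \<bar>t\<bar> > R ==> \<phi> t = 0"
 shows "(LBINT t. \<phi>' t) = 0" "(LBINT t. indicator {0<..} t * \<phi>' t) = - \<phi> 0"
proof -
 define K where "K = \<bar>R\<bar> + 1"
 have K: "K > 0" "K > R" "\<phi> K = 0" "\<phi> (-K) = 0" by (auto simp: K_def intro!: z)
 have z': "\<phi>' t = 0" if "\<bar>t\<bar> > K" for t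
 proof -
  have "open {s. \<bar>s\<bar> > R}" by (intro open_Collect_less continuous_intros)
  moreover have "t \<in> {s. \<bar>s\<bar> > R}" using that K by auto
  ultimately have "((%t. 0) has_real_derivative \<phi>' t) (at t)"
   by (rule has_field_derivative_transform_within_open[OF d[of t]]) (use z in auto)
  then show ?thesis using DERIV_unique DERIV_const by blast
 qed
 have ic: "isCont \<phi>' t" for t using c by (simp add: continuous_on_eq_continuous_at)
 have "(LBINT t. \<phi>' t * indicator {-K..K} t) = \<phi> K - \<phi> (-K)"
  using K by (intro integral_FTC_Icc_real d ic) auto
 moreover have "\<phi>' t * indicator {-K..K} t = \<phi>' t" for t using z'[of t] by (fastforce simp: indicator_def)
 ultimately show "(LBINT t. \<phi>' t) = 0" using K by simp
 have "(LBINT t. \<phi>' t * indicator {0..K} t) = \<phi> K - \<phi> 0"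
  using K by (intro integral_FTC_Icc_real d ic) auto
 moreover have "(LBINT t. indicator {0<..} t * \<phi>' t) = (LBINT t. \<phi>' t * indicator {0..K} t)"
 proof (rule integral_cong_AE)
  have [measurable]: "\<phi>' \<in> borel_measurable borel" using c by (rule borel_measurable_continuous_onI)
  show "(%t. indicator {0<..} t * \<phi>' t) \<in> borel_measurable lborel" "(%t. \<phi>' t * indicator {0..K} t) \<in> borel_measurable lborel"
   by measurable
  show "AE t in lborel. indicator {0<..} t * \<phi>' t = \<phi>' t * indicator {0..K} t"
   using AE_lborel_singleton[of 0] by eventually_elim (use z' in \<open>auto simp: indicator_def\<close>)
 qed
 ultimately show "(LBINT t. indicator {0<..} t * \<phi>' t) = - \<phi> 0" using K by simp
qed

lemma C1_integral_deriv_zero: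
 fixes g :: "real^'n => real"
 assumes g: "C1 g g'" and z: "!!x. norm x > R ==> g x = 0" and e: "norm e = 1"
 shows "(LBINT x. e \<bullet> g' x) = 0"
proof -
 have z': "g' x = 0" if "norm x > R" for x using C1_grad_compact_support[OF g z that] .
 have i: "integrable lborel (%x. e \<bullet> g' x)"
  by (rule continuous_compact_support_integrable[of _ R]) (use z' C1_cont_grad[OF g] in \<open>auto intro!: continuous_intros\<close>)
 have "(LBINT s. e \<bullet> g' (x + s *R e)) = 0" for x
 proof (rule FTC_compact_support(1)[where R = "norm x + R"])
  show "((%s. g (x + s *R e)) has_real_derivative e \<bullet> g' (x + s *R e)) (at s)" for s by (rule C1_line[OF g])
  show "continuous_on UNIV (%s. e \<bullet> g' (x + s *R e))"
   by (intro continuous_intros continuous_on_compose2[OF C1_cont_grad[OF g]]) auto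
  show "g (x + s *R e) = 0" if "norm x + R < \<bar>s\<bar>" for s
  proof (rule z)
   have "norm (s *R e) <= norm (x + s *R e) + norm x" using norm_triangle_ineq4[of "x + s *R e" x] by simp
   then show "R < norm (x + s *R e)" using that e by simp
  qed
 qed
 then show ?thesis using line_Fubini[OF i, of e] e by (simp add: dot_square_norm)
qed

text \<open>Integration over the graph \<open>y = 0\<close>, parametrised by the orthogonal projection along \<open>e\<close>;
 the hyperplane is thickened to the slab \<open>0 <= e \<bullet> x <= 1\<close>, on which the integrand is constant
 in direction \<open>e\<close>.\<close>

definition graph_proj :: "real^'n => (real^'n => real) => real^'n => real^'n" where
 "graph_proj e y x = x - y x *R e"

definition gint :: "real^'n => (real^'n => real) => (real^'n => real) => real" where
 "gint e y F = (LBINT x. indicator {0..1::real} (e \<bullet> x) * F (graph_proj e y x))"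

lemma graph_proj_continuous: "C1 y y' ==> continuous_on UNIV (graph_proj e y)"
 unfolding graph_proj_def[abs_def] by (intro continuous_intros C1_cont)

text \<open>Inside the slab the component of x along e is bounded, so a bounded point on the line of
  x bounds x. Integrands over the graph therefore have bounded support.\<close>

lemma graph_proj_bounded:
 assumes e: "norm e = 1" and s: "0 <= e \<bullet> x" "e \<bullet> x <= 1" and R: "norm (graph_proj e y x + t *R e) <= R"
 shows "norm x <= 2 * R + 1"
proof -
 let ?z = "graph_proj e y x + t *R e"
 have ee: "e \<bullet> e = 1" using e by (simp add: dot_square_norm)
 have x: "x = ?z + (y x - t) *R e" by (simp add: graph_proj_def algebra_simps)
 have "e \<bullet> x = e \<bullet> ?z + (y x - t)" by (subst x) (simp add: inner_add_right ee del: add_diff_eq)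
 moreover have "\<bar>e \<bullet> ?z\<bar> <= norm ?z" using Cauchy_Schwarz_ineq2[of e ?z] e by simp
 ultimately have "\<bar>y x - t\<bar> <= 1 + R" using s R by linarith
 moreover have "norm x <= norm ?z + norm ((y x - t) *R e)" by (subst x) (rule norm_triangle_ineq)
 ultimately show ?thesis using R e by simp
qed

lemma gint_integrable:
 assumes e: "norm e = 1" and y: "C1 y y'" and F: "continuous_on UNIV F" and z: "!!x. norm x > R ==> F x = 0"
 shows "integrable lborel (%x. indicator {0..1::real} (e \<bullet> x) * F (graph_proj e y x) :: real)"
proof -
 have [measurable]: "F \<in> borel_measurable borel" "graph_proj e y \<in> borel_measurable borel"
  using F graph_proj_continuous[OF y] by (auto intro!: borel_measurable_continuous_onI)
 obtain B where B: "!!x. norm (F x) <= B" using compact_support_bounded[OF F z] by metis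
 have "integrable lborel (%x. indicator (cball 0 (2 * R + 1)) x *R (indicator {0..1::real} (e \<bullet> x) * F (graph_proj e y x)))"
 proof (rule integrable_bounded_scale)
  show "integrable lborel (indicator (cball 0 (2 * R + 1)) :: real^'a => real)"
   by (rule integrable_real_indicator) (simp_all add: emeasure_bounded_finite[unfolded infinity_ennreal_def])
  show "norm (indicator {0..1::real} (e \<bullet> x) * F (graph_proj e y x)) <= B" for x
   using B[of "graph_proj e y x"] order_trans[OF norm_ge_zero B] by (auto simp: indicator_def)
 qed measurable
 moreover have "indicator (cball 0 (2 * R + 1)) x *R (indicator {0..1::real} (e \<bullet> x) * F (graph_proj e y x)) =
  indicator {0..1::real} (e \<bullet> x) * F (graph_proj e y x)" for x
  using graph_proj_bounded[OF e, of x y 0 R] z[of "graph_proj e y x"]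
  by (cases "norm (graph_proj e y x) <= R") (auto simp: indicator_def)
 ultimately show ?thesis by (simp only:)
qed

text \<open>Replace the indicator of y > 0 by \<open>step\<close> of y / eps and integrate the
  derivative of the product; the gradient of the step concentrates on the graph. The vector y' is
  left unnormalised: it is the inner unit normal times |y'|, and |y'| is the surface element of the
  graph over the hyperplane.\<close>

lemma graph_div_theorem:
 fixes f :: "real^'n => real"
 assumes e: "norm e = 1" and y: "C1 y y'" and ye: "!!x t. y (x + t *R e) = y x + t"
  and f: "C1 f f'" and z: "!!x. norm x > R ==> f x = 0"
 shows "(LBINT x. indicator {x. y x > 0} x * f' x $ k) = - gint e y (%x. f x * y' x $ k)"
proof -
 obtain step' where s: "!!t. (step has_real_derivative step' t) (at t)" and sc: "continuous_on UNIV step'"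
  by (rule step_deriv) (rule that)
 have s0: "step' t = 0" if t: "t < 0 \<or> t > 1" for t
 proof -
  consider "t < 0" | "t > 1" using t by blast
  then have "\<exists>c. ((%_. c) has_real_derivative step' t) (at t)"
  proof cases
   case 1
   have "((%_. 0) has_real_derivative step' t) (at t)"
    by (rule has_field_derivative_transform_within_open[OF s[of t], of "{..<0}"]) (use 1 in \<open>auto simp: step_0\<close>)
   then show ?thesis by blast
  next
   case 2
   have "((%_. 1) has_real_derivative step' t) (at t)"
    by (rule has_field_derivative_transform_within_open[OF s[of t], of "{1<..}"]) (use 2 in \<open>auto simp: step_1\<close>)
   then show ?thesis by blast
  qed
  then show ?thesis using DERIV_unique DERIV_const by blast
 qed
 have ee: "e \<bullet> e = 1" using e by (simp add: dot_square_norm)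
 have [measurable]: "step' \<in> borel_measurable borel" "step \<in> borel_measurable borel" 
  using sc s by (auto intro!: borel_measurable_continuous_onI continuous_at_imp_continuous_on DERIV_isCont)
 note [measurable] = C1_borel[OF f] C1_borel_grad[OF f] C1_borel[OF y] C1_borel_grad[OF y]
 have s0': "step' t = 0" if "norm t > 1" for t using that by (intro s0) auto
 have ist: "integrable lborel step'" by (rule continuous_compact_support_integrable[OF sc s0'])
 have int1: "(LBINT t. step' t) = 1"
 proof -
  have "(LBINT t. step' t * indicator {0..1} t) = step 1 - step 0"
   using sc by (intro integral_FTC_Icc_real s) (auto simp: continuous_on_eq_continuous_at)
  moreover have "step' t * indicator {0..1} t = step' t" for t using s0[of t] by (fastforce simp: indicator_def)
  ultimately show ?thesis by (simp add: step_0 step_1)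
 qed
 define F where "F x = f x * y' x $ k" for x
 have cF: "continuous_on UNIV F" unfolding F_def using C1_cont[OF f] C1_cont_grad[OF y] by (intro continuous_intros)
 have zF: "F x = 0" if "norm x > R" for x using z[OF that] by (simp add: F_def)
 obtain N where N: "N > 0" "!!x. norm (F x) <= N" using compact_support_bounded[of F R, OF cF zF] by metis
 have [measurable]: "F \<in> borel_measurable borel" using cF by (rule borel_measurable_continuous_onI)
 have zf': "f' x = 0" if "norm x > R" for x using C1_grad_compact_support[OF f z that] .
 have if': "integrable lborel (%x. f' x $ k)"
  by (rule continuous_compact_support_integrable[of _ R]) (use zf' C1_cont_grad[OF f] in \<open>auto intro!: continuous_intros\<close>)
 then have [measurable]: "(%x. f' x $ k) \<in> borel_measurable borel" by auto
 define eps where "eps j = 1 / real (Suc j)" for j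
 have eps: "eps j > 0" for j by (simp add: eps_def)
 have eps0: "eps ----> 0" unfolding eps_def by (rule LIMSEQ_Suc[of "%j. 1 / real j"]) (rule lim_const_over_n)
 \<comment> \<open>The boundary layer: the derivative of the smoothed indicator, concentrated where
   0 <= y <= eps.\<close>
 define H where "H j x = F x * (step' (y x / eps j) / eps j)" for j x
 have iH: "integrable lborel (H j)" for j
 proof (rule continuous_compact_support_integrable[of _ R])
  show "continuous_on UNIV (H j)" unfolding H_def[abs_def]
   using cF C1_cont[OF y] eps[of j] by (intro continuous_intros continuous_on_compose2[OF sc]) auto
 qed (simp add: H_def zF)
 have A: "(LBINT x. step (y x / eps j) * f' x $ k) = - (LBINT x. H j x)" for j
 proof -
  have "((%t. step (t / eps j)) has_real_derivative step' (t / eps j) / eps j) (at t)" for t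
  proof -
   have "((%t. t / eps j) has_real_derivative 1 / eps j) (at t)" using eps[of j] by (auto intro!: derivative_eq_intros)
   from DERIV_chain2[OF s this] show ?thesis by simp
  qed
  moreover have "continuous_on UNIV (%t. step' (t / eps j) / eps j)"
   using eps[of j] by (intro continuous_intros continuous_on_compose2[OF sc]) auto
  ultimately have "C1 (%x. step (y x / eps j)) (%x. (step' (y x / eps j) / eps j) *R y' x)"
   by (rule C1_compose[OF y])
  from C1_integral_deriv_zero[OF C1_mult[OF f this], of R "axis k 1"] z
  have "(LBINT x. H j x + step (y x / eps j) * f' x $ k) = 0"
   by (simp add: inner_axis' H_def F_def mult_ac)
  moreover have "integrable lborel (%x. step (y x / eps j) * f' x $ k)"
   by (rule Bochner_Integration.integrable_bound[OF if'])
    (auto intro!: AE_I2 mult_left_le_one_le simp: abs_mult step_range)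
  ultimately show ?thesis using iH[of j] by simp
 qed
 have "(%j. LBINT x. step (y x / eps j) * f' x $ k) ----> (LBINT x. indicator {x. y x > 0} x * f' x $ k)"
 proof (rule integral_dominated_convergence[where w = "%x. \<bar>f' x $ k\<bar>"])
  show "AE x in lborel. (%j. step (y x / eps j) * f' x $ k) ----> indicator {x. y x > 0} x * f' x $ k"
  proof (intro AE_I2 tendsto_mult_right)
   fix x
   show "(%j. step (y x / eps j)) ----> indicator {x. y x > 0} x"
   proof (cases "y x > 0")
    case True
    have "\<forall>\<^sub>F j in sequentially. eps j < y x" using order_tendstoD(2)[OF eps0 True] .
    then have "\<forall>\<^sub>F j in sequentially. 1 = step (y x / eps j)"
     by eventually_elim (use eps in \<open>simp add: step_1 field_simps\<close>)
    from Lim_transform_eventually[OF tendsto_const this] True show ?thesis by simp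
   next
    case False
    then have "step (y x / eps j) = 0" for j using eps[of j] by (intro step_0) (simp add: field_simps)
    then show ?thesis using False by simp
   qed
  qed
  show "AE x in lborel. norm (step (y x / eps j) * f' x $ k) <= \<bar>f' x $ k\<bar>" for j
   by (auto intro!: AE_I2 mult_left_le_one_le simp: abs_mult step_range)
 qed (use if' in auto)
 moreover have "(%j. LBINT x. H j x) ----> gint e y F"
 proof -
  \<comment> \<open>On a line in direction e the height is the arc length, so the line integral of
    the layer is F near the foot point weighted by \<open>step'\<close>, whose total mass is
    1.\<close>
  define J where "J j x = (LBINT t. F (graph_proj e y x + (eps j * t) *R e) * step' t)" for j x
  have [measurable]: "graph_proj e y \<in> borel_measurable borel"
   using graph_proj_continuous[OF y] by (rule borel_measurable_continuous_onI)
  have [measurable]: "J j \<in> borel_measurable borel" for j unfolding J_def[abs_def] by measurable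
  have HJ: "(LBINT t. H j (x + t *R e)) = J j x" for j x
  proof -
   have [measurable]: "H j \<in> borel_measurable borel" using iH[of j] by auto
   have "(LBINT t. H j (x + t *R e)) = (LBINT t. H j (x + (t + - y x) *R e))"
    by (rule lborel_integral_translate[symmetric]) measurable
   also have "... = (LBINT t. F (graph_proj e y x + t *R e) * (step' (t / eps j) / eps j))"
   proof (rule Bochner_Integration.integral_cong)
    fix t
    have "x + (t + - y x) *R e = graph_proj e y x + t *R e" by (simp add: graph_proj_def algebra_simps)
    moreover have "y (x + (t + - y x) *R e) = t" unfolding ye by simp
    ultimately show "H j (x + (t + - y x) *R e) = F (graph_proj e y x + t *R e) * (step' (t / eps j) / eps j)"
     unfolding H_def by simp
   qed simp
   also have "... = eps j *R (LBINT t. F (graph_proj e y x + (eps j * t) *R e) * (step' (eps j * t / eps j) / eps j))"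
    using lborel_integral_real_affine[of "eps j" "%t. F (graph_proj e y x + t *R e) * (step' (t / eps j) / eps j)" 0] eps[of j]
    by simp
   also have "... = (LBINT t. eps j *R (F (graph_proj e y x + (eps j * t) *R e) * (step' (eps j * t / eps j) / eps j)))"
    by simp
   also have "... = J j x"
    unfolding J_def using eps[of j] by (intro Bochner_Integration.integral_cong) auto
   finally show ?thesis .
  qed
  have bJ: "integrable lborel (%t. F (graph_proj e y x + (eps j * t) *R e) * step' t)" for j x
   using integrable_bounded_scale[OF ist, of "%t. F (graph_proj e y x + (eps j * t) *R e)" N] N(2) by (simp add: mult.commute)
  define S where "S = (LBINT t. \<bar>step' t\<bar>)"
  have S: "S >= 0" unfolding S_def by simp
  have Jle: "\<bar>J j x\<bar> <= N * S" for j x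
  proof -
   have "norm (J j x) <= (LBINT t. N * \<bar>step' t\<bar>)"
    unfolding J_def using bJ ist N(2)
    by (intro Bochner_norm_bound_integral) (auto simp: abs_mult intro!: mult_right_mono)
   then show ?thesis by (simp add: S_def)
  qed
  have "(%j. LBINT x. indicator {0..1::real} (e \<bullet> x) * J j x) ----> gint e y F"
   unfolding gint_def
  proof (rule integral_dominated_convergence[where w = "%x. N * S * indicator (cball 0 (2 * R + 1)) x"])
   show "integrable lborel (%x. N * S * indicator (cball 0 (2 * R + 1)) x :: real)"
    by (intro integrable_mult_right integrable_real_indicator) (simp_all add: emeasure_bounded_finite[unfolded infinity_ennreal_def])
   show "AE x in lborel. (%j. indicator {0..1::real} (e \<bullet> x) * J j x) ----> indicator {0..1::real} (e \<bullet> x) * F (graph_proj e y x)"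
   proof (intro AE_I2 tendsto_mult_left)
    fix x
    have "(%j. J j x) ----> (LBINT t. F (graph_proj e y x) * step' t)"
     unfolding J_def
    proof (rule integral_dominated_convergence[where w = "%t. N * \<bar>step' t\<bar>"])
     show "AE t in lborel. (%j. F (graph_proj e y x + (eps j * t) *R e) * step' t) ----> F (graph_proj e y x) * step' t"
     proof (intro AE_I2 tendsto_mult_right)
      fix t
      have "(%j. graph_proj e y x + (eps j * t) *R e) ----> graph_proj e y x + (0 * t) *R e"
       by (intro tendsto_intros eps0)
      moreover have "isCont F (graph_proj e y x)" using cF by (simp add: continuous_on_eq_continuous_at)
      ultimately show "(%j. F (graph_proj e y x + (eps j * t) *R e)) ----> F (graph_proj e y x)"
       using isCont_tendsto_compose[of "graph_proj e y x" F] by simp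
     qed
     show "AE t in lborel. norm (F (graph_proj e y x + (eps j * t) *R e) * step' t) <= N * \<bar>step' t\<bar>" for j
      using N(2) by (auto simp: abs_mult intro!: AE_I2 mult_right_mono)
    qed (use ist in auto)
    then show "(%j. J j x) ----> F (graph_proj e y x)" using int1 by simp
   qed
   show "AE x in lborel. norm (indicator {0..1::real} (e \<bullet> x) * J j x) <= N * S * indicator (cball 0 (2 * R + 1)) x" for j
   proof (intro AE_I2)
    fix x
    show "norm (indicator {0..1::real} (e \<bullet> x) * J j x) <= N * S * indicator (cball 0 (2 * R + 1)) x"
    proof (cases "x \<in> cball 0 (2 * R + 1)")
     case True
     then show ?thesis using Jle[of j x] N S by (auto simp: indicator_def)
    next
     case False
     show ?thesis
     proof (cases "e \<bullet> x \<in> {0..1}")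
      case True
      have "F (graph_proj e y x + t *R e) = 0" for t
       using graph_proj_bounded[OF e, of x y t R] True False by (intro zF) force
      then have "J j x = 0" by (simp add: J_def)
      then show ?thesis using False by simp
     qed (use False in simp)
    qed
   qed
  qed measurable
  then show ?thesis using line_Fubini[OF iH ee] by (simp add: HJ)
 qed
 ultimately have "(LBINT x. indicator {x. y x > 0} x * f' x $ k) = - gint e y F"
  using tendsto_minus[of "%j. LBINT x. H j x"] unfolding A by (auto intro: LIMSEQ_unique)
 then show ?thesis by (simp add: F_def[abs_def])
qed

text \<open>The defect of integration by parts, formally the integral of the divergence of f times
  the field, that is, the flux through the boundary. Only the diagonal entries of the derivative of
  the field enter a divergence.\<close>

definition ibp :: "(real^'n => real) => (real^'n => real^'n) => ('n => real^'n => real) => ('n => real^'n => real^'n) => real" where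
 "ibp f g \<phi> \<phi>' = (\<Sum>k\<in>UNIV. LBINT x. f x * \<phi>' k x $ k + \<phi> k x * g x $ k)"

lemma L1_tendsto_integral_bounded:
 fixes u :: "nat => 'a => real"
 assumes ui: "!!j. integrable M (u j)" and vi: "integrable M v" and [measurable]: "h \<in> borel_measurable M" and hB: "!!x. \<bar>h x\<bar> <= B"
  and lim: "(%j. \<integral>x. \<bar>u j x - v x\<bar> \<partial>M) ----> 0"
 shows "(%j. \<integral>x. u j x * h x \<partial>M) ----> (\<integral>x. v x * h x \<partial>M)"
proof (rule LIM_zero_cancel, rule tendsto_rabs_zero_cancel)
 have iu: "integrable M (%x. u j x * h x)" and iv: "integrable M (%x. v x * h x)" for j
  using integrable_bounded_scale[of M _ h B] ui vi hB by auto
 have le: "\<bar>(\<integral>x. u j x * h x \<partial>M) - (\<integral>x. v x * h x \<partial>M)\<bar> <= B * (\<integral>x. \<bar>u j x - v x\<bar> \<partial>M)" for j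
 proof -
  have "\<bar>(\<integral>x. u j x * h x \<partial>M) - (\<integral>x. v x * h x \<partial>M)\<bar> = norm (\<integral>x. (u j x - v x) * h x \<partial>M)"
   using iu[of j] iv by (simp add: left_diff_distrib)
  also have "... <= (\<integral>x. B * \<bar>u j x - v x\<bar> \<partial>M)"
  proof (rule Bochner_norm_bound_integral)
   show "norm ((u j x - v x) * h x) <= B * \<bar>u j x - v x\<bar>" for x
    using mult_left_mono[OF hB[of x], of "\<bar>u j x - v x\<bar>"] by (simp add: abs_mult mult.commute)
  qed (use iu[of j] iv ui[of j] vi in \<open>auto simp: left_diff_distrib\<close>)
  finally show ?thesis by simp
 qed
 show "(%j. \<bar>(\<integral>x. u j x * h x \<partial>M) - (\<integral>x. v x * h x \<partial>M)\<bar>) ----> 0"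
  by (rule tendsto_sandwich[OF _ _ tendsto_const tendsto_mult_right_zero[OF lim, of B]]) (use le in auto)
qed

lemma real_vec_component_borel [measurable]:
 "(%x::real^'n. x $ k) \<in> borel_measurable borel"
 by (intro borel_measurable_continuous_onI continuous_intros)

lemma chart_dir_deriv:
 assumes y: "C1 y y'" and ye: "!!x t. y (x + t *R e) = y x + t"
 shows "e \<bullet> y' x = 1"
proof -
 have "((%t. y x + t) has_real_derivative e \<bullet> y' x) (at 0)"
  using C1_line[OF y, of x e 0] by (simp add: ye)
 moreover have "((%t. y x + t) has_real_derivative 1) (at 0)" by (auto intro!: derivative_eq_intros)
 ultimately show ?thesis by (rule DERIV_unique)
qed

text \<open>Mollified along the cone, f becomes C1 with the right gradient where b does not vanish,
  so \<open>graph_div_theorem\<close> writes the defect as a graph integral. The weight b^2 gives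
  one factor b to each side of Cauchy-Schwarz. The side with f is bounded by a trace inequality: its
  graph integral is converted back to a volume integral by the divergence theorem in direction
  e.\<close>

proposition chart_ibp:
 fixes U :: "(real^'n) set"
 assumes op: "open U" and ch: "chart U p \<rho> e y y'" and cone: "cone_at U p r a t0" and r: "r <= \<rho>"
  and b: "C1 b b'" and b01: "!!x. 0 <= b x" "!!x. b x <= 1" and b0: "!!x. x \<notin> ball p r ==> b x = 0"
 obtains C where "C >= 0" "\<forall>f g \<phi> \<phi>' \<Phi>'. wgrad U f g --> (\<forall>k. C1 (\<phi> k) (\<phi>' k)) --> (\<forall>k. C1 (%x. (b x)^2 * \<phi> k x) (\<Phi>' k)) -->
  (ibp f g (%k x. (b x)^2 * \<phi> k x) \<Phi>')^2 <=
   C * H1_mass f g * gint e y (%x. (b x)^2 * (\<Sum>k\<in>UNIV. \<phi> k x * y' x $ k)^2)"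
proof -
 have e: "norm e = 1" and y: "C1 y y'" and ye: "!!x t. y (x + t *R e) = y x + t"
  and eq: "!!x. x \<in> ball p \<rho> ==> x \<in> U \<longleftrightarrow> y x > 0"
  using ch unfolding chart_def by auto
 have t0: "t0 > 0" and cone': "!!x t. x \<in> U ==> x \<in> ball p r ==> 0 < t ==> t <= t0 ==> cball (x + t *R a) t \<subseteq> U"
  using cone unfolding cone_at_def by auto
 have [measurable]: "U \<in> sets borel" using op by auto
 have [measurable]: "{x. 0 < y x} \<in> sets borel" using C1_borel[OF y] by measurable
 define R where "R = norm p + \<bar>r\<bar>"
 have far: "x \<notin> ball p r" if "norm x > R" for x
  using that norm_triangle_ineq2[of x p] by (simp add: R_def dist_norm norm_minus_commute)
 have bR: "b x = 0" if "norm x > R" for x using b0 far[OF that] by blast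
 have bR': "b' x = 0" if "norm x > R" for x using C1_grad_compact_support[OF b bR that] .
 obtain B' where B': "B' > 0" "!!x. norm (b' x) <= B'"
  using compact_support_bounded[of b' R, OF C1_cont_grad[OF b] bR'] by metis
 \<comment> \<open>From 2 |F| (|Gm| + B' |F|) <= (1 + 2 B') F^2 + |Gm|^2.\<close>
 define C where "C = 1 + 2 * B'"
 show ?thesis
 proof (rule that[of C])
  show "C >= 0" using B' by (simp add: C_def)
  show "\<forall>f g \<phi> \<phi>' \<Phi>'. wgrad U f g --> (\<forall>k. C1 (\<phi> k) (\<phi>' k)) --> (\<forall>k. C1 (%x. (b x)^2 * \<phi> k x) (\<Phi>' k)) -->
   (ibp f g (%k x. (b x)^2 * \<phi> k x) \<Phi>')^2 <=
   C * H1_mass f g * gint e y (%x. (b x)^2 * (\<Sum>k\<in>UNIV. \<phi> k x * y' x $ k)^2)"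
  proof (intro allI impI)
   fix f :: "real^'n => real" and g :: "real^'n => real^'n" and \<phi> :: "'n => real^'n => real" and \<phi>' \<Phi>'
   assume wg: "wgrad U f g" and \<phi>0: "\<forall>k. C1 (\<phi> k) (\<phi>' k)" and \<Phi>0: "\<forall>k. C1 (%x. (b x)^2 * \<phi> k x) (\<Phi>' k)"
   have \<phi>: "C1 (\<phi> k) (\<phi>' k)" for k using \<phi>0 by blast
   define \<Phi> where "\<Phi> k x = (b x)^2 * \<phi> k x" for k x
   have \<Phi>: "C1 (\<Phi> k) (\<Phi>' k)" for k using \<Phi>0 unfolding \<Phi>_def[abs_def] by blast
   have f: "integrable lborel f" and g: "integrable lborel g" and f2: "integrable lborel (%x. (norm (f x))^2)"
    and g2: "integrable lborel (%x. (norm (g x))^2)" and f0: "!!x. x \<notin> U ==> f x = 0" and g0: "!!x. x \<notin> U ==> g x = 0"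
    using wg unfolding wgrad_def by auto
   have [measurable]: "f \<in> borel_measurable borel" "g \<in> borel_measurable borel" using f g by auto
   note [measurable] = C1_borel[OF \<Phi>] C1_borel_grad[OF \<Phi>] C1_borel[OF b] C1_borel_grad[OF b]
   \<comment> \<open>Where b vanishes, b^2 has a double zero, so the gradient of the cut-off field
     vanishes there as well.\<close>
   have \<Phi>b: "\<Phi> k x = 0" "\<Phi>' k x = 0" if "b x = 0" for k x
   proof -
    show "\<Phi> k x = 0" using that by (simp add: \<Phi>_def)
    have "C1 (%x. (b x * b x) * \<phi> k x) (\<Phi>' k)" using \<Phi>[of k] by (simp add: \<Phi>_def[abs_def] power2_eq_square)
    from C1_unique[OF this C1_mult[OF C1_mult[OF b b] \<phi>]] that show "\<Phi>' k x = 0" by simp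
   qed
   have z\<Phi>: "\<Phi> k x = 0" if "norm x > R" for k x using \<Phi>b bR[OF that] by blast
   have z\<Phi>': "\<Phi>' k x = 0" if "norm x > R" for k x using \<Phi>b bR[OF that] by blast
   define eps where "eps j = t0 / real (Suc j)" for j
   have eps: "eps j > 0" "eps j <= t0" for j using t0 by (auto simp: eps_def field_simps)
   have eps0: "eps ----> 0" unfolding eps_def by (rule LIMSEQ_Suc[of "%j. t0 / real j"]) (rule lim_const_over_n)
   define NN where "NN = H1_mass f g"
   define \<Sigma> where "\<Sigma> x = (\<Sum>k\<in>UNIV. \<phi> k x * y' x $ k)" for x
   have c\<Sigma>: "continuous_on UNIV \<Sigma>" unfolding \<Sigma>_def[abs_def]
    using C1_cont[OF \<phi>] C1_cont_grad[OF y] by (intro continuous_intros)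
   define E where "E = gint e y (%x. (b x)^2 * (\<Sigma> x)^2)"
   define F where "F j = moll (eps j) a f" for j
   define Gm where "Gm j = moll (eps j) a g" for j
   have [measurable]: "F j \<in> borel_measurable borel" "Gm j \<in> borel_measurable borel" for j unfolding F_def Gm_def by measurable
   define S where "S j = (\<Sum>k\<in>UNIV. LBINT x. indicator U x * (F j x * \<Phi>' k x $ k + \<Phi> k x * Gm j x $ k))" for j
   have iF: "integrable lborel (F j)" and iG: "integrable lborel (Gm j)" for j
    unfolding F_def Gm_def by (rule moll_integrable[OF eps(1) f], rule moll_integrable[OF eps(1) g])
   have iGk: "integrable lborel (%x. Gm j x $ k)" "integrable lborel (%x. g x $ k)" for j k
    using integrable_inner_left[OF iG[of j], of "axis k 1"] integrable_inner_left[OF g, of "axis k 1"] by (simp_all add: inner_axis)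
   have Fl: "(%j. LBINT x. \<bar>F j x - f x\<bar>) ----> 0"
    using moll_tendsto_L1[OF f eps(1) eps0, of a] by (simp add: F_def)
   have Gl: "(%j. LBINT x. \<bar>Gm j x $ k - g x $ k\<bar>) ----> 0" for k
   proof (rule tendsto_sandwich[OF _ _ tendsto_const moll_tendsto_L1[OF g eps(1) eps0, of a]])
    have c: "\<bar>Gm j x $ k - g x $ k\<bar> <= norm (moll (eps j) a g x - g x)" for j x
     using component_le_norm_cart[of "Gm j x - g x" k] by (simp add: Gm_def)
    show "\<forall>\<^sub>F j in sequentially. (LBINT x. \<bar>Gm j x $ k - g x $ k\<bar>) <= (LBINT x. norm (moll (eps j) a g x - g x))"
     using iGk iG[unfolded Gm_def] g by (intro always_eventually allI integral_mono c) auto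
   qed auto
   have bdk: "\<exists>B. \<forall>x. \<bar>indicator U x * \<Phi>' k x $ k\<bar> <= B" "\<exists>B. \<forall>x. \<bar>indicator U x * \<Phi> k x\<bar> <= B" for k
   proof -
    obtain B where "!!x. norm (\<Phi>' k x) <= B"
     using compact_support_bounded[of "\<Phi>' k" R, OF C1_cont_grad[OF \<Phi>] z\<Phi>'] by metis
    then have "\<bar>indicator U x * \<Phi>' k x $ k\<bar> <= B" for x
     using component_le_norm_cart[of "\<Phi>' k x" k] order_trans[OF norm_ge_zero, of "\<Phi>' k x" B] by (auto simp: indicator_def intro: order_trans)
    then show "\<exists>B. \<forall>x. \<bar>indicator U x * \<Phi>' k x $ k\<bar> <= B" by blast
    obtain B where "!!x. norm (\<Phi> k x) <= B"
     using compact_support_bounded[of "\<Phi> k" R, OF C1_cont[OF \<Phi>] z\<Phi>] by metis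
    then have "\<bar>indicator U x * \<Phi> k x\<bar> <= B" for x
     using order_trans[OF norm_ge_zero, of "\<Phi> k x" B] by (auto simp: indicator_def)
    then show "\<exists>B. \<forall>x. \<bar>indicator U x * \<Phi> k x\<bar> <= B" by blast
   qed
   have Slim: "S ----> ibp f g \<Phi> \<Phi>'"
    unfolding S_def ibp_def
   proof (rule tendsto_sum)
    fix k :: 'n
    obtain B1 B2 where B1: "!!x. \<bar>indicator U x * \<Phi>' k x $ k\<bar> <= B1" and B2: "!!x. \<bar>indicator U x * \<Phi> k x\<bar> <= B2"
     using bdk by meson
    have i1: "integrable lborel (%x. u x * (indicator U x * \<Phi>' k x $ k))" if "integrable lborel u" for u :: "real^'n => real"
     using integrable_bounded_scale[OF that, of "%x. indicator U x * \<Phi>' k x $ k" B1] B1 by simp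
    have i2: "integrable lborel (%x. u x * (indicator U x * \<Phi> k x))" if "integrable lborel u" for u :: "real^'n => real"
     using integrable_bounded_scale[OF that, of "%x. indicator U x * \<Phi> k x" B2] B2 by simp
    have "(%j. (LBINT x. F j x * (indicator U x * \<Phi>' k x $ k)) + (LBINT x. Gm j x $ k * (indicator U x * \<Phi> k x))) ---->
     (LBINT x. f x * (indicator U x * \<Phi>' k x $ k)) + (LBINT x. g x $ k * (indicator U x * \<Phi> k x))"
    proof (rule tendsto_add)
     show "(%j. LBINT x. F j x * (indicator U x * \<Phi>' k x $ k)) ----> (LBINT x. f x * (indicator U x * \<Phi>' k x $ k))"
      by (rule L1_tendsto_integral_bounded[OF iF f _ B1 Fl]) measurable
     show "(%j. LBINT x. Gm j x $ k * (indicator U x * \<Phi> k x)) ----> (LBINT x. g x $ k * (indicator U x * \<Phi> k x))"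
      by (rule L1_tendsto_integral_bounded[OF iGk _ B2 Gl]) measurable
    qed
    moreover have "(LBINT x. F j x * (indicator U x * \<Phi>' k x $ k)) + (LBINT x. Gm j x $ k * (indicator U x * \<Phi> k x)) =
     (LBINT x. indicator U x * (F j x * \<Phi>' k x $ k + \<Phi> k x * Gm j x $ k))" for j
     using i1[OF iF] i2[OF iGk(1)] by (subst Bochner_Integration.integral_add[symmetric]) (auto simp: algebra_simps)
    moreover have "(LBINT x. f x * (indicator U x * \<Phi>' k x $ k)) + (LBINT x. g x $ k * (indicator U x * \<Phi> k x)) =
     (LBINT x. f x * \<Phi>' k x $ k + \<Phi> k x * g x $ k)"
    proof -
     have "f x * (indicator U x * \<Phi>' k x $ k) + g x $ k * (indicator U x * \<Phi> k x) = f x * \<Phi>' k x $ k + \<Phi> k x * g x $ k" for x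
      using f0[of x] g0[of x] by (auto simp: indicator_def)
     then show ?thesis using i1[OF f] i2[OF iGk(2)] by (subst Bochner_Integration.integral_add[symmetric]) auto
    qed
    ultimately show "(%j. LBINT x. indicator U x * (F j x * \<Phi>' k x $ k + \<Phi> k x * Gm j x $ k)) ---->
     (LBINT x. f x * \<Phi>' k x $ k + \<Phi> k x * g x $ k)" by simp
   qed
   have bound: "(S j)^2 <= C * NN * E" for j
   proof -
    obtain G where G: "C1 (F j) G" and GF: "!!x. cball (x + eps j *R a) (eps j) \<subseteq> U ==> G x = Gm j x"
     by (rule moll_C1[OF eps(1)[of j] wg, of a, folded F_def Gm_def]) (rule that)
    have GGm: "G x = Gm j x" if "x \<in> U" "b x \<noteq> 0" for x
     using that b0[of x] by (intro GF cone' eps) auto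
    \<comment> \<open>U agrees with the positivity set of y only in the chart ball; an integrand
      that vanishes together with b does not see the difference.\<close>
    have ind: "indicator {x. 0 < y x} x * h x = indicator U x * (h x :: real)" if "b x = 0 ==> h x = 0" for h x
    proof (cases "b x = 0")
     case False
     then have "x \<in> ball p r" using b0 by blast
     then have "x \<in> ball p \<rho>" using r by simp
     then show ?thesis using eq[of x] by (simp add: indicator_def)
    qed (use that in simp)
    have Sk: "(LBINT x. indicator U x * (F j x * \<Phi>' k x $ k + \<Phi> k x * Gm j x $ k)) = - gint e y (%x. \<Phi> k x * F j x * y' x $ k)" for k
    proof -
     have "(LBINT x. indicator {x. 0 < y x} x * (\<Phi> k x *R G x + F j x *R \<Phi>' k x) $ k) = - gint e y (%x. \<Phi> k x * F j x * y' x $ k)"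
      by (rule graph_div_theorem[OF e y ye C1_mult[OF \<Phi> G]]) (use z\<Phi> in auto)
     moreover have "indicator {x. 0 < y x} x * (\<Phi> k x *R G x + F j x *R \<Phi>' k x) $ k =
      indicator U x * (F j x * \<Phi>' k x $ k + \<Phi> k x * Gm j x $ k)" for x
     proof -
      have "indicator {x. 0 < y x} x * (\<Phi> k x *R G x + F j x *R \<Phi>' k x) $ k = indicator U x * (\<Phi> k x *R G x + F j x *R \<Phi>' k x) $ k"
       by (rule ind) (use \<Phi>b in auto)
      also have "... = indicator U x * (F j x * \<Phi>' k x $ k + \<Phi> k x * Gm j x $ k)"
       using GGm[of x] \<Phi>b[of x k] by (cases "b x = 0") (auto simp: indicator_def)
      finally show ?thesis .
     qed
     ultimately show ?thesis by (simp only:)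
    qed
    define \<alpha> where "\<alpha> x = b x * F j x" for x
    define \<beta> where "\<beta> x = b x * \<Sigma> x" for x
    have \<alpha>: "C1 \<alpha> (%x. b x *R G x + F j x *R b' x)" unfolding \<alpha>_def[abs_def] by (rule C1_mult[OF b G])
    have c\<alpha>: "continuous_on UNIV \<alpha>" and c\<beta>: "continuous_on UNIV \<beta>"
     using C1_cont[OF \<alpha>] C1_cont[OF b] c\<Sigma> unfolding \<beta>_def[abs_def] by (auto intro!: continuous_intros)
    let ?c = "%x. indicator {0..1::real} (e \<bullet> x) :: real"
    let ?P = "graph_proj e y"
    have gi: "integrable lborel (%x. ?c x * h (?P x))" if "continuous_on UNIV h" "!!x. b x = 0 ==> h x = 0" for h
     by (rule gint_integrable[OF e y that(1), of R]) (use that(2) bR in auto)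
    have csq: "(?c x)^2 = ?c x" for x by (simp add: indicator_def)
    have [measurable]: "\<alpha> \<in> borel_measurable borel" "\<beta> \<in> borel_measurable borel" "?P \<in> borel_measurable borel"
     using c\<alpha> c\<beta> graph_proj_continuous[OF y] by (auto intro!: borel_measurable_continuous_onI)
    have "S j = - (\<Sum>k\<in>UNIV. gint e y (%x. \<Phi> k x * F j x * y' x $ k))"
     unfolding S_def Sk by (rule sum_negf)
    also have "(\<Sum>k\<in>UNIV. gint e y (%x. \<Phi> k x * F j x * y' x $ k)) =
     (LBINT x. (\<Sum>k\<in>UNIV. ?c x * (\<Phi> k (?P x) * F j (?P x) * y' (?P x) $ k)))"
     unfolding gint_def
    proof (rule Bochner_Integration.integral_sum[symmetric])
     fix k :: 'n
     show "integrable lborel (%x. ?c x * (\<Phi> k (?P x) * F j (?P x) * y' (?P x) $ k))"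
      by (rule gi[of "%x. \<Phi> k x * F j x * y' x $ k"])
       (use C1_cont[OF \<Phi>[of k]] C1_cont[OF G] C1_cont_grad[OF y] \<Phi>b in \<open>auto intro!: continuous_intros\<close>)
    qed
    also have "... = (LBINT x. (?c x * \<alpha> (?P x)) * (?c x * \<beta> (?P x)))"
    proof (rule Bochner_Integration.integral_cong)
     fix x
     have "(\<Sum>k\<in>UNIV. ?c x * (\<Phi> k (?P x) * F j (?P x) * y' (?P x) $ k)) = ?c x * (\<alpha> (?P x) * \<beta> (?P x))"
      unfolding \<alpha>_def \<beta>_def \<Sigma>_def \<Phi>_def by (simp add: sum_distrib_left power2_eq_square mult_ac)
     also have "... = (?c x)^2 * (\<alpha> (?P x) * \<beta> (?P x))" unfolding csq ..
     finally show "(\<Sum>k\<in>UNIV. ?c x * (\<Phi> k (?P x) * F j (?P x) * y' (?P x) $ k)) = (?c x * \<alpha> (?P x)) * (?c x * \<beta> (?P x))"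
      by (simp add: power2_eq_square)
    qed simp
    finally have "(S j)^2 = (LBINT x. (?c x * \<alpha> (?P x)) * (?c x * \<beta> (?P x)))^2" by simp
    also have "... <= (LBINT x. (?c x * \<alpha> (?P x))^2) * (LBINT x. (?c x * \<beta> (?P x))^2)"
    proof (rule integral_Cauchy_Schwarz(3))
     show "integrable lborel (%x. (?c x * \<alpha> (?P x))^2)" unfolding power_mult_distrib csq
      by (rule gi[of "%x. (\<alpha> x)^2"]) (use c\<alpha> in \<open>auto intro!: continuous_intros simp: \<alpha>_def\<close>)
     show "integrable lborel (%x. (?c x * \<beta> (?P x))^2)" unfolding power_mult_distrib csq
      by (rule gi[of "%x. (\<beta> x)^2"]) (use c\<beta> in \<open>auto intro!: continuous_intros simp: \<beta>_def\<close>)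
    qed measurable
    also have "(LBINT x. (?c x * \<beta> (?P x))^2) = E"
     unfolding E_def gint_def power_mult_distrib csq \<beta>_def by simp
    also have "(LBINT x. (?c x * \<alpha> (?P x))^2) = gint e y (%x. \<alpha> x * \<alpha> x)"
     unfolding gint_def power_mult_distrib csq by (simp add: power2_eq_square)
    also have "gint e y (%x. \<alpha> x * \<alpha> x) <= C * NN"
    proof -
     let ?w = "%x. \<alpha> x *R (b x *R G x + F j x *R b' x) + \<alpha> x *R (b x *R G x + F j x *R b' x)"
     have w: "C1 (%x. \<alpha> x * \<alpha> x) ?w" by (rule C1_mult[OF \<alpha> \<alpha>])
     have wz: "?w x = 0" if "b x = 0" for x using that by (simp add: \<alpha>_def)
     have iw: "integrable lborel (%x. indicator {x. 0 < y x} x * ?w x $ k)" for k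
     proof -
      have "integrable lborel (%x. ?w x $ k)"
      proof (rule continuous_compact_support_integrable[of _ R])
       show "continuous_on UNIV (%x. ?w x $ k)" by (rule continuous_on_component[OF C1_cont_grad[OF w]])
       show "?w x $ k = 0" if "norm x > R" for x using wz[OF bR[OF that]] by (simp only: zero_index)
      qed
      then have "integrable lborel (%x. ?w x $ k *R (indicator {x. 0 < y x} x :: real))"
      proof (rule integrable_bounded_scale[where B = 1])
       show "(indicator {x. 0 < y x} :: real^'n => real) \<in> borel_measurable lborel" by measurable
      qed (simp add: indicator_def)
      then show ?thesis by (simp add: mult.commute)
     qed
     \<comment> \<open>Inserting e . y' = 1 turns the plain integral of the square into a flux, to
       which the divergence theorem applies.\<close>
     have "gint e y (%x. \<alpha> x * \<alpha> x) = gint e y (%x. \<Sum>k\<in>UNIV. e $ k * (\<alpha> x * \<alpha> x * y' x $ k))"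
     proof -
      have "(\<Sum>k\<in>UNIV. e $ k * (\<alpha> x * \<alpha> x * y' x $ k)) = \<alpha> x * \<alpha> x * (e \<bullet> y' x)" for x
       by (simp add: inner_vec_def sum_distrib_left mult_ac)
      then show ?thesis by (simp add: chart_dir_deriv[OF y ye])
     qed
     also have "... = (\<Sum>k\<in>UNIV. e $ k * gint e y (%x. \<alpha> x * \<alpha> x * y' x $ k))"
     proof -
      have "integrable lborel (%x. ?c x * (\<alpha> (?P x) * \<alpha> (?P x) * y' (?P x) $ k))" for k
       by (rule gi[of "%x. \<alpha> x * \<alpha> x * y' x $ k"])
        (use c\<alpha> C1_cont_grad[OF y] in \<open>auto intro!: continuous_intros simp: \<alpha>_def\<close>)
      note i = this
      have "gint e y (%x. \<Sum>k\<in>UNIV. e $ k * (\<alpha> x * \<alpha> x * y' x $ k)) =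
       (LBINT x. (\<Sum>k\<in>UNIV. e $ k * (?c x * (\<alpha> (?P x) * \<alpha> (?P x) * y' (?P x) $ k))))"
       unfolding gint_def by (intro Bochner_Integration.integral_cong) (auto simp: sum_distrib_left mult_ac)
      also have "... = (\<Sum>k\<in>UNIV. LBINT x. e $ k * (?c x * (\<alpha> (?P x) * \<alpha> (?P x) * y' (?P x) $ k)))"
       by (rule Bochner_Integration.integral_sum) (intro integrable_mult_right i)
      finally show ?thesis unfolding gint_def by (simp only: integral_mult_right_zero)
     qed
     also have "... = - (\<Sum>k\<in>UNIV. e $ k * (LBINT x. indicator {x. 0 < y x} x * ?w x $ k))"
     proof -
      have "gint e y (%x. \<alpha> x * \<alpha> x * y' x $ k) = - (LBINT x. indicator {x. 0 < y x} x * ?w x $ k)" for k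
       using graph_div_theorem[OF e y ye w, of R k] bR by (simp add: \<alpha>_def)
      then show ?thesis by (simp add: sum_negf)
     qed
     also have "... = (LBINT x. - (\<Sum>k\<in>UNIV. e $ k * (indicator {x. 0 < y x} x * ?w x $ k)))"
      using iw by simp
     also have "... <= (LBINT x. (1 + 2 * B') * (F j x)^2 + (norm (Gm j x))^2)"
     proof (rule integral_mono)
      show "integrable lborel (%x. - (\<Sum>k\<in>UNIV. e $ k * (indicator {x. 0 < y x} x * ?w x $ k)))" using iw by simp
      show "integrable lborel (%x. (1 + 2 * B') * (F j x)^2 + (norm (Gm j x))^2)"
       using moll_L2(1)[OF eps(1) f f2, of j a] moll_L2(1)[OF eps(1) g g2, of j a] by (simp add: F_def Gm_def)
      fix x
      have "- (\<Sum>k\<in>UNIV. e $ k * (indicator {x. 0 < y x} x * ?w x $ k)) = - (indicator {x. 0 < y x} x * (e \<bullet> ?w x))"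
       by (simp add: inner_vec_def sum_distrib_left mult_ac)
      also have "... = - (indicator U x * (e \<bullet> ?w x))" by (subst ind) (auto simp: \<alpha>_def)
      also have "... <= (1 + 2 * B') * (F j x)^2 + (norm (Gm j x))^2"
      proof (cases "x \<in> U \<and> b x \<noteq> 0")
       case True
       have "\<bar>e \<bullet> ?w x\<bar> <= norm (?w x)" using Cauchy_Schwarz_ineq2[of e "?w x"] e by simp
       also have "norm (?w x) = norm (2 *R (\<alpha> x *R (b x *R Gm j x + F j x *R b' x)))" using GGm[of x] True by (simp only: scaleR_2 simp_thms)
       also have "... = 2 * (\<bar>\<alpha> x\<bar> * norm (b x *R Gm j x + F j x *R b' x))" by (simp add: abs_mult)
       also have "... <= 2 * (\<bar>F j x\<bar> * (norm (Gm j x) + \<bar>F j x\<bar> * B'))"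
       proof (intro mult_left_mono mult_mono)
        show "\<bar>\<alpha> x\<bar> <= \<bar>F j x\<bar>" using b01[of x] by (auto simp: \<alpha>_def abs_mult intro: mult_left_le_one_le)
        have "norm (b x *R Gm j x + F j x *R b' x) <= norm (b x *R Gm j x) + norm (F j x *R b' x)" by (rule norm_triangle_ineq)
        also have "... <= norm (Gm j x) + \<bar>F j x\<bar> * B'"
         using b01[of x] B'(2)[of x] by (auto intro!: add_mono mult_left_le_one_le mult_left_mono)
        finally show "norm (b x *R Gm j x + F j x *R b' x) <= norm (Gm j x) + \<bar>F j x\<bar> * B'" .
       qed auto
       also have "... <= (1 + 2 * B') * (F j x)^2 + (norm (Gm j x))^2"
        using sum_squares_bound[of "\<bar>F j x\<bar>" "norm (Gm j x)"] by (simp add: algebra_simps power2_eq_square)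
       finally have wb: "\<bar>e \<bullet> ?w x\<bar> <= (1 + 2 * B') * (F j x)^2 + (norm (Gm j x))^2" .
       have "indicator U x = (1::real)" using True by simp
       then show ?thesis using wb unfolding \<open>indicator U x = (1::real)\<close> mult_1 by linarith
      next
       case False
       then have "indicator U x * (e \<bullet> ?w x) = 0" using wz[of x] by (auto simp: indicator_def)
       then show ?thesis using B' unfolding \<open>indicator U x * (e \<bullet> ?w x) = 0\<close> by simp
      qed
      finally show "- (\<Sum>k\<in>UNIV. e $ k * (indicator {x. 0 < y x} x * ?w x $ k)) <= (1 + 2 * B') * (F j x)^2 + (norm (Gm j x))^2" .
     qed
     also have "... = (1 + 2 * B') * (LBINT x. (F j x)^2) + (LBINT x. (norm (Gm j x))^2)"
      using moll_L2(1)[OF eps(1) f f2, of j a] moll_L2(1)[OF eps(1) g g2, of j a] by (simp add: F_def Gm_def)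
     also have "... <= (1 + 2 * B') * (LBINT x. (f x)^2) + (1 + 2 * B') * (LBINT x. (norm (g x))^2)"
     proof (intro add_mono mult_left_mono)
      show "(LBINT x. (F j x)^2) <= (LBINT x. (f x)^2)"
       using moll_L2(2)[OF eps(1) f f2, of j a] by (simp add: F_def)
      have "(LBINT x. (norm (Gm j x))^2) <= 1 * (LBINT x. (norm (g x))^2)"
       using moll_L2(2)[OF eps(1) g g2, of j a] by (simp add: Gm_def)
      also have "... <= (1 + 2 * B') * (LBINT x. (norm (g x))^2)" using B' by (intro mult_right_mono) auto
      finally show "(LBINT x. (norm (Gm j x))^2) <= (1 + 2 * B') * (LBINT x. (norm (g x))^2)" .
     qed (use B' in auto)
     finally show ?thesis by (simp add: C_def NN_def H1_mass_def algebra_simps)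
    qed
    finally show ?thesis by (simp add: mult_right_mono E_def gint_def integral_nonneg)
   qed
   have "(%j. (S j)^2) ----> (ibp f g \<Phi> \<Phi>')^2" by (intro tendsto_intros Slim)
   then have "(ibp f g \<Phi> \<Phi>')^2 <= C * NN * E"
    by (rule LIMSEQ_le_const2) (use bound in auto)
   then show "(ibp f g (%k x. (b x)^2 * \<phi> k x) \<Phi>')^2 <=
    C * H1_mass f g * gint e y (%x. (b x)^2 * (\<Sum>k\<in>UNIV. \<phi> k x * y' x $ k)^2)"
    unfolding \<Phi>_def[abs_def] NN_def E_def \<Sigma>_def .
  qed
 qed
qed

section \<open>The Hausdorff measure\<close>

definition hcover :: "real => (real^'n) set => (nat => (real^'n) set) set" where
 "hcover \<delta> A = {U. A \<subseteq> (\<Union>i. U i) \<and> (\<forall>i. bounded (U i) \<and> diameter (U i) <= \<delta>)}"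

definition hsum :: "nat => (nat => (real^'n) set) => ennreal" where
 "hsum s U = (\<Sum>i. ennreal (unit_ball_vol (real s) * (diameter (U i) / 2) ^ s))"

definition hpre :: "nat => real => (real^'n) set => ennreal" where
 "hpre s \<delta> A = (INF U\<in>hcover \<delta> A. hsum s U)"

lemma hausdorff_outer_eq: "hausdorff_outer s A = (SUP \<delta>\<in>{0<..}. hpre s \<delta> A)"
 unfolding hausdorff_outer_def hpre_def hcover_def hsum_def ..

lemma hpre_mono: "A \<subseteq> B ==> hpre s \<delta> A <= hpre s \<delta> B"
 unfolding hpre_def hcover_def by (intro INF_superset_mono) auto

lemma hpre_antimono:
 assumes "\<delta> <= \<delta>'" shows "hpre s \<delta>' A <= hpre s \<delta> A"
proof -
 have "hcover \<delta> A \<subseteq> hcover \<delta>' A"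
  unfolding hcover_def by (auto dest: spec intro: order_trans[OF _ assms])
 then show ?thesis unfolding hpre_def by (intro INF_superset_mono) auto
qed

lemma hsum_le: "U \<in> hcover \<delta> A ==> hpre s \<delta> A <= hsum s U"
 unfolding hpre_def by (rule INF_lower)

lemma hpre_empty: "s >= 1 ==> \<delta> > 0 ==> hpre s \<delta> {} = 0"
 using hsum_le[of "%_. {}" \<delta> "{}" s] by (simp add: hcover_def hsum_def power_0_left)

lemma hpre_countably_subadditive:
 fixes A :: "nat => (real^'n) set"
 shows "hpre s \<delta> (\<Union>n. A n) <= (\<Sum>n. hpre s \<delta> (A n))"
proof (cases "(\<Sum>n. hpre s \<delta> (A n)) = top")
 case False
 show ?thesis
 proof (rule ennreal_le_epsilon)
  fix eps :: real assume eps: "0 < eps"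
  have fin: "hpre s \<delta> (A n) \<noteq> top" for n
  proof
   assume top: "hpre s \<delta> (A n) = top"
   have "(\<Sum>i\<in>{n}. hpre s \<delta> (A i)) <= (\<Sum>i. hpre s \<delta> (A i))" by (rule sum_le_suminf) auto
   then show False using False top by (simp add: top_unique)
  qed
  have "\<exists>U\<in>hcover \<delta> (A n). hsum s U <= hpre s \<delta> (A n) + ennreal (eps * (1/2)^Suc n)" for n
  proof -
   let ?e = "ennreal (eps * (1/2)^Suc n)"
   have "?e > 0" using eps by simp
   then have "hpre s \<delta> (A n) < hpre s \<delta> (A n) + ?e"
    using fin[of n] by (cases "hpre s \<delta> (A n)") (auto simp flip: ennreal_plus simp: ennreal_less_iff)
   moreover have "hpre s \<delta> (A n) = (INF U\<in>hcover \<delta> (A n). hsum s U)" by (rule hpre_def)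
   ultimately have "(INF U\<in>hcover \<delta> (A n). hsum s U) < hpre s \<delta> (A n) + ?e" by metis
   then show ?thesis unfolding INF_less_iff using less_imp_le by blast
  qed
  then have "\<forall>n. \<exists>U. U \<in> hcover \<delta> (A n) \<and> hsum s U <= hpre s \<delta> (A n) + ennreal (eps * (1/2)^Suc n)" by blast
  from choice[OF this] obtain U where U: "!!n. U n \<in> hcover \<delta> (A n)"
   and Ule: "!!n. hsum s (U n) <= hpre s \<delta> (A n) + ennreal (eps * (1/2)^Suc n)" by blast
  define V where "V i = (case prod_decode i of (n, m) => U n m)" for i
  have "V \<in> hcover \<delta> (\<Union>n. A n)"
  proof -
   have "x \<in> (\<Union>i. V i)" if x: "x \<in> A n" for x n
   proof -
    obtain m where "x \<in> U n m" using U[of n] x unfolding hcover_def by auto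
    then have "x \<in> V (prod_encode (n, m))" by (simp add: V_def)
    then show ?thesis by blast
   qed
   then show ?thesis using U unfolding hcover_def by (auto simp: V_def split: prod.split)
  qed
  then have "hpre s \<delta> (\<Union>n. A n) <= hsum s V" by (rule hsum_le)
  also have "hsum s V = (\<Sum>n. hsum s (U n))"
   unfolding hsum_def
   using suminf_ennreal_2dimen[of "%n. hsum s (U n)" "%(n, m). ennreal (unit_ball_vol (real s) * (diameter (U n m) / 2) ^ s)"]
   by (simp add: hsum_def V_def comp_def case_prod_unfold)
  also have "... <= (\<Sum>n. hpre s \<delta> (A n) + ennreal (eps * (1/2)^Suc n))"
   by (intro suminf_le Ule) auto
  also have "... = (\<Sum>n. hpre s \<delta> (A n)) + (\<Sum>n. ennreal (eps * (1/2)^Suc n))"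
   by (rule suminf_add[symmetric]) auto
  also have "(\<Sum>n. ennreal (eps * (1/2)^Suc n)) = ennreal eps"
  proof -
   have "(%n. eps * (1/2)^Suc n) sums (eps * 1)" by (intro sums_mult power_half_series)
   then show ?thesis using eps by (intro suminf_ennreal_eq) auto
  qed
  finally show "hpre s \<delta> (\<Union>n. A n) <= (\<Sum>n. hpre s \<delta> (A n)) + ennreal eps" .
 qed
qed simp

lemma hausdorff_outer_empty: "s >= 1 ==> hausdorff_outer s {} = 0"
 unfolding hausdorff_outer_eq by (simp add: hpre_empty)

lemma hausdorff_outer_mono: "A \<subseteq> B ==> hausdorff_outer s A <= hausdorff_outer s B"
 unfolding hausdorff_outer_eq by (intro SUP_subset_mono hpre_mono) auto

lemma hpre_le_hausdorff: "\<delta> > 0 ==> hpre s \<delta> A <= hausdorff_outer s A"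
 unfolding hausdorff_outer_eq by (rule SUP_upper) simp

lemma hausdorff_outer_UN: "hausdorff_outer s (\<Union>n. A n) <= (\<Sum>n. hausdorff_outer s (A n))"
 unfolding hausdorff_outer_eq[of s "\<Union>n. A n"]
proof (rule SUP_least)
 fix \<delta> :: real assume "\<delta> \<in> {0<..}"
 then have "(\<Sum>n. hpre s \<delta> (A n)) <= (\<Sum>n. hausdorff_outer s (A n))"
  by (intro suminf_le hpre_le_hausdorff) auto
 with hpre_countably_subadditive show "hpre s \<delta> (\<Union>n. A n) <= (\<Sum>n. hausdorff_outer s (A n))" by (rule order_trans)
qed

lemma hausdorff_outer_Un:
 assumes "s >= 1" shows "hausdorff_outer s (A \<union> B) <= hausdorff_outer s A + hausdorff_outer s B"
proof -
 have "A \<union> B = (\<Union>n. if n = (0::nat) then A else if n = 1 then B else {})" by (auto split: if_splits)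
 also have "hausdorff_outer s ... <= (\<Sum>n. hausdorff_outer s (if n = (0::nat) then A else if n = 1 then B else {}))"
  by (rule hausdorff_outer_UN)
 also have "... = (\<Sum>n\<in>{0,1}. hausdorff_outer s (if n = (0::nat) then A else if n = 1 then B else {}))"
  by (rule suminf_finite) (auto simp: hausdorff_outer_empty[OF assms])
 finally show ?thesis by simp
qed

text \<open>No covering set of diameter below d meets both A and B, so every fine cover of the union
  splits into a cover of A and a cover of B.\<close>

lemma hausdorff_outer_separated:
 assumes s: "s >= 1" and d: "d > 0" and sep: "!!x y. x \<in> A ==> y \<in> B ==> dist x y >= d"
 shows "hausdorff_outer s A + hausdorff_outer s B <= hausdorff_outer s (A \<union> B)"
proof -
 have small: "hpre s \<delta> A + hpre s \<delta> B <= hpre s \<delta> (A \<union> B)" if \<delta>: "0 < \<delta>" "\<delta> < d" for \<delta>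
  unfolding hpre_def[of s \<delta> "A \<union> B"]
 proof (rule INF_greatest)
  fix U assume U: "U \<in> hcover \<delta> (A \<union> B)"
  define UA where "UA i = (if U i \<inter> A \<noteq> {} then U i else {})" for i
  define UB where "UB i = (if U i \<inter> B \<noteq> {} then U i else {})" for i
  have cov: "X \<subseteq> (\<Union>i. if U i \<inter> X \<noteq> {} then U i else {})" if X: "X \<subseteq> (\<Union>i. U i)" for X
  proof
   fix t assume t: "t \<in> X"
   then obtain i where i: "t \<in> U i" using X by blast
   then have "t \<in> (if U i \<inter> X \<noteq> {} then U i else {})" using t by auto
   then show "t \<in> (\<Union>i. if U i \<inter> X \<noteq> {} then U i else {})" by blast
  qed
  have "UA \<in> hcover \<delta> A" "UB \<in> hcover \<delta> B"
   using U \<delta> unfolding hcover_def UA_def UB_def using cov[of A] cov[of B] by auto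
  then have "hpre s \<delta> A + hpre s \<delta> B <= hsum s UA + hsum s UB" by (intro add_mono hsum_le)
  also have "... = (\<Sum>i. ennreal (unit_ball_vol (real s) * (diameter (UA i) / 2) ^ s) + ennreal (unit_ball_vol (real s) * (diameter (UB i) / 2) ^ s))"
   unfolding hsum_def by (rule suminf_add) auto
  also have "... <= hsum s U"
   unfolding hsum_def
  proof (intro suminf_le)
   fix i
   have "U i \<inter> A = {} \<or> U i \<inter> B = {}"
   proof (rule ccontr)
    assume "\<not> ?thesis"
    then obtain x y where xy: "x \<in> U i" "x \<in> A" "y \<in> U i" "y \<in> B" by blast
    have "bounded (U i)" "diameter (U i) <= \<delta>" using U unfolding hcover_def by auto
    then have "dist x y <= \<delta>" using diameter_bounded_bound[of "U i" x y] xy by auto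
    then show False using sep[of x y] xy \<delta> by simp
   qed
   then show "ennreal (unit_ball_vol (real s) * (diameter (UA i) / 2) ^ s) + ennreal (unit_ball_vol (real s) * (diameter (UB i) / 2) ^ s)
    <= ennreal (unit_ball_vol (real s) * (diameter (U i) / 2) ^ s)"
    using s by (auto simp: UA_def UB_def power_0_left)
  qed auto
  finally show "hpre s \<delta> A + hpre s \<delta> B <= hsum s U" .
 qed
 have le: "hpre s \<delta>1 A + hpre s \<delta>2 B <= hausdorff_outer s (A \<union> B)" if "\<delta>1 > 0" "\<delta>2 > 0" for \<delta>1 \<delta>2
 proof -
  define \<delta> where "\<delta> = min (min \<delta>1 \<delta>2) (d/2)"
  have \<delta>: "0 < \<delta>" "\<delta> < d" "\<delta> <= \<delta>1" "\<delta> <= \<delta>2" using that d by (auto simp: \<delta>_def)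
  have "hpre s \<delta>1 A + hpre s \<delta>2 B <= hpre s \<delta> A + hpre s \<delta> B" using \<delta> by (intro add_mono hpre_antimono)
  also have "... <= hpre s \<delta> (A \<union> B)" by (rule small[OF \<delta>(1,2)])
  also have "... <= hausdorff_outer s (A \<union> B)" by (rule hpre_le_hausdorff[OF \<delta>(1)])
  finally show ?thesis .
 qed
 have ne: "{0::real<..} \<noteq> {}" by (simp add: greaterThan_non_empty)
 have "hausdorff_outer s A + hausdorff_outer s B = (SUP \<delta>1\<in>{0<..}. hpre s \<delta>1 A + hausdorff_outer s B)"
  unfolding hausdorff_outer_eq[of s A] by (rule ennreal_SUP_add_left[OF ne, symmetric])
 also have "... = (SUP \<delta>1\<in>{0<..}. SUP \<delta>2\<in>{0<..}. hpre s \<delta>1 A + hpre s \<delta>2 B)"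
  unfolding hausdorff_outer_eq[of s B] by (intro SUP_cong refl ennreal_SUP_add_right[OF ne])
 also have "... <= hausdorff_outer s (A \<union> B)" by (intro SUP_least le) auto
 finally show ?thesis .
qed

text \<open>Caratheodory's criterion for metric outer measures. The sets E n keep a positive
  distance from F, and the shells R n fill the rest of T - F. Shells whose indices have the same
  parity are mutually separated, so the even and the odd shells each sum to at most the measure of
  T, and the tail of the series becomes negligible.\<close>

lemma hausdorff_outer_closed_split:
 fixes F T :: "(real^'n) set"
 assumes s: "s >= 1" and F: "closed F" "F \<noteq> {}"
 shows "hausdorff_outer s (T \<inter> F) + hausdorff_outer s (T - F) <= hausdorff_outer s T"
proof (cases "hausdorff_outer s T = top")
 case False
 let ?H = "hausdorff_outer s :: (real^'n) set => ennreal"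
 define E where "E n = {x \<in> T - F. infdist x F >= 1 / real (Suc n)}" for n
 define R where "R n = E (Suc n) - E n" for n
 have RD: "x \<in> T - F" "infdist x F >= 1 / real (n + 2)" "infdist x F < 1 / real (n + 1)" if "x \<in> R n" for x n
  using that by (auto simp: R_def E_def)
 have sep_le: "1 / real (m + 2) - 1 / real (n + 1) <= dist x z" if x: "x \<in> R m" and z: "z \<in> R n" for x z m n
  using RD(2)[OF x] RD(3)[OF z] infdist_triangle[of x F z] by simp
 have skip: "(\<Sum>i<N. ?H (R (2 * i + c))) <= ?H (\<Union>i<N. R (2 * i + c))" for N c
 proof (induction N)
  case (Suc N)
  have "(\<Sum>i<Suc N. ?H (R (2 * i + c))) <= ?H (\<Union>i<N. R (2 * i + c)) + ?H (R (2 * N + c))"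
   using Suc by (simp add: add_right_mono)
  also have "... <= ?H ((\<Union>i<N. R (2 * i + c)) \<union> R (2 * N + c))"
  proof (cases "N = 0")
   case True
   then show ?thesis by (simp add: hausdorff_outer_empty[OF s])
  next
   case N: False
   show ?thesis
   \<comment> \<open>Earlier shells of the same parity have distance at least 1 / (2N + c) from F,
     the new shell less than 1 / (2N + c + 1); the triangle inequality for \<open>infdist\<close>
     gives the gap.\<close>
   proof (rule hausdorff_outer_separated[OF s, of "1 / real (2 * N + c) - 1 / real (2 * N + c + 1)"])
    show "0 < 1 / real (2 * N + c) - 1 / real (2 * N + c + 1)" 
    proof -
     have "1 / real (2 * N + c + 1) < 1 / real (2 * N + c)" using N by (intro divide_strict_left_mono) auto
     then show ?thesis by simp
    qed
    show "1 / real (2 * N + c) - 1 / real (2 * N + c + 1) <= dist x z"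
     if x: "x \<in> (\<Union>i<N. R (2 * i + c))" and z: "z \<in> R (2 * N + c)" for x z
    proof -
     obtain i where i: "i < N" "x \<in> R (2 * i + c)" using x by blast
     have "1 / real (2 * N + c) <= 1 / real (2 * i + c + 2)" using i(1) by (intro divide_left_mono) auto
     with sep_le[OF i(2) z] show ?thesis by linarith
    qed
   qed
  qed
  finally show ?case by (simp add: lessThan_Suc Un_commute)
 qed simp
 have half: "(\<Sum>i. ?H (R (2 * i + c))) <= ?H T" for c
 proof (rule suminf_le_const)
  show "(\<Sum>i<N. ?H (R (2 * i + c))) <= ?H T" for N
   by (rule order_trans[OF skip hausdorff_outer_mono]) (auto dest: RD(1))
 qed simp
 have "(\<Sum>i. ?H (R i)) = (\<Sum>i. ?H (R (2 * i)) + ?H (R (2 * i + 1)))"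
 proof -
  have "(%n. ?H (R n)) sums (\<Sum>i. ?H (R i))" by (intro summable_sums) simp
  then have "(%n. \<Sum>i\<in>{n * 2..<n * 2 + 2}. ?H (R i)) sums (\<Sum>i. ?H (R i))" by (rule sums_group) simp
  moreover have "(\<Sum>i\<in>{n * 2..<n * 2 + 2}. ?H (R i)) = ?H (R (2 * n)) + ?H (R (2 * n + 1))" for n
   by (simp add: numeral_2_eq_2 mult.commute)
  ultimately show ?thesis by (simp add: sums_iff)
 qed
 also have "... = (\<Sum>i. ?H (R (2 * i + 0))) + (\<Sum>i. ?H (R (2 * i + 1)))" by (simp add: suminf_add)
 also have "... <= ?H T + ?H T" by (intro add_mono half)
 also have "... < top" using False by (simp add: less_top)
 finally have fin: "(\<Sum>i. ?H (R i)) < top" .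
 then have fi: "?H (R i) < top" for i
  using sum_le_suminf[of "%i. ?H (R i)" "{i}"] by (auto intro: le_less_trans)
 define f where "f i = enn2real (?H (R i))" for i
 have fH: "ennreal (f i) = ?H (R i)" for i using fi[of i] by (simp add: f_def)
 have f0: "0 <= f i" for i by (simp add: f_def)
 have sf: "summable f"
  by (rule summable_suminf_not_top) (use fin f0 in \<open>auto simp: fH less_top\<close>)
 show ?thesis
 proof (rule ennreal_le_epsilon)
  fix eps :: real assume eps: "0 < eps"
  obtain N where N: "norm (\<Sum>i. f (i + N)) < eps" using suminf_exist_split[OF eps sf] by blast
  have tail: "(\<Sum>i. ?H (R (i + N))) <= ennreal eps"
  proof -
   have "(\<Sum>i. ?H (R (i + N))) = ennreal (\<Sum>i. f (i + N))"
    unfolding fH[symmetric] using f0 sf by (intro suminf_ennreal2) (auto simp: summable_iff_shift)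
   then show ?thesis using N by (simp add: ennreal_leI)
  qed
  have "T - F \<subseteq> E N \<union> (\<Union>i. R (i + N))"
  proof
   fix x assume x: "x \<in> T - F"
   then have "infdist x F > 0" using F infdist_pos_not_in_closed by blast
   then obtain m where m: "1 / real (Suc m) < infdist x F" using nat_approx_posE by blast
   have xE: "\<exists>n. x \<in> E n" using x m by (auto simp: E_def intro!: exI[of _ m])
   define n where "n = (LEAST n. x \<in> E n)"
   have n: "x \<in> E n" "!!k. k < n ==> x \<notin> E k" unfolding n_def using LeastI_ex[OF xE] not_less_Least by auto
   show "x \<in> E N \<union> (\<Union>i. R (i + N))"
   proof (cases "n <= N")
    case True
    have "1 / real (Suc N) <= 1 / real (Suc n)" using True by (intro divide_left_mono) auto
    then show ?thesis using n(1) by (auto simp: E_def)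
   next
    case False
    then obtain k where k: "n = Suc (k + N)" by (metis add.commute less_imp_Suc_add not_le)
    then have "x \<in> R (k + N)" using n by (simp add: R_def)
    then show ?thesis by blast
   qed
  qed
  then have "?H (T - F) <= ?H (E N \<union> (\<Union>i. R (i + N)))" by (rule hausdorff_outer_mono)
  also have "... <= ?H (E N) + ?H (\<Union>i. R (i + N))" by (rule hausdorff_outer_Un[OF s])
  also have "... <= ?H (E N) + (\<Sum>i. ?H (R (i + N)))" by (intro add_left_mono hausdorff_outer_UN)
  also have "... <= ?H (E N) + ennreal eps" by (intro add_left_mono tail)
  finally have "?H (T \<inter> F) + ?H (T - F) <= (?H (T \<inter> F) + ?H (E N)) + ennreal eps"
   by (simp add: add.assoc add_left_mono)
  also have "... <= ?H (T \<inter> F \<union> E N) + ennreal eps"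
  proof (intro add_right_mono hausdorff_outer_separated[OF s, of "1 / real (Suc N)"])
   fix x z assume "x \<in> T \<inter> F" "z \<in> E N"
   then show "1 / real (Suc N) <= dist x z"
    using infdist_le[of x F z] by (auto simp: E_def dist_commute)
  qed simp
  also have "... <= ?H T + ennreal eps" by (intro add_right_mono hausdorff_outer_mono) (auto simp: E_def)
  finally show "?H (T \<inter> F) + ?H (T - F) <= ?H T + ennreal eps" .
 qed
qed simp

text \<open>\<open>measure_of\<close> returns the given set function only if it is a measure on the
  sigma-algebra, and 0 otherwise. Closed sets satisfy Caratheodory's condition, hence so do the
  Borel sets they generate, and there the outer measure is countably additive.\<close>

lemma emeasure_hausdorff_measure:
 fixes A :: "(real^'n) set"
 assumes s: "s >= 1" and A: "A \<in> sets borel"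
 shows "emeasure (hausdorff_measure s) A = hausdorff_outer s A"
proof -
 let ?H = "hausdorff_outer s :: (real^'n) set => ennreal"
 let ?L = "lambda_system UNIV (Pow UNIV) ?H"
 interpret P: sigma_algebra UNIV "Pow UNIV :: (real^'n) set set" by (rule sigma_algebra_Pow)
 have "outer_measure_space (Pow UNIV) ?H"
  unfolding outer_measure_space_def positive_def increasing_def countably_subadditive_def
  by (intro conjI ballI impI allI hausdorff_outer_empty[OF s] hausdorff_outer_mono hausdorff_outer_UN)
 then have ms: "measure_space UNIV ?L ?H" by (rule P.caratheodory_lemma)
 have "closed F ==> F \<in> ?L" for F
 proof -
  assume F: "closed F"
  have "?H (F \<inter> T) + ?H ((UNIV - F) \<inter> T) = ?H T" for T
  proof (rule antisym)
   show "?H (F \<inter> T) + ?H ((UNIV - F) \<inter> T) <= ?H T"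
   proof (cases "F = {}")
    case True then show ?thesis by (simp add: hausdorff_outer_empty[OF s])
   next
    case False
    have "(UNIV - F) \<inter> T = T - F" by blast
    then show ?thesis using hausdorff_outer_closed_split[OF s F False, of T] by (simp add: Int_commute)
   qed
   have "T = (F \<inter> T) \<union> ((UNIV - F) \<inter> T)" by blast
   then show "?H T <= ?H (F \<inter> T) + ?H ((UNIV - F) \<inter> T)"
    using hausdorff_outer_Un[OF s, of "F \<inter> T" "(UNIV - F) \<inter> T"] by simp
  qed
  then show "F \<in> ?L" unfolding lambda_system_def by simp
 qed
 then have "sigma_sets UNIV (Collect closed) \<subseteq> ?L"
  using ms unfolding measure_space_def by (intro sigma_algebra.sigma_sets_subset) auto
 then have sub: "sets (borel :: (real^'n) measure) \<subseteq> ?L"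
  unfolding borel_eq_closed by simp
 have "countably_additive (sets borel) ?H"
  unfolding countably_additive_def
 proof (intro allI impI)
  fix B :: "nat => (real^'n) set" assume B: "range B \<subseteq> sets borel" "disjoint_family B" "(\<Union>i. B i) \<in> sets borel"
  have "countably_additive ?L ?H" using ms unfolding measure_space_def by simp
  from this[unfolded countably_additive_def, rule_format, OF order_trans[OF B(1) sub] B(2) subsetD[OF sub B(3)]]
  show "(\<Sum>i. ?H (B i)) = ?H (\<Union>i. B i)" .
 qed
 moreover have "positive (sets borel) ?H" unfolding positive_def by (simp add: hausdorff_outer_empty[OF s])
 ultimately show ?thesis
  using A sets.sigma_sets_eq[of "borel :: (real^'n) measure"]
  by (intro emeasure_measure_of[of "hausdorff_measure s" UNIV "sets borel" ?H])
   (simp_all add: hausdorff_measure_def)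
qed


section \<open>Graph integrals and the surface measure\<close>

text \<open>The norm in the last condition is the distance of x from the line through u in direction
  e, so this is a solid cylinder cut to length 1.\<close>

definition tube :: "real^'n => real^'n => real => (real^'n) set" where
 "tube e u \<delta> = {x. 0 <= e \<bullet> x \<and> e \<bullet> x <= 1 \<and> norm ((x - u) - (e \<bullet> (x - u)) *R e) <= \<delta>}"

lemma tube_sets [measurable]: "tube e u \<delta> \<in> sets borel"
proof -
 have "closed (tube e u \<delta>)" unfolding tube_def
  by (intro closed_Collect_conj closed_Collect_le continuous_intros)
 then show ?thesis by auto
qed

text \<open>A cylinder of length 1 and radius \<delta> is covered by about 1/\<delta> balls of
  radius 2 \<delta>. Its volume is thus at most a multiple of \<delta>^s, the weight that the
  Hausdorff measure gives to a set of diameter \<delta>.\<close>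

lemma emeasure_tube_le:
 fixes e :: "real^'n"
 assumes e: "norm e = 1" and s: "CARD('n) = Suc s" "s >= 1"
 obtains c where "c > 0" "\<forall>u \<delta>. 0 <= \<delta> --> \<delta> <= 1/2 -->
  ennreal c * emeasure lborel (tube e u \<delta>) <= ennreal (unit_ball_vol (real s) * (\<delta> / 2)^s)"
proof -
 have ee: "e \<bullet> e = 1" using e by (simp add: dot_square_norm)
 define v where "v = unit_ball_vol (real (CARD('n)))"
 \<comment> \<open>From at most 3/\<delta> balls, each of volume v (2 \<delta>)^(s+1).\<close>
 define K where "K = 3 * v * 2 ^ Suc s"
 have v: "v > 0" by (simp add: v_def)
 have K: "K > 0" using v by (simp add: K_def)
 have pos: "emeasure lborel (tube e u \<delta>) <= ennreal (K * \<delta>^s)" if \<delta>: "0 < \<delta>" "\<delta> <= 1" for u \<delta>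
 proof -
  define N where "N = nat \<lfloor>1 / \<delta>\<rfloor>"
  have N: "real N <= 1 / \<delta>" using \<delta> by (simp add: N_def of_nat_floor)
  define z where "z j = u - (e \<bullet> u) *R e + (real j * \<delta>) *R e" for j
  have "tube e u \<delta> \<subseteq> (\<Union>j\<in>{..N}. cball (z j) (2 * \<delta>))"
  proof
   fix x assume x: "x \<in> tube e u \<delta>"
   define j where "j = nat \<lfloor>(e \<bullet> x) / \<delta>\<rfloor>"
   have ex: "0 <= (e \<bullet> x) / \<delta>" "(e \<bullet> x) / \<delta> <= 1 / \<delta>" using x \<delta> by (auto simp: tube_def divide_right_mono)
   have "j <= N" unfolding j_def N_def using ex by (intro nat_mono floor_mono)
   have j1: "real j = of_int \<lfloor>(e \<bullet> x) / \<delta>\<rfloor>" unfolding j_def using ex by simp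
   have "real j <= (e \<bullet> x) / \<delta>" "(e \<bullet> x) / \<delta> < real j + 1" unfolding j1 by linarith+
   then have "real j * \<delta> <= e \<bullet> x" "e \<bullet> x < (real j + 1) * \<delta>" using \<delta> by (simp_all add: field_simps)
   then have jd: "\<bar>e \<bullet> x - real j * \<delta>\<bar> <= \<delta>" by (simp add: algebra_simps)
   have "x - z j = ((x - u) - (e \<bullet> (x - u)) *R e) + (e \<bullet> x - real j * \<delta>) *R e"
    by (simp add: z_def inner_diff_right algebra_simps)
   then have "norm (x - z j) <= norm ((x - u) - (e \<bullet> (x - u)) *R e) + norm ((e \<bullet> x - real j * \<delta>) *R e)"
    by (metis norm_triangle_ineq)
   also have "... <= \<delta> + \<delta>" using x jd e by (intro add_mono) (auto simp: tube_def)
   finally show "x \<in> (\<Union>j\<in>{..N}. cball (z j) (2 * \<delta>))"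
    using \<open>j <= N\<close> by (auto simp: dist_norm norm_minus_commute intro!: bexI[of _ j])
  qed
  then have "emeasure lborel (tube e u \<delta>) <= emeasure lborel (\<Union>j\<in>{..N}. cball (z j) (2 * \<delta>))"
   by (intro emeasure_mono) auto
  also have "... <= (\<Sum>j\<in>{..N}. emeasure lborel (cball (z j) (2 * \<delta>)))"
   by (intro emeasure_subadditive_finite) auto
  also have "... = (\<Sum>j\<in>{..N}. ennreal (v * (2 * \<delta>) ^ CARD('n)))"
   using \<delta> by (simp add: emeasure_cball v_def)
  also have "... = ennreal (real (Suc N) * (v * (2 * \<delta>) ^ Suc s))"
   using s v \<delta> by (simp add: ennreal_of_nat_eq_real_of_nat ennreal_mult' del: power_Suc)
  also have "... <= ennreal (K * \<delta>^s)"
  proof (rule ennreal_leI)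
   have "real (Suc N) <= 3 / \<delta>" using N \<delta> by (simp add: field_simps)
   then have "real (Suc N) * (v * (2 * \<delta>) ^ Suc s) <= (3 / \<delta>) * (v * (2 * \<delta>) ^ Suc s)"
    using v \<delta> by (intro mult_right_mono) auto
   also have "... = K * \<delta>^s" using \<delta> by (simp add: K_def power_mult_distrib)
   finally show "real (Suc N) * (v * (2 * \<delta>) ^ Suc s) <= K * \<delta>^s" .
  qed
  finally show ?thesis .
 qed
 define c where "c = unit_ball_vol (real s) / (2 ^ s * K)"
 have c: "c > 0" using K by (simp add: c_def)
 have cK: "c * (K * \<delta>^s) = unit_ball_vol (real s) * (\<delta> / 2)^s" for \<delta>
  using K by (simp add: c_def power_divide)
 show ?thesis
 proof (rule that[OF c], intro allI impI)
  fix u :: "real^'n" and \<delta> :: real assume \<delta>: "0 <= \<delta>" "\<delta> <= 1/2"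
  show "ennreal c * emeasure lborel (tube e u \<delta>) <= ennreal (unit_ball_vol (real s) * (\<delta> / 2)^s)"
  proof (cases "\<delta> = 0")
   case False
   have "ennreal c * emeasure lborel (tube e u \<delta>) <= ennreal c * ennreal (K * \<delta>^s)"
    using \<delta> False by (intro mult_left_mono pos) auto
   also have "... = ennreal (unit_ball_vol (real s) * (\<delta> / 2)^s)" using c by (simp add: ennreal_mult'[symmetric] cK)
   finally show ?thesis .
  next
   \<comment> \<open>A tube of radius 0 lies in tubes of every radius d, and K d^s tends to 0 with d
     because s >= 1.\<close>
   case True
   have "emeasure lborel (tube e u 0) <= 0 + ennreal eps" if eps: "eps > 0" for eps
   proof -
    define d where "d = min 1 (eps / K)"
    have d: "0 < d" "d <= 1" "K * d <= eps" using eps K by (auto simp: d_def min_def field_simps)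
    have "emeasure lborel (tube e u 0) <= emeasure lborel (tube e u d)"
     using d by (intro emeasure_mono) (auto simp: tube_def)
    also have "... <= ennreal (K * d^s)" by (rule pos[OF d(1,2)])
    also have "... <= ennreal eps"
    proof (rule ennreal_leI)
     have "d^s <= d^1" using d s by (intro power_decreasing) auto
     then have "K * d^s <= K * d" using K by simp
     then show "K * d^s <= eps" using d by simp
    qed
    finally show ?thesis by simp
   qed
   then have "emeasure lborel (tube e u 0) <= 0" by (rule ennreal_le_epsilon)
   then show ?thesis using True by simp
  qed
 qed
qed

text \<open>Moving along e does not change the component orthogonal to e. So two points of the slab
  whose graph projections lie in a set of diameter \<delta> have orthogonal components at distance
  at most \<delta>, and the preimage of each covering set fits into a tube. The constant is
  independent of the graph.\<close>

lemma graph_measure_le_hausdorff: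
 fixes e :: "real^'n"
 assumes e: "norm e = 1" and s: "CARD('n) = Suc s" "s >= 1"
 obtains c where "c > 0" "\<forall>y A. ennreal c * emeasure lborel {x. 0 <= e \<bullet> x \<and> e \<bullet> x <= 1 \<and> graph_proj e y x \<in> A} <= hausdorff_outer s A"
proof -
 have ee: "e \<bullet> e = 1" using e by (simp add: dot_square_norm)
 obtain c where c: "c > 0" and tube: "\<forall>u \<delta>. 0 <= \<delta> --> \<delta> <= 1/2 -->
  ennreal c * emeasure lborel (tube e u \<delta>) <= ennreal (unit_ball_vol (real s) * (\<delta> / 2)^s)"
  by (rule emeasure_tube_le[OF e s]) (rule that)
 show ?thesis
 proof (rule that[OF c], intro allI)
  fix y :: "real^'n => real" and A :: "(real^'n) set"
  let ?S = "%A. {x. 0 <= e \<bullet> x \<and> e \<bullet> x <= 1 \<and> graph_proj e y x \<in> A}"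
  have "ennreal c * emeasure lborel (?S A) <= hpre s (1/2) A"
   unfolding hpre_def
  proof (rule INF_greatest)
   fix U assume U: "U \<in> hcover (1/2) A"
   have Ub: "bounded (U i)" "diameter (U i) <= 1/2" for i using U by (auto simp: hcover_def)
   define V where "V i = (if ?S (U i) = {} then {} else tube e (SOME u. u \<in> ?S (U i)) (diameter (U i)))" for i
   have SV: "?S (U i) \<subseteq> V i" for i
   proof
    fix x assume x: "x \<in> ?S (U i)"
    define u where "u = (SOME u. u \<in> ?S (U i))"
    have u: "u \<in> ?S (U i)" unfolding u_def using x by (rule someI)
    have n1: "norm (graph_proj e y x - graph_proj e y u) <= diameter (U i)"
     using diameter_bounded_bound[OF Ub(1), of "graph_proj e y x" i "graph_proj e y u"] x u by (simp add: dist_norm)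
    have n2: "norm (w - (e \<bullet> w) *R e) <= norm w" for w
    proof -
     have "(norm (w - (e \<bullet> w) *R e))^2 = (norm w)^2 - (e \<bullet> w)^2"
      unfolding power2_norm_eq_inner by (simp add: inner_diff_left inner_diff_right ee inner_commute power2_eq_square)
     then have "(norm (w - (e \<bullet> w) *R e))^2 <= (norm w)^2" by simp
     then show ?thesis by (rule power2_le_imp_le) simp
    qed
    have n3: "(x - u) - (e \<bullet> (x - u)) *R e =
     (graph_proj e y x - graph_proj e y u) - (e \<bullet> (graph_proj e y x - graph_proj e y u)) *R e"
     by (simp add: graph_proj_def inner_diff_right ee algebra_simps)
    have "norm ((x - u) - (e \<bullet> (x - u)) *R e) <= diameter (U i)"
     unfolding n3 by (rule order_trans[OF n2 n1])
    then have "x \<in> tube e u (diameter (U i))" using x unfolding tube_def by simp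
    then show "x \<in> V i" using x unfolding V_def u_def by auto
   qed
   have Vm[measurable]: "V i \<in> sets borel" for i unfolding V_def by auto
   have "?S A \<subseteq> (\<Union>i. V i)"
   proof
    fix x assume "x \<in> ?S A"
    then obtain i where "x \<in> ?S (U i)" using U unfolding hcover_def by blast
    then show "x \<in> (\<Union>i. V i)" using SV by blast
   qed
   then have "emeasure lborel (?S A) <= emeasure lborel (\<Union>i. V i)" by (intro emeasure_mono) auto
   also have "... <= (\<Sum>i. emeasure lborel (V i))" by (intro emeasure_subadditive_countably) auto
   finally have "ennreal c * emeasure lborel (?S A) <= ennreal c * (\<Sum>i. emeasure lborel (V i))" by (rule mult_left_mono) simp
   also have "... = (\<Sum>i. ennreal c * emeasure lborel (V i))" by (rule ennreal_suminf_cmult[symmetric])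
   also have "... <= hsum s U"
    unfolding hsum_def
   proof (intro suminf_le)
    fix i
    show "ennreal c * emeasure lborel (V i) <= ennreal (unit_ball_vol (real s) * (diameter (U i) / 2) ^ s)"
     using tube[rule_format, of "diameter (U i)"] Ub[of i] diameter_ge_0[OF Ub(1)[of i]] by (simp add: V_def)
   qed auto
   finally show "ennreal c * emeasure lborel (?S A) <= hsum s U" .
  qed
  also have "... <= hausdorff_outer s A" by (rule hpre_le_hausdorff) simp
  finally show "ennreal c * emeasure lborel (?S A) <= hausdorff_outer s A" .
 qed
qed

lemma sets_hausdorff_measure [measurable_cong, simp]: "sets (hausdorff_measure s :: (real^'n) measure) = sets borel"
 unfolding hausdorff_measure_def using sets.sigma_sets_eq[of "borel :: (real^'n) measure"] by simp

lemma continuous_surface_measurable: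
 assumes "continuous_on UNIV f" shows "f \<in> borel_measurable (surface_measure U)"
 unfolding surface_measure_def using borel_measurable_continuous_onI[OF assms]
 by (intro measurable_restrict_space1) (simp cong: measurable_cong_sets)

text \<open>The inequality for sets says that a multiple of the image of the slab measure under
  \<open>graph_proj\<close> is dominated by the Hausdorff measure; domination of measures passes to
  integrals.\<close>

proposition graph_integral_le_hausdorff:
 fixes e :: "real^'n"
 assumes e: "norm e = 1" and s: "CARD('n) = Suc s" "s >= 1"
 obtains c where "c > 0" "\<forall>y y' h. C1 y y' --> h \<in> borel_measurable borel -->
  ennreal c * (NI x. indicator {0..1::real} (e \<bullet> x) * h (graph_proj e y x)) <= (\<integral>\<^sup>+x. h x \<partial>hausdorff_measure s)"
proof -
 obtain c where c: "c > 0" and le: "\<forall>y A. ennreal c * emeasure lborel {x. 0 <= e \<bullet> x \<and> e \<bullet> x <= 1 \<and> graph_proj e y x \<in> A} <= hausdorff_outer s A"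
  by (rule graph_measure_le_hausdorff[OF e s]) (rule that)
 show ?thesis
 proof (rule that[OF c], intro allI impI)
  fix y :: "real^'n => real" and y' and h :: "real^'n => ennreal" assume y: "C1 y y'" and [measurable]: "h \<in> borel_measurable borel"
  have [measurable]: "graph_proj e y \<in> borel_measurable borel"
   using graph_proj_continuous[OF y] by (rule borel_measurable_continuous_onI)
  define D where "D = density lborel (%x. indicator {0..1::real} (e \<bullet> x))"
  define M where "M = distr D borel (graph_proj e y)"
  note sH = sets_hausdorff_measure[where 'n = 'n, of s]
  have gm: "graph_proj e y \<in> measurable D borel" unfolding D_def by simp
  have "scale_measure c M <= hausdorff_measure s"
   unfolding le_measure[OF trans[OF sets_scale_measure trans[OF sets_distr[of D borel "graph_proj e y", folded M_def] sH[symmetric]]]]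
  proof
   fix A assume "A \<in> sets (scale_measure c M)"
   then have A[measurable]: "A \<in> sets borel" by (simp add: M_def)
   have "emeasure M A = (NI x. indicator {0..1::real} (e \<bullet> x) * indicator (graph_proj e y -` A) x)"
    unfolding M_def using measurable_sets[OF gm A]
    by (subst emeasure_distr[OF gm A]) (simp add: D_def emeasure_density)
   also have "... = (NI x. indicator {x. 0 <= e \<bullet> x \<and> e \<bullet> x <= 1 \<and> graph_proj e y x \<in> A} x)"
    by (intro nn_integral_cong) (auto simp: indicator_def)
   also have "... = emeasure lborel {x. 0 <= e \<bullet> x \<and> e \<bullet> x <= 1 \<and> graph_proj e y x \<in> A}"
    by (rule nn_integral_indicator) measurable
   finally show "emeasure (scale_measure c M) A <= emeasure (hausdorff_measure s) A"
    using le by (simp add: emeasure_hausdorff_measure[OF s(2) A])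
  qed
  then have "(\<integral>\<^sup>+x. h x \<partial>scale_measure c M) <= (\<integral>\<^sup>+x. h x \<partial>hausdorff_measure s)"
   by (rule nn_integral_mono_measure[rotated]) (simp add: M_def sH)
  moreover have "(\<integral>\<^sup>+x. h x \<partial>scale_measure c M) = ennreal c * (NI x. indicator {0..1::real} (e \<bullet> x) * h (graph_proj e y x))"
  proof -
   have "(\<integral>\<^sup>+x. h x \<partial>M) = (NI x. indicator {0..1::real} (e \<bullet> x) * h (graph_proj e y x))"
    unfolding M_def by (subst nn_integral_distr[OF gm]) (auto simp: D_def nn_integral_density)
   then show ?thesis by (subst nn_integral_scale_measure) (auto simp: M_def)
  qed
  ultimately show "ennreal c * (NI x. indicator {0..1::real} (e \<bullet> x) * h (graph_proj e y x)) <= (\<integral>\<^sup>+x. h x \<partial>hausdorff_measure s)"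
   by simp
 qed
qed

section \<open>The outward normal and the boundary term\<close>

lemma chart_frontier:
 assumes op: "open U" and ch: "chart U p \<rho> e y y'" and x: "x \<in> ball p \<rho>"
 shows "x \<in> frontier U \<longleftrightarrow> y x = 0" and "y x < 0 ==> x \<notin> closure U"
proof -
 have e: "norm e = 1" and y: "C1 y y'" and ye: "!!x t. y (x + t *R e) = y x + t"
  and eq: "!!x. x \<in> ball p \<rho> ==> x \<in> U \<longleftrightarrow> y x > 0"
  using ch unfolding chart_def by auto
 have ynot: "x \<notin> closure U" if "y x < 0"
 proof -
  have "open (ball p \<rho> \<inter> {x. y x < 0})"
   using C1_cont[OF y] by (intro open_Int open_ball open_Collect_less) auto
  moreover have "(ball p \<rho> \<inter> {x. y x < 0}) \<inter> U = {}" using eq by force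
  ultimately have "(ball p \<rho> \<inter> {x. y x < 0}) \<inter> closure U = {}" using open_Int_closure_eq_empty by blast
  then show ?thesis using x that by auto
 qed
 show "y x < 0 ==> x \<notin> closure U" by (rule ynot)
 have fr: "frontier U = closure U - U" using op by (simp add: frontier_def interior_open)
 have "x \<in> closure U" if "y x = 0"
 proof (rule closure_sequential[THEN iffD2], intro exI conjI)
  define d where "d = (\<rho> - dist p x) / 2"
  have d: "d > 0" using x by (simp add: d_def)
  let ?z = "%n::nat. x + (d / (real n + 1)) *R e"
  show "\<forall>n. ?z n \<in> U"
  proof
   fix n
   have "dist p (?z n) <= dist p x + dist x (?z n)" by (rule dist_triangle)
   also have "dist x (?z n) = d / (real n + 1)" using d e by (simp add: dist_norm)
   also have "... <= d" using d by (simp add: field_simps)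
   finally have "?z n \<in> ball p \<rho>" using x by (simp add: d_def field_simps)
   then show "?z n \<in> U" using d that by (simp add: eq ye)
  qed
  have "(%n. d / (real n + 1)) ----> 0" by real_asymp
  then have "(%n. x + (d / (real n + 1)) *R e) ----> x + 0 *R e" by (intro tendsto_intros)
  then show "?z ----> x" by simp
 qed
 then show "x \<in> frontier U \<longleftrightarrow> y x = 0"
  using eq[OF x] ynot unfolding fr by (auto simp: not_less less_le)
qed

text \<open>Along -y' / |y'| the height strictly decreases to first order, which gives the inner and
  outer side. For uniqueness, every h orthogonal to y' is a limit of secant directions from x to
  frontier points, obtained by projecting x + s h to the graph. A tangency-respecting unit vector is
  therefore orthogonal to all such h, hence one of two opposite vectors, and the side condition
  selects the sign.\<close>

lemma outward_unit_normal_chart: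
 fixes U :: "(real^'n) set"
 assumes op: "open U" and ch: "chart U p \<rho> e y y'" and x: "x \<in> ball p \<rho>" and y0: "y x = 0"
 shows "outward_unit_normal U x = - (1 / norm (y' x)) *R y' x"
proof -
 have e: "norm e = 1" and y: "C1 y y'" and ye: "!!x t. y (x + t *R e) = y x + t"
  and eq: "!!x. x \<in> ball p \<rho> ==> x \<in> U \<longleftrightarrow> y x > 0"
  using ch unfolding chart_def by auto
 define g where "g = y' x"
 have eg: "e \<bullet> g = 1" unfolding g_def by (rule chart_dir_deriv[OF y ye])
 then have g0: "g \<noteq> 0" by auto
 then have ng: "norm g > 0" by simp
 define \<nu>0 where "\<nu>0 = - (1 / norm g) *R g"
 have n1: "norm \<nu>0 = 1" using ng by (simp add: \<nu>0_def)
 have inball: "\<forall>\<^sub>F t in at_right (0::real). z t \<in> ball p \<rho>" if "(z \<longlongrightarrow> x) (at_right 0)" for z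
  using topological_tendstoD[OF that, of "ball p \<rho>"] x by simp
 have lind: "((%t. y (x + t *R v)) has_real_derivative v \<bullet> g) (at 0 within {0<..})" for v
  using C1_line[OF y, of x v 0] by (auto simp: g_def intro: has_field_derivative_at_within)
 have quot: "((%t. y (x + t *R v) / t) \<longlongrightarrow> v \<bullet> g) (at_right 0)" for v
  using lind[of v] by (simp add: has_field_derivative_iff y0)
 have tl: "((%t. x + t *R v) \<longlongrightarrow> x) (at_right 0)" for v :: "real^'n"
 proof -
  have "((%t. x + t *R v) \<longlongrightarrow> x + 0 *R v) (at_right 0)" by (intro tendsto_intros)
  then show ?thesis by simp
 qed
 have pos: "\<forall>\<^sub>F t in at_right (0::real). t > 0" by (rule eventually_at_right_less)
 have inn: "\<forall>\<^sub>F t in at_right 0. x - t *R \<nu>0 \<in> U"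
 proof -
  have "(- \<nu>0) \<bullet> g > 0" using g0 by (simp add: \<nu>0_def)
  from order_tendstoD(1)[OF quot this] have "\<forall>\<^sub>F t in at_right 0. y (x + t *R (- \<nu>0)) / t > 0" .
  then show ?thesis using inball[OF tl[of "- \<nu>0"]] pos
   by eventually_elim (auto simp: eq zero_less_divide_iff)
 qed
 have out: "\<forall>\<^sub>F t in at_right 0. x + t *R \<nu>0 \<notin> closure U"
 proof -
  have "\<nu>0 \<bullet> g < 0" using g0 by (simp add: \<nu>0_def)
  from order_tendstoD(2)[OF quot this] have "\<forall>\<^sub>F t in at_right 0. y (x + t *R \<nu>0) / t < 0" .
  then show ?thesis using inball[OF tl[of "\<nu>0"]] pos
  proof eventually_elim
   case (elim t)
   then show ?case using chart_frontier(2)[OF op ch, of "x + t *R \<nu>0"] by (auto simp: divide_less_0_iff)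
  qed
 qed
 have tang: "((%z. ((z - x) \<bullet> \<nu>0) / norm (z - x)) \<longlongrightarrow> 0) (at x within frontier U)"
 proof -
  have "(y has_derivative (%h. h \<bullet> g)) (at x within frontier U)"
   using C1_deriv[OF y, of x] unfolding g_def by (rule has_derivative_at_withinI)
  then have "((%z. (1 / norm (z - x)) *R (y z - (y x + (z - x) \<bullet> g))) \<longlongrightarrow> 0) (at x within frontier U)"
   by (simp add: has_derivative_within)
  then have "((%z. (1 / norm g) * ((1 / norm (z - x)) *R (y z - (y x + (z - x) \<bullet> g)))) \<longlongrightarrow> (1 / norm g) * 0) (at x within frontier U)"
   by (intro tendsto_intros)
  then have lim: "((%z. (1 / norm g) * ((1 / norm (z - x)) *R (y z - (y x + (z - x) \<bullet> g)))) \<longlongrightarrow> 0) (at x within frontier U)" by simp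
  have "\<forall>\<^sub>F z in at x within frontier U. z \<in> ball p \<rho>"
   using topological_tendstoD[OF tendsto_ident_at open_ball x, of "frontier U"] by simp
  moreover have "\<forall>\<^sub>F z in at x within frontier U. z \<in> frontier U"
   by (simp add: eventually_at_filter)
  ultimately have "\<forall>\<^sub>F z in at x within frontier U. (1 / norm g) * ((1 / norm (z - x)) *R (y z - (y x + (z - x) \<bullet> g))) = ((z - x) \<bullet> \<nu>0) / norm (z - x)"
  proof eventually_elim
   case (elim z)
   then have "y z = 0" using chart_frontier(1)[OF op ch] by blast
   then show ?case by (simp add: y0 \<nu>0_def)
  qed
  then show ?thesis by (rule Lim_transform_eventually[OF lim])
 qed
 have orth: "h \<bullet> \<nu> = 0"
  if t: "((%z. ((z - x) \<bullet> \<nu>) / norm (z - x)) \<longlongrightarrow> 0) (at x within frontier U)" and hg: "h \<bullet> g = 0" for h \<nu>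
 proof (cases "h = 0")
  case False
  define z where "z s = graph_proj e y (x + s *R h)" for s
  have zx: "z s - x = s *R h - y (x + s *R h) *R e" for s by (simp add: z_def graph_proj_def)
  have "((%s. h - (y (x + s *R h) / s) *R e) \<longlongrightarrow> h - (h \<bullet> g) *R e) (at_right 0)"
   by (intro tendsto_intros quot)
  then have L0: "((%s. h - (y (x + s *R h) / s) *R e) \<longlongrightarrow> h) (at_right 0)" by (simp add: hg)
  have L: "((%s. (1 / s) *R (z s - x)) \<longlongrightarrow> h) (at_right 0)"
   by (rule Lim_transform_eventually[OF L0]) (use pos in \<open>eventually_elim, simp add: zx scaleR_diff_right\<close>)
  have "(z \<longlongrightarrow> graph_proj e y x) (at_right 0)"
   unfolding z_def by (rule continuous_on_tendsto_compose[OF graph_proj_continuous[OF y] tl]) auto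
  then have zlim: "(z \<longlongrightarrow> x) (at_right 0)" by (simp add: graph_proj_def y0)
  have yz: "y (z s) = 0" for s
   using ye[of "x + s *R h" "- y (x + s *R h)"] by (simp add: z_def graph_proj_def)
  have "\<forall>\<^sub>F s in at_right 0. z s \<in> frontier U \<and> z s \<noteq> x"
   using inball[OF zlim] pos
  proof eventually_elim
   case (elim s)
   have "z s \<noteq> x"
   proof
    assume "z s = x"
    then have "s *R h = y (x + s *R h) *R e" using zx[of s] by simp
    moreover then have "s * (h \<bullet> g) = y (x + s *R h) * (e \<bullet> g)" by (metis inner_scaleR_left)
    ultimately have "s *R h = 0" by (simp add: hg eg)
    then show False using elim False by simp
   qed
   then show ?case using chart_frontier(1)[OF op ch elim(1)] yz by simp
  qed
  then have "filterlim z (at x within frontier U) (at_right 0)"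
   using zlim by (auto simp: filterlim_at elim: eventually_mono)
  from filterlim_compose[OF t this]
  have "((%s. ((z s - x) \<bullet> \<nu>) / norm (z s - x)) \<longlongrightarrow> 0) (at_right 0)" .
  from tendsto_mult[OF this tendsto_norm[OF L]]
  have "((%s. ((z s - x) \<bullet> \<nu>) / norm (z s - x) * norm ((1 / s) *R (z s - x))) \<longlongrightarrow> 0) (at_right 0)" by simp
  then have "((%s. ((1 / s) *R (z s - x)) \<bullet> \<nu>) \<longlongrightarrow> 0) (at_right 0)"
   by (rule Lim_transform_eventually) (use pos in \<open>eventually_elim, simp\<close>)
  moreover have "((%s. ((1 / s) *R (z s - x)) \<bullet> \<nu>) \<longlongrightarrow> h \<bullet> \<nu>) (at_right 0)"
   by (intro tendsto_intros L)
  ultimately show ?thesis using tendsto_unique[OF trivial_limit_at_right_real] by blast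
 qed simp
 have "outward_unit_normal U x = \<nu>0"
  unfolding outward_unit_normal_def
 proof (rule the_equality)
  show "norm \<nu>0 = 1 \<and> ((%z. ((z - x) \<bullet> \<nu>0) / norm (z - x)) \<longlongrightarrow> 0) (at x within frontier U) \<and>
    (\<forall>\<^sub>F t in at_right 0. x - t *R \<nu>0 \<in> U \<and> x + t *R \<nu>0 \<notin> closure U)"
   using n1 tang inn out by (simp add: eventually_conj_iff)
 next
  fix \<nu> assume a: "norm \<nu> = 1 \<and> ((%z. ((z - x) \<bullet> \<nu>) / norm (z - x)) \<longlongrightarrow> 0) (at x within frontier U) \<and>
    (\<forall>\<^sub>F t in at_right 0. x - t *R \<nu> \<in> U \<and> x + t *R \<nu> \<notin> closure U)"
  define h where "h = \<nu> - (\<nu> \<bullet> \<nu>0) *R \<nu>0"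
  have n01: "\<nu>0 \<bullet> \<nu>0 = 1" using n1 by (simp add: dot_square_norm)
  have h0: "h \<bullet> \<nu>0 = 0" by (simp add: h_def inner_diff_left n01)
  then have "h \<bullet> g = 0" using ng by (simp add: \<nu>0_def)
  then have "h \<bullet> \<nu> = 0" using orth a by blast
  then have "h \<bullet> h = 0" using h0 by (simp add: h_def[of] inner_diff_right) 
  then have nu: "\<nu> = (\<nu> \<bullet> \<nu>0) *R \<nu>0" by (simp add: h_def)
  then have "norm \<nu> = \<bar>\<nu> \<bullet> \<nu>0\<bar>" using n1 by (metis mult.right_neutral norm_scaleR)
  then consider "\<nu> \<bullet> \<nu>0 = 1" | "\<nu> \<bullet> \<nu>0 = -1" using a by linarith
  then show "\<nu> = \<nu>0"
  proof cases
   case 2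
   then have m: "\<nu> = - \<nu>0" using nu by simp
   have "\<forall>\<^sub>F t in at_right (0::real). x - t *R \<nu> \<in> U" using a by (simp add: eventually_conj_iff)
   with out have "\<forall>\<^sub>F t in at_right (0::real). False"
    by eventually_elim (use closure_subset in \<open>auto simp: m\<close>)
   then show ?thesis by simp
  qed (use nu in simp)
 qed
 then show ?thesis by (simp add: \<nu>0_def g_def)
qed

definition bdry_mass :: "(real^'n) set => ('n => real^'n => real) => ('n => real^'n => real) => ennreal" where
 "bdry_mass U \<phi> G = (\<integral>\<^sup>+x. (\<Sum>k\<in>UNIV. ennreal ((\<phi> k x - G k x)^2)) \<partial>surface_measure U)"

definition tangential :: "(real^'n) set => ('n => real^'n => real) => bool" where
 "tangential U G \<longleftrightarrow> (\<forall>k. G k \<in> borel_measurable (surface_measure U)) \<and>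
   (AE x in surface_measure U. (\<Sum>k\<in>UNIV. outward_unit_normal U x $ k * G k x) = 0)"

text \<open>On the frontier y' is parallel to the outward normal and G has no normal component, so
  the normal part of \<phi> equals that of \<phi> - G. The integrand is then bounded by |\<phi> -
  G|^2, and the graph integral by the Hausdorff integral.\<close>

proposition gint_le_surface_integral:
 fixes U :: "(real^'n) set"
 assumes card: "CARD('n) >= 2" and op: "open U" and ch: "chart U p \<rho> e y y'" and r: "r <= \<rho>"
  and b: "continuous_on UNIV b" and b01: "!!x. 0 <= b x" "!!x. b x <= 1" and b0: "!!x. x \<notin> ball p r ==> b x = 0"
 obtains C where "C >= 0" "\<forall>\<phi> G. (\<forall>k. continuous_on UNIV (\<phi> k)) --> tangential U G -->
  ennreal (gint e y (%x. (b x)^2 * (\<Sum>k\<in>UNIV. \<phi> k x * y' x $ k)^2)) <=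
   ennreal C * bdry_mass U \<phi> G"
proof -
 have e: "norm e = 1" and y: "C1 y y'" and ye: "!!x t. y (x + t *R e) = y x + t"
  using ch unfolding chart_def by auto
 obtain s where s: "CARD('n) = Suc s" "s >= 1" using card by (metis Suc_le_D Suc_le_mono numeral_2_eq_2 One_nat_def)
 obtain c where c: "c > 0" and gh: "\<forall>y y' h. C1 y y' --> h \<in> borel_measurable borel -->
  ennreal c * (NI x. indicator {0..1::real} (e \<bullet> x) * h (graph_proj e y x)) <= (\<integral>\<^sup>+x. h x \<partial>hausdorff_measure s)"
  by (rule graph_integral_le_hausdorff[OF e s]) (rule that)
 have "compact (y' ` cball p r)"
  using C1_cont_grad[OF y] by (intro compact_continuous_image) (auto intro: continuous_on_subset)
 then obtain B where B: "B > 0" "!!x. x \<in> cball p r ==> norm (y' x) <= B"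
  using bounded_pos[of "y' ` cball p r"] compact_imp_bounded by (metis imageI)
 have sH: "space (hausdorff_measure s :: (real^'n) measure) = UNIV" by (simp add: hausdorff_measure_def)
 have sm: "surface_measure U = restrict_space (hausdorff_measure s) (frontier U)"
  by (simp add: surface_measure_def s)
 show ?thesis
 \<comment> \<open>B bounds |y'| on the ball, the dimension comes from squaring a sum over the
   components, and c from the comparison of graph and Hausdorff integrals.\<close>
 proof (rule that[of "B^2 * real CARD('n) / c"], goal_cases)
  case 1 show ?case using c by simp
 next
  case 2 show ?case
  proof (intro allI impI)
   fix \<phi> :: "'n => real^'n => real" and G :: "'n => real^'n => real"
   assume phi: "\<forall>k. continuous_on UNIV (\<phi> k)" and "tangential U G"
   then have G: "\<forall>k. G k \<in> borel_measurable (surface_measure U)"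
    and ae: "AE x in surface_measure U. (\<Sum>k\<in>UNIV. outward_unit_normal U x $ k * G k x) = 0"
    unfolding tangential_def by blast+
   let ?F = "%x. (b x)^2 * (\<Sum>k\<in>UNIV. \<phi> k x * y' x $ k)^2"
   have cF: "continuous_on UNIV ?F"
    using phi by (intro continuous_intros b continuous_on_component C1_cont_grad[OF y]) auto
   have F0: "?F x = 0" if "norm x > norm p + \<bar>r\<bar>" for x
   proof -
    have "x \<notin> ball p r" using that norm_triangle_ineq2[of x p] by (auto simp: dist_norm norm_minus_commute)
    then show ?thesis by (simp add: b0)
   qed
   have iF: "integrable lborel (%x. indicator {0..1::real} (e \<bullet> x) * ?F (graph_proj e y x) :: real)"
    by (rule gint_integrable[OF e y cF F0])
   have [measurable]: "?F \<in> borel_measurable borel" using cF by (rule borel_measurable_continuous_onI)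
   have [measurable]: "frontier U \<in> sets borel" by (simp add: borel_closed)
   let ?h = "%x. ennreal (?F x) * indicator (frontier U) x"
   have "ennreal (gint e y ?F) = (NI x. ennreal (indicator {0..1::real} (e \<bullet> x) * ?F (graph_proj e y x)))"
    unfolding gint_def by (rule nn_integral_eq_integral[symmetric, OF iF]) (auto intro!: AE_I2 mult_nonneg_nonneg)
   also have "... = (NI x. indicator {0..1::real} (e \<bullet> x) * ?h (graph_proj e y x))"
   proof (rule nn_integral_cong)
    fix x
    have y0: "y (graph_proj e y x) = 0" using ye[of x "- y x"] by (simp add: graph_proj_def)
    show "ennreal (indicator {0..1::real} (e \<bullet> x) * ?F (graph_proj e y x)) = indicator {0..1::real} (e \<bullet> x) * ?h (graph_proj e y x)"
    proof (cases "graph_proj e y x \<in> ball p r")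
     case True
     then have "graph_proj e y x \<in> ball p \<rho>" using r by simp
     then have "graph_proj e y x \<in> frontier U" using chart_frontier(1)[OF op ch] y0 by blast
     then show ?thesis by (auto simp: indicator_def)
    qed (simp add: b0)
   qed
   finally have g1: "ennreal c * ennreal (gint e y ?F) <= (\<integral>\<^sup>+x. ?h x \<partial>hausdorff_measure s)"
    using gh[rule_format, OF y, of ?h] by simp
   have "(\<integral>\<^sup>+x. ?h x \<partial>hausdorff_measure s) = (\<integral>\<^sup>+x. ennreal (?F x) \<partial>surface_measure U)"
    unfolding sm by (subst nn_integral_restrict_space) (auto simp: sH borel_closed)
   also have "... <= (\<integral>\<^sup>+x. ennreal (B^2 * real CARD('n)) * (\<Sum>k\<in>UNIV. ennreal ((\<phi> k x - G k x)^2)) \<partial>surface_measure U)"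
   proof (rule nn_integral_mono_AE)
    have fr: "AE x in surface_measure U. x \<in> frontier U"
     by (rule AE_I2) (simp add: sm space_restrict_space)
    show "AE x in surface_measure U. ennreal (?F x) <= ennreal (B^2 * real CARD('n)) * (\<Sum>k\<in>UNIV. ennreal ((\<phi> k x - G k x)^2))"
     using ae fr
    proof eventually_elim
     case (elim x)
     have "?F x <= B^2 * real CARD('n) * (\<Sum>k\<in>UNIV. (\<phi> k x - G k x)^2)"
     proof (cases "x \<in> ball p r")
      case True
      then have xb: "x \<in> ball p \<rho>" using r by simp
      then have "y x = 0" using chart_frontier(1)[OF op ch] elim by blast
      from outward_unit_normal_chart[OF op ch xb this]
      have nn: "outward_unit_normal U x $ k = - (y' x $ k / norm (y' x))" for k by simp
      have "e \<bullet> y' x = 1" by (rule chart_dir_deriv[OF y ye])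
      then have n0: "norm (y' x) \<noteq> 0" by auto
      have "(\<Sum>k\<in>UNIV. G k x * y' x $ k) = - norm (y' x) * (\<Sum>k\<in>UNIV. outward_unit_normal U x $ k * G k x)"
       unfolding sum_distrib_left by (rule sum.cong) (use n0 in \<open>auto simp: nn\<close>)
      then have "(\<Sum>k\<in>UNIV. \<phi> k x * y' x $ k) = (\<Sum>k\<in>UNIV. (\<phi> k x - G k x) * y' x $ k)"
       using elim by (simp add: left_diff_distrib sum_subtractf)
      then have "\<bar>\<Sum>k\<in>UNIV. \<phi> k x * y' x $ k\<bar> <= (\<Sum>k\<in>UNIV. \<bar>\<phi> k x - G k x\<bar> * B)"
      proof -
       have "\<bar>(\<phi> k x - G k x) * y' x $ k\<bar> <= \<bar>\<phi> k x - G k x\<bar> * B" for k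
        unfolding abs_mult using B(2)[of x] True component_le_norm_cart[of "y' x" k]
        by (intro mult_left_mono) auto
       then have "(\<Sum>k\<in>UNIV. \<bar>(\<phi> k x - G k x) * y' x $ k\<bar>) <= (\<Sum>k\<in>UNIV. \<bar>\<phi> k x - G k x\<bar> * B)" by (rule sum_mono)
       then show ?thesis using sum_abs[of "%k. (\<phi> k x - G k x) * y' x $ k" UNIV] \<open>(\<Sum>k\<in>UNIV. \<phi> k x * y' x $ k) = _\<close> by linarith
      qed
      also have "... = B * (\<Sum>k\<in>UNIV. \<bar>\<phi> k x - G k x\<bar>)" by (simp add: sum_distrib_left mult.commute)
      finally have "(\<Sum>k\<in>UNIV. \<phi> k x * y' x $ k)^2 <= (B * (\<Sum>k\<in>UNIV. \<bar>\<phi> k x - G k x\<bar>))^2"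
       using B(1) by (subst power2_le_iff_abs_le) (auto intro!: mult_nonneg_nonneg sum_nonneg)
      also have "... <= B^2 * (real CARD('n) * (\<Sum>k\<in>UNIV. (\<phi> k x - G k x)^2))"
       unfolding power_mult_distrib
       using sum_squared_le_sum_of_squares[of "%k. \<bar>\<phi> k x - G k x\<bar>" UNIV] by (intro mult_left_mono) (auto simp: mult.commute)
      finally have *: "(\<Sum>k\<in>UNIV. \<phi> k x * y' x $ k)^2 <= B^2 * real CARD('n) * (\<Sum>k\<in>UNIV. (\<phi> k x - G k x)^2)" by simp
      have "(b x)^2 <= 1" using b01[of x] by (simp add: power_le_one)
      then have "?F x <= 1 * (\<Sum>k\<in>UNIV. \<phi> k x * y' x $ k)^2" by (intro mult_right_mono) auto
      then show ?thesis using * by simp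
     qed (simp add: b0 sum_nonneg)
     then have "ennreal (?F x) <= ennreal (B^2 * real CARD('n) * (\<Sum>k\<in>UNIV. (\<phi> k x - G k x)^2))" by (rule ennreal_leI)
     also have "... = ennreal (B^2 * real CARD('n)) * (\<Sum>k\<in>UNIV. ennreal ((\<phi> k x - G k x)^2))"
      by (subst sum_ennreal) (auto simp: ennreal_mult sum_nonneg)
     finally show ?case .
    qed
   qed
   also have "... <= ennreal (B^2 * real CARD('n)) * bdry_mass U \<phi> G"
    unfolding bdry_mass_def
   proof (subst nn_integral_cmult)
    have [measurable]: "\<phi> k \<in> borel_measurable (surface_measure U)" for k using phi by (simp add: continuous_surface_measurable)
    have [measurable]: "G k \<in> borel_measurable (surface_measure U)" for k using G by simp
    show "(%x. \<Sum>k\<in>UNIV. ennreal ((\<phi> k x - G k x)^2)) \<in> borel_measurable (surface_measure U)"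
     by measurable
   qed simp
   finally have "ennreal c * ennreal (gint e y ?F) <= ennreal (B^2 * real CARD('n)) * bdry_mass U \<phi> G"
    using g1 by (rule order_trans[rotated])
   then have "ennreal (1/c) * (ennreal c * ennreal (gint e y ?F)) <= ennreal (1/c) * (ennreal (B^2 * real CARD('n)) * bdry_mass U \<phi> G)"
    by (rule mult_left_mono) simp
   moreover have "ennreal (1/c) * (ennreal c * X) = X" for X
    using c by (simp add: mult.assoc[symmetric] ennreal_mult[symmetric])
   moreover have "ennreal (1/c) * (ennreal (B^2 * real CARD('n)) * X) = ennreal (B^2 * real CARD('n) / c) * X" for X
    using c by (simp add: mult.assoc[symmetric] ennreal_mult[symmetric])
   ultimately show "ennreal (gint e y ?F) <= ennreal (B^2 * real CARD('n) / c) * bdry_mass U \<phi> G"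
    by simp
  qed
 qed
qed

section \<open>Integration by parts on the whole domain\<close>

text \<open>Multiplying the test field by \<open>\<psi>\<close> changes the integration-by-parts defect only by boundary
 terms. Such cutoffs are closed under products, and products of factors \<open>1 - b^2\<close> with local
 bumps \<open>b\<close> eventually vanish on the whole domain.\<close>

definition removable :: "(real^'n) set => (real^'n => real) => bool" where
 "removable U \<psi> \<longleftrightarrow> (\<exists>\<psi>'. C1 \<psi> \<psi>') \<and> (\<forall>x. 0 <= \<psi> x \<and> \<psi> x <= 1) \<and>
   (\<exists>C\<ge>0. \<forall>f g \<phi> \<phi>' \<Phi>' G. wgrad U f g --> tangential U G --> (\<forall>k. C1 (\<phi> k) (\<phi>' k)) -->
    (\<forall>k. C1 (%x. \<psi> x * \<phi> k x) (\<Phi>' k)) -->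
    ennreal ((ibp f g \<phi> \<phi>' - ibp f g (%k x. \<psi> x * \<phi> k x) \<Phi>')^2) <= ennreal (C * H1_mass f g) * bdry_mass U \<phi> G)"

lemma C1_diff: "C1 f f' ==> C1 g g' ==> C1 (%x. f x - g x) (%x. f' x - g' x)"
 using C1_add[of f f' "%x. - 1 * g x" "%x. - 1 *R g' x"] C1_cmult[of g g' "-1"] by simp

lemma tangential_mult:
 assumes G: "tangential U G" and psi: "continuous_on UNIV \<psi>"
 shows "tangential U (%k x. \<psi> x * G k x)"
proof -
 have "\<psi> \<in> borel_measurable (surface_measure U)" by (rule continuous_surface_measurable[OF psi])
 moreover have "AE x in surface_measure U. (\<Sum>k\<in>UNIV. outward_unit_normal U x $ k * (\<psi> x * G k x)) = 0"
  using G[unfolded tangential_def, THEN conjunct2]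
 proof eventually_elim
  case (elim x)
  have "(\<Sum>k\<in>UNIV. outward_unit_normal U x $ k * (\<psi> x * G k x)) = \<psi> x * (\<Sum>k\<in>UNIV. outward_unit_normal U x $ k * G k x)"
   by (simp add: sum_distrib_left mult_ac)
  then show ?case using elim by simp
 qed
 ultimately show ?thesis using G unfolding tangential_def by (auto intro: borel_measurable_times)
qed

lemma bdry_mass_mult:
 assumes "!!x. 0 <= \<psi> x \<and> \<psi> x <= (1::real)"
 shows "bdry_mass U (%k x. \<psi> x * \<phi> k x) (%k x. \<psi> x * G k x) <= bdry_mass U \<phi> G"
 unfolding bdry_mass_def
proof (rule nn_integral_mono, rule sum_mono, rule ennreal_leI)
 fix x k
 have "(\<psi> x)^2 <= 1" using assms[of x] by (simp add: power_le_one)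
 then have "(\<psi> x)^2 * (\<phi> k x - G k x)^2 <= 1 * (\<phi> k x - G k x)^2" by (rule mult_right_mono) simp
 then show "(\<psi> x * \<phi> k x - \<psi> x * G k x)^2 <= (\<phi> k x - G k x)^2"
  by (simp add: power_mult_distrib[symmetric] right_diff_distrib)
qed

lemma removable_1:
 fixes U :: "(real^'n) set"
 shows "removable U (%x. 1)"
 unfolding removable_def
proof (intro conjI exI[of _ "%x. 0"] exI[of _ "0::real"] allI impI)
 show "C1 (%x. 1) (%x. 0)" by (rule C1_const)
 fix f g \<phi>' \<Phi>' G and \<phi> :: "'n => real^'n => real" assume "\<forall>k. C1 (\<phi> k) (\<phi>' k)" "\<forall>k. C1 (%x. 1 * \<phi> k x) (\<Phi>' k)"
 then have "\<Phi>' k = \<phi>' k" for k using C1_unique[of "\<phi> k" "\<Phi>' k" "\<phi>' k"] by simp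
 then have "\<Phi>' = \<phi>'" by (rule ext)
 then show "ennreal ((ibp f g \<phi> \<phi>' - ibp f g (%k x. 1 * \<phi> k x) \<Phi>')^2) <= ennreal (0 * H1_mass f g) * bdry_mass U \<phi> G"
  by simp
qed auto

text \<open>First pass to the field multiplied by \<psi>, whose tangential comparison field is
  \<psi> G and whose boundary mass has not grown; then multiply by \<theta>. The two changes of the
  defect add, and squaring the sum costs the factor 2.\<close>

lemma removable_mult:
 fixes U :: "(real^'n) set"
 assumes a: "removable U \<theta>" and b: "removable U \<psi>"
 shows "removable U (%x. \<theta> x * \<psi> x)"
proof -
 obtain \<theta>' C where c: "C1 \<theta> \<theta>'" "!!x. 0 <= \<theta> x \<and> \<theta> x <= 1" "C >= 0" and cc: "\<forall>f g \<phi> \<phi>' \<Phi>' G. wgrad U f g --> tangential U G --> (\<forall>k. C1 (\<phi> k) (\<phi>' k)) -->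
    (\<forall>k. C1 (%x. \<theta> x * \<phi> k x) (\<Phi>' k)) -->
    ennreal ((ibp f g \<phi> \<phi>' - ibp f g (%k x. \<theta> x * \<phi> k x) \<Phi>')^2) <= ennreal (C * H1_mass f g) * bdry_mass U \<phi> G"
  using a unfolding removable_def by (elim conjE exE) (rule that, auto)
 obtain \<psi>' D where d: "C1 \<psi> \<psi>'" "!!x. 0 <= \<psi> x \<and> \<psi> x <= 1" "D >= 0" and dd: "\<forall>f g \<phi> \<phi>' \<Phi>' G. wgrad U f g --> tangential U G --> (\<forall>k. C1 (\<phi> k) (\<phi>' k)) -->
    (\<forall>k. C1 (%x. \<psi> x * \<phi> k x) (\<Phi>' k)) -->
    ennreal ((ibp f g \<phi> \<phi>' - ibp f g (%k x. \<psi> x * \<phi> k x) \<Phi>')^2) <= ennreal (D * H1_mass f g) * bdry_mass U \<phi> G"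
  using b unfolding removable_def by (elim conjE exE) (rule that, auto)
 show ?thesis unfolding removable_def
 proof (intro conjI exI[of _ "2 * (C + D)"] allI impI)
  show "\<exists>\<psi>'. C1 (%x. \<theta> x * \<psi> x) \<psi>'" using C1_mult[OF c(1) d(1)] by blast
  show "0 <= \<theta> x * \<psi> x" for x using c(2)[of x] d(2)[of x] by simp
  show "\<theta> x * \<psi> x <= 1" for x using c(2)[of x] d(2)[of x] by (simp add: mult_le_one)
  show "0 <= 2 * (C + D)" using c d by simp
  fix f g \<phi>' \<Phi>' G and \<phi> :: "'n => real^'n => real"
  assume w: "wgrad U f g" and G: "tangential U G" and ph: "\<forall>k. C1 (\<phi> k) (\<phi>' k)"
   and Ph: "\<forall>k. C1 (%x. \<theta> x * \<psi> x * \<phi> k x) (\<Phi>' k)"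
  have "\<exists>\<Psi>'. \<forall>k. C1 (%x. \<psi> x * \<phi> k x) (\<Psi>' k)"
   using C1_mult[OF d(1) ph[rule_format]] by (intro choice allI exI)
  then obtain \<Psi>' where Ps: "\<forall>k. C1 (%x. \<psi> x * \<phi> k x) (\<Psi>' k)" ..
  let ?A = "ibp f g \<phi> \<phi>'" and ?B = "ibp f g (%k x. \<psi> x * \<phi> k x) \<Psi>'" and ?C = "ibp f g (%k x. \<theta> x * \<psi> x * \<phi> k x) \<Phi>'"
  let ?m = "bdry_mass U \<phi> G"
  have 1: "ennreal ((?A - ?B)^2) <= ennreal (D * H1_mass f g) * ?m"
   using dd[rule_format, OF w G] ph Ps by blast
  have "ennreal ((?B - ibp f g (%k x. \<theta> x * (\<psi> x * \<phi> k x)) \<Phi>')^2) <= ennreal (C * H1_mass f g) * bdry_mass U (%k x. \<psi> x * \<phi> k x) (%k x. \<psi> x * G k x)"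
   using Ph by (intro cc[rule_format, OF w tangential_mult[OF G C1_cont[OF d(1)]] Ps[rule_format]]) (simp add: mult.assoc)
  also have "... <= ennreal (C * H1_mass f g) * ?m"
   by (intro mult_left_mono bdry_mass_mult d(2)) simp
  finally have 2: "ennreal ((?B - ?C)^2) <= ennreal (C * H1_mass f g) * ?m" by (simp add: mult.assoc)
  have "(?A - ?C)^2 <= 2 * ((?A - ?B)^2 + (?B - ?C)^2)"
   using sum_squares_ge_zero[of "(?A - ?B) - (?B - ?C)" 0] by (simp add: power2_eq_square algebra_simps)
  then have "ennreal ((?A - ?C)^2) <= 2 * (ennreal ((?A - ?B)^2) + ennreal ((?B - ?C)^2))"
   by (metis (no_types, lifting) ennreal_leI ennreal_mult' ennreal_numeral ennreal_plus zero_le_numeral zero_le_power2)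
  also have "... <= 2 * (ennreal (D * H1_mass f g) * ?m + ennreal (C * H1_mass f g) * ?m)"
   by (intro mult_left_mono add_mono 1 2) simp
  also have "... = ennreal (2 * (C + D) * H1_mass f g) * ?m"
  proof -
   have nn: "D * H1_mass f g >= 0" "C * H1_mass f g >= 0" using c(3) d(3) H1_mass_nonneg by (auto intro: mult_nonneg_nonneg)
   have "ennreal (2 * (C + D) * H1_mass f g) = ennreal (2 * (D * H1_mass f g + C * H1_mass f g))" by (simp add: algebra_simps)
   also have "... = ennreal 2 * ennreal (D * H1_mass f g + C * H1_mass f g)" by (rule ennreal_mult') simp
   also have "... = 2 * (ennreal (D * H1_mass f g) + ennreal (C * H1_mass f g))" by (simp only: ennreal_plus[OF nn] ennreal_numeral)
   finally have "ennreal (2 * (C + D) * H1_mass f g) = 2 * (ennreal (D * H1_mass f g) + ennreal (C * H1_mass f g))" .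
   then show ?thesis by (simp add: distrib_right mult.assoc)
  qed
  finally show "ennreal ((?A - ?C)^2) <= ennreal (2 * (C + D) * H1_mass f g) * ?m" .
 qed
qed

lemma ibp_integrable:
 fixes h :: "real^'n => real"
 assumes w: "wgrad U f g" and bd: "bounded U" and h: "C1 h h'"
 shows "integrable lborel (%x. f x * h' x $ k + h x * g x $ k)"
proof -
 obtain R where R: "!!x. x \<in> U ==> x \<in> cball 0 R" using bd unfolding bounded_iff by (auto simp: mem_cball)
 have f: "integrable lborel f" and g: "integrable lborel g" and z: "!!x. x \<notin> U ==> f x = 0 \<and> g x = 0"
  using w unfolding wgrad_def by auto
 have gk: "integrable lborel (%x. g x $ k)" using integrable_inner_left[OF g, of "axis k 1"] by (simp add: inner_axis)
 have [measurable]: "h \<in> borel_measurable borel" using C1_borel[OF h] by auto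
 have [measurable]: "(%x. h' x $ k) \<in> borel_measurable borel" using C1_borel_grad[OF h] by simp
 have [measurable]: "cball (0::real^'n) R \<in> sets borel" by simp
 have comp: "compact (h ` cball 0 R)" "compact (h' ` cball 0 R)"
  using C1_cont[OF h] C1_cont_grad[OF h] by (auto intro!: compact_continuous_image intro: continuous_on_subset)
 obtain A where A: "!!x. x \<in> cball 0 R ==> norm (h x) <= A"
  using compact_imp_bounded[OF comp(1)] unfolding bounded_iff by blast
 obtain B where B: "!!x. x \<in> cball 0 R ==> norm (h' x) <= B"
  using compact_imp_bounded[OF comp(2)] unfolding bounded_iff by blast
 have 1: "integrable lborel (%x. f x *R (indicator (cball 0 R) x * h' x $ k))"
 proof (rule integrable_bounded_scale[OF f, of _ "\<bar>B\<bar>"])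
  show "norm (indicator (cball 0 R) x * h' x $ k) <= \<bar>B\<bar>" for x
   using B[of x] component_le_norm_cart[of "h' x" k] by (auto simp: indicator_def)
 qed measurable
 have 2: "integrable lborel (%x. g x $ k *R (indicator (cball 0 R) x * h x))"
 proof (rule integrable_bounded_scale[OF gk, of _ "\<bar>A\<bar>"])
  show "norm (indicator (cball 0 R) x * h x) <= \<bar>A\<bar>" for x
   using A[of x] by (auto simp: indicator_def)
 qed measurable
 have eq: "f x *R (indicator (cball 0 R) x * h' x $ k) + g x $ k *R (indicator (cball 0 R) x * h x) = f x * h' x $ k + h x * g x $ k" for x
  using z[of x] R[of x] by (cases "x \<in> U") (auto simp: indicator_def)
 show ?thesis using Bochner_Integration.integrable_add[OF 1 2] by (simp only: eq)
qed

lemma ibp_diff: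
 assumes w: "wgrad U f g" and ph: "!!k. C1 (\<phi> k) (\<phi>' k)" and ps: "!!k. C1 (\<psi> k) (\<psi>' k)" and bd: "bounded U"
 shows "ibp f g \<phi> \<phi>' - ibp f g \<psi> \<psi>' = ibp f g (%k x. \<phi> k x - \<psi> k x) (%k x. \<phi>' k x - \<psi>' k x)"
proof -
 have i: "integrable lborel (%x. f x * h' x $ k + h x * g x $ k)" if "C1 h h'" for h h' k
  by (rule ibp_integrable[OF w bd that])
 show ?thesis
  unfolding ibp_def sum_subtractf[symmetric]
 proof (rule sum.cong[OF refl])
  fix k
  show "(LBINT x. f x * \<phi>' k x $ k + \<phi> k x * g x $ k) - (LBINT x. f x * \<psi>' k x $ k + \<psi> k x * g x $ k) =
   (LBINT x. f x * (\<phi>' k x - \<psi>' k x) $ k + (\<phi> k x - \<psi> k x) * g x $ k)"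
   by (subst Bochner_Integration.integral_diff[symmetric, OF i[OF ph] i[OF ps]])
    (auto intro!: Bochner_Integration.integral_cong simp: algebra_simps)
 qed
qed

text \<open>An interior point gets an artificial chart, an affine height that is positive on a whole
  ball inside U, together with the degenerate cone of axis 0. Interior and boundary points can then
  be treated by the same argument.\<close>

lemma closure_chart:
 fixes U :: "(real^'n) set"
 assumes "open U" "C2_boundary U" "p \<in> closure U"
 obtains \<rho> e y y' r a t0 where "chart U p \<rho> e y y'" "r <= \<rho>" "cone_at U p r a t0"
proof (cases "p \<in> U")
 case True
 obtain \<rho> t0 where c: "cone_at U p \<rho> 0 t0" "ball p \<rho> \<subseteq> U" by (rule interior_cone[OF assms(1) True])
 obtain e :: "real^'n" where e: "norm e = 1" using vector_choose_size[of 1] by auto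
 define y where "y x = (x - p) \<bullet> e + \<rho>" for x
 have ee: "e \<bullet> e = 1" using e by (simp add: dot_square_norm)
 have y: "C1 y (%x. e)" unfolding C1_def y_def by (auto intro!: derivative_eq_intros simp: inner_diff_left)
 have "y x > 0" if "x \<in> ball p \<rho>" for x
  using Cauchy_Schwarz_ineq2[of "x - p" e] that e by (simp add: y_def dist_norm norm_minus_commute)
 then have "chart U p \<rho> e y (%x. e)"
  using c e y unfolding chart_def cone_at_def by (auto simp: y_def inner_add_left inner_diff_left ee)
 then show ?thesis by (rule that[OF _ order_refl c(1)])
next
 case False
 then have "p \<in> frontier U" using assms by (simp add: frontier_def interior_open)
 then obtain \<rho> e y y' where ch: "chart U p \<rho> e y y'" by (rule C2_boundary_chart[OF assms(2)])
 then obtain r a t0 where "r < \<rho>" "cone_at U p r a t0" by (rule chart_cone)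
 then show ?thesis by (intro that[OF ch less_imp_le])
qed

text \<open>With the factor 1 - b^2 the part of the field that is removed is exactly the b^2
  multiple handled by \<open>chart_ibp\<close>, and its graph integral is bounded by
  \<open>gint_le_surface_integral\<close>.\<close>

lemma removable_local:
 fixes U :: "(real^'n) set"
 assumes card: "CARD('n) >= 2" and op: "open U" and bd: "bounded U" and C2: "C2_boundary U" and p: "p \<in> closure U"
 obtains \<psi> \<delta> where "removable U \<psi>" "\<delta> > 0" "\<forall>x\<in>ball p \<delta>. \<psi> x = 0"
proof -
 obtain \<rho> e y y' r a t0 where ch: "chart U p \<rho> e y y'" and r: "r <= \<rho>" and co: "cone_at U p r a t0"
  by (rule closure_chart[OF op C2 p])
 have r0: "r > 0" using co by (simp add: cone_at_def)
 obtain b b' where b: "C1 b b'" "!!x. 0 <= b x" "!!x. b x <= 1" "!!x. x \<in> cball p (r/2) ==> b x = 1" "!!x. x \<notin> ball p r ==> b x = 0"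
  using C1_bump[OF r0, of p] by metis
 obtain C where C: "C >= 0" and Cc: "\<forall>f g \<phi> \<phi>' \<Phi>'. wgrad U f g --> (\<forall>k. C1 (\<phi> k) (\<phi>' k)) --> (\<forall>k. C1 (%x. (b x)^2 * \<phi> k x) (\<Phi>' k)) -->
  (ibp f g (%k x. (b x)^2 * \<phi> k x) \<Phi>')^2 <=
   C * H1_mass f g * gint e y (%x. (b x)^2 * (\<Sum>k\<in>UNIV. \<phi> k x * y' x $ k)^2)"
  by (rule chart_ibp[OF op ch co r b(1) b(2) b(3)]) (rule b(5), assumption, rule that)
 obtain D where D: "D >= 0" and Dd: "\<forall>\<phi> G. (\<forall>k. continuous_on UNIV (\<phi> k)) --> tangential U G -->
  ennreal (gint e y (%x. (b x)^2 * (\<Sum>k\<in>UNIV. \<phi> k x * y' x $ k)^2)) <=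
   ennreal D * bdry_mass U \<phi> G"
  by (rule gint_le_surface_integral[OF card op ch r C1_cont[OF b(1)] b(2) b(3)]) (rule b(5), assumption, rule that)
 obtain B' where B': "C1 (%x. 1 - (b x)^2) B'"
  using C1_diff[OF C1_const[of 1] C1_mult[OF b(1) b(1)]] by (auto simp: power2_eq_square)
 have "removable U (%x. 1 - (b x)^2)"
  unfolding removable_def
 proof (intro conjI exI[of _ "C * D"] exI[of _ B'] B' allI impI)
  show "0 <= 1 - (b x)^2" "1 - (b x)^2 <= 1" for x using b(2,3)[of x] by (auto simp: power_le_one)
  show "0 <= C * D" using C D by simp
  fix f g \<phi>' \<Phi>' G and \<phi> :: "'n => real^'n => real"
  assume w: "wgrad U f g" and G: "tangential U G" and ph: "\<forall>k. C1 (\<phi> k) (\<phi>' k)"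
   and Ph: "\<forall>k. C1 (%x. (1 - (b x)^2) * \<phi> k x) (\<Phi>' k)"
  have df: "ibp f g \<phi> \<phi>' - ibp f g (%k x. (1 - (b x)^2) * \<phi> k x) \<Phi>' = ibp f g (%k x. (b x)^2 * \<phi> k x) (%k x. \<phi>' k x - \<Phi>' k x)"
   by (subst ibp_diff[OF w ph[rule_format] Ph[rule_format] bd]) (simp add: algebra_simps)
  have Q: "C1 (%x. (b x)^2 * \<phi> k x) (%x. \<phi>' k x - \<Phi>' k x)" for k
   using C1_diff[OF ph[rule_format, of k] Ph[rule_format, of k]] by (simp add: algebra_simps)
  let ?g = "gint e y (%x. (b x)^2 * (\<Sum>k\<in>UNIV. \<phi> k x * y' x $ k)^2)"
  have 1: "(ibp f g (%k x. (b x)^2 * \<phi> k x) (%k x. \<phi>' k x - \<Phi>' k x))^2 <= C * H1_mass f g * ?g"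
   using Cc[rule_format, OF w ph[rule_format] Q] .
  have 2: "ennreal ?g <= ennreal D * bdry_mass U \<phi> G"
   by (rule Dd[rule_format, OF C1_cont[OF ph[rule_format]] G])
  have cm: "C * H1_mass f g >= 0" by (rule mult_nonneg_nonneg[OF C H1_mass_nonneg])
  have "ennreal ((ibp f g (%k x. (b x)^2 * \<phi> k x) (%k x. \<phi>' k x - \<Phi>' k x))^2) <= ennreal (C * H1_mass f g) * ennreal ?g"
   using ennreal_leI[OF 1] by (simp add: ennreal_mult'[OF cm])
  also have "... <= ennreal (C * H1_mass f g) * (ennreal D * bdry_mass U \<phi> G)" by (intro mult_left_mono 2) simp
  also have "... = ennreal (C * D * H1_mass f g) * bdry_mass U \<phi> G"
  proof -
   have "ennreal (C * D * H1_mass f g) = ennreal (C * H1_mass f g * D)" by (simp add: mult_ac)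
   also have "... = ennreal (C * H1_mass f g) * ennreal D" by (rule ennreal_mult'[OF cm])
   finally show ?thesis by (simp only: mult.assoc)
  qed
  finally show "ennreal ((ibp f g \<phi> \<phi>' - ibp f g (%k x. (1 - (b x)^2) * \<phi> k x) \<Phi>')^2) <= ennreal (C * D * H1_mass f g) * bdry_mass U \<phi> G"
   by (simp add: df)
 qed
 then show ?thesis by (rule that[of _ "r/2"]) (use r0 b(4) in auto)
qed

text \<open>The right-hand side is small as soon as the field is close, in L^2 of the boundary, to
  some tangential field. This lets the defect vanish in the limit for smooth approximations of a
  trace.\<close>

theorem ibp_bound:
 fixes U :: "(real^'n) set"
 assumes card: "CARD('n) >= 2" and op: "open U" and bd: "bounded U" and C2: "C2_boundary U"
 obtains C where "C >= 0" "\<forall>f g \<phi> \<phi>' G. wgrad U f g --> tangential U G --> (\<forall>k. C1 (\<phi> k) (\<phi>' k)) -->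
    ennreal ((ibp f g \<phi> \<phi>')^2) <= ennreal (C * H1_mass f g) * bdry_mass U \<phi> G"
proof -
 have "\<forall>p\<in>closure U. \<exists>\<psi> \<delta>. removable U \<psi> \<and> \<delta> > 0 \<and> (\<forall>x\<in>ball p \<delta>. \<psi> x = 0)"
 proof
  fix p assume "p \<in> closure U"
  then obtain \<psi> \<delta> where "removable U \<psi>" "\<delta> > 0" "\<forall>x\<in>ball p \<delta>. \<psi> x = 0"
   by (rule removable_local[OF card op bd C2])
  then show "\<exists>\<psi> \<delta>. removable U \<psi> \<and> \<delta> > 0 \<and> (\<forall>x\<in>ball p \<delta>. \<psi> x = 0)" by blast
 qed
 then obtain \<psi> \<delta> where P: "!!p. p \<in> closure U ==> removable U (\<psi> p)" "!!p. p \<in> closure U ==> \<delta> p > 0"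
  "!!p x. p \<in> closure U ==> x \<in> ball p (\<delta> p) ==> \<psi> p x = 0"
  unfolding bchoice_iff by blast
 have co: "compact (closure U)" using bd by simp
 have cov: "closure U \<subseteq> (\<Union>p\<in>closure U. ball p (\<delta> p))" using P(2) by force
 obtain I where I: "I \<subseteq> closure U" "finite I" "closure U \<subseteq> (\<Union>p\<in>I. ball p (\<delta> p))"
  by (rule compactE_image[OF co _ cov]) auto
 have "removable U (%x. \<Prod>p\<in>I. \<psi> p x)"
  using I(2,1)
 proof (induction I)
  case empty show ?case by (simp add: removable_1)
 next
  case (insert p J)
  then show ?case using removable_mult[of U "\<psi> p" "%x. \<Prod>p\<in>J. \<psi> p x"] P(1)[of p] by simp
 qed
 then obtain \<theta>' C where c: "C1 (%x. \<Prod>p\<in>I. \<psi> p x) \<theta>'" "C >= 0" and cc: "\<forall>f g \<phi> \<phi>' \<Phi>' G. wgrad U f g --> tangential U G --> (\<forall>k. C1 (\<phi> k) (\<phi>' k)) -->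
    (\<forall>k. C1 (%x. (\<Prod>p\<in>I. \<psi> p x) * \<phi> k x) (\<Phi>' k)) -->
    ennreal ((ibp f g \<phi> \<phi>' - ibp f g (%k x. (\<Prod>p\<in>I. \<psi> p x) * \<phi> k x) \<Phi>')^2) <= ennreal (C * H1_mass f g) * bdry_mass U \<phi> G"
  unfolding removable_def by (elim conjE exE) (rule that, auto)
 have z: "(\<Prod>p\<in>I. \<psi> p x) = 0" if "x \<in> U" for x
 proof -
  have "x \<in> closure U" using that closure_subset by blast
  then obtain p where "p \<in> I" "x \<in> ball p (\<delta> p)" using I(3) by blast
  then show ?thesis using P(3)[of p x] I by (auto intro!: prod_zero)
 qed
 show ?thesis
 proof (rule that[OF c(2)], intro allI impI)
  fix f g \<phi>' G and \<phi> :: "'n => real^'n => real"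
  assume w: "wgrad U f g" and G: "tangential U G" and ph: "\<forall>k. C1 (\<phi> k) (\<phi>' k)"
  have "\<exists>\<Phi>'. \<forall>k. C1 (%x. (\<Prod>p\<in>I. \<psi> p x) * \<phi> k x) (\<Phi>' k)"
   using C1_mult[OF c(1) ph[rule_format]] by (intro choice allI exI)
  then obtain \<Phi>' where Ph: "\<forall>k. C1 (%x. (\<Prod>p\<in>I. \<psi> p x) * \<phi> k x) (\<Phi>' k)" ..
  have gz: "\<Phi>' k x = 0" if x: "x \<in> U" for k x
   using C1_grad_zero[OF Ph[rule_format, of k] op x] z by simp
  have "f x * \<Phi>' k x $ k + ((\<Prod>p\<in>I. \<psi> p x) * \<phi> k x) * g x $ k = 0" for k x
   using w gz[of x k] z[of x] unfolding wgrad_def by (cases "x \<in> U") auto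
  then have "ibp f g (%k x. (\<Prod>p\<in>I. \<psi> p x) * \<phi> k x) \<Phi>' = 0" by (simp add: ibp_def)
  moreover have "ennreal ((ibp f g \<phi> \<phi>' - ibp f g (%k x. (\<Prod>p\<in>I. \<psi> p x) * \<phi> k x) \<Phi>')^2) <= ennreal (C * H1_mass f g) * bdry_mass U \<phi> G"
   by (rule cc[rule_format, OF w G ph[rule_format] Ph[rule_format]])
  ultimately show "ennreal ((ibp f g \<phi> \<phi>')^2) <= ennreal (C * H1_mass f g) * bdry_mass U \<phi> G"
   by simp
 qed
qed

section \<open>Weak derivatives\<close>

text \<open>Completeness of Lebesgue measure: a change on a null set preserves
  measurability.\<close>

lemma measurable_lebesgue_on_AE:
 fixes f :: "'a::euclidean_space => 'b::euclidean_space"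
 assumes S: "S \<in> sets lebesgue" and f: "f \<in> borel_measurable (lebesgue_on S)" and ae: "AE x in lebesgue_on S. f x = g x"
 shows "g \<in> borel_measurable (lebesgue_on S)"
proof -
 have S': "S \<inter> space lebesgue \<in> sets lebesgue" using S by simp
 have "(%x. indicator S x *R f x) \<in> borel_measurable lebesgue" using f by (simp add: borel_measurable_restrict_space_iff[OF S'])
 moreover have "AE x in lebesgue. indicator S x *R f x = indicator S x *R g x"
  using ae unfolding AE_restrict_space_iff[OF S'] by eventually_elim (auto simp: indicator_def)
 ultimately have "(%x. indicator S x *R g x) \<in> borel_measurable lebesgue" by (rule borel_measurable_AE)
 then show ?thesis by (simp add: borel_measurable_restrict_space_iff[OF S'])
qed

lemma integral_lebesgue_on_cong:
 fixes f :: "'a::euclidean_space => 'b::euclidean_space"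
 assumes S: "S \<in> sets lebesgue" and ae: "AE x in lebesgue_on S. f x = g x"
 shows "integral\<^sup>L (lebesgue_on S) f = integral\<^sup>L (lebesgue_on S) g"
  and "integrable (lebesgue_on S) f \<longleftrightarrow> integrable (lebesgue_on S) g"
proof -
 have ae': "AE x in lebesgue_on S. g x = f x" using ae by eventually_elim simp
 show i: "integrable (lebesgue_on S) f \<longleftrightarrow> integrable (lebesgue_on S) g"
 proof
  assume f: "integrable (lebesgue_on S) f"
  show "integrable (lebesgue_on S) g"
   by (rule integrable_cong_AE_imp[OF f measurable_lebesgue_on_AE[OF S borel_measurable_integrable[OF f] ae] ae])
 next
  assume f: "integrable (lebesgue_on S) g"
  show "integrable (lebesgue_on S) f"
   by (rule integrable_cong_AE_imp[OF f measurable_lebesgue_on_AE[OF S borel_measurable_integrable[OF f] ae'] ae'])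
 qed
 show "integral\<^sup>L (lebesgue_on S) f = integral\<^sup>L (lebesgue_on S) g"
 proof (cases "integrable (lebesgue_on S) f")
  case True
  then have "integrable (lebesgue_on S) g" using i by simp
  then show ?thesis using True ae by (intro integral_cong_AE) auto
 next
  case False
  then show ?thesis using i by (simp add: not_integrable_integral_eq)
 qed
qed

text \<open>Passes from functions on \<open>lebesgue_on S\<close>, known up to null sets, to Borel
  representatives extended by zero, for which the arguments with \<open>lborel\<close>, translations
  and Fubini are available.\<close>

lemma lborel_transfer:
 fixes h h' :: "'a::euclidean_space => 'b::euclidean_space"
 assumes S: "S \<in> sets borel" and h': "h' \<in> borel_measurable borel" and z: "!!x. x \<notin> S ==> h' x = 0"
  and ae: "AE x in lebesgue_on S. h x = h' x"
 shows "integral\<^sup>L (lebesgue_on S) h = integral\<^sup>L lborel h'" and "integrable (lebesgue_on S) h \<longleftrightarrow> integrable lborel h'"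
proof -
 have SL: "S \<in> sets lebesgue" using S by auto
 then have S': "S \<inter> space lebesgue \<in> sets lebesgue" by simp
 have eq: "indicator S x *R h' x = h' x" for x using z[of x] by (auto simp: indicator_def)
 have "integral\<^sup>L (lebesgue_on S) h = integral\<^sup>L (lebesgue_on S) h'" by (rule integral_lebesgue_on_cong(1)[OF SL ae])
 also have "... = integral\<^sup>L lebesgue h'" by (simp only: integral_restrict_space[OF S'] eq)
 also have "... = integral\<^sup>L lborel h'" using h' by (intro integral_completion) simp
 finally show "integral\<^sup>L (lebesgue_on S) h = integral\<^sup>L lborel h'" .
 have "integrable (lebesgue_on S) h \<longleftrightarrow> integrable (lebesgue_on S) h'" by (rule integral_lebesgue_on_cong(2)[OF SL ae])
 also have "... \<longleftrightarrow> integrable lebesgue h'" by (simp only: integrable_restrict_space[OF S'] eq)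
 also have "... \<longleftrightarrow> integrable lborel h'" using h' by (intro integrable_completion) simp
 finally show "integrable (lebesgue_on S) h \<longleftrightarrow> integrable lborel h'" .
qed

lemma borel_representative:
 fixes u :: "'a::euclidean_space => real"
 assumes S: "S \<in> sets borel" and u: "u \<in> borel_measurable (lebesgue_on S)"
 obtains f where "f \<in> borel_measurable borel" "\<forall>x. x \<notin> S --> f x = 0" "AE x in lebesgue_on S. u x = f x"
proof -
 have S': "S \<inter> space lebesgue \<in> sets lebesgue" using S by simp
 have "(%x. indicator S x *R u x) \<in> borel_measurable lebesgue" using u by (simp add: borel_measurable_restrict_space_iff[OF S'])
 from completion_ex_borel_measurable_real[OF this]
 obtain g where g: "g \<in> borel_measurable lborel" "AE x in lborel. indicator S x *R u x = g x" by blast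
 show ?thesis
 proof (rule that[of "%x. indicator S x * g x"])
  show "(%x. indicator S x * g x) \<in> borel_measurable borel" using g S by simp
  have "AE x in lebesgue. indicator S x *R u x = g x" using g(2) by (rule AE_completion)
  then show "AE x in lebesgue_on S. u x = indicator S x * g x"
   unfolding AE_restrict_space_iff[OF S'] by eventually_elim (auto simp: indicator_def)
 qed auto
qed

lemma loc_integrable_mult:
 fixes u :: "real^'n => 'b::euclidean_space"
 assumes op: "open U" and u: "loc_integrable U u" and \<phi>: "continuous_on UNIV (\<phi> :: real^'n => real)"
  and K: "compact K" "K \<subseteq> U" and z: "!!x. x \<notin> K ==> \<phi> x = 0"
 shows "integrable (lebesgue_on U) (%x. \<phi> x *R u x)"
proof -
 have O: "U \<inter> space lebesgue \<in> sets lebesgue" using op by (simp add: borel_open)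
 have KL: "K \<inter> space lebesgue \<in> sets lebesgue" using K(1) by (simp add: borel_compact)
 have i: "integrable lebesgue (%x. indicator K x *R u x)"
  using u K unfolding loc_integrable_def by (intro integrable_restrict_space[OF KL, THEN iffD1]) blast
 obtain R where R: "!!x. x \<in> K ==> norm x <= R" using compact_imp_bounded[OF K(1)] unfolding bounded_iff by blast
 then have "\<phi> x = 0" if "norm x > R" for x using that z[of x] by force
 then obtain B where B: "!!x. norm (\<phi> x) <= B" using compact_support_bounded[OF \<phi>] by metis
 have m: "\<phi> \<in> borel_measurable lebesgue"
  using borel_measurable_continuous_onI[OF \<phi>] by (simp add: measurable_completion)
 have "integrable lebesgue (%x. \<phi> x *R (indicator K x *R u x))"
 proof (rule Bochner_Integration.integrable_bound)
  show "integrable lebesgue (%x. B *R (indicator K x *R u x))" using i by (rule integrable_scaleR_right)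
  have "\<bar>\<phi> x\<bar> * norm (indicator K x *R u x) <= \<bar>B\<bar> * norm (indicator K x *R u x)" for x
   using B[of x] by (intro mult_right_mono) auto
  then show "AE x in lebesgue. norm (\<phi> x *R (indicator K x *R u x)) <= norm (B *R (indicator K x *R u x))"
   by (simp only: norm_scaleR) (rule AE_I2, simp)
  show "(%x. \<phi> x *R (indicator K x *R u x)) \<in> borel_measurable lebesgue"
   using m borel_measurable_integrable[OF i] by (rule borel_measurable_scaleR)
 qed
 moreover have "\<phi> x *R (indicator K x *R u x) = indicator U x *R (\<phi> x *R u x)" for x
  using z[of x] K(2) by (auto simp: indicator_def)
 ultimately show ?thesis by (simp only: integrable_restrict_space[OF O])
qed

lemma test_function_support:
 assumes t: "test_function U \<phi>"
 obtains K where "compact K" "K \<subseteq> U" "\<forall>x. x \<notin> K --> \<phi> x = 0 \<and> (\<forall>k. pderiv_at k \<phi> x = 0)"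
  "continuous_on UNIV \<phi>" "\<forall>k. continuous_on UNIV (pderiv_at k \<phi>)"
proof -
 have c: "C1 \<phi> (%x. \<chi> k. pderiv_at k \<phi> x)" using t smooth_imp_C1 unfolding test_function_def by blast
 define K where "K = closure {x. \<phi> x \<noteq> 0}"
 have z: "\<phi> x = 0" if "x \<in> - K" for x using that closure_subset[of "{x. \<phi> x \<noteq> 0}"] unfolding K_def by blast
 have "pderiv_at k \<phi> x = 0" if x: "x \<in> - K" for x k
 proof -
  have "(\<chi> k. pderiv_at k \<phi> x) = 0"
   by (rule C1_grad_zero[OF c _ x z]) (auto simp: K_def open_Compl)
  then show ?thesis by (simp add: vec_eq_iff)
 qed
 moreover have "continuous_on UNIV (pderiv_at k \<phi>)" for k
  using continuous_on_component[OF C1_cont_grad[OF c], of k] by simp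
 moreover have "compact K" "K \<subseteq> U" using t unfolding test_function_def K_def by blast+
 ultimately show ?thesis using z C1_cont[OF c] that[of K] by blast
qed

lemma test_function_integrable:
 assumes "open U" "loc_integrable U u" "test_function U \<phi>"
 shows "integrable (lebesgue_on U) (%x. \<phi> x *R u x)" "integrable (lebesgue_on U) (%x. pderiv_at k \<phi> x *R u x)"
proof -
 obtain K where K: "compact K" "K \<subseteq> U" "\<forall>x. x \<notin> K --> \<phi> x = 0 \<and> (\<forall>k. pderiv_at k \<phi> x = 0)"
  "continuous_on UNIV \<phi>" "\<forall>k. continuous_on UNIV (pderiv_at k \<phi>)" by (rule test_function_support[OF assms(3)])
 show "integrable (lebesgue_on U) (%x. \<phi> x *R u x)" "integrable (lebesgue_on U) (%x. pderiv_at k \<phi> x *R u x)"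
  using K by (auto intro!: loc_integrable_mult[OF assms(1,2) _ K(1,2)])
qed

text \<open>Near an interior point the centred kernels are test functions, so the mollifications of
  h vanish there; they converge to h in L^1, so h vanishes almost everywhere on a small ball.
  Lindelof's theorem reduces the union of these balls to countably many null sets.\<close>

proposition fundamental_lemma:
 fixes h :: "real^'n => real"
 assumes op: "open U" and h: "loc_integrable U h"
  and t: "!!\<phi>. test_function U \<phi> ==> (LINT x|lebesgue_on U. \<phi> x * h x) = 0"
 shows "AE x in lebesgue_on U. h x = 0"
proof -
 have "\<exists>r>0. AE x in lebesgue. x \<in> ball p r --> h x = 0" if p: "p \<in> U" for p
 proof -
  obtain d where d: "d > 0" "cball p d \<subseteq> U" using op p open_contains_cball by blast
  define r where "r = d / 2"
  have r: "r > 0" "cball p (2 * r) \<subseteq> U" using d by (auto simp: r_def)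
  define K where "K = cball p (2 * r)"
  have KB: "K \<in> sets borel" by (simp add: K_def)
  have KL: "K \<inter> space lebesgue \<in> sets lebesgue" "K \<in> sets lebesgue" using KB by auto
  have O: "U \<inter> space lebesgue \<in> sets lebesgue" using op by (simp add: borel_open)
  have ih: "integrable (lebesgue_on K) h" using h r unfolding loc_integrable_def K_def by simp
  obtain f where f[measurable]: "f \<in> borel_measurable borel" and fz: "\<forall>x. x \<notin> K --> f x = 0" and fh: "AE x in lebesgue_on K. h x = f x"
   by (rule borel_representative[OF KB borel_measurable_integrable[OF ih]])
  have iF: "integrable lborel f" using lborel_transfer(2)[OF KB f _ fh] fz ih by blast
  have m0: "moll eps 0 f x = 0" if e: "0 < eps" "eps <= r" and x: "x \<in> ball p r" for eps x
  proof -
   obtain m' where m': "C1 (mkern eps (0::real^'n)) m'" using mkern_C1 by blast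
   have sub: "cball x eps \<subseteq> K"
   proof
    fix z assume "z \<in> cball x eps"
    then show "z \<in> K" using dist_triangle[of p z x] x e by (simp add: K_def)
   qed
   have tf: "test_function U (%z. mkern eps 0 (z - x))"
    using sub r by (intro mkern_test_function[OF e(1)]) (auto simp: K_def)
   have mz: "mkern eps 0 (z - x) = 0" if "z \<notin> K" for z
   proof (rule mkern_zero[OF e(1)])
    have "z \<notin> cball x eps" using that sub by blast
    then show "eps <= norm (z - x - eps *R 0)" by (simp add: dist_norm norm_minus_commute)
   qed
   have "moll eps 0 f x = (LBINT z. mkern eps 0 (z - x) *R f z)" by (rule moll_kernel[OF e(1) f])
   also have "... = (LINT z|lebesgue_on K. mkern eps 0 (z - x) *R h z)"
   proof (rule lborel_transfer(1)[OF KB, symmetric])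
    show "(%z. mkern eps 0 (z - x) *R f z) \<in> borel_measurable borel"
     by (intro borel_measurable_scaleR f measurable_compose[OF _ C1_borel[OF m']]) simp
    show "AE z in lebesgue_on K. mkern eps 0 (z - x) *R h z = mkern eps 0 (z - x) *R f z"
     using fh by eventually_elim simp
   qed (use fz in auto)
   also have "... = (LINT z|lebesgue_on U. mkern eps 0 (z - x) *R h z)"
    unfolding integral_restrict_space[OF KL(1)] integral_restrict_space[OF O]
    using mz r by (intro Bochner_Integration.integral_cong refl) (auto simp: indicator_def K_def)
   also have "... = 0" using t[OF tf] by simp
   finally show ?thesis .
  qed
  let ?e = "%i::nat. r / (real i + 1)"
  have e: "?e i > 0" "?e i <= r" for i using r by (auto simp: field_simps)
  have "?e ----> 0" by real_asymp
  from moll_tendsto_L1[OF iF e(1) this, of 0]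
  have lim: "(%i. LBINT x. norm (moll (?e i) 0 f x - f x)) ----> 0" .
  have ii: "integrable lborel (%x. indicator (ball p r) x * \<bar>f x\<bar>)"
   using integrable_mult_indicator[of "ball p r" lborel "%x. \<bar>f x\<bar>"] iF by simp
  have le: "(LBINT x. indicator (ball p r) x * \<bar>f x\<bar>) <= (LBINT x. norm (moll (?e i) 0 f x - f x))" for i
  proof (rule integral_mono[OF ii])
   show "integrable lborel (%x. norm (moll (?e i) 0 f x - f x))"
    using moll_integrable[OF e(1) iF] iF by (intro integrable_norm Bochner_Integration.integrable_diff)
   show "indicator (ball p r) x * \<bar>f x\<bar> <= norm (moll (?e i) 0 f x - f x)" for x
    using m0[OF e, of x i] by (auto simp: indicator_def)
  qed
  have "(LBINT x. indicator (ball p r) x * \<bar>f x\<bar>) <= 0"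
   using le by (intro LIMSEQ_le_const[OF lim]) auto
  moreover have "(LBINT x. indicator (ball p r) x * \<bar>f x\<bar>) >= 0" by (intro integral_nonneg_AE) auto
  ultimately have "AE x in lborel. indicator (ball p r) x * \<bar>f x\<bar> = 0"
   using integral_nonneg_eq_0_iff_AE[OF ii] by auto
  then have "AE x in lebesgue. indicator (ball p r) x * \<bar>f x\<bar> = 0" by (rule AE_completion)
  moreover have "AE x in lebesgue. x \<in> K --> h x = f x" using fh unfolding AE_restrict_space_iff[OF KL(1)] .
  ultimately have "AE x in lebesgue. x \<in> ball p r --> h x = 0"
   by eventually_elim (use r in \<open>auto simp: indicator_def K_def\<close>)
  then show ?thesis using r by blast
 qed
 then obtain r where r: "!!p. p \<in> U ==> r p > 0" "!!p. p \<in> U ==> AE x in lebesgue. x \<in> ball p (r p) --> h x = 0" by metis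
 obtain F where F: "F \<subseteq> (%p. ball p (r p)) ` U" "countable F" "\<Union>F = \<Union>((%p. ball p (r p)) ` U)"
  by (rule Lindelof[of "(%p. ball p (r p)) ` U"]) auto
 have "AE x in lebesgue. \<forall>B\<in>F. x \<in> B --> h x = 0"
  using F r(2) by (intro AE_ball_countable') auto
 then have "AE x in lebesgue. x \<in> U --> h x = 0"
 proof eventually_elim
  case (elim x)
  have "x \<in> \<Union>F" if "x \<in> U" unfolding F(3) using r(1)[OF that] that by (auto intro!: bexI[of _ x])
  then show ?case using elim by blast
 qed
 then show ?thesis using op by (subst AE_restrict_space_iff) (auto simp: borel_open)
qed

section \<open>Algebra and uniqueness of weak derivatives\<close>

lemma has_weak_pderiv_inner:
 fixes u :: "real^'n => 'b::euclidean_space"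
 assumes op: "open U" and w: "has_weak_pderiv U k u g"
 shows "has_weak_pderiv U k (%x. u x \<bullet> b) (%x. g x \<bullet> b)"
proof -
 have u: "loc_integrable U u" and g: "loc_integrable U g"
  and eq: "!!\<phi>. test_function U \<phi> ==> (LINT x|lebesgue_on U. pderiv_at k \<phi> x *R u x) = - (LINT x|lebesgue_on U. \<phi> x *R g x)"
  using w unfolding has_weak_pderiv_def by auto
 show ?thesis unfolding has_weak_pderiv_def
 proof (intro conjI allI impI)
  show "loc_integrable U (%x. u x \<bullet> b)" "loc_integrable U (%x. g x \<bullet> b)"
   using u g unfolding loc_integrable_def by auto
  fix \<phi> assume t: "test_function U \<phi>"
  have "(LINT x|lebesgue_on U. (pderiv_at k \<phi> x *R u x) \<bullet> b) = (LINT x|lebesgue_on U. pderiv_at k \<phi> x *R u x) \<bullet> b"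
   by (rule integral_inner_left) (rule test_function_integrable(2)[OF op u t])
  moreover have "(LINT x|lebesgue_on U. (\<phi> x *R g x) \<bullet> b) = (LINT x|lebesgue_on U. \<phi> x *R g x) \<bullet> b"
   by (rule integral_inner_left) (rule test_function_integrable(1)[OF op g t])
  ultimately show "(LINT x|lebesgue_on U. pderiv_at k \<phi> x *R (u x \<bullet> b)) = - (LINT x|lebesgue_on U. \<phi> x *R (g x \<bullet> b))"
   by (simp add: eq[OF t])
 qed
qed

lemma has_weak_pderiv_diff:
 assumes op: "open U" and w: "has_weak_pderiv U k u g" "has_weak_pderiv U k v h"
 shows "has_weak_pderiv U k (%x. u x - v x) (%x. g x - h x)"
proof -
 have l: "loc_integrable U u" "loc_integrable U g" "loc_integrable U v" "loc_integrable U h"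
  using w unfolding has_weak_pderiv_def by auto
 show ?thesis unfolding has_weak_pderiv_def
 proof (intro conjI allI impI)
  show "loc_integrable U (%x. u x - v x)" "loc_integrable U (%x. g x - h x)"
   using l unfolding loc_integrable_def by auto
  fix \<phi> assume t: "test_function U \<phi>"
  note i = test_function_integrable[OF op _ t]
  have "(LINT x|lebesgue_on U. pderiv_at k \<phi> x *R u x) = - (LINT x|lebesgue_on U. \<phi> x *R g x)"
   "(LINT x|lebesgue_on U. pderiv_at k \<phi> x *R v x) = - (LINT x|lebesgue_on U. \<phi> x *R h x)"
   using w t unfolding has_weak_pderiv_def by auto
  then show "(LINT x|lebesgue_on U. pderiv_at k \<phi> x *R (u x - v x)) = - (LINT x|lebesgue_on U. \<phi> x *R (g x - h x))"
   unfolding scaleR_diff_right by (simp add: i l)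
 qed
qed

lemma weak_pderiv_unique:
 fixes u :: "real^'n => 'b::euclidean_space"
 assumes op: "open U" and w: "has_weak_pderiv U k u g" "has_weak_pderiv U k u h"
 shows "AE x in lebesgue_on U. g x = h x"
proof -
 have "AE x in lebesgue_on U. (g x - h x) \<bullet> b = 0" for b
 proof (rule fundamental_lemma[OF op])
  have d: "has_weak_pderiv U k (%x. (u x - u x) \<bullet> b) (%x. (g x - h x) \<bullet> b)"
   by (rule has_weak_pderiv_inner[OF op has_weak_pderiv_diff[OF op w]])
  show "loc_integrable U (%x. (g x - h x) \<bullet> b)" using d unfolding has_weak_pderiv_def by blast
  fix \<phi> assume "test_function U \<phi>"
  then have "(LINT x|lebesgue_on U. pderiv_at k \<phi> x *R ((u x - u x) \<bullet> b)) = - (LINT x|lebesgue_on U. \<phi> x *R ((g x - h x) \<bullet> b))"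
   using d unfolding has_weak_pderiv_def by blast
  then show "(LINT x|lebesgue_on U. \<phi> x * ((g x - h x) \<bullet> b)) = 0" by simp
 qed
 then have "AE x in lebesgue_on U. \<forall>b\<in>Basis. (g x - h x) \<bullet> b = 0" by (intro AE_ball_countable') (auto simp: countable_finite)
 then show ?thesis
 proof eventually_elim
  case (elim x)
  then have "g x - h x = 0" by (simp add: euclidean_all_zero_iff)
  then show ?case by simp
 qed
qed

lemma L2_on_AE:
 assumes op: "open U" and u: "L2_on U u" and ae: "AE x in lebesgue_on U. u x = v x"
 shows "L2_on U v"
proof -
 have S: "U \<in> sets lebesgue" using op by (simp add: borel_open)
 have "AE x in lebesgue_on U. (norm (u x))^2 = (norm (v x))^2" using ae by eventually_elim simp
 from integral_lebesgue_on_cong(2)[OF S this] show ?thesis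
  using u measurable_lebesgue_on_AE[OF S _ ae] unfolding L2_on_def by auto
qed

lemma has_weak_pderiv_AE:
 fixes u :: "real^'n => 'b::euclidean_space"
 assumes op: "open U" and w: "has_weak_pderiv U k u g" and ae: "AE x in lebesgue_on U. u x = v x"
 shows "has_weak_pderiv U k v g"
proof -
 have S: "U \<in> sets lebesgue" using op by (simp add: borel_open)
 have ae': "AE x in lebesgue. x \<in> U --> u x = v x" using ae S by (subst (asm) AE_restrict_space_iff) auto
 have "integrable (lebesgue_on K) v" if K: "compact K" "K \<subseteq> U" for K
 proof -
  have KL: "K \<in> sets lebesgue" using K by (simp add: borel_compact)
  have "AE x in lebesgue_on K. u x = v x"
   using ae' K KL by (subst AE_restrict_space_iff) (auto elim!: eventually_mono)
  from integral_lebesgue_on_cong(2)[OF KL this] show ?thesis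
   using w K unfolding has_weak_pderiv_def loc_integrable_def by blast
 qed
 moreover have "(LINT x|lebesgue_on U. pderiv_at k \<phi> x *R v x) = (LINT x|lebesgue_on U. pderiv_at k \<phi> x *R u x)" for \<phi>
 proof (rule integral_lebesgue_on_cong(1)[OF S])
  show "AE x in lebesgue_on U. pderiv_at k \<phi> x *R v x = pderiv_at k \<phi> x *R u x" using ae by eventually_elim simp
 qed
 ultimately show ?thesis using w unfolding has_weak_pderiv_def loc_integrable_def by auto
qed

text \<open>The choice in \<open>weak_pderiv\<close> picks some weak derivative, not necessarily the
  square integrable one that \<open>H1\<close> provides; uniqueness up to null sets transfers the
  integrability.\<close>

lemma H1_weak_pderiv:
 assumes op: "open U" and u: "H1 U u"
 shows "has_weak_pderiv U k u (weak_pderiv U k u)" "L2_on U (weak_pderiv U k u)"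
proof -
 obtain g where g: "has_weak_pderiv U k u g" "L2_on U g" using u unfolding H1_def by blast
 show w: "has_weak_pderiv U k u (weak_pderiv U k u)" unfolding weak_pderiv_def by (rule someI[of _ g]) (rule g)
 show "L2_on U (weak_pderiv U k u)" by (rule L2_on_AE[OF op g(2) weak_pderiv_unique[OF op g(1) w]])
qed

lemma H2_H1:
 assumes op: "open U" and u: "H2 U u"
 shows "H1 U u" "H1 U (weak_pderiv U k u)"
proof -
 show h: "H1 U u" using u unfolding H2_def H1_def by blast
 obtain g where g: "has_weak_pderiv U k u g" "H1 U g" using u unfolding H2_def by blast
 note ae = weak_pderiv_unique[OF op g(1) H1_weak_pderiv(1)[OF op h]]
 show "H1 U (weak_pderiv U k u)"
  using g(2) L2_on_AE[OF op _ ae] has_weak_pderiv_AE[OF op _ ae] unfolding H1_def by blast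
qed

section \<open>Sobolev inequality and Green's formula for weak derivatives\<close>

lemma L2_on_diff:
 assumes u: "L2_on U u" and v: "L2_on U v" shows "L2_on U (%x. u x - v x)"
 unfolding L2_on_def
proof (intro conjI)
 have m[measurable]: "u \<in> borel_measurable (lebesgue_on U)" "v \<in> borel_measurable (lebesgue_on U)"
  and i: "integrable (lebesgue_on U) (%x. (norm (u x))^2)" "integrable (lebesgue_on U) (%x. (norm (v x))^2)"
  using u v unfolding L2_on_def by auto
 show "(%x. u x - v x) \<in> borel_measurable (lebesgue_on U)" by measurable
 show "integrable (lebesgue_on U) (%x. (norm (u x - v x))^2)"
 proof (rule Bochner_Integration.integrable_bound)
  show "integrable (lebesgue_on U) (%x. 2 * ((norm (u x))^2 + (norm (v x))^2))" using i by simp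
  have "(norm (a - b))^2 <= 2 * ((norm a)^2 + (norm b)^2)" for a b :: 'b
  proof -
   have "(norm (a - b))^2 <= (norm a + norm b)^2" by (intro power_mono norm_triangle_ineq4) simp
   also have "... <= 2 * ((norm a)^2 + (norm b)^2)" using sum_squares_bound[of "norm a" "norm b"] by (simp add: power2_sum)
   finally show ?thesis .
  qed
  then show "AE x in lebesgue_on U. norm ((norm (u x - v x))^2) <= norm (2 * ((norm (u x))^2 + (norm (v x))^2))" by simp
 qed measurable
qed

lemma L2_on_cscale:
 fixes u :: "real^'n => 'b::euclidean_space"
 assumes u: "L2_on U u" shows "L2_on U (%x. c *R u x)"
 using u unfolding L2_on_def by (auto simp: power_mult_distrib)

lemma L2_on_zero: "L2_on U (%x. 0)"
 unfolding L2_on_def by simp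

lemma L2_on_add:
 fixes u :: "real^'n => 'b::euclidean_space"
 assumes u: "L2_on U u" and v: "L2_on U v" shows "L2_on U (%x. u x + v x)"
 using L2_on_diff[OF u L2_on_cscale[OF v, of "-1"]] by simp

lemma L2_on_sum:
 fixes u :: "'a => real^'n => 'b::euclidean_space"
 assumes "!!i. i \<in> I ==> L2_on U (u i)" shows "L2_on U (%x. \<Sum>i\<in>I. u i x)"
 using assms by (induction I rule: infinite_finite_induct) (auto intro: L2_on_zero L2_on_add)

lemma L2_on_inner_integrable:
 fixes u :: "real^'n => 'b::euclidean_space"
 assumes u: "L2_on U u" and v: "L2_on U v" shows "integrable (lebesgue_on U) (%x. u x \<bullet> v x)"
proof (rule Bochner_Integration.integrable_bound)
 have [measurable]: "u \<in> borel_measurable (lebesgue_on U)" "v \<in> borel_measurable (lebesgue_on U)"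
  and i: "integrable (lebesgue_on U) (%x. (norm (u x))^2)" "integrable (lebesgue_on U) (%x. (norm (v x))^2)"
  using u v unfolding L2_on_def by auto
 show "integrable (lebesgue_on U) (%x. (norm (u x))^2 + (norm (v x))^2)" using i by simp
 have "\<bar>a \<bullet> b\<bar> <= (norm a)^2 + (norm b)^2" for a b :: 'b
 proof -
  have "\<bar>a \<bullet> b\<bar> <= norm a * norm b" by (rule Cauchy_Schwarz_ineq2)
  also have "... <= (norm a)^2 + (norm b)^2"
   using sum_squares_bound[of "norm a" "norm b"] mult_nonneg_nonneg[OF norm_ge_zero[of a] norm_ge_zero[of b]] by linarith
  finally show ?thesis .
 qed
 then show "AE x in lebesgue_on U. norm (u x \<bullet> v x) <= norm ((norm (u x))^2 + (norm (v x))^2)" by simp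
 show "(%x. u x \<bullet> v x) \<in> borel_measurable (lebesgue_on U)" by measurable
qed

lemma L2_on_component:
 fixes u :: "real^'n => 'b::euclidean_space"
 assumes u: "L2_on U u" and b: "b \<in> Basis"
 shows "L2_on U (%x. u x \<bullet> b)" and "L2_norm U (%x. u x \<bullet> b) <= L2_norm U u"
proof -
 have [measurable]: "u \<in> borel_measurable (lebesgue_on U)" and i: "integrable (lebesgue_on U) (%x. (norm (u x))^2)"
  using u unfolding L2_on_def by auto
 have le: "(norm (u x \<bullet> b))^2 <= (norm (u x))^2" for x
  using Basis_le_norm[OF b, of "u x"] by (intro power_mono) auto
 have i2: "integrable (lebesgue_on U) (%x. (norm (u x \<bullet> b))^2)"
  by (rule Bochner_Integration.integrable_bound[OF i]) (use le in auto)
 then show "L2_on U (%x. u x \<bullet> b)" unfolding L2_on_def by simp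
 show "L2_norm U (%x. u x \<bullet> b) <= L2_norm U u"
  unfolding L2_norm_def by (intro real_sqrt_le_mono integral_mono[OF i2 i] le)
qed

lemma continuous_L2_on:
 fixes u :: "real^'n => 'b::euclidean_space"
 assumes op: "open U" and bd: "bounded U" and u: "continuous_on UNIV u" shows "L2_on U u"
proof -
 have "compact (u ` closure U)"
  using u bd by (intro compact_continuous_image) (auto intro: continuous_on_subset)
 then have "bounded (u ` closure U)" by (rule compact_imp_bounded)
 then obtain B where B: "!!x. x \<in> closure U ==> norm (u x) <= B"
  unfolding bounded_iff by blast
 have O: "U \<in> sets lebesgue" using op by (simp add: borel_open)
 have m: "u \<in> borel_measurable (lebesgue_on U)"
  using borel_measurable_continuous_onI[OF u] by (intro measurable_restrict_space1) (simp add: measurable_completion)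
 have fin: "finite_measure (lebesgue_on U)"
  using bd O by (simp add: finite_measure_lebesgue_on bounded_set_imp_lmeasurable)
 interpret finite_measure "lebesgue_on U" by (rule fin)
 have "integrable (lebesgue_on U) (%x. (norm (u x))^2)"
 proof (rule integrable_const_bound[of _ "B^2"])
  have "norm ((norm (u x))^2) <= B^2" if "x \<in> U" for x
  proof -
   have "norm (u x) <= B" using B that closure_subset by blast
   then show ?thesis by (simp add: power_mono)
  qed
  then show "AE x in lebesgue_on U. norm ((norm (u x))^2) <= B^2"
   by (intro AE_I2) (simp add: space_restrict_space)
 qed (use m in measurable)
 then show ?thesis using m unfolding L2_on_def by simp
qed

text \<open>Entry point to the \<open>wgrad\<close> results. On a bounded set square integrability
  implies integrability, so the Borel representatives satisfy all its requirements.\<close>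

lemma L2_on_wgrad:
 fixes u :: "real^'n => real"
 assumes op: "open U" and bd: "bounded U" and u: "L2_on U u"
  and g: "!!k. has_weak_pderiv U k u (g k)" "!!k. L2_on U (g k)"
 obtains f G where "wgrad U f G" "AE x in lebesgue_on U. u x = f x" "\<forall>k. AE x in lebesgue_on U. g k x = G x $ k"
proof -
 have OB: "U \<in> sets borel" using op by simp
 have rep: "\<exists>f. f \<in> borel_measurable borel \<and> (\<forall>x. x \<notin> U --> f x = 0) \<and> (AE x in lebesgue_on U. v x = f x) \<and> integrable lborel f \<and> integrable lborel (%x. (f x)^2)"
  if v: "L2_on U v" for v :: "real^'n => real"
 proof -
  have vm: "v \<in> borel_measurable (lebesgue_on U)" and vi: "integrable (lebesgue_on U) (%x. (norm (v x))^2)"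
   using v unfolding L2_on_def by auto
  obtain f where f[measurable]: "f \<in> borel_measurable borel" and z: "\<forall>x. x \<notin> U --> f x = 0" and ae: "AE x in lebesgue_on U. v x = f x"
   by (rule borel_representative[OF OB vm])
  have i2: "integrable lborel (%x. (f x)^2)"
  proof (rule lborel_transfer(2)[OF OB, THEN iffD1])
   show "AE x in lebesgue_on U. (norm (v x))^2 = (f x)^2" using ae by eventually_elim simp
  qed (use z vi in auto)
  have "integrable lborel f"
  proof (rule Bochner_Integration.integrable_bound)
   have "integrable lborel (indicator U :: real^'n => real)"
    using OB bd by (intro integrable_real_indicator) (auto simp: emeasure_bounded_finite[unfolded infinity_ennreal_def])
   then show "integrable lborel (%x. indicator U x + (f x)^2)" using i2 by (rule Bochner_Integration.integrable_add)
   have "\<bar>t\<bar> <= 1 + t^2" for t :: real using sum_squares_bound[of "\<bar>t\<bar>" 1] by (simp add: power2_eq_square)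
   then show "AE x in lborel. norm (f x) <= norm (indicator U x + (f x)^2)"
    using z by (intro AE_I2) (auto simp: indicator_def)
  qed simp
  then show ?thesis using f z ae i2 by blast
 qed
 obtain f where f[measurable]: "f \<in> borel_measurable borel" and fz: "\<forall>x. x \<notin> U --> f x = 0" and fae: "AE x in lebesgue_on U. u x = f x"
  and fi: "integrable lborel f" "integrable lborel (%x. (f x)^2)"
  using rep[OF u] by blast
 have "\<exists>G. \<forall>k. G k \<in> borel_measurable borel \<and> (\<forall>x. x \<notin> U --> G k x = 0) \<and> (AE x in lebesgue_on U. g k x = G k x) \<and> integrable lborel (G k) \<and> integrable lborel (%x. (G k x)^2)"
  using rep[OF g(2)] by (intro choice allI)
 then obtain G where G: "!!k. G k \<in> borel_measurable borel" "!!k x. x \<notin> U ==> G k x = 0" "!!k. AE x in lebesgue_on U. g k x = G k x"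
  "!!k. integrable lborel (G k)" "!!k. integrable lborel (%x. (G k x)^2)" by blast
 let ?G = "%x. (\<chi> k. G k x) :: real^'n"
 have Gs: "?G = (%x. \<Sum>k\<in>UNIV. G k x *R axis k 1)"
  by (auto simp: vec_eq_iff axis_def if_distrib cong: if_cong)
 have iG: "integrable lborel ?G" unfolding Gs using G(4) by simp
 show ?thesis
 proof (rule that[of f ?G])
  show "wgrad U f ?G" unfolding wgrad_def
  proof (intro conjI allI impI fi iG)
   have "(norm (?G x))^2 = (\<Sum>k\<in>UNIV. (G k x)^2)" for x
    by (simp add: norm_vec_def L2_set_def sum_nonneg)
   then show "integrable lborel (%x. (norm (?G x))^2)" using G(5) by simp
   show "f x = 0" "?G x = 0" if "x \<notin> U" for x using that fz G(2) by (auto simp: vec_eq_iff)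
   fix \<phi> \<phi>' assume "test_function U \<phi> \<and> C1 \<phi> \<phi>'"
   then have t: "test_function U \<phi>" and p: "C1 \<phi> \<phi>'" by auto
   obtain K where K: "compact K" "K \<subseteq> U" "\<forall>x. x \<notin> K --> \<phi> x = 0 \<and> (\<forall>k. pderiv_at k \<phi> x = 0)"
    "continuous_on UNIV \<phi>" "\<forall>k. continuous_on UNIV (pderiv_at k \<phi>)" by (rule test_function_support[OF t])
   obtain R where R: "!!x. x \<in> K ==> norm x <= R" using compact_imp_bounded[OF K(1)] unfolding bounded_iff by blast
   have z1: "\<phi> x = 0" "\<phi>' x = 0" if "norm x > R" for x
    using that R[of x] K(3) C1_pderiv_at[OF p] by (force simp: vec_eq_iff)+
   obtain B1 where B1: "!!x. norm (\<phi> x) <= B1" using compact_support_bounded[OF C1_cont[OF p] z1(1)] by metis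
   obtain B2 where B2: "!!x. norm (\<phi>' x) <= B2" using compact_support_bounded[OF C1_cont_grad[OF p] z1(2)] by metis
   have i1: "integrable lborel (%x. f x *R \<phi>' x)"
    by (rule integrable_bounded_scale[OF fi(1) _ B2]) (use C1_borel_grad[OF p] in simp)
   have i2: "integrable lborel (%x. G k x *R \<phi> x)" for k
    by (rule integrable_bounded_scale[OF G(4) _ B1]) (use C1_borel[OF p] in simp)
   have "\<phi> x *R ?G x = (\<Sum>k\<in>UNIV. (G k x *R \<phi> x) *R axis k 1)" for x
    by (auto simp: vec_eq_iff axis_def if_distrib cong: if_cong)
   then have i3: "integrable lborel (%x. \<phi> x *R ?G x)" using i2 by simp
   show "(LBINT x. f x *R \<phi>' x) = - (LBINT x. \<phi> x *R ?G x)"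
   proof (subst vec_eq_iff, intro allI)
    fix k
    have "(LBINT x. f x *R \<phi>' x) $ k = (LBINT x. (f x *R \<phi>' x) $ k)"
     by (rule integral_bounded_linear[OF bounded_linear_vec_nth i1, symmetric])
    also have "... = (LINT x|lebesgue_on U. pderiv_at k \<phi> x *R u x)"
    proof (rule lborel_transfer(1)[OF OB, symmetric])
     show "AE x in lebesgue_on U. pderiv_at k \<phi> x *R u x = (f x *R \<phi>' x) $ k"
      using fae by eventually_elim (simp add: C1_pderiv_at[OF p])
     show "(%x. (f x *R \<phi>' x) $ k) \<in> borel_measurable borel" using C1_borel_grad[OF p] f by simp
    qed (use fz in auto)
    also have "... = - (LINT x|lebesgue_on U. \<phi> x *R g k x)" using g(1)[of k] t unfolding has_weak_pderiv_def by blast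
    also have "(LINT x|lebesgue_on U. \<phi> x *R g k x) = (LBINT x. (\<phi> x *R ?G x) $ k)"
    proof (rule lborel_transfer(1)[OF OB])
     show "AE x in lebesgue_on U. \<phi> x *R g k x = (\<phi> x *R ?G x) $ k"
      using G(3)[of k] by eventually_elim simp
     show "(%x. (\<phi> x *R ?G x) $ k) \<in> borel_measurable borel" using C1_borel[OF p] G(1) by simp
    qed (use G(2) in auto)
    also have "... = (LBINT x. \<phi> x *R ?G x) $ k"
     by (rule integral_bounded_linear[OF bounded_linear_vec_nth i3])
    finally show "(LBINT x. f x *R \<phi>' x) $ k = (- (LBINT x. \<phi> x *R ?G x)) $ k" by simp
   qed
  qed
  show "AE x in lebesgue_on U. u x = f x" by (rule fae)
  show "\<forall>k. AE x in lebesgue_on U. g k x = ?G x $ k" using G(3) by simp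
 qed
qed

lemma sum_cubes_bound:
 fixes a :: "'a => real"
 assumes "finite I" "!!i. i \<in> I ==> a i >= 0"
 shows "(\<Sum>i\<in>I. a i)^3 <= real (card I)^3 * (\<Sum>i\<in>I. (a i)^3)"
proof (cases "I = {}")
 case False
 define m where "m = Max (a ` I)"
 have le: "a i <= m" if "i \<in> I" for i unfolding m_def using assms(1) that by simp
 have "m \<in> a ` I" unfolding m_def using assms(1) False by (intro Max_in) auto
 then obtain j where j: "j \<in> I" "m = a j" by blast
 have "(\<Sum>i\<in>I. a i) <= real (card I) * m" using sum_bounded_above[of I a m] le by simp
 then have "(\<Sum>i\<in>I. a i)^3 <= (real (card I) * m)^3" using assms by (intro power_mono sum_nonneg) auto
 also have "... = real (card I)^3 * (a j)^3" by (simp add: power_mult_distrib j)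
 also have "... <= real (card I)^3 * (\<Sum>i\<in>I. (a i)^3)"
  using assms j by (intro mult_left_mono member_le_sum[of j I "%i. (a i)^3"]) auto
 finally show ?thesis .
qed simp

theorem sobolev_weak:
 fixes U :: "(real^'n) set"
 assumes card: "CARD('n) = 2 \<or> CARD('n) = 3" and op: "open U" and bd: "bounded U" and C2: "C2_boundary U"
 obtains C where "C >= 0" "\<forall>(u :: real^'n => 'b::euclidean_space) g. L2_on U u --> (\<forall>k. has_weak_pderiv U k u (g k)) --> (\<forall>k. L2_on U (g k)) -->
  integrable (lebesgue_on U) (%x. (norm (u x))^6) \<and>
  (LINT x|lebesgue_on U. (norm (u x))^6) <= C * ((LINT x|lebesgue_on U. (norm (u x))^2) + (\<Sum>k\<in>UNIV. LINT x|lebesgue_on U. (norm (g k x))^2))^3"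
proof -
 have OB: "U \<in> sets borel" using op by simp
 obtain C where C: "C >= 0" and S: "\<forall>f g. wgrad U f g --> integrable lborel (%x. (f x)^6) \<and>
  (LBINT x. (f x)^6) <= C * H1_mass f g^3"
  by (rule sobolev[OF card op bd C2]) (rule that)
 define d where "d = real DIM('b)"
 show ?thesis
 \<comment> \<open>The factor d^3 compares the cube of a sum of d squares with the sum of their
   cubes; d C comes from adding the scalar inequality over the d components.\<close>
 proof (rule that[of "d^3 * (d * C)"], goal_cases)
  case 1 show ?case using C by (simp add: d_def)
 next
  case 2 show ?case
  proof (intro allI impI)
   fix u :: "real^'n => 'b" and g
   assume u: "L2_on U u" and w: "\<forall>k. has_weak_pderiv U k u (g k)" and g: "\<forall>k. L2_on U (g k)"
   let ?N = "(LINT x|lebesgue_on U. (norm (u x))^2) + (\<Sum>k\<in>UNIV. LINT x|lebesgue_on U. (norm (g k x))^2)"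
   have comp: "integrable (lebesgue_on U) (%x. (u x \<bullet> b)^6) \<and> (LINT x|lebesgue_on U. (u x \<bullet> b)^6) <= C * ?N^3"
    if b: "b \<in> Basis" for b
   proof -
    obtain f G where fG: "wgrad U f G" and fa: "AE x in lebesgue_on U. u x \<bullet> b = f x"
     and ga: "\<forall>k. AE x in lebesgue_on U. g k x \<bullet> b = G x $ k"
     by (rule L2_on_wgrad[OF op bd L2_on_component(1)[OF u b] has_weak_pderiv_inner[OF op w[rule_format]] L2_on_component(1)[OF g[rule_format] b]]) (rule that)
    have fz: "!!x. x \<notin> U ==> f x = 0" "!!x. x \<notin> U ==> G x = 0" and fi: "integrable lborel f" "integrable lborel G" "integrable lborel (%x. (norm (G x))^2)"
     using fG unfolding wgrad_def by auto
    have [measurable]: "f \<in> borel_measurable borel" "G \<in> borel_measurable borel" using fi by auto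
    have mk: "(%x. G x $ k) \<in> borel_measurable borel" for k by measurable
    have a6: "AE x in lebesgue_on U. (u x \<bullet> b)^6 = (f x)^6" using fa by eventually_elim simp
    have a2: "AE x in lebesgue_on U. (u x \<bullet> b)^2 = (f x)^2" using fa by eventually_elim simp
    have ag: "AE x in lebesgue_on U. (g k x \<bullet> b)^2 = (G x $ k)^2" for k using ga[rule_format, of k] by eventually_elim simp
    have t6: "(LINT x|lebesgue_on U. (u x \<bullet> b)^6) = (LBINT x. (f x)^6)" "integrable (lebesgue_on U) (%x. (u x \<bullet> b)^6) \<longleftrightarrow> integrable lborel (%x. (f x)^6)"
     by (rule lborel_transfer[OF OB _ _ a6]; use fz in simp)+
    have t2: "(LINT x|lebesgue_on U. (u x \<bullet> b)^2) = (LBINT x. (f x)^2)"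
     by (rule lborel_transfer(1)[OF OB _ _ a2]; use fz in simp)
    have tg: "(LINT x|lebesgue_on U. (g k x \<bullet> b)^2) = (LBINT x. (G x $ k)^2)" for k
     by (rule lborel_transfer(1)[OF OB _ _ ag]; use fz mk in simp)
    have L2b: "(LINT x|lebesgue_on U. (v x \<bullet> b)^2) <= (LINT x|lebesgue_on U. (norm (v x))^2)" if v: "L2_on U v" for v :: "real^'n => 'b"
    proof (rule integral_mono)
     show "integrable (lebesgue_on U) (%x. (v x \<bullet> b)^2)" using L2_on_component(1)[OF v b] unfolding L2_on_def by simp
     show "integrable (lebesgue_on U) (%x. (norm (v x))^2)" using v unfolding L2_on_def by simp
     show "(v x \<bullet> b)^2 <= (norm (v x))^2" for x using Basis_le_norm[OF b, of "v x"] by (simp add: abs_le_square_iff[symmetric])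
    qed
    have iGk: "integrable lborel (%x. (G x $ k)^2)" for k
    proof (rule Bochner_Integration.integrable_bound[OF fi(3)])
     show "AE x in lborel. norm ((G x $ k)^2) <= norm ((norm (G x))^2)"
      using component_le_norm_cart[of "G _" k] by (intro AE_I2) (simp add: abs_le_square_iff[symmetric])
    qed (use mk in simp)
    have "(LBINT x. (norm (G x))^2) = (LBINT x. (\<Sum>k\<in>UNIV. (G x $ k)^2))"
     by (intro Bochner_Integration.integral_cong refl) (simp add: norm_vec_def L2_set_def sum_nonneg)
    also have "... = (\<Sum>k\<in>UNIV. LBINT x. (G x $ k)^2)" using iGk by simp
    also have "... = (\<Sum>k\<in>UNIV. LINT x|lebesgue_on U. (g k x \<bullet> b)^2)" by (simp add: tg)
    moreover have "(\<Sum>k\<in>UNIV. LINT x|lebesgue_on U. (g k x \<bullet> b)^2) <= (\<Sum>k\<in>UNIV. LINT x|lebesgue_on U. (norm (g k x))^2)"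
     using g by (intro sum_mono L2b) simp
    ultimately have "(LBINT x. (f x)^2) + (LBINT x. (norm (G x))^2) <= ?N"
     using L2b[OF u] by (simp add: t2)
    moreover have "(LBINT x. (f x)^2) + (LBINT x. (norm (G x))^2) >= 0"
     by (intro add_nonneg_nonneg integral_nonneg_AE) auto
    ultimately have "((LBINT x. (f x)^2) + (LBINT x. (norm (G x))^2))^3 <= ?N^3" by (intro power_mono)
    then have "C * ((LBINT x. (f x)^2) + (LBINT x. (norm (G x))^2))^3 <= C * ?N^3" using C by (rule mult_left_mono)
    then show ?thesis using S[rule_format, OF fG] by (simp add: t6 H1_mass_def)
   qed
   have pt: "(norm (u x))^6 <= d^3 * (\<Sum>b\<in>Basis. (u x \<bullet> b)^6)" for x
   proof -
    have "(norm (u x))^6 = ((norm (u x))^2)^3" by simp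
    also have "(norm (u x))^2 = (\<Sum>b\<in>Basis. (u x \<bullet> b)^2)"
     by (simp add: norm_eq_sqrt_inner euclidean_inner[of "u x" "u x"] power2_eq_square sum_nonneg)
    also have "(\<Sum>b\<in>Basis. (u x \<bullet> b)^2)^3 <= d^3 * (\<Sum>b\<in>Basis. ((u x \<bullet> b)^2)^3)"
     unfolding d_def by (rule sum_cubes_bound) auto
    finally show ?thesis by simp
   qed
   have iS: "integrable (lebesgue_on U) (%x. d^3 * (\<Sum>b\<in>Basis. (u x \<bullet> b)^6))"
    using comp by (intro integrable_mult_right Bochner_Integration.integrable_sum) auto
   have i6: "integrable (lebesgue_on U) (%x. (norm (u x))^6)"
   proof (rule Bochner_Integration.integrable_bound[OF iS])
    have "u \<in> borel_measurable (lebesgue_on U)" using u unfolding L2_on_def by simp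
    then show "(%x. (norm (u x))^6) \<in> borel_measurable (lebesgue_on U)" by measurable
    show "AE x in lebesgue_on U. norm ((norm (u x))^6) <= norm (d^3 * (\<Sum>b\<in>Basis. (u x \<bullet> b)^6))"
    proof (rule AE_I2)
     fix x show "norm ((norm (u x))^6) <= norm (d^3 * (\<Sum>b\<in>Basis. (u x \<bullet> b)^6))"
      using pt[of x] abs_ge_self[of "d^3 * (\<Sum>b\<in>Basis. (u x \<bullet> b)^6)"] by simp
    qed
   qed
   have "(LINT x|lebesgue_on U. (norm (u x))^6) <= (LINT x|lebesgue_on U. d^3 * (\<Sum>b\<in>Basis. (u x \<bullet> b)^6))"
    by (rule integral_mono[OF i6 iS pt])
   also have "... = d^3 * (\<Sum>b\<in>Basis. LINT x|lebesgue_on U. (u x \<bullet> b)^6)"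
    using comp by (subst Bochner_Integration.integral_mult_right_zero, subst Bochner_Integration.integral_sum) auto
   also have "... <= d^3 * (\<Sum>b\<in>(Basis :: 'b set). C * ?N^3)"
    using comp by (intro mult_left_mono sum_mono) (auto simp: d_def)
   also have "... = d^3 * (d * C) * ?N^3" by (simp add: d_def)
   finally show "integrable (lebesgue_on U) (%x. (norm (u x))^6) \<and> (LINT x|lebesgue_on U. (norm (u x))^6) <= d^3 * (d * C) * ?N^3"
    using i6 by simp
  qed
 qed
qed

section \<open>Green's formula in the limit of smooth fields\<close>

lemma L2_on_tendsto_inner:
 fixes h q :: "real^'n => real"
 assumes h: "L2_on U h" and q: "L2_on U q" and p: "!!m. L2_on U (p m)"
  and lim: "(%m. L2_norm U (%x. p m x - q x)) ----> 0"
 shows "(%m. LINT x|lebesgue_on U. h x * p m x) ----> (LINT x|lebesgue_on U. h x * q x)"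
proof (rule LIM_zero_cancel, rule tendsto_rabs_zero_cancel)
 have le: "\<bar>(LINT x|lebesgue_on U. h x * p m x) - (LINT x|lebesgue_on U. h x * q x)\<bar> <= L2_norm U h * L2_norm U (%x. p m x - q x)" for m
 proof -
  have d: "L2_on U (%x. p m x - q x)" by (rule L2_on_diff[OF p q])
  have "(LINT x|lebesgue_on U. h x * p m x) - (LINT x|lebesgue_on U. h x * q x) = (LINT x|lebesgue_on U. h x * (p m x - q x))"
   unfolding right_diff_distrib
   using L2_on_inner_integrable[OF h p] L2_on_inner_integrable[OF h q] by (intro Bochner_Integration.integral_diff[symmetric]) auto
  moreover have "(LINT x|lebesgue_on U. h x * (p m x - q x))^2 <= (LINT x|lebesgue_on U. (h x)^2) * (LINT x|lebesgue_on U. (p m x - q x)^2)"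
   using h d unfolding L2_on_def by (intro integral_Cauchy_Schwarz(3)) auto
  moreover have "... = (L2_norm U h * L2_norm U (%x. p m x - q x))^2"
   unfolding L2_norm_def power_mult_distrib by (simp add: integral_nonneg_AE)
  moreover have "0 <= L2_norm U h * L2_norm U (%x. p m x - q x)" unfolding L2_norm_def by (simp add: integral_nonneg_AE)
  ultimately show ?thesis by (simp add: power2_le_iff_abs_le)
 qed
 show "(%m. \<bar>(LINT x|lebesgue_on U. h x * p m x) - (LINT x|lebesgue_on U. h x * q x)\<bar>) ----> 0"
  by (rule tendsto_sandwich[OF _ _ tendsto_const tendsto_mult_right_zero[OF lim, of "L2_norm U h"]]) (use le in auto)
qed

text \<open>Here \<open>a k\<close> and \<open>c k\<close> are the L^2 limits of the field
  components and of their diagonal derivatives. The defect converges to the sum in the conclusion,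
  while \<open>ibp_bound\<close> forces it to 0.\<close>

proposition ibp_limit:
 fixes U :: "(real^'n) set" and \<phi> :: "nat => 'n => real^'n => real"
 assumes card: "CARD('n) >= 2" and op: "open U" and bd: "bounded U" and C2: "C2_boundary U"
  and w: "L2_on U w" "!!k. has_weak_pderiv U k w (dw k)" "!!k. L2_on U (dw k)"
  and a: "!!k. L2_on U (a k)" and c: "!!k. L2_on U (c k)"
  and ph: "!!m k. C1 (\<phi> m k) (\<phi>' m k)"
  and la: "!!k. (%m. L2_norm U (%x. \<phi> m k x - a k x)) ----> 0"
  and lc: "!!k. (%m. L2_norm U (%x. \<phi>' m k x $ k - c k x)) ----> 0"
  and G: "tangential U G" and lG: "(%m. bdry_mass U (\<phi> m) G) ----> 0"
 shows "(\<Sum>k\<in>UNIV. (LINT x|lebesgue_on U. w x * c k x) + (LINT x|lebesgue_on U. dw k x * a k x)) = 0"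
proof -
 have OB: "U \<in> sets borel" using op by simp
 obtain f Gr where fG: "wgrad U f Gr" and fa: "AE x in lebesgue_on U. w x = f x" and ga: "\<forall>k. AE x in lebesgue_on U. dw k x = Gr x $ k"
  by (rule L2_on_wgrad[OF op bd w]) (rule that)
 have fz: "!!x. x \<notin> U ==> f x = 0" "!!x. x \<notin> U ==> Gr x = 0" and [measurable]: "f \<in> borel_measurable borel" "Gr \<in> borel_measurable borel"
  using fG unfolding wgrad_def by auto
 have p2: "L2_on U (\<phi> m k)" "L2_on U (%x. \<phi>' m k x $ k)" for m k
  by (auto intro!: continuous_L2_on[OF op bd] C1_cont[OF ph] continuous_on_component C1_cont_grad[OF ph])
 define J where "J m = (\<Sum>k\<in>UNIV. (LINT x|lebesgue_on U. w x * \<phi>' m k x $ k) + (LINT x|lebesgue_on U. dw k x * \<phi> m k x))" for m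
 have J: "ibp f Gr (\<phi> m) (\<phi>' m) = J m" for m
  unfolding ibp_def J_def
 proof (rule sum.cong[OF refl])
  fix k
  have "(LBINT x. f x * \<phi>' m k x $ k + \<phi> m k x * Gr x $ k) = (LINT x|lebesgue_on U. w x * \<phi>' m k x $ k + dw k x * \<phi> m k x)"
  proof (rule lborel_transfer(1)[OF OB, symmetric])
   show "AE x in lebesgue_on U. w x * \<phi>' m k x $ k + dw k x * \<phi> m k x = f x * \<phi>' m k x $ k + \<phi> m k x * Gr x $ k"
    using fa ga[rule_format, of k] by eventually_elim simp
   have [measurable]: "\<phi> m k \<in> borel_measurable borel" "\<phi>' m k \<in> borel_measurable borel" by (rule C1_borel[OF ph] C1_borel_grad[OF ph])+
   show "(%x. f x * \<phi>' m k x $ k + \<phi> m k x * Gr x $ k) \<in> borel_measurable borel" by measurable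
  qed (use fz in auto)
  also have "... = (LINT x|lebesgue_on U. w x * \<phi>' m k x $ k) + (LINT x|lebesgue_on U. dw k x * \<phi> m k x)"
   using L2_on_inner_integrable[OF w(1) p2(2)] L2_on_inner_integrable[OF w(3) p2(1)] by (intro Bochner_Integration.integral_add) auto
  finally show "(LBINT x. f x * \<phi>' m k x $ k + \<phi> m k x * Gr x $ k) = (LINT x|lebesgue_on U. w x * \<phi>' m k x $ k) + (LINT x|lebesgue_on U. dw k x * \<phi> m k x)" .
 qed
 obtain C where C: "C >= 0" and Cb: "\<forall>f g \<phi> \<phi>' G. wgrad U f g --> tangential U G --> (\<forall>k. C1 (\<phi> k) (\<phi>' k)) -->
    ennreal ((ibp f g \<phi> \<phi>')^2) <= ennreal (C * H1_mass f g) * bdry_mass U \<phi> G"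
  by (rule ibp_bound[OF card op bd C2]) (rule that)
 have le: "ennreal ((J m)^2) <= ennreal (C * H1_mass f Gr) * bdry_mass U (\<phi> m) G" for m
  unfolding J[symmetric] by (rule Cb[rule_format, OF fG G ph])
 have lim: "(%m. ennreal (C * H1_mass f Gr) * bdry_mass U (\<phi> m) G) ----> 0"
  using ennreal_tendsto_cmult[OF _ lG, of "ennreal (C * H1_mass f Gr)"] by simp
 have "(%m. ennreal ((J m)^2)) ----> 0"
  by (rule tendsto_sandwich[OF _ _ tendsto_const lim]) (use le in auto)
 then have "(%m. ennreal ((J m)^2)) ----> ennreal 0" by simp
 then have "(%m. (J m)^2) ----> 0" by (rule tendsto_ennrealD) auto
 from tendsto_real_sqrt[OF this] have "(%m. \<bar>J m\<bar>) ----> 0" by simp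
 then have J0: "J ----> 0" by (rule tendsto_rabs_zero_cancel)
 have "J ----> (\<Sum>k\<in>UNIV. (LINT x|lebesgue_on U. w x * c k x) + (LINT x|lebesgue_on U. dw k x * a k x))"
  unfolding J_def by (intro tendsto_sum tendsto_add L2_on_tendsto_inner w a c p2 la lc)
 then show ?thesis using J0 by (rule LIMSEQ_unique)
qed

lemma smooth_component:
 fixes \<psi> :: "real^'n => 'b::euclidean_space"
 assumes s: "smooth \<psi>"
 shows "C1 (%x. \<psi> x \<bullet> b) (%x. \<chi> k. pderiv_at k \<psi> x \<bullet> b)" and "continuous_on UNIV \<psi>" and "continuous_on UNIV (pderiv_at k \<psi>)"
proof -
 have "C_k (Suc 0) \<psi>" using s unfolding smooth_def by blast
 then obtain D where D: "!!x. (\<psi> has_derivative (%h. \<Sum>i\<in>UNIV. (h $ i) *R D i x)) (at x)" and Dc: "!!i. continuous_on UNIV (D i)"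
  by (auto simp del: One_nat_def)
 have pd: "pderiv_at k \<psi> x = D k x" for k x
 proof -
  have "frechet_derivative \<psi> (at x) = (%h. \<Sum>i\<in>UNIV. (h $ i) *R D i x)" using frechet_derivative_at[OF D[of x]] by simp
  then show ?thesis by (simp add: pderiv_at_def axis_def if_distrib[of "%t. t *R _"] cong: if_cong)
 qed
 show "continuous_on UNIV \<psi>" using has_derivative_continuous[OF D] by (intro continuous_at_imp_continuous_on) simp
 show "continuous_on UNIV (pderiv_at k \<psi>)" unfolding pd[abs_def] by (rule Dc)
 have "smooth (%x. \<psi> x \<bullet> b)" using s C_k_bounded_linear[OF bounded_linear_inner_left, of _ \<psi> b] unfolding smooth_def by blast
 from smooth_imp_C1[OF this] have c: "C1 (%x. \<psi> x \<bullet> b) (%x. \<chi> k. pderiv_at k (%x. \<psi> x \<bullet> b) x)" .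
 have "pderiv_at k (%x. \<psi> x \<bullet> b) x = pderiv_at k \<psi> x \<bullet> b" for k x
 proof -
  have "((%x. \<psi> x \<bullet> b) has_derivative (%h. (\<Sum>i\<in>UNIV. (h $ i) *R D i x) \<bullet> b)) (at x)"
   by (rule has_derivative_inner_left[OF D])
  from frechet_derivative_at[OF this] have "frechet_derivative (%x. \<psi> x \<bullet> b) (at x) = (%h. (\<Sum>i\<in>UNIV. (h $ i) *R D i x) \<bullet> b)" by simp
  then show ?thesis unfolding pd by (simp add: pderiv_at_def axis_def if_distrib[of "%t. t *R _"] cong: if_cong)
 qed
 then show "C1 (%x. \<psi> x \<bullet> b) (%x. \<chi> k. pderiv_at k \<psi> x \<bullet> b)" using c by simp
qed

lemma L2_norm_tendsto_component:
 fixes p :: "nat => real^'n => 'b::euclidean_space"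
 assumes p: "!!m. L2_on U (p m)" and q: "L2_on U q" and lim: "(%m. L2_norm U (%x. p m x - q x)) ----> 0" and b: "b \<in> Basis"
 shows "(%m. L2_norm U (%x. p m x \<bullet> b - q x \<bullet> b)) ----> 0"
proof (rule tendsto_sandwich[OF _ _ tendsto_const lim])
 show "\<forall>\<^sub>F m in sequentially. 0 <= L2_norm U (%x. p m x \<bullet> b - q x \<bullet> b)"
  unfolding L2_norm_def by (simp add: integral_nonneg_AE)
 show "\<forall>\<^sub>F m in sequentially. L2_norm U (%x. p m x \<bullet> b - q x \<bullet> b) <= L2_norm U (%x. p m x - q x)"
  using L2_on_component(2)[OF L2_on_diff[OF p q] b] by (simp add: inner_diff_left)
qed

text \<open>The smooth approximations are placed on the factor whose boundary behaviour is known.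
  Under the Dirichlet condition they approximate v, the comparison field is 0, and the weakly
  differentiable factor is a derivative of u; under the Neumann condition they approximate the
  gradient of u, the comparison field is its trace, and the weak factor is v.\<close>

theorem weak_green:
 fixes U :: "(real^'n) set" and u v :: "real^'n => 'b::euclidean_space"
 assumes card: "CARD('n) >= 2" and op: "open U" and bd: "bounded U" and C2: "C2_boundary U"
  and u: "H2 U u" "satisfies_bc U bc u" and v: "H2 U v" "satisfies_bc U bc v"
 shows "(LINT x|lebesgue_on U. weak_laplacian U u x \<bullet> v x) = - (LINT x|lebesgue_on U. weak_grad U u x \<bullet> weak_grad U v x)"
proof -
 have u1: "H1 U u" and v1: "H1 U v" and du1: "H1 U (weak_pderiv U k u)" for k
  using H2_H1[OF op] u v by auto
 have v2: "L2_on U v" and dv2: "L2_on U (weak_pderiv U k v)" and du2: "L2_on U (weak_pderiv U k u)"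
  and ddu2: "L2_on U (weak_pderiv U j (weak_pderiv U k u))" for j k
  using v1 H1_weak_pderiv(2)[OF op u1] H1_weak_pderiv(2)[OF op v1] H1_weak_pderiv(2)[OF op du1] unfolding H1_def by blast+
 note cmp = L2_on_component(1)
 have fr: "frontier U \<in> sets borel" by (simp add: borel_closed)
 let ?I = "%b k. (LINT x|lebesgue_on U. (weak_pderiv U k u x \<bullet> b) * (weak_pderiv U k v x \<bullet> b)) +
   (LINT x|lebesgue_on U. (weak_pderiv U k (weak_pderiv U k u) x \<bullet> b) * (v x \<bullet> b))"
 have main: "(\<Sum>k\<in>UNIV. ?I b k) = 0" if b: "b \<in> Basis" for b
 proof (cases bc)
  case Dirichlet
  then have tr: "has_trace U v (%_. 0)" using v(2) by simp
  then obtain \<psi> where s: "!!m. smooth (\<psi> m)" and l0: "(%m. L2_norm U (%x. \<psi> m x - v x)) ----> 0"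
   and l1: "!!k. (%m. L2_norm U (%x. pderiv_at k (\<psi> m) x - weak_pderiv U k v x)) ----> 0"
   and lb: "(%m. \<integral>\<^sup>+x. ennreal ((norm (\<psi> m x - 0))^2) \<partial>surface_measure U) ----> 0"
   unfolding has_trace_def by blast
  have p2: "L2_on U (\<psi> m)" "L2_on U (pderiv_at k (\<psi> m))" for m k
   using smooth_component(2,3)[OF s] by (auto intro: continuous_L2_on[OF op bd])
  have "?I b j = 0" for j
  proof -
   \<comment> \<open>The test field carries the component of v in direction j and is 0 in the other
     directions, so exactly one summand survives.\<close>
   let ?d = "%k. if k = j then 1 else (0::real)"
   have z0: "L2_norm U (%x. 0 :: real) = 0" by (simp add: L2_norm_def)
   have "(\<Sum>k\<in>UNIV. (LINT x|lebesgue_on U. (weak_pderiv U j u x \<bullet> b) * (?d k * (weak_pderiv U k v x \<bullet> b))) +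
    (LINT x|lebesgue_on U. (weak_pderiv U k (weak_pderiv U j u) x \<bullet> b) * (?d k * (v x \<bullet> b)))) = 0"
   proof (rule ibp_limit[OF card op bd C2, where \<phi> = "%m k x. ?d k * (\<psi> m x \<bullet> b)" and \<phi>' = "%m k x. ?d k *R (\<chi> i. pderiv_at i (\<psi> m) x \<bullet> b)" and G = "%k x. 0"])
    show "L2_on U (%x. weak_pderiv U j u x \<bullet> b)" by (rule cmp[OF du2 b])
    show "has_weak_pderiv U k (%x. weak_pderiv U j u x \<bullet> b) (%x. weak_pderiv U k (weak_pderiv U j u) x \<bullet> b)" for k
     by (rule has_weak_pderiv_inner[OF op H1_weak_pderiv(1)[OF op du1]])
    show "L2_on U (%x. weak_pderiv U k (weak_pderiv U j u) x \<bullet> b)" for k by (rule cmp[OF ddu2 b])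
    show "L2_on U (%x. ?d k * (v x \<bullet> b))" for k using L2_on_cscale[OF cmp[OF v2 b], of "?d k"] by (simp only: real_scaleR_def)
    show "L2_on U (%x. ?d k * (weak_pderiv U k v x \<bullet> b))" for k using L2_on_cscale[OF cmp[OF dv2 b], of "?d k"] by (simp only: real_scaleR_def)
    show "C1 (%x. ?d k * (\<psi> m x \<bullet> b)) (%x. ?d k *R (\<chi> i. pderiv_at i (\<psi> m) x \<bullet> b))" for m k
     by (rule C1_cmult[OF smooth_component(1)[OF s]])
    show "(%m. L2_norm U (%x. ?d k * (\<psi> m x \<bullet> b) - ?d k * (v x \<bullet> b))) ----> 0" for k
     using L2_norm_tendsto_component[OF p2(1) v2 l0 b] by (simp add: z0)
    show "(%m. L2_norm U (%x. (?d k *R (\<chi> i. pderiv_at i (\<psi> m) x \<bullet> b)) $ k - ?d k * (weak_pderiv U k v x \<bullet> b))) ----> 0" for k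
     using L2_norm_tendsto_component[OF p2(2) dv2 l1 b, of k] by (cases "k = j") (simp_all add: z0)
    show "tangential U (%k x. 0)" unfolding tangential_def by simp
    have le: "bdry_mass U (%k x. ?d k * (\<psi> m x \<bullet> b)) (%k x. 0) <= (\<integral>\<^sup>+x. ennreal ((norm (\<psi> m x - 0))^2) \<partial>surface_measure U)" for m
     unfolding bdry_mass_def
    proof (rule nn_integral_mono)
     fix x
     have "(\<Sum>k\<in>UNIV. ennreal ((?d k * (\<psi> m x \<bullet> b) - 0)^2)) = (\<Sum>k\<in>UNIV. if k = j then ennreal ((\<psi> m x \<bullet> b)^2) else 0)"
      by (intro sum.cong) auto
     also have "... = ennreal ((\<psi> m x \<bullet> b)^2)" by simp
     also have "... <= ennreal ((norm (\<psi> m x - 0))^2)"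
      using Basis_le_norm[OF b, of "\<psi> m x"] by (intro ennreal_leI) (simp add: abs_le_square_iff[symmetric])
     finally show "(\<Sum>k\<in>UNIV. ennreal ((?d k * (\<psi> m x \<bullet> b) - 0)^2)) <= ennreal ((norm (\<psi> m x - 0))^2)" .
    qed
    show "(%m. bdry_mass U (%k x. ?d k * (\<psi> m x \<bullet> b)) (%k x. 0)) ----> 0"
     by (rule tendsto_sandwich[OF _ _ tendsto_const lb]) (use le in auto)
   qed
   moreover have "(LINT x|lebesgue_on U. (weak_pderiv U j u x \<bullet> b) * (?d k * (weak_pderiv U k v x \<bullet> b))) +
    (LINT x|lebesgue_on U. (weak_pderiv U k (weak_pderiv U j u) x \<bullet> b) * (?d k * (v x \<bullet> b))) = (if k = j then ?I b j else 0)" for k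
    by simp
   ultimately show ?thesis by simp
  qed
  then show ?thesis by simp
 next
  case Neumann
  then obtain G where tr: "!!k. has_trace U (weak_pderiv U k u) (G k)" and
    nz: "AE x in surface_measure U. (\<Sum>k\<in>UNIV. (outward_unit_normal U x $ k) *R G k x) = 0"
   using u(2) by auto
  have "\<exists>\<psi>. (\<forall>m. smooth (\<psi> m)) \<and> ((%m. L2_norm U (%x. \<psi> m x - weak_pderiv U k u x)) ----> 0)
   \<and> (\<forall>i. (%m. L2_norm U (%x. pderiv_at i (\<psi> m) x - weak_pderiv U i (weak_pderiv U k u) x)) ----> 0)
   \<and> ((%m. \<integral>\<^sup>+x. ennreal ((norm (\<psi> m x - G k x))^2) \<partial>surface_measure U) ----> 0)" for k
   using tr[of k] unfolding has_trace_def by blast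
  then have "\<exists>\<psi>. \<forall>k. (\<forall>m. smooth (\<psi> k m)) \<and> ((%m. L2_norm U (%x. \<psi> k m x - weak_pderiv U k u x)) ----> 0)
   \<and> (\<forall>i. (%m. L2_norm U (%x. pderiv_at i (\<psi> k m) x - weak_pderiv U i (weak_pderiv U k u) x)) ----> 0)
   \<and> ((%m. \<integral>\<^sup>+x. ennreal ((norm (\<psi> k m x - G k x))^2) \<partial>surface_measure U) ----> 0)"
   by (intro choice allI)
  then obtain \<psi> where s: "!!k m. smooth (\<psi> k m)" and l0: "!!k. (%m. L2_norm U (%x. \<psi> k m x - weak_pderiv U k u x)) ----> 0"
   and l1: "!!k i. (%m. L2_norm U (%x. pderiv_at i (\<psi> k m) x - weak_pderiv U i (weak_pderiv U k u) x)) ----> 0"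
   and lb: "!!k. (%m. \<integral>\<^sup>+x. ennreal ((norm (\<psi> k m x - G k x))^2) \<partial>surface_measure U) ----> 0"
   by blast
  have p2: "L2_on U (\<psi> k m)" "L2_on U (pderiv_at i (\<psi> k m))" for m k i
   using smooth_component(2,3)[OF s] by (auto intro: continuous_L2_on[OF op bd])
  have Gm[measurable]: "G k \<in> borel_measurable (surface_measure U)" for k using tr[of k] unfolding has_trace_def by blast
  have [measurable]: "\<psi> k m \<in> borel_measurable (surface_measure U)" for k m
   by (rule continuous_surface_measurable[OF smooth_component(2)[OF s]])
  have "(\<Sum>k\<in>UNIV. (LINT x|lebesgue_on U. (v x \<bullet> b) * (weak_pderiv U k (weak_pderiv U k u) x \<bullet> b)) +
    (LINT x|lebesgue_on U. (weak_pderiv U k v x \<bullet> b) * (weak_pderiv U k u x \<bullet> b))) = 0"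
  proof (rule ibp_limit[OF card op bd C2, where \<phi> = "%m k x. \<psi> k m x \<bullet> b" and \<phi>' = "%m k x. \<chi> i. pderiv_at i (\<psi> k m) x \<bullet> b" and G = "%k x. G k x \<bullet> b"])
   show "L2_on U (%x. v x \<bullet> b)" by (rule cmp[OF v2 b])
   show "has_weak_pderiv U k (%x. v x \<bullet> b) (%x. weak_pderiv U k v x \<bullet> b)" for k
    by (rule has_weak_pderiv_inner[OF op H1_weak_pderiv(1)[OF op v1]])
   show "L2_on U (%x. weak_pderiv U k v x \<bullet> b)" for k by (rule cmp[OF dv2 b])
   show "L2_on U (%x. weak_pderiv U k u x \<bullet> b)" for k by (rule cmp[OF du2 b])
   show "L2_on U (%x. weak_pderiv U k (weak_pderiv U k u) x \<bullet> b)" for k by (rule cmp[OF ddu2 b])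
   show "C1 (%x. \<psi> k m x \<bullet> b) (%x. \<chi> i. pderiv_at i (\<psi> k m) x \<bullet> b)" for m k by (rule smooth_component(1)[OF s])
   show "(%m. L2_norm U (%x. \<psi> k m x \<bullet> b - weak_pderiv U k u x \<bullet> b)) ----> 0" for k
    by (rule L2_norm_tendsto_component[OF p2(1) du2 l0 b])
   show "(%m. L2_norm U (%x. (\<chi> i. pderiv_at i (\<psi> k m) x \<bullet> b) $ k - weak_pderiv U k (weak_pderiv U k u) x \<bullet> b)) ----> 0" for k
    using L2_norm_tendsto_component[OF p2(2) ddu2 l1 b, of k k] by simp
   have "AE x in surface_measure U. (\<Sum>k\<in>UNIV. outward_unit_normal U x $ k * (G k x \<bullet> b)) = 0"
    using nz
   proof eventually_elim
    case (elim x)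
    have "(\<Sum>k\<in>UNIV. outward_unit_normal U x $ k * (G k x \<bullet> b)) = (\<Sum>k\<in>UNIV. (outward_unit_normal U x $ k) *R G k x) \<bullet> b"
     by (simp add: inner_sum_left)
    then show ?case using elim by simp
   qed
   then show "tangential U (%k x. G k x \<bullet> b)" unfolding tangential_def by simp
   have le: "bdry_mass U (%k x. \<psi> k m x \<bullet> b) (%k x. G k x \<bullet> b) <= (\<Sum>k\<in>UNIV. \<integral>\<^sup>+x. ennreal ((norm (\<psi> k m x - G k x))^2) \<partial>surface_measure U)" for m
   proof -
    have "bdry_mass U (%k x. \<psi> k m x \<bullet> b) (%k x. G k x \<bullet> b) <= (\<integral>\<^sup>+x. (\<Sum>k\<in>UNIV. ennreal ((norm (\<psi> k m x - G k x))^2)) \<partial>surface_measure U)"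
     unfolding bdry_mass_def
    proof (rule nn_integral_mono, rule sum_mono, rule ennreal_leI)
     fix x k
     show "(\<psi> k m x \<bullet> b - G k x \<bullet> b)^2 <= (norm (\<psi> k m x - G k x))^2"
      using Basis_le_norm[OF b, of "\<psi> k m x - G k x"] by (simp add: abs_le_square_iff[symmetric] inner_diff_left)
    qed
    also have "... = (\<Sum>k\<in>UNIV. \<integral>\<^sup>+x. ennreal ((norm (\<psi> k m x - G k x))^2) \<partial>surface_measure U)"
     by (rule nn_integral_sum) measurable
    finally show ?thesis .
   qed
   have "(%m. \<Sum>k\<in>UNIV. \<integral>\<^sup>+x. ennreal ((norm (\<psi> k m x - G k x))^2) \<partial>surface_measure U) ----> (\<Sum>k\<in>(UNIV::'n set). 0)"
    by (intro tendsto_sum lb)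
   then have l: "(%m. \<Sum>k\<in>UNIV. \<integral>\<^sup>+x. ennreal ((norm (\<psi> k m x - G k x))^2) \<partial>surface_measure U) ----> 0" by simp
   show "(%m. bdry_mass U (%k x. \<psi> k m x \<bullet> b) (%k x. G k x \<bullet> b)) ----> 0"
    by (rule tendsto_sandwich[OF _ _ tendsto_const l]) (use le in auto)
  qed
  then show ?thesis by (simp add: add.commute mult.commute)
 qed
 have i1: "integrable (lebesgue_on U) (%x. (weak_pderiv U k u x \<bullet> b) * (weak_pderiv U k v x \<bullet> b))"
  and i2: "integrable (lebesgue_on U) (%x. (weak_pderiv U k (weak_pderiv U k u) x \<bullet> b) * (v x \<bullet> b))" if b: "b \<in> Basis" for b k
  using L2_on_inner_integrable[OF cmp[OF du2 b] cmp[OF dv2 b]] L2_on_inner_integrable[OF cmp[OF ddu2 b] cmp[OF v2 b]] by auto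
 have "(LINT x|lebesgue_on U. weak_grad U u x \<bullet> weak_grad U v x) =
  (LINT x|lebesgue_on U. (\<Sum>b\<in>Basis. \<Sum>k\<in>UNIV. (weak_pderiv U k u x \<bullet> b) * (weak_pderiv U k v x \<bullet> b)))"
 proof (rule Bochner_Integration.integral_cong[OF refl])
  fix x
  have "weak_grad U u x \<bullet> weak_grad U v x = (\<Sum>k\<in>UNIV. weak_pderiv U k u x \<bullet> weak_pderiv U k v x)"
   by (simp add: weak_grad_def inner_vec_def)
  also have "... = (\<Sum>k\<in>UNIV. \<Sum>b\<in>Basis. (weak_pderiv U k u x \<bullet> b) * (weak_pderiv U k v x \<bullet> b))"
   by (rule sum.cong[OF refl euclidean_inner])
  also have "... = (\<Sum>b\<in>Basis. \<Sum>k\<in>UNIV. (weak_pderiv U k u x \<bullet> b) * (weak_pderiv U k v x \<bullet> b))" by (rule sum.swap)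
  finally show "weak_grad U u x \<bullet> weak_grad U v x = ..." .
 qed
 also have "... = (\<Sum>b\<in>Basis. \<Sum>k\<in>UNIV. LINT x|lebesgue_on U. (weak_pderiv U k u x \<bullet> b) * (weak_pderiv U k v x \<bullet> b))"
  using i1 by (simp add: Bochner_Integration.integral_sum Bochner_Integration.integrable_sum cong: sum.cong_simp)
 finally have A: "(LINT x|lebesgue_on U. weak_grad U u x \<bullet> weak_grad U v x) = ..." .
 have "(LINT x|lebesgue_on U. weak_laplacian U u x \<bullet> v x) =
  (LINT x|lebesgue_on U. (\<Sum>b\<in>Basis. \<Sum>k\<in>UNIV. (weak_pderiv U k (weak_pderiv U k u) x \<bullet> b) * (v x \<bullet> b)))"
 proof (rule Bochner_Integration.integral_cong[OF refl])
  fix x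
  have "weak_laplacian U u x \<bullet> v x = (\<Sum>k\<in>UNIV. weak_pderiv U k (weak_pderiv U k u) x \<bullet> v x)"
   by (simp add: weak_laplacian_def inner_sum_left)
  also have "... = (\<Sum>k\<in>UNIV. \<Sum>b\<in>Basis. (weak_pderiv U k (weak_pderiv U k u) x \<bullet> b) * (v x \<bullet> b))"
   by (rule sum.cong[OF refl euclidean_inner])
  also have "... = (\<Sum>b\<in>Basis. \<Sum>k\<in>UNIV. (weak_pderiv U k (weak_pderiv U k u) x \<bullet> b) * (v x \<bullet> b))" by (rule sum.swap)
  finally show "weak_laplacian U u x \<bullet> v x = ..." .
 qed
 also have "... = (\<Sum>b\<in>Basis. \<Sum>k\<in>UNIV. LINT x|lebesgue_on U. (weak_pderiv U k (weak_pderiv U k u) x \<bullet> b) * (v x \<bullet> b))"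
  using i2 by (simp add: Bochner_Integration.integral_sum Bochner_Integration.integrable_sum cong: sum.cong_simp)
 finally have B: "(LINT x|lebesgue_on U. weak_laplacian U u x \<bullet> v x) = ..." .
 have "(\<Sum>b\<in>(Basis::'b set). \<Sum>k\<in>UNIV. ?I b k) = 0" using main by simp
 then show ?thesis unfolding A B by (simp add: sum.distrib)
qed

section \<open>The bulk potential\<close>

lemma bounded_bilinear_matrix_mult: "bounded_bilinear ((**) :: real^'n^'n => real^'n^'n => real^'n^'n)"
 unfolding bilinear_conv_bounded_bilinear[symmetric] bilinear_def
 by (intro conjI allI linearI)
  (auto simp: vec_eq_iff matrix_matrix_mult_def sum.distrib distrib_left distrib_right sum_distrib_left mult_ac)

lemma bounded_linear_trace: "bounded_linear (trace :: real^'n^'n => real)"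
 by (intro linear_conv_bounded_linear[THEN iffD1] linearI) (auto simp: trace_def sum.distrib sum_distrib_left)

lemma trace_mult_inner:
 fixes A B :: "real^'n^'n"
 assumes "transpose B = B" shows "trace (A ** B) = A \<bullet> B"
proof -
 have B: "B $ k $ i = B $ i $ k" for i k using assms by (metis transpose_def vec_lambda_beta)
 show ?thesis unfolding trace_def matrix_matrix_mult_def inner_vec_def by (simp add: B)
qed

lemma Q_tensor_subspace: "subspace {A :: real^'n^'n. Q_tensor A}"
 unfolding subspace_def Q_tensor_def
 by (auto simp: trace_def transpose_def vec_eq_iff sum.distrib sum_distrib_left[symmetric])

lemma Q_tensor_add_scale: "Q_tensor A ==> Q_tensor H ==> Q_tensor (A + t *R H)"
 using subspace_add[OF Q_tensor_subspace, of A "t *R H"] subspace_mul[OF Q_tensor_subspace, of H t] by auto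

lemma Q_tensor_diff: "Q_tensor A ==> Q_tensor B ==> Q_tensor (A - B)"
 using subspace_diff[OF Q_tensor_subspace, of A B] by auto

lemma Q_tensor_trace_square: "Q_tensor A ==> trace (A ** A) = (norm A)^2"
 unfolding Q_tensor_def by (simp add: trace_mult_inner dot_square_norm)

text \<open>The Lipschitz constant on balls of radius \<open>m\<close> grows like \<open>m^k\<close>; this is stable under products.\<close>

definition lip_const :: "nat => ('a::real_normed_vector => 'b::real_normed_vector) => real => bool" where
 "lip_const k f C \<longleftrightarrow> 0 <= C \<and> (\<forall>m\<ge>1. \<forall>A B. norm A <= m --> norm B <= m -->
   norm (f A) <= C * m ^ Suc k \<and> norm (f A - f B) <= C * m ^ k * norm (A - B))"

definition lip_growth :: "nat => ('a::real_normed_vector => 'b::real_normed_vector) => bool" where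
 "lip_growth k f \<longleftrightarrow> (\<exists>C. lip_const k f C)"

lemma lip_constD:
 assumes "lip_const k f C"
 shows "C >= 0" "!!m A. m >= 1 ==> norm A <= m ==> norm (f A) <= C * m ^ Suc k"
  "!!m A B. m >= 1 ==> norm A <= m ==> norm B <= m ==> norm (f A - f B) <= C * m ^ k * norm (A - B)"
 using assms unfolding lip_const_def by blast+

lemma lip_growthE: "lip_growth k f ==> (!!C. lip_const k f C ==> thesis) ==> thesis"
 unfolding lip_growth_def by blast

lemma lip_growth_id: "lip_growth 0 (%x. x)"
 unfolding lip_growth_def lip_const_def by (intro exI[of _ 1]) auto

lemma lip_growth_const: "lip_growth k (%x. c)"
 unfolding lip_growth_def lip_const_def
proof (intro exI[of _ "norm c"] conjI allI impI)
 fix m :: real assume m: "1 <= m"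
 have "norm c * 1 <= norm c * m ^ Suc k" by (intro mult_left_mono one_le_power m) simp
 then show "norm c <= norm c * m ^ Suc k" by simp
qed (auto intro!: mult_nonneg_nonneg)

lemma lip_growth_mono:
 assumes f: "lip_growth k f" and kl: "k <= l" shows "lip_growth l f"
proof -
 obtain C where "lip_const k f C" by (rule lip_growthE[OF f])
 note C = lip_constD[OF this]
 have "norm (f A) <= C * m ^ Suc l \<and> norm (f A - f B) <= C * m ^ l * norm (A - B)"
  if m: "m >= 1" and A: "norm A <= m" and B: "norm B <= m" for m A B
 proof -
  have "C * m ^ Suc k <= C * m ^ Suc l" "C * m ^ k * norm (A - B) <= C * m ^ l * norm (A - B)"
   using C(1) m kl by (intro mult_left_mono mult_right_mono power_increasing; simp)+
  then show ?thesis using C(2)[OF m A] C(3)[OF m A B] by linarith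
 qed
 then show ?thesis unfolding lip_growth_def lip_const_def using C(1) by blast
qed

text \<open>Index k stands for growth of degree k + 1. Degrees add under products, k + 1 + l + 1,
  which is the shift by one in the index.\<close>

lemma lip_growth_bilinear:
 fixes f :: "'a::real_normed_vector => 'b::real_normed_vector" and g :: "'a => 'c::real_normed_vector" and h :: "'b => 'c => 'd::real_normed_vector"
 assumes h: "bounded_bilinear h" and f: "lip_growth k f" and g: "lip_growth l g"
 shows "lip_growth (Suc (k + l)) (%x. h (f x) (g x))"
proof -
 interpret h: bounded_bilinear h by (rule h)
 obtain K where K: "K > 0" "!!a b. norm (h a b) <= norm a * norm b * K" using h.pos_bounded by blast
 obtain C where "lip_const k f C" by (rule lip_growthE[OF f])
 note C = lip_constD[OF this]
 obtain D where "lip_const l g D" by (rule lip_growthE[OF g])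
 note D = lip_constD[OF this]
 have bd: "norm (h a b) <= s * t * K" if "norm a <= s" "norm b <= t" for a b s t
 proof -
  have "norm a * norm b <= s * t" using that order_trans[OF norm_ge_zero that(1)] by (intro mult_mono) auto
  then show ?thesis using K(2)[of a b] K(1) mult_right_mono[of "norm a * norm b" "s * t" K] by linarith
 qed
 show ?thesis unfolding lip_growth_def lip_const_def
 proof (intro exI[of _ "2 * C * D * K"] conjI allI impI)
  show "0 <= 2 * C * D * K" using C D K by simp
  fix m :: real and A B :: 'a assume m: "1 <= m" and A: "norm A <= m" and B: "norm B <= m"
  have nn: "0 <= C * D * K * m ^ Suc (Suc (k + l))" using C D K m by simp
  have "norm (h (f A) (g A)) <= C * m ^ Suc k * (D * m ^ Suc l) * K" by (rule bd[OF C(2)[OF m A] D(2)[OF m A]])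
  also have "... = C * D * K * m ^ Suc (Suc (k + l))" by (simp add: power_add mult_ac)
  also have "... <= 2 * C * D * K * m ^ Suc (Suc (k + l))" using nn by simp
  finally show "norm (h (f A) (g A)) <= 2 * C * D * K * m ^ Suc (Suc (k + l))" .
  have "h (f A) (g A) - h (f B) (g B) = h (f A - f B) (g A) + h (f B) (g A - g B)"
   by (simp add: h.diff_left h.diff_right)
  then have "norm (h (f A) (g A) - h (f B) (g B)) <= norm (h (f A - f B) (g A)) + norm (h (f B) (g A - g B))"
   by (simp add: norm_triangle_ineq)
  also have "... <= C * m ^ k * norm (A - B) * (D * m ^ Suc l) * K + C * m ^ Suc k * (D * m ^ l * norm (A - B)) * K"
   by (intro add_mono bd C(2,3)[OF m] D(2,3)[OF m] A B)
  also have "... = 2 * C * D * K * m ^ Suc (k + l) * norm (A - B)" by (simp add: power_add algebra_simps)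
  finally show "norm (h (f A) (g A) - h (f B) (g B)) <= 2 * C * D * K * m ^ Suc (k + l) * norm (A - B)" .
 qed
qed

lemma lip_growth_linear:
 assumes h: "bounded_linear h" and f: "lip_growth k f" shows "lip_growth k (%x. h (f x))"
proof -
 interpret h: bounded_linear h by (rule h)
 obtain K where K: "K > 0" "!!a. norm (h a) <= norm a * K" using h.pos_bounded by blast
 obtain C where "lip_const k f C" by (rule lip_growthE[OF f])
 note C = lip_constD[OF this]
 have bd: "norm (h a) <= K * s" if "norm a <= s" for a s
  by (rule order_trans[OF K(2)[of a]]) (use that K(1) in \<open>simp add: mult.commute\<close>)
 have "norm (h (f A)) <= K * C * m ^ Suc k \<and> norm (h (f A) - h (f B)) <= K * C * m ^ k * norm (A - B)"
  if m: "m >= 1" and A: "norm A <= m" and B: "norm B <= m" for m A B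
  using bd[OF C(2)[OF m A]] bd[OF C(3)[OF m A B]] by (simp add: h.diff mult.assoc)
 then show ?thesis unfolding lip_growth_def lip_const_def using C(1) K(1) by (intro exI[of _ "K * C"]) auto
qed

lemma lip_growth_add:
 assumes f: "lip_growth k f" and g: "lip_growth k g" shows "lip_growth k (%x. f x + g x)"
proof -
 obtain C where "lip_const k f C" by (rule lip_growthE[OF f])
 note C = lip_constD[OF this]
 obtain D where "lip_const k g D" by (rule lip_growthE[OF g])
 note D = lip_constD[OF this]
 have "norm (f A + g A) <= (C + D) * m ^ Suc k \<and> norm ((f A + g A) - (f B + g B)) <= (C + D) * m ^ k * norm (A - B)"
  if m: "m >= 1" and A: "norm A <= m" and B: "norm B <= m" for m A B
 proof -
  have "norm (f A + g A) <= norm (f A) + norm (g A)" "norm ((f A + g A) - (f B + g B)) <= norm (f A - f B) + norm (g A - g B)"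
   by (rule norm_triangle_ineq norm_diff_triangle_ineq)+
  then show ?thesis using C(2)[OF m A] D(2)[OF m A] C(3)[OF m A B] D(3)[OF m A B] by (simp add: distrib_right)
 qed
 then show ?thesis unfolding lip_growth_def lip_const_def using C(1) D(1) by (intro exI[of _ "C + D"]) auto
qed

lemma lip_growth_continuous:
 assumes f: "lip_growth k f" shows "continuous_on UNIV f"
proof -
 obtain C where "lip_const k f C" by (rule lip_growthE[OF f])
 note C = lip_constD[OF this]
 have "continuous (at A) f" for A
  unfolding isCont_def
 proof (rule LIM_zero_cancel, rule tendsto_norm_zero_cancel, rule tendsto_sandwich[OF _ _ tendsto_const])
  show "\<forall>\<^sub>F B in at A. norm (f B - f A) <= C * (norm A + 1) ^ k * norm (B - A)"
  proof (rule eventually_at_ball[THEN eventually_mono, of 1])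
   fix B assume "B \<in> ball A 1 \<and> B \<in> UNIV"
   then have "norm B <= norm A + 1" using norm_triangle_ineq2[of B A] by (simp add: dist_norm norm_minus_commute)
   then show "norm (f B - f A) <= C * (norm A + 1) ^ k * norm (B - A)" by (intro C(3)) auto
  qed simp
  have "((%B. C * (norm A + 1) ^ k * norm (B - A)) \<longlongrightarrow> C * (norm A + 1) ^ k * norm (A - A)) (at A)" by (intro tendsto_intros)
  then show "((%B. C * (norm A + 1) ^ k * norm (B - A)) \<longlongrightarrow> 0) (at A)" by simp
 qed simp
 then show ?thesis by (simp add: continuous_at_imp_continuous_on)
qed

lemma lip_growth_square: "lip_growth 1 (%Q :: real^'n^'n. Q ** Q)"
 using lip_growth_bilinear[OF bounded_bilinear_matrix_mult lip_growth_id lip_growth_id] by simp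

lemma lip_growth_trace_square: "lip_growth 1 (%Q :: real^'n^'n. trace (Q ** Q))"
 by (rule lip_growth_linear[OF bounded_linear_trace lip_growth_square])

lemma lip_growth_S: "lip_growth 2 (S_bulk a b c :: real^'n^'n => _)"
proof -
 have 1: "lip_growth 2 (%Q :: real^'n^'n. a *R Q)"
  by (rule lip_growth_mono[OF lip_growth_linear[OF bounded_linear_scaleR_right lip_growth_id]]) simp
 have "lip_growth 1 (%Q :: real^'n^'n. Q ** Q + (- (1 / real CARD('n))) *R (trace (Q ** Q) *R mat 1))"
  by (intro lip_growth_add lip_growth_square lip_growth_linear[OF bounded_linear_scaleR_right] lip_growth_linear[OF bounded_linear_scaleR_left] lip_growth_trace_square)
 then have 2: "lip_growth 2 (%Q :: real^'n^'n. (- b) *R (Q ** Q + (- (1 / real CARD('n))) *R (trace (Q ** Q) *R mat 1)))"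
  by (rule lip_growth_mono[OF lip_growth_linear[OF bounded_linear_scaleR_right]]) simp
 have "lip_growth (Suc (1 + 0)) (%Q :: real^'n^'n. trace (Q ** Q) *R Q)"
  by (rule lip_growth_bilinear[OF bounded_bilinear_scaleR lip_growth_trace_square lip_growth_id])
 then have 3: "lip_growth 2 (%Q :: real^'n^'n. c *R (trace (Q ** Q) *R Q))"
  by (intro lip_growth_linear[OF bounded_linear_scaleR_right]) (simp add: numeral_2_eq_2)
 have eq: "(S_bulk a b c :: real^'n^'n => _) = (%Q. (a *R Q + (- b) *R (Q ** Q + (- (1 / real CARD('n))) *R (trace (Q ** Q) *R mat 1))) + c *R (trace (Q ** Q) *R Q))"
  by (rule ext) (simp add: S_bulk_def algebra_simps)
 show ?thesis unfolding eq by (intro lip_growth_add 1 2 3)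
qed

lemma lip_growth_F: "lip_growth 3 (%Q :: real^'n^'n. 2 * F_B a b c Q + A0)"
proof -
 have 1: "lip_growth 3 (%Q :: real^'n^'n. a * trace (Q ** Q))"
  by (rule lip_growth_mono[OF lip_growth_linear[OF bounded_linear_mult_right lip_growth_trace_square]]) simp
 have "lip_growth (Suc (1 + 0)) (%Q :: real^'n^'n. Q ** Q ** Q)"
  by (rule lip_growth_bilinear[OF bounded_bilinear_matrix_mult lip_growth_square lip_growth_id])
 then have 2: "lip_growth 3 (%Q :: real^'n^'n. (- (2 * b / 3)) * trace (Q ** Q ** Q))"
  by (intro lip_growth_mono[OF lip_growth_linear[OF bounded_linear_mult_right lip_growth_linear[OF bounded_linear_trace]]]) auto
 have "lip_growth (Suc (1 + 1)) (%Q :: real^'n^'n. trace (Q ** Q) * trace (Q ** Q))"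
  by (rule lip_growth_bilinear[OF bounded_bilinear_mult lip_growth_trace_square lip_growth_trace_square])
 then have 3: "lip_growth 3 (%Q :: real^'n^'n. (c / 2) * (trace (Q ** Q) * trace (Q ** Q)))"
  by (intro lip_growth_linear[OF bounded_linear_mult_right]) (simp add: numeral_3_eq_3)
 have eq: "(%Q :: real^'n^'n. 2 * F_B a b c Q + A0) = (%Q. ((a * trace (Q ** Q) + (- (2 * b / 3)) * trace (Q ** Q ** Q)) + (c / 2) * (trace (Q ** Q) * trace (Q ** Q))) + A0)"
  by (rule ext) (simp add: F_B_def power2_eq_square field_simps)
 show ?thesis unfolding eq by (intro lip_growth_add 1 2 3 lip_growth_const)
qed

text \<open>For large A the quartic term, equal to c/2 |A|^4 by symmetry of A, absorbs the others.
  On the remaining compact ball a positive minimum is attained.\<close>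

lemma F_coercive:
 fixes a b c A0 :: real
 assumes c: "c > 0" and A0: "A0 > 0" and pos: "\<forall>A :: real^'n^'n. Q_tensor A --> 2 * F_B a b c A + A0 > 0"
 obtains \<delta> where "\<delta> > 0" "!!A :: real^'n^'n. Q_tensor A ==> 2 * F_B a b c A + A0 >= \<delta> * (1 + norm A)^4"
proof -
 let ?G = "%A :: real^'n^'n. 2 * F_B a b c A + A0"
 have "lip_growth (Suc (1 + 0)) (%Q :: real^'n^'n. Q ** Q ** Q)"
  by (rule lip_growth_bilinear[OF bounded_bilinear_matrix_mult lip_growth_square lip_growth_id])
 then obtain K where "lip_const (Suc (1 + 0)) (%A :: real^'n^'n. trace (A ** A ** A)) K"
  by (rule lip_growthE[OF lip_growth_linear[OF bounded_linear_trace]])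
 note K = lip_constD[OF this]
 define k where "k = \<bar>a\<bar> + 2 * \<bar>b\<bar> * K / 3"
 \<comment> \<open>For t >= R the lower order terms, at most k t^3, are bounded by c/4 of
   t^4.\<close>
 define R where "R = 1 + 4 * k / c"
 have k0: "k >= 0" using K by (simp add: k_def)
 have R1: "R >= 1" using k0 c by (simp add: R_def)
 \<comment> \<open>What remains is at least c/4 t^4, and (1 + t)^4 <= 16 t^4 for t >= 1.\<close>
 have big: "?G A >= c / 64 * (1 + norm A)^4" if A: "Q_tensor A" and n: "norm A >= R" for A
 proof -
  define t where "t = norm A"
  have t: "t >= R" "t >= 1" using n R1 by (auto simp: t_def)
  have tr2: "trace (A ** A) = t^2" using Q_tensor_trace_square[OF A] by (simp add: t_def)
  have tr3: "\<bar>trace (A ** A ** A)\<bar> <= K * t^3" using K(2)[of t A] t by (simp add: t_def eval_nat_numeral)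
  have "\<bar>b * trace (A ** A ** A)\<bar> <= \<bar>b\<bar> * (K * t^3)" unfolding abs_mult using tr3 by (intro mult_left_mono) auto
  then have b1: "- (2 * b / 3 * trace (A ** A ** A)) >= - (2 * \<bar>b\<bar> * K / 3 * t^3)" by (simp add: field_simps abs_le_iff)
  have "\<bar>a\<bar> * t^2 <= \<bar>a\<bar> * t^3" using t by (intro mult_left_mono power_increasing) auto
  moreover have "a * t^2 >= - (\<bar>a\<bar> * t^2)" using mult_right_mono[of "- \<bar>a\<bar>" a "t^2"] by simp
  ultimately have a1: "a * t^2 >= - (\<bar>a\<bar> * t^3)" by linarith
  have "?G A = a * t^2 + - (2 * b / 3 * trace (A ** A ** A)) + c / 2 * (t^2)^2 + A0"
   by (simp add: F_B_def tr2)
  also have "... >= c / 2 * t^4 - k * t^3" using a1 b1 A0 by (simp add: k_def distrib_right)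
  finally have "?G A >= c / 2 * t^4 - k * t^3" .
  moreover have "k * t^3 <= c / 4 * t^4"
  proof -
   have "4 * k / c <= t" using t(1) by (simp add: R_def)
   then have "k <= c / 4 * t" using c by (simp add: field_simps)
   then have "k * t^3 <= c / 4 * t * t^3" using t by (intro mult_right_mono) auto
   then show ?thesis by (simp add: eval_nat_numeral)
  qed
  moreover have "(1 + t)^4 <= (2 * t)^4" using t by (intro power_mono) auto
  then have "c / 64 * (1 + t)^4 <= c / 64 * (2 * t)^4" using c by (intro mult_left_mono) auto
  then have "c / 64 * (1 + t)^4 <= c / 4 * t^4" by (simp add: power_mult_distrib)
  ultimately show ?thesis by (simp add: t_def)
 qed
 let ?S = "{A :: real^'n^'n. Q_tensor A} \<inter> cball 0 R"
 have cG: "continuous_on UNIV ?G" by (rule lip_growth_continuous[OF lip_growth_F])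
 have "compact ?S" by (intro closed_Int_compact closed_subspace Q_tensor_subspace compact_cball)
 moreover have "0 \<in> ?S" using subspace_0[OF Q_tensor_subspace] R1 by auto
 ultimately obtain B where B: "B \<in> ?S" "!!A. A \<in> ?S ==> ?G B <= ?G A"
  using continuous_attains_inf[of ?S ?G] continuous_on_subset[OF cG] by (metis empty_iff subset_UNIV)
 define \<delta> where "\<delta> = min (c / 64) (?G B / (1 + R)^4)"
 have gB: "?G B > 0" using B pos by auto
 show ?thesis
 proof (rule that[of \<delta>])
  show "\<delta> > 0" using gB c R1 by (simp add: \<delta>_def)
  fix A :: "real^'n^'n" assume A: "Q_tensor A"
  show "?G A >= \<delta> * (1 + norm A)^4"
  proof (cases "norm A >= R")
   case True
   have "\<delta> * (1 + norm A)^4 <= c / 64 * (1 + norm A)^4" unfolding \<delta>_def by (intro mult_right_mono min.cobounded1) simp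
   then show ?thesis using big[OF A True] by linarith
  next
   case False
   have "\<delta> * (1 + norm A)^4 <= ?G B / (1 + R)^4 * (1 + R)^4"
    using False gB R1 by (intro mult_mono power_mono) (auto simp: \<delta>_def)
   also have "... = ?G B" using R1 by simp
   also have "... <= ?G A" using False A by (intro B(2)) auto
   finally show ?thesis .
  qed
 qed
qed

lemma trace_symmetric_derivatives:
 fixes X H :: "real^'n^'n"
 assumes H: "transpose H = H"
 shows "trace (X ** H + H ** X) = 2 * (X \<bullet> H)"
  and "trace ((X ** X) ** H + (X ** H + H ** X) ** X) = 3 * ((X ** X) \<bullet> H)"
proof -
 interpret m: bounded_bilinear "(**) :: real^'n^'n => real^'n^'n => real^'n^'n" by (rule bounded_bilinear_matrix_mult)
 interpret tr: bounded_linear "trace :: real^'n^'n => real" by (rule bounded_linear_trace)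
 show "trace (X ** H + H ** X) = 2 * (X \<bullet> H)"
  using trace_mult_inner[OF H, of X] trace_mul_sym[of H X] by (simp add: tr.add)
 have "trace ((X ** H) ** X) = (X ** X) \<bullet> H"
  using trace_mul_sym[of "X ** H" X] trace_mult_inner[OF H, of "X ** X"] by (simp add: matrix_mul_assoc)
 moreover have "trace ((H ** X) ** X) = (X ** X) \<bullet> H"
  using trace_mul_sym[of H "X ** X"] trace_mult_inner[OF H, of "X ** X"] by (simp add: matrix_mul_assoc)
 ultimately show "trace ((X ** X) ** H + (X ** H + H ** X) ** X) = 3 * ((X ** X) \<bullet> H)"
  using trace_mult_inner[OF H, of "X ** X"] by (simp add: tr.add m.add_left)
qed

text \<open>The multiple of the identity in \<open>S_bulk\<close> makes it trace-free; it is
  orthogonal to the trace-free direction H and hence invisible in the derivative.\<close>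

lemma F_line_derivative:
 fixes A H :: "real^'n^'n"
 assumes A: "Q_tensor A" and H: "Q_tensor H"
 shows "((%t. 2 * F_B a b c (A + t *R H) + A0) has_real_derivative 2 * (S_bulk a b c (A + t *R H) \<bullet> H)) (at t)"
proof -
 let ?X = "%t. A + t *R H"
 interpret m: bounded_bilinear "(**) :: real^'n^'n => real^'n^'n => real^'n^'n" by (rule bounded_bilinear_matrix_mult)
 interpret tr: bounded_linear "trace :: real^'n^'n => real" by (rule bounded_linear_trace)
 have dX: "(?X has_vector_derivative H) (at t)" by (auto intro!: derivative_eq_intros)
 have d2: "((%t. ?X t ** ?X t) has_vector_derivative (?X t ** H + H ** ?X t)) (at t)"
  by (rule m.has_vector_derivative[OF dX dX])
 have d3: "((%t. ?X t ** ?X t ** ?X t) has_vector_derivative ((?X t ** ?X t) ** H + (?X t ** H + H ** ?X t) ** ?X t)) (at t)"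
  by (rule m.has_vector_derivative[OF d2 dX])
 have t2: "((%t. trace (?X t ** ?X t)) has_real_derivative trace (?X t ** H + H ** ?X t)) (at t)"
  using tr.has_vector_derivative[OF d2] by (simp add: has_real_derivative_iff_has_vector_derivative)
 have t3: "((%t. trace (?X t ** ?X t ** ?X t)) has_real_derivative trace ((?X t ** ?X t) ** H + (?X t ** H + H ** ?X t) ** ?X t)) (at t)"
  using tr.has_vector_derivative[OF d3] by (simp add: has_real_derivative_iff_has_vector_derivative)
 have Hs: "transpose H = H" "trace H = 0" using H unfolding Q_tensor_def by auto
 note e = trace_symmetric_derivatives[OF Hs(1), of "?X t"]
 have mi: "mat 1 \<bullet> H = 0" using trace_mult_inner[OF Hs(1), of "mat 1"] Hs(2) by simp
 have "((%t. 2 * F_B a b c (?X t) + A0) has_real_derivative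
   2 * (a / 2 * trace (?X t ** H + H ** ?X t) - b / 3 * trace ((?X t ** ?X t) ** H + (?X t ** H + H ** ?X t) ** ?X t)
    + c / 4 * (2 * trace (?X t ** ?X t) * trace (?X t ** H + H ** ?X t)))) (at t)"
  unfolding F_B_def by (auto intro!: derivative_eq_intros t2 t3)
 moreover have "2 * (a / 2 * trace (?X t ** H + H ** ?X t) - b / 3 * trace ((?X t ** ?X t) ** H + (?X t ** H + H ** ?X t) ** ?X t)
    + c / 4 * (2 * trace (?X t ** ?X t) * trace (?X t ** H + H ** ?X t))) = 2 * (S_bulk a b c (?X t) \<bullet> H)"
  unfolding e S_bulk_def inner_add_left[of _ _ H] inner_diff_left[of _ _ H] inner_scaleR_left mi by (simp add: algebra_simps)
 ultimately show ?thesis by simp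
qed

text \<open>Coercivity bounds \<open>r_aux\<close> below by a multiple of (1 + |A|)^2, so the cubic
  \<open>S_bulk\<close> divided by it grows linearly. Along segments the derivative of
  \<open>r_aux\<close> is the inner product with \<open>P_bulk\<close>, so the mean value theorem
  and the Lipschitz bound give the quadratic Taylor remainder.\<close>

proposition bulk_bounds:
 fixes a b c A0 :: real
 assumes c: "c > 0" and A0: "A0 > 0" and pos: "\<forall>A :: real^'n^'n. Q_tensor A --> 2 * F_B a b c A + A0 > 0"
 obtains K where "K >= 0"
  "!!A :: real^'n^'n. Q_tensor A ==> norm (P_bulk a b c A0 A) <= K * (1 + norm A)"
  "!!A B :: real^'n^'n. Q_tensor A ==> Q_tensor B ==> norm (P_bulk a b c A0 A - P_bulk a b c A0 B) <= K * norm (A - B)"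
  "!!A :: real^'n^'n. Q_tensor A ==> \<bar>r_aux a b c A0 A\<bar> <= K * (1 + norm A)^2"
  "!!A B :: real^'n^'n. Q_tensor A ==> Q_tensor B ==> \<bar>r_aux a b c A0 B - r_aux a b c A0 A - P_bulk a b c A0 A \<bullet> (B - A)\<bar> <= K * (norm (B - A))^2"
proof -
 let ?G = "%A :: real^'n^'n. 2 * F_B a b c A + A0"
 let ?r = "r_aux a b c A0 :: real^'n^'n => real" and ?S = "S_bulk a b c :: real^'n^'n => real^'n^'n" and ?P = "P_bulk a b c A0 :: real^'n^'n => real^'n^'n"
 obtain \<delta>' where d': "\<delta>' > 0" "!!A :: real^'n^'n. Q_tensor A ==> ?G A >= \<delta>' * (1 + norm A)^4"
  by (rule F_coercive[OF c A0 pos]) (rule that, blast+)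
 define \<delta> where "\<delta> = sqrt \<delta>'"
 have d: "\<delta> > 0" using d' by (simp add: \<delta>_def)
 have r_eq: "?r A = sqrt (?G A)" for A by (simp add: r_aux_def)
 have rl: "?r A >= \<delta> * (1 + norm A)^2" if "Q_tensor A" for A
 proof -
  have "sqrt (\<delta>' * (1 + norm A)^4) <= ?r A" unfolding r_eq by (rule real_sqrt_le_mono[OF d'(2)[OF that]])
  moreover have "sqrt (\<delta>' * (1 + norm A)^4) = \<delta> * (1 + norm A)^2"
  proof -
   have "(1 + norm A)^4 = ((1 + norm A)^2)^2" by simp
   then show ?thesis by (simp only: \<delta>_def real_sqrt_mult real_sqrt_abs abs_power2)
  qed
  ultimately show ?thesis by simp
 qed
 have rpos: "?r A > 0" if "Q_tensor A" for A
 proof -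
  have "0 < \<delta> * (1 + norm A)^2" using d by (intro mult_pos_pos zero_less_power) (auto simp: add_pos_nonneg)
  then show ?thesis using rl[OF that] by linarith
 qed
 obtain CS where "lip_const 2 ?S CS" by (rule lip_growthE[OF lip_growth_S[of a b c]])
 note CS = lip_constD[OF this]
 obtain CG where "lip_const 3 ?G CG" by (rule lip_growthE[OF lip_growth_F[of a b c A0]])
 note CG = lip_constD[OF this]
 have Pb: "norm (?P A) <= CS / \<delta> * (1 + norm A)" if A: "Q_tensor A" for A
 proof -
  let ?m = "1 + norm A"
  have m: "?m > 0" by (simp add: add_pos_nonneg)
  have m3: "(CS * t ^ Suc 2) / (\<delta> * t^2) = CS / \<delta> * t" if "t > 0" for t
   using that d by (simp add: power2_eq_square power3_eq_cube)
  have "norm (?P A) = norm (?S A) / ?r A" using rpos[OF A] by (simp add: P_bulk_def)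
  also have "... <= (CS * ?m ^ Suc 2) / (\<delta> * ?m^2)"
   using CS(2)[of ?m A] rl[OF A] m d CS(1) by (intro frac_le) auto
  also have "... = CS / \<delta> * ?m" by (rule m3[OF m])
  finally show ?thesis .
 qed
 \<comment> \<open>The two summands bound the two parts of the difference: the change of
   \<open>S_bulk\<close> at fixed denominator, and the change of the denominator.\<close>
 define L where "L = CS / \<delta> + (CS / \<delta>) * (CG / \<delta>^2)"
 have L0: "L >= 0" using CS CG d by (simp add: L_def)
 \<comment> \<open>The denominator \<open>?r A\<close> belongs to the larger tensor, so one radius 1
   + |A| serves in all numerators and in the lower bound of the denominator.\<close>
 have Pl: "norm (?P A - ?P B) <= L * norm (A - B)" if A: "Q_tensor A" and B: "Q_tensor B" and le: "norm B <= norm A" for A B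
 proof -
  let ?m = "1 + norm A"
  have m: "?m >= 1" "?m > 0" "norm A <= ?m" "norm B <= ?m" using le by (auto simp: add_pos_nonneg)
  have eq: "?P A - ?P B = (1 / ?r A) *R (?S A - ?S B) + ((?r B - ?r A) / ?r A) *R ?P B"
  proof -
   have "(?r B - ?r A) / ?r A * (1 / ?r B) = 1 / ?r A - 1 / ?r B" using rpos[OF A] rpos[OF B] by (simp add: field_simps)
   then have "((?r B - ?r A) / ?r A) *R ?P B = (1 / ?r A - 1 / ?r B) *R ?S B" unfolding P_bulk_def scaleR_scaleR by (simp only:)
   then show ?thesis by (simp only: P_bulk_def scaleR_diff_right scaleR_diff_left) simp
  qed
  have 1: "norm ((1 / ?r A) *R (?S A - ?S B)) <= CS / \<delta> * norm (A - B)"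
  proof -
   have "norm ((1 / ?r A) *R (?S A - ?S B)) = norm (?S A - ?S B) / ?r A" using rpos[OF A] by simp
   also have "... <= (CS * ?m ^ 2 * norm (A - B)) / (\<delta> * ?m^2)"
    using CS(3)[OF m(1,3,4)] rl[OF A] m d CS(1) by (intro frac_le) auto
   also have "... = CS / \<delta> * norm (A - B)" using m d by (simp add: field_simps)
   finally show ?thesis .
  qed
  have rd: "\<bar>?r B - ?r A\<bar> <= CG * ?m ^ 3 * norm (A - B) / (\<delta> * ?m^2)"
  proof -
   have sq: "(?r A)^2 = ?G A" "(?r B)^2 = ?G B" using pos A B by (auto simp: r_eq less_imp_le)
   have "(?r B - ?r A) * (?r B + ?r A) = ?G B - ?G A" using sq by (simp add: power2_eq_square algebra_simps)
   then have "\<bar>?r B - ?r A\<bar> * (?r B + ?r A) = \<bar>?G B - ?G A\<bar>"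
    using rpos[OF A] rpos[OF B] by (metis abs_mult abs_of_pos add_pos_pos)
   also have "... <= CG * ?m ^ 3 * norm (A - B)" using CG(3)[OF m(1,3,4)] by (simp add: abs_minus_commute)
   finally have "\<bar>?r B - ?r A\<bar> * (?r B + ?r A) <= CG * ?m ^ 3 * norm (A - B)" .
   moreover have "\<bar>?r B - ?r A\<bar> * (\<delta> * ?m^2) <= \<bar>?r B - ?r A\<bar> * (?r B + ?r A)"
    using rl[OF A] rpos[OF B] by (intro mult_left_mono) auto
   ultimately show ?thesis using d m by (simp add: pos_le_divide_eq)
  qed
  have 2: "norm (((?r B - ?r A) / ?r A) *R ?P B) <= (CS / \<delta>) * (CG / \<delta>^2) * norm (A - B)"
  proof -
   have "norm (((?r B - ?r A) / ?r A) *R ?P B) = \<bar>?r B - ?r A\<bar> / ?r A * norm (?P B)" using rpos[OF A] by simp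
   also have "... <= (CG * ?m ^ 3 * norm (A - B) / (\<delta> * ?m^2)) / (\<delta> * ?m^2) * (CS / \<delta> * ?m)"
   proof (rule mult_mono)
    show "\<bar>?r B - ?r A\<bar> / ?r A <= (CG * ?m ^ 3 * norm (A - B) / (\<delta> * ?m^2)) / (\<delta> * ?m^2)"
     using rd rl[OF A] d m CG(1) by (intro frac_le) auto
    have "CS / \<delta> * (1 + norm B) <= CS / \<delta> * ?m" using le CS(1) d by (intro mult_left_mono) auto
    then show "norm (?P B) <= CS / \<delta> * ?m" using Pb[OF B] by linarith
   qed (use CG(1) d m in auto)
   also have "... = (CS / \<delta>) * (CG / \<delta>^2) * norm (A - B)"
    using d m by (simp add: divide_simps) (simp add: eval_nat_numeral algebra_simps)
   finally show ?thesis .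
  qed
  have "norm (?P A - ?P B) <= norm ((1 / ?r A) *R (?S A - ?S B)) + norm (((?r B - ?r A) / ?r A) *R ?P B)"
   unfolding eq by (rule norm_triangle_ineq)
  then show ?thesis using 1 2 by (simp add: L_def distrib_right)
 qed
 have PL: "norm (?P A - ?P B) <= L * norm (A - B)" if A: "Q_tensor A" and B: "Q_tensor B" for A B
  using Pl[OF A B] Pl[OF B A] by (cases "norm B <= norm A") (auto simp: norm_minus_commute)
 have ru: "\<bar>?r A\<bar> <= sqrt CG * (1 + norm A)^2" if A: "Q_tensor A" for A
 proof -
  have "?G A <= CG * (1 + norm A) ^ Suc 3" using CG(2)[of "1 + norm A" A] by simp
  then have "?r A <= sqrt (CG * (1 + norm A) ^ Suc 3)" unfolding r_eq by (rule real_sqrt_le_mono)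
  also have "(1 + norm A) ^ Suc 3 = ((1 + norm A)^2)^2" by (simp add: eval_nat_numeral)
  also have "sqrt (CG * ((1 + norm A)^2)^2) = sqrt CG * (1 + norm A)^2" by (simp only: real_sqrt_mult real_sqrt_abs abs_power2)
  finally show ?thesis using rpos[OF A] by simp
 qed
 have taylor: "\<bar>?r B - ?r A - ?P A \<bullet> (B - A)\<bar> <= L * (norm (B - A))^2" if A: "Q_tensor A" and B: "Q_tensor B" for A B
 proof -
  define H where "H = B - A"
  have H: "Q_tensor H" unfolding H_def by (rule Q_tensor_diff[OF B A])
  have X: "Q_tensor (A + t *R H)" for t by (rule Q_tensor_add_scale[OF A H])
  have dr: "((%t. ?r (A + t *R H)) has_real_derivative ?P (A + t *R H) \<bullet> H) (at t)" for t
  proof -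
   have g: "?G (A + t *R H) > 0" using pos X by blast
   have "((%t. sqrt (?G (A + t *R H))) has_real_derivative (inverse (sqrt (?G (A + t *R H))) / 2) * (2 * (?S (A + t *R H) \<bullet> H))) (at t)"
    by (rule DERIV_chain2[OF DERIV_real_sqrt[OF g] F_line_derivative[OF A H]])
   then show ?thesis by (simp add: r_eq P_bulk_def field_simps)
  qed
  obtain z where z: "0 < z" "z < 1" "?r (A + 1 *R H) - ?r (A + 0 *R H) = (1 - 0) * (?P (A + z *R H) \<bullet> H)"
   using MVT2[of 0 1 "%t. ?r (A + t *R H)" "%t. ?P (A + t *R H) \<bullet> H"] dr by auto
  have BH: "A + H = B" by (simp add: H_def)
  have "?r B - ?r A - ?P A \<bullet> H = (?P (A + z *R H) - ?P A) \<bullet> H" using z(3) by (simp add: BH inner_diff_left)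
  also have "\<bar>...\<bar> <= norm (?P (A + z *R H) - ?P A) * norm H" by (rule Cauchy_Schwarz_ineq2)
  also have "... <= (L * norm (z *R H)) * norm H" using PL[OF X A, of z] by (intro mult_right_mono) auto
  also have "... <= (L * norm H) * norm H"
   using z L0 by (intro mult_right_mono mult_left_mono) (auto simp: mult_left_le_one_le)
  finally show ?thesis by (simp add: H_def power2_eq_square)
 qed
 define K where "K = CS / \<delta> + L + sqrt CG"
 have "CS / \<delta> >= 0" "sqrt CG >= 0" using CS CG d by auto
 then have K: "CS / \<delta> <= K" "L <= K" "sqrt CG <= K" "K >= 0" using L0 by (auto simp: K_def)
 show ?thesis
 proof (rule that[OF K(4)])
  show "norm (?P A) <= K * (1 + norm A)" if "Q_tensor A" for A
   using Pb[OF that] mult_right_mono[OF K(1), of "1 + norm A"] by (simp add: add_nonneg_nonneg) 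
  show "norm (?P A - ?P B) <= K * norm (A - B)" if "Q_tensor A" "Q_tensor B" for A B
   using PL[OF that] mult_right_mono[OF K(2), of "norm (A - B)"] by simp
  show "\<bar>?r A\<bar> <= K * (1 + norm A)^2" if "Q_tensor A" for A
   using ru[OF that] mult_right_mono[OF K(3), of "(1 + norm A)^2"] by simp
  show "\<bar>?r B - ?r A - ?P A \<bullet> (B - A)\<bar> <= K * (norm (B - A))^2" if "Q_tensor A" "Q_tensor B" for A B
   using taylor[OF that] mult_right_mono[OF K(2), of "(norm (B - A))^2"] by simp
 qed
qed

lemma bulk_measurable:
 "r_aux a b c A0 \<in> borel_measurable borel" "P_bulk a b c A0 \<in> borel_measurable borel"
proof -
 show r: "r_aux a b c A0 \<in> borel_measurable borel"
  unfolding r_aux_def[abs_def]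
  by (rule measurable_compose[OF borel_measurable_continuous_onI[OF lip_growth_continuous[OF lip_growth_F]] borel_measurable_sqrt])
 have "S_bulk a b c \<in> borel_measurable borel"
  by (rule borel_measurable_continuous_onI[OF lip_growth_continuous[OF lip_growth_S]])
 then show "P_bulk a b c A0 \<in> borel_measurable borel"
  unfolding P_bulk_def[abs_def] using r by measurable
qed

section \<open>Integral inequalities\<close>

definition ip :: "(real^'n) set => (real^'n => 'b::euclidean_space) => (real^'n => 'b) => real" where
 "ip U u v = (LINT x|lebesgue_on U. u x \<bullet> v x)"

lemma ip_commute: "ip U u v = ip U v u"
 unfolding ip_def by (simp add: inner_commute)

lemma ip_self: "ip U u u = (LINT x|lebesgue_on U. (norm (u x))^2)"
 unfolding ip_def by (simp add: dot_square_norm)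

lemma ip_self_nonneg: "0 <= ip U u u"
 unfolding ip_self by (simp add: integral_nonneg_AE)

lemma ip_diff_left: "L2_on U u ==> L2_on U v ==> L2_on U w ==> ip U (%x. u x - v x) w = ip U u w - ip U v w"
 unfolding ip_def inner_diff_left by (intro Bochner_Integration.integral_diff L2_on_inner_integrable)

lemma ip_diff_right: "L2_on U u ==> L2_on U v ==> L2_on U w ==> ip U w (%x. u x - v x) = ip U w u - ip U w v"
 using ip_diff_left[of U u v w] by (simp add: ip_commute)

lemma ip_scale_left: "ip U (%x. t *R u x) w = t * ip U u w"
 unfolding ip_def by simp

lemma ip_cong_AE:
 assumes op: "open U" and "AE x in lebesgue_on U. u x \<bullet> v x = u' x \<bullet> v' x"
 shows "ip U u v = ip U u' v'"
 unfolding ip_def by (rule integral_lebesgue_on_cong(1)) (use assms in \<open>auto simp: borel_open\<close>)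

lemma ip_polarization:
 assumes u: "L2_on U u" and v: "L2_on U v"
 shows "ip U u (%x. u x - v x) = (ip U u u - ip U v v + ip U (%x. u x - v x) (%x. u x - v x)) / 2"
 using ip_diff_left[OF u v L2_on_diff[OF u v]] ip_diff_right[OF u v u] ip_diff_right[OF u v v] ip_commute[of U u v] by simp

lemma ip_young:
 assumes u: "L2_on U u" and v: "L2_on U v" and e: "e > 0"
 shows "\<bar>ip U u v\<bar> <= e / 2 * ip U u u + 1 / (2 * e) * ip U v v"
proof -
 have pt: "\<bar>a \<bullet> b\<bar> <= e / 2 * (a \<bullet> a) + 1 / (2 * e) * (b \<bullet> b)" for a b :: 'b
 proof -
  have "0 <= (sqrt e * norm a - norm b / sqrt e)^2" by simp
  also have "... = e * (norm a)^2 + (norm b)^2 / e - 2 * (norm a * norm b)"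
   using e by (simp add: power2_diff power_mult_distrib power_divide)
  finally have "norm a * norm b <= e / 2 * (a \<bullet> a) + 1 / (2 * e) * (b \<bullet> b)"
   using e by (simp add: dot_square_norm field_simps)
  then show ?thesis using Cauchy_Schwarz_ineq2[of a b] by linarith
 qed
 have i: "integrable (lebesgue_on U) (%x. e / 2 * (u x \<bullet> u x) + 1 / (2 * e) * (v x \<bullet> v x))"
  by (intro Bochner_Integration.integrable_add integrable_mult_right L2_on_inner_integrable u v)
 have "\<bar>ip U u v\<bar> <= (LINT x|lebesgue_on U. e / 2 * (u x \<bullet> u x) + 1 / (2 * e) * (v x \<bullet> v x))"
  unfolding ip_def real_norm_def[symmetric]
  by (rule Bochner_norm_bound_integral[OF L2_on_inner_integrable[OF u v] i]) (use pt in simp)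
 also have "... = e / 2 * ip U u u + 1 / (2 * e) * ip U v v"
  unfolding ip_def using L2_on_inner_integrable[OF u u] L2_on_inner_integrable[OF v v] by simp
 finally show ?thesis .
qed

lemma ip_self_mono:
 fixes u :: "real^'n => 'b::euclidean_space" and f :: "real^'n => real"
 assumes u: "u \<in> borel_measurable (lebesgue_on U)" and f: "integrable (lebesgue_on U) f"
  and le: "AE x in lebesgue_on U. (norm (u x))^2 <= f x"
 shows "L2_on U u" "ip U u u <= integral\<^sup>L (lebesgue_on U) f"
proof -
 have i: "integrable (lebesgue_on U) (%x. (norm (u x))^2)"
 proof (rule Bochner_Integration.integrable_bound[OF f])
  show "AE x in lebesgue_on U. norm ((norm (u x))^2) <= norm (f x)" using le by eventually_elim simp
 qed (use u in measurable)
 then show "L2_on U u" using u unfolding L2_on_def by simp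
 show "ip U u u <= integral\<^sup>L (lebesgue_on U) f" unfolding ip_self by (rule integral_mono_AE[OF i f le])
qed

section \<open>The L^3 norm and Hoelder's inequality for three factors\<close>

definition L3 :: "'a measure => ('a => real) => bool" where
 "L3 M f \<longleftrightarrow> f \<in> borel_measurable M \<and> integrable M (%x. \<bar>f x\<bar>^3)"

definition n3 :: "'a measure => ('a => real) => real" where
 "n3 M f = root 3 (\<integral>x. \<bar>f x\<bar>^3 \<partial>M)"

lemma n3_nonneg: "0 <= n3 M f"
 unfolding n3_def by (simp add: integral_nonneg_AE)

lemma n3_cube: "(n3 M f)^3 = (\<integral>x. \<bar>f x\<bar>^3 \<partial>M)"
 unfolding n3_def by (rule real_root_pow_pos2) (simp_all add: integral_nonneg_AE)

lemma amgm3: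
 fixes x y z :: real
 assumes "x >= 0" "y >= 0" "z >= 0" shows "3 * (x * y * z) <= x^3 + y^3 + z^3"
proof -
 have "x^3 + y^3 + z^3 - 3 * (x * y * z) = (x + y + z) * ((x - y)^2 + (y - z)^2 + (z - x)^2) / 2"
  by (simp add: power2_eq_square power3_eq_cube algebra_simps)
 moreover have "... >= 0" using assms by simp
 ultimately show ?thesis by linarith
qed

text \<open>The inequality of arithmetic and geometric means for three numbers, applied to the
  functions divided by their norms; a vanishing norm makes the product vanish almost everywhere and
  is treated apart.\<close>

lemma holder3:
 assumes f: "L3 M f" and g: "L3 M g" and h: "L3 M h"
 shows "integrable M (%x. f x * g x * h x)" and "(\<integral>x. \<bar>f x * g x * h x\<bar> \<partial>M) <= n3 M f * n3 M g * n3 M h"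
proof -
 have m[measurable]: "f \<in> borel_measurable M" "g \<in> borel_measurable M" "h \<in> borel_measurable M"
  and i: "integrable M (%x. \<bar>f x\<bar>^3)" "integrable M (%x. \<bar>g x\<bar>^3)" "integrable M (%x. \<bar>h x\<bar>^3)"
  using f g h unfolding L3_def by auto
 show ii: "integrable M (%x. f x * g x * h x)"
 proof (rule Bochner_Integration.integrable_bound)
  show "integrable M (%x. \<bar>f x\<bar>^3 + \<bar>g x\<bar>^3 + \<bar>h x\<bar>^3)" using i by simp
  have "\<bar>f x * g x * h x\<bar> <= \<bar>f x\<bar>^3 + \<bar>g x\<bar>^3 + \<bar>h x\<bar>^3" for x
  proof -
   have "0 <= \<bar>f x\<bar> * \<bar>g x\<bar> * \<bar>h x\<bar>" by simp
   then show ?thesis using amgm3[of "\<bar>f x\<bar>" "\<bar>g x\<bar>" "\<bar>h x\<bar>"] unfolding abs_mult by linarith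
  qed
  then show "AE x in M. norm (f x * g x * h x) <= norm (\<bar>f x\<bar>^3 + \<bar>g x\<bar>^3 + \<bar>h x\<bar>^3)" by simp
 qed measurable
 have zero: "AE x in M. u x = 0" if u: "L3 M u" "n3 M u = 0" for u
 proof -
  have "(\<integral>x. \<bar>u x\<bar>^3 \<partial>M) = 0" using n3_cube[of M u] u(2) by simp
  then have "AE x in M. \<bar>u x\<bar>^3 = 0" using u(1) integral_nonneg_eq_0_iff_AE[of M "%x. \<bar>u x\<bar>^3"] unfolding L3_def by simp
  then show ?thesis by eventually_elim simp
 qed
 show "(\<integral>x. \<bar>f x * g x * h x\<bar> \<partial>M) <= n3 M f * n3 M g * n3 M h"
 proof (cases "n3 M f = 0 \<or> n3 M g = 0 \<or> n3 M h = 0")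
  case True
  then have "AE x in M. f x * g x * h x = 0"
  proof (elim disjE)
   assume "n3 M f = 0" from zero[OF f this] show ?thesis by eventually_elim simp
  next
   assume "n3 M g = 0" from zero[OF g this] show ?thesis by eventually_elim simp
  next
   assume "n3 M h = 0" from zero[OF h this] show ?thesis by eventually_elim simp
  qed
  then have "AE x in M. \<bar>f x * g x * h x\<bar> = 0" by eventually_elim simp
  then have "(\<integral>x. \<bar>f x * g x * h x\<bar> \<partial>M) = (\<integral>x. 0 \<partial>M)" by (intro integral_cong_AE) auto
  then show ?thesis using n3_nonneg[of M] by simp
 next
  case False
  define p q s where "p = n3 M f" and "q = n3 M g" and "s = n3 M h"
  have pos: "p > 0" "q > 0" "s > 0" using False n3_nonneg[of M] by (auto simp: p_def q_def s_def less_le)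
  have pt: "\<bar>f x * g x * h x\<bar> <= p * q * s / 3 * (\<bar>f x\<bar>^3 / p^3 + \<bar>g x\<bar>^3 / q^3 + \<bar>h x\<bar>^3 / s^3)" for x
  proof -
   have "3 * (\<bar>f x\<bar> / p * (\<bar>g x\<bar> / q) * (\<bar>h x\<bar> / s)) <= (\<bar>f x\<bar> / p)^3 + (\<bar>g x\<bar> / q)^3 + (\<bar>h x\<bar> / s)^3"
    using pos by (intro amgm3) auto
   then have "p * q * s / 3 * (3 * (\<bar>f x\<bar> / p * (\<bar>g x\<bar> / q) * (\<bar>h x\<bar> / s))) <= p * q * s / 3 * ((\<bar>f x\<bar> / p)^3 + (\<bar>g x\<bar> / q)^3 + (\<bar>h x\<bar> / s)^3)"
    using pos by (intro mult_left_mono) auto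
   moreover have "p * q * s / 3 * (3 * (\<bar>f x\<bar> / p * (\<bar>g x\<bar> / q) * (\<bar>h x\<bar> / s))) = \<bar>f x * g x * h x\<bar>"
    using pos by (simp add: abs_mult)
   ultimately show ?thesis by (simp add: power_divide)
  qed
  have "(\<integral>x. \<bar>f x * g x * h x\<bar> \<partial>M) <= (\<integral>x. p * q * s / 3 * (\<bar>f x\<bar>^3 / p^3 + \<bar>g x\<bar>^3 / q^3 + \<bar>h x\<bar>^3 / s^3) \<partial>M)"
   by (rule integral_mono[OF integrable_abs[OF ii] _ pt]) (use i in auto)
  also have "... = p * q * s / 3 * ((\<integral>x. \<bar>f x\<bar>^3 \<partial>M) / p^3 + (\<integral>x. \<bar>g x\<bar>^3 \<partial>M) / q^3 + (\<integral>x. \<bar>h x\<bar>^3 \<partial>M) / s^3)"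
   using i by simp
  also have "... = p * q * s" using pos by (simp add: p_def q_def s_def n3_cube[symmetric])
  finally show ?thesis by (simp add: p_def q_def s_def)
 qed
qed

lemma L3_mono:
 assumes g: "L3 M g" and f: "f \<in> borel_measurable M" and le: "AE x in M. \<bar>f x\<bar> <= \<bar>g x\<bar>"
 shows "L3 M f" "n3 M f <= n3 M g"
proof -
 have c: "AE x in M. \<bar>f x\<bar>^3 <= \<bar>g x\<bar>^3" using le by eventually_elim (simp add: power_mono)
 have i: "integrable M (%x. \<bar>f x\<bar>^3)"
 proof (rule Bochner_Integration.integrable_bound)
  show "integrable M (%x. \<bar>g x\<bar>^3)" using g unfolding L3_def by simp
  show "AE x in M. norm (\<bar>f x\<bar>^3) <= norm (\<bar>g x\<bar>^3)" using c by eventually_elim simp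
 qed (use f in measurable)
 then show "L3 M f" using f unfolding L3_def by simp
 show "n3 M f <= n3 M g" unfolding n3_def
  using g i c unfolding L3_def by (intro real_root_le_mono integral_mono_AE) auto
qed

lemma L3_cmult:
 assumes f: "L3 M f" shows "L3 M (%x. t * f x)" "n3 M (%x. t * f x) = \<bar>t\<bar> * n3 M f"
proof -
 show "L3 M (%x. t * f x)" using f unfolding L3_def by (auto simp: abs_mult power_mult_distrib)
 have "(\<integral>x. \<bar>t * f x\<bar>^3 \<partial>M) = \<bar>t\<bar>^3 * (\<integral>x. \<bar>f x\<bar>^3 \<partial>M)" by (simp add: abs_mult power_mult_distrib)
 then show "n3 M (%x. t * f x) = \<bar>t\<bar> * n3 M f" unfolding n3_def by (simp add: real_root_mult real_root_power_cancel)
qed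

text \<open>Minkowski's inequality by expanding the cube and estimating the mixed terms with
  \<open>holder3\<close>.\<close>

lemma L3_add:
 assumes f: "L3 M f" and g: "L3 M g"
 shows "L3 M (%x. f x + g x)" "n3 M (%x. f x + g x) <= n3 M f + n3 M g"
proof -
 have m[measurable]: "f \<in> borel_measurable M" "g \<in> borel_measurable M"
  and i: "integrable M (%x. \<bar>f x\<bar>^3)" "integrable M (%x. \<bar>g x\<bar>^3)"
  using f g unfolding L3_def by auto
 note h1 = holder3[OF f f g] and h2 = holder3[OF f g g]
 let ?B = "%x. \<bar>f x\<bar>^3 + 3 * \<bar>f x * f x * g x\<bar> + 3 * \<bar>f x * g x * g x\<bar> + \<bar>g x\<bar>^3"
 have iB: "integrable M ?B" using i integrable_abs[OF h1(1)] integrable_abs[OF h2(1)] by simp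
 have gen: "(a + b)^3 = a^3 + 3 * (a * a * b) + 3 * (a * b * b) + b^3" for a b :: real
  by (simp add: power3_eq_cube algebra_simps)
 have pt: "\<bar>f x + g x\<bar>^3 <= ?B x" for x
 proof -
  have "\<bar>f x + g x\<bar>^3 <= (\<bar>f x\<bar> + \<bar>g x\<bar>)^3" by (intro power_mono abs_triangle_ineq) simp
  also have "... = ?B x" unfolding gen by (simp only: abs_mult)
  finally show ?thesis .
 qed
 have i3: "integrable M (%x. \<bar>f x + g x\<bar>^3)"
  by (rule Bochner_Integration.integrable_bound[OF iB]) (use pt in \<open>auto intro!: AE_I2 order_trans[OF _ abs_ge_self]\<close>)
 then show "L3 M (%x. f x + g x)" unfolding L3_def by simp
 have "(n3 M (%x. f x + g x))^3 <= (\<integral>x. ?B x \<partial>M)" unfolding n3_cube by (rule integral_mono[OF i3 iB pt])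
 also have "... = (n3 M f)^3 + 3 * (\<integral>x. \<bar>f x * f x * g x\<bar> \<partial>M) + 3 * (\<integral>x. \<bar>f x * g x * g x\<bar> \<partial>M) + (n3 M g)^3"
  unfolding n3_cube using i integrable_abs[OF h1(1)] integrable_abs[OF h2(1)] by simp
 also have "... <= (n3 M f)^3 + 3 * (n3 M f * n3 M f * n3 M g) + 3 * (n3 M f * n3 M g * n3 M g) + (n3 M g)^3"
  using h1(2) h2(2) by simp
 also have "... = (n3 M f + n3 M g)^3" by (simp add: power3_eq_cube algebra_simps)
 finally show "n3 M (%x. f x + g x) <= n3 M f + n3 M g"
  using n3_nonneg[of M] by (meson add_nonneg_nonneg power_le_imp_le_base power_mono_iff zero_less_numeral)
qed

lemma L3_zero: "L3 M (%x. 0)" "n3 M (%x. 0) = 0"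
 unfolding L3_def n3_def by auto

lemma L3_sum:
 assumes "finite I" "!!i. i \<in> I ==> L3 M (f i)"
 shows "L3 M (%x. \<Sum>i\<in>I. f i x) \<and> n3 M (%x. \<Sum>i\<in>I. f i x) <= (\<Sum>i\<in>I. n3 M (f i))"
 using assms
proof (induction I)
 case empty show ?case by (simp add: L3_zero)
next
 case (insert i I)
 then have IH: "L3 M (%x. \<Sum>i\<in>I. f i x)" "n3 M (%x. \<Sum>i\<in>I. f i x) <= (\<Sum>i\<in>I. n3 M (f i))" and fi: "L3 M (f i)" by auto
 show ?case using insert.hyps L3_add[OF fi IH(1)] IH(2) by simp
qed

text \<open>A bootstrap: the recursive estimate is available only after dt Y <= 1 is known for all
  earlier indices. The claimed bound itself implies this by \<open>small\<close>, so strong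
  induction closes the circle. C2 (1 + C3 dt)^m solves the recursion with equality.\<close>

lemma discrete_gronwall:
 fixes Y :: "nat => real"
 assumes step: "!!m. m <= N ==> (!!k. k < m ==> dt * Y k <= 1) ==> Y m <= C2 + C3 * dt * (\<Sum>k<m. Y k)"
  and nn: "C2 >= 0" "C3 >= 0" "dt > 0" and T: "real N * dt <= T" and small: "dt * (C2 * exp (C3 * T)) <= 1"
 shows "m <= N ==> Y m <= C2 * exp (C3 * T)"
proof -
 have e: "C2 * (1 + C3 * dt)^k <= C2 * exp (C3 * T)" if "k <= N" for k
 proof (rule mult_left_mono[OF _ nn(1)])
  have "(1 + C3 * dt)^k <= (exp (C3 * dt))^k" using nn by (intro power_mono) auto
  also have "... = exp (C3 * (real k * dt))" by (simp add: exp_of_nat_mult[symmetric] mult_ac)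
  also have "... <= exp (C3 * T)"
  proof -
   have "real k * dt <= real N * dt" using that nn by (intro mult_right_mono) auto
   then have "real k * dt <= T" using T by linarith
   then show ?thesis using nn by (simp add: mult_left_mono)
  qed
  finally show "(1 + C3 * dt)^k <= exp (C3 * T)" .
 qed
 have bound: "m <= N ==> Y m <= C2 * (1 + C3 * dt)^m" for m
 proof (induction m rule: less_induct)
  case (less m)
  have IH: "Y k <= C2 * (1 + C3 * dt)^k" if "k < m" for k using less that by simp
  have "dt * Y k <= 1" if "k < m" for k
  proof -
   have "Y k <= C2 * exp (C3 * T)" using IH[OF that] e[of k] that less.prems by linarith
   then have "dt * Y k <= dt * (C2 * exp (C3 * T))" using nn by (intro mult_left_mono) auto
   then show ?thesis using small by linarith
  qed
  then have "Y m <= C2 + C3 * dt * (\<Sum>k<m. Y k)" by (rule step[OF less.prems])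
  also have "... <= C2 + C3 * dt * (\<Sum>k<m. C2 * (1 + C3 * dt)^k)"
   using IH nn by (intro add_left_mono mult_left_mono sum_mono) auto
  also have "... = C2 * (1 + C3 * dt)^m"
  proof -
   have "C3 * dt * (\<Sum>k<m. (1 + C3 * dt)^k) = (1 + C3 * dt)^m - 1"
    using power_diff_1_eq[of "1 + C3 * dt" m] by simp
   then have "C3 * dt * (C2 * (\<Sum>k<m. (1 + C3 * dt)^k)) = C2 * ((1 + C3 * dt)^m - 1)" by (simp add: mult_ac)
   then show ?thesis by (simp add: sum_distrib_left[symmetric] right_diff_distrib)
  qed
  finally show ?case .
 qed
 show "m <= N ==> Y m <= C2 * exp (C3 * T)" using bound[of m] e[of m] by linarith
qed

lemma L2_on_weak_grad:
 assumes op: "open U" and u: "H1 U u"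
 shows "L2_on U (weak_grad U u)"
proof -
 have w: "L2_on U (weak_pderiv U k u)" for k by (rule H1_weak_pderiv(2)[OF op u])
 have m: "weak_grad U u \<in> borel_measurable (lebesgue_on U)"
 proof (subst borel_measurable_euclidean_space, intro ballI)
  fix i assume "i \<in> (Basis :: ('b^'a) set)"
  then obtain k b where "i = axis k b" by (auto simp: Basis_vec_def)
  then have "weak_grad U u x \<bullet> i = weak_pderiv U k u x \<bullet> b" for x by (simp add: weak_grad_def inner_axis)
  then show "(%x. weak_grad U u x \<bullet> i) \<in> borel_measurable (lebesgue_on U)"
   using w[of k] unfolding L2_on_def by (simp add: borel_measurable_inner)
 qed
 have "(norm (weak_grad U u x))^2 = (\<Sum>k\<in>UNIV. (norm (weak_pderiv U k u x))^2)" for x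
  by (simp add: norm_vec_def L2_set_def sum_nonneg weak_grad_def)
 then show ?thesis using m w unfolding L2_on_def by simp
qed

lemma ip_weak_grad_diff:
 assumes op: "open U" and u: "H1 U u" and v: "H1 U v"
 shows "(\<Sum>k\<in>UNIV. LINT x|lebesgue_on U. (norm (weak_pderiv U k u x - weak_pderiv U k v x))^2) =
  ip U (%x. weak_grad U u x - weak_grad U v x) (%x. weak_grad U u x - weak_grad U v x)"
proof -
 have w: "L2_on U (%x. weak_pderiv U k u x - weak_pderiv U k v x)" for k
  by (intro L2_on_diff H1_weak_pderiv(2)[OF op] u v)
 have "(norm (weak_grad U u x - weak_grad U v x))^2 = (\<Sum>k\<in>UNIV. (norm (weak_pderiv U k u x - weak_pderiv U k v x))^2)" for x
  by (simp add: norm_vec_def L2_set_def sum_nonneg weak_grad_def)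
 then show ?thesis unfolding ip_self using w unfolding L2_on_def by simp
qed

lemma ip_weak_grad:
 assumes op: "open U" and u: "H1 U u"
 shows "(\<Sum>k\<in>UNIV. LINT x|lebesgue_on U. (norm (weak_pderiv U k u x))^2) = ip U (weak_grad U u) (weak_grad U u)"
proof -
 have w: "L2_on U (weak_pderiv U k u)" for k by (rule H1_weak_pderiv(2)[OF op u])
 have "(norm (weak_grad U u x))^2 = (\<Sum>k\<in>UNIV. (norm (weak_pderiv U k u x))^2)" for x
  by (simp add: norm_vec_def L2_set_def sum_nonneg weak_grad_def)
 then show ?thesis unfolding ip_self using w unfolding L2_on_def by simp
qed

section \<open>A priori estimates for the scheme\<close>

text \<open>One run of the scheme with a fixed time step. The constants K and Cs are parameters
  chosen outside, so that every dependence on dt in the estimates below is explicit.\<close>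

locale scheme_run =
 fixes U :: "(real^'n) set" and bc :: bdry_cond and M L a b c A0 dt K Cs :: real
  and Q0 :: "real^'n => real^'n^'n" and Q :: "nat => real^'n => real^'n^'n" and r :: "nat => real^'n => real"
  and H :: "nat => real^'n => real^'n^'n"
 assumes card: "CARD('n) >= 2" and op: "open U" and bd: "bounded U" and C2: "C2_boundary U"
  and M: "M > 0" and L: "L > 0" and dt: "dt > 0" and sol: "scheme_solution U bc M L a b c A0 Q0 dt Q r H"
  and K: "K >= 0" and P_le: "!!A :: real^'n^'n. Q_tensor A ==> norm (P_bulk a b c A0 A) <= K * (1 + norm A)"
  and P_lip: "!!A B :: real^'n^'n. Q_tensor A ==> Q_tensor B ==> norm (P_bulk a b c A0 A - P_bulk a b c A0 B) <= K * norm (A - B)"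
  and r_le: "!!A :: real^'n^'n. Q_tensor A ==> \<bar>r_aux a b c A0 A\<bar> <= K * (1 + norm A)^2"
  and r_taylor: "!!A B :: real^'n^'n. Q_tensor A ==> Q_tensor B ==> \<bar>r_aux a b c A0 B - r_aux a b c A0 A - P_bulk a b c A0 A \<bullet> (B - A)\<bar> <= K * (norm (B - A))^2"
  and Cs: "Cs >= 0" and sob: "!!(u :: real^'n => real^'n^'n) g. L2_on U u ==> (\<forall>k. has_weak_pderiv U k u (g k)) ==> (\<forall>k. L2_on U (g k)) ==>
   integrable (lebesgue_on U) (%x. (norm (u x))^6) \<and>
   (LINT x|lebesgue_on U. (norm (u x))^6) <= Cs * ((LINT x|lebesgue_on U. (norm (u x))^2) + (\<Sum>k\<in>UNIV. LINT x|lebesgue_on U. (norm (g k x))^2))^3"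
begin

abbreviation "\<mu> \<equiv> lebesgue_on U"
abbreviation "P n x \<equiv> P_bulk a b c A0 (Q n x)"
abbreviation "\<Lambda> n \<equiv> weak_laplacian U (Q n)"
abbreviation "\<gamma> n \<equiv> weak_grad U (Q n)"
abbreviation "sq u \<equiv> ip U u u"

text \<open>At \<open>n = 0\<close> truncated subtraction makes the increments vanish and turns \<open>N 0\<close> into \<open>r 0 P 0\<close>.\<close>

definition "e n x = Q n x - Q (n - 1) x"
definition "d\<gamma> n x = \<gamma> n x - \<gamma> (n - 1) x"
definition "N n x = r n x *R P (n - 1) x"
definition "w n x = (1 + norm (Q n x))^2"
text \<open>The squared H^1 norm of the increment, in the form in which \<open>L3_e\<close> uses
  it.\<close>

definition "DG n = sq (e n) + sq (d\<gamma> n)"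
text \<open>The modified energy at time 0, in which the square of the auxiliary variable replaces
  the bulk potential.\<close>

definition "E = L / 2 * sq (\<gamma> 0) + sq (r 0) / 2"
text \<open>With undivided increments the coefficient becomes 1 / (dt M); this is
  \<open>W_quantity\<close> with the dissipative sum counted twice.\<close>

definition "Y m = L / 2 * sq (\<Lambda> m) + (\<Sum>k<m. sq (d\<gamma> (Suc k))) / (dt * M)"
definition "cs = root 3 Cs"

text \<open>All pointwise relations for all n hold outside one common null set, so later arguments
  may iterate in n at a fixed point x.\<close>

lemma scheme: "AE x in \<mu>. \<forall>n. Q_tensor (Q n x) \<and> e (Suc n) x = (dt * M) *R (L *R \<Lambda> (Suc n) x - N (Suc n) x) \<and>
  r (Suc n) x - r n x = P n x \<bullet> e (Suc n) x \<and> r 0 x = r_aux a b c A0 (Q 0 x)"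
proof (subst AE_all_countable, intro allI)
 fix n
 have "AE x in \<mu>. r 0 x = r_aux a b c A0 (Q 0 x)" "AE x in \<mu>. Q_tensor (Q n x)"
  "AE x in \<mu>. (1 / dt) *R (Q (Suc n) x - Q n x) = M *R H (Suc n) x \<and>
    r (Suc n) x - r n x = P n x \<bullet> (Q (Suc n) x - Q n x) \<and>
    H (Suc n) x = L *R \<Lambda> (Suc n) x - r (Suc n) x *R P n x"
  using sol unfolding scheme_solution_def by auto
 then show "AE x in \<mu>. Q_tensor (Q n x) \<and> e (Suc n) x = (dt * M) *R (L *R \<Lambda> (Suc n) x - N (Suc n) x) \<and>
  r (Suc n) x - r n x = P n x \<bullet> e (Suc n) x \<and> r 0 x = r_aux a b c A0 (Q 0 x)"
 proof eventually_elim
  case (elim x)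
  have "e (Suc n) x = dt *R ((1 / dt) *R (Q (Suc n) x - Q n x))" using dt by (simp add: e_def)
  also have "... = dt *R (M *R (L *R \<Lambda> (Suc n) x - N (Suc n) x))" using elim(3) by (simp add: N_def)
  finally show ?case using elim by (simp add: e_def)
 qed
qed

lemma H2_Q: "H2 U (Q n)" and bc_Q: "satisfies_bc U bc (Q n)"
 using sol unfolding scheme_solution_def by blast+

lemma H1_Q: "H1 U (Q n)"
 by (rule H2_H1(1)[OF op H2_Q])

lemma L2_Q: "L2_on U (Q n)" "L2_on U (\<gamma> n)" "L2_on U (\<Lambda> n)" "L2_on U (e n)" "L2_on U (d\<gamma> n)"
proof -
 show q: "L2_on U (Q n)" for n using H1_Q unfolding H1_def by blast
 show g: "L2_on U (\<gamma> n)" for n by (rule L2_on_weak_grad[OF op H1_Q])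
 have "L2_on U (%x. \<Sum>k\<in>UNIV. weak_pderiv U k (weak_pderiv U k (Q n)) x)"
  by (intro L2_on_sum H1_weak_pderiv(2)[OF op] H2_H1(2)[OF op H2_Q])
 then show "L2_on U (\<Lambda> n)" unfolding weak_laplacian_def[abs_def] .
 show "L2_on U (e n)" "L2_on U (d\<gamma> n)" unfolding e_def[abs_def] d\<gamma>_def[abs_def] by (intro L2_on_diff q g)+
qed

lemma Q_meas [measurable]: "Q n \<in> borel_measurable \<mu>" "e n \<in> borel_measurable \<mu>"
 using L2_Q(1,4)[of n] unfolding L2_on_def by blast+

lemma e_0: "e 0 = (%x. 0)" "d\<gamma> 0 = (%x. 0)" "DG 0 = 0"
 by (auto simp: e_def[abs_def] d\<gamma>_def[abs_def] DG_def ip_def)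

lemma DG_nonneg: "0 <= DG n"
 unfolding DG_def by (intro add_nonneg_nonneg ip_self_nonneg)

lemma green: "ip U (\<Lambda> i) (e j) = - ip U (\<gamma> i) (d\<gamma> j)"
proof -
 have "ip U (\<Lambda> i) (Q k) = - ip U (\<gamma> i) (\<gamma> k)" for k
  unfolding ip_def by (rule weak_green[OF card op bd C2 H2_Q bc_Q H2_Q bc_Q])
 then show ?thesis unfolding e_def[abs_def] d\<gamma>_def[abs_def] by (simp add: ip_diff_right L2_Q)
qed

text \<open>The L^3 norm of |u|^2 is the square of the L^6 norm of u; the Sobolev bound therefore
  becomes linear in the squared H^1 norm.\<close>

lemma sobolev_n3:
 assumes u: "L2_on U u" "\<forall>k. has_weak_pderiv U k u (g k)" "\<forall>k. L2_on U (g k)"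
 shows "L3 \<mu> (%x. (norm (u x :: real^'n^'n))^2)"
  and "n3 \<mu> (%x. (norm (u x))^2) <= cs * (sq u + (\<Sum>k\<in>UNIV. sq (g k)))"
proof -
 have eq: "\<bar>(norm (u x))^2\<bar>^3 = (norm (u x))^6" for x by simp
 have "u \<in> borel_measurable \<mu>" using u(1) unfolding L2_on_def by blast
 then show "L3 \<mu> (%x. (norm (u x))^2)" unfolding L3_def eq using sob[OF u] by simp
 have "n3 \<mu> (%x. (norm (u x))^2) <= root 3 (Cs * (sq u + (\<Sum>k\<in>UNIV. sq (g k)))^3)"
  unfolding n3_def eq ip_self using sob[OF u] by (intro real_root_le_mono) auto
 also have "... = cs * (sq u + (\<Sum>k\<in>UNIV. sq (g k)))"
  by (simp add: cs_def real_root_mult real_root_power_cancel add_nonneg_nonneg sum_nonneg ip_self_nonneg)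
 finally show "n3 \<mu> (%x. (norm (u x))^2) <= cs * (sq u + (\<Sum>k\<in>UNIV. sq (g k)))" .
qed

lemma L3_Q: "L3 \<mu> (%x. (norm (Q n x))^2)" "n3 \<mu> (%x. (norm (Q n x))^2) <= cs * (sq (Q n) + sq (\<gamma> n))"
proof -
 have "(\<Sum>k\<in>UNIV. sq (weak_pderiv U k (Q n))) = sq (\<gamma> n)"
  using ip_weak_grad[OF op H1_Q[of n]] by (simp only: ip_self)
 then show "L3 \<mu> (%x. (norm (Q n x))^2)" "n3 \<mu> (%x. (norm (Q n x))^2) <= cs * (sq (Q n) + sq (\<gamma> n))"
  using sobolev_n3[of "Q n" "%k. weak_pderiv U k (Q n)"] L2_Q(1)[of n] H1_weak_pderiv[OF op H1_Q[of n]] by simp_all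
qed

lemma L3_e: "L3 \<mu> (%x. (norm (e n x))^2)" "n3 \<mu> (%x. (norm (e n x))^2) <= cs * DG n"
proof -
 let ?g = "%k x. weak_pderiv U k (Q n) x - weak_pderiv U k (Q (n - 1)) x"
 have h: "\<forall>k. has_weak_pderiv U k (e n) (?g k)" unfolding e_def[abs_def]
  by (intro allI has_weak_pderiv_diff[OF op] H1_weak_pderiv(1)[OF op H1_Q])
 have g: "\<forall>k. L2_on U (?g k)" by (intro allI L2_on_diff H1_weak_pderiv(2)[OF op H1_Q])
 have "(\<Sum>k\<in>UNIV. sq (?g k)) = sq (d\<gamma> n)"
  using ip_weak_grad_diff[OF op H1_Q[of n] H1_Q[of "n - 1"]] by (simp add: d\<gamma>_def[abs_def] ip_self)
 then show "L3 \<mu> (%x. (norm (e n x))^2)" "n3 \<mu> (%x. (norm (e n x))^2) <= cs * DG n"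
  using sobolev_n3[OF L2_Q(4) h g] by (simp_all add: DG_def)
qed

lemma cs_nonneg: "0 <= cs"
 using Cs by (simp add: cs_def)

lemma L3_1: "L3 \<mu> (%x. 1)"
 using continuous_L2_on[OF op bd, of "%x. 1 :: real"] by (simp add: L3_def L2_on_def)

lemma L3_w: "L3 \<mu> (w n)" "n3 \<mu> (w n) <= 2 * n3 \<mu> (%x. 1) + 2 * cs * (sq (Q n) + sq (\<gamma> n))"
proof -
 note s = L3_add[OF L3_cmult(1)[OF L3_1, of 2] L3_cmult(1)[OF L3_Q(1), of 2]]
 have "AE x in \<mu>. \<bar>w n x\<bar> <= \<bar>2 * 1 + 2 * (norm (Q n x))^2\<bar>"
 proof (rule AE_I2)
  fix x show "\<bar>w n x\<bar> <= \<bar>2 * 1 + 2 * (norm (Q n x))^2\<bar>"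
   using sum_squares_bound[of 1 "norm (Q n x)"] by (simp add: w_def power2_sum)
 qed
 moreover have "w n \<in> borel_measurable \<mu>" unfolding w_def[abs_def] by measurable
 ultimately have *: "L3 \<mu> (w n)" "n3 \<mu> (w n) <= n3 \<mu> (%x. 2 * 1 + 2 * (norm (Q n x))^2)"
  using L3_mono[OF s(1)] by blast+
 then show "L3 \<mu> (w n)" by blast
 show "n3 \<mu> (w n) <= 2 * n3 \<mu> (%x. 1) + 2 * cs * (sq (Q n) + sq (\<gamma> n))"
 proof -
  have "n3 \<mu> (%x. 2 * 1 + 2 * (norm (Q n x))^2) <= \<bar>2\<bar> * n3 \<mu> (%x. 1) + \<bar>2\<bar> * n3 \<mu> (%x. (norm (Q n x))^2)"
   using s(2)[of n] by (simp only: L3_cmult(2)[OF L3_1] L3_cmult(2)[OF L3_Q(1)])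
  moreover have "2 * n3 \<mu> (%x. (norm (Q n x))^2) <= 2 * cs * (sq (Q n) + sq (\<gamma> n))" using L3_Q(2)[of n] by simp
  ultimately show ?thesis using *(2) by simp
 qed
qed

lemma P_meas [measurable]: "P n \<in> borel_measurable \<mu>"
 by (rule measurable_compose[OF Q_meas(1) bulk_measurable(2)])

lemma U_meas: "U \<in> sets lebesgue"
 using op by (simp add: borel_open)

text \<open>The scheme prescribes r only through pointwise relations; measurability is inherited
  step by step from the recursion, up to null sets.\<close>

lemma r_meas [measurable]: "r n \<in> borel_measurable \<mu>"
proof (induction n)
 case 0
 have "(%x. r_aux a b c A0 (Q 0 x)) \<in> borel_measurable \<mu>"
  by (rule measurable_compose[OF Q_meas(1) bulk_measurable(1)])
 moreover have "AE x in \<mu>. r_aux a b c A0 (Q 0 x) = r 0 x" using scheme by eventually_elim auto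
 ultimately show ?case by (rule measurable_lebesgue_on_AE[OF U_meas])
next
 case (Suc n)
 have "(%x. r n x + P n x \<bullet> e (Suc n) x) \<in> borel_measurable \<mu>"
  by (intro borel_measurable_add borel_measurable_inner Suc P_meas Q_meas)
 moreover have "AE x in \<mu>. r n x + P n x \<bullet> e (Suc n) x = r (Suc n) x"
  using scheme
 proof eventually_elim
  case (elim x)
  then have "r (Suc n) x - r n x = P n x \<bullet> e (Suc n) x" by blast
  then show ?case by simp
 qed
 ultimately show ?case by (rule measurable_lebesgue_on_AE[OF U_meas])
qed

text \<open>The update of r is the first order Taylor term of \<open>r_aux\<close> between
  consecutive iterates, so each step adds an error of at most K |e|^2.\<close>

lemma r_deviation: "AE x in \<mu>. \<bar>r n x\<bar> <= K * w n x + K * (\<Sum>k<n. (norm (e (Suc k) x))^2)"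
 using scheme
proof eventually_elim
 case (elim x)
 have "\<bar>r n x - r_aux a b c A0 (Q n x)\<bar> <= K * (\<Sum>k<n. (norm (e (Suc k) x))^2)" for n
 proof (induction n)
  case 0 show ?case using elim by simp
 next
  case (Suc n)
  have "\<bar>r_aux a b c A0 (Q (Suc n) x) - r_aux a b c A0 (Q n x) - P n x \<bullet> e (Suc n) x\<bar> <= K * (norm (e (Suc n) x))^2"
   using r_taylor[of "Q n x" "Q (Suc n) x"] elim by (simp add: e_def)
  moreover have "r (Suc n) x - r n x = P n x \<bullet> e (Suc n) x" using elim by blast
  ultimately show ?case using Suc by (simp add: distrib_left)
 qed
 from this[of n] show ?case using r_le[of "Q n x"] elim unfolding w_def by fastforce
qed

lemma L3_r: "L3 \<mu> (r n)" "n3 \<mu> (r n) <= K * n3 \<mu> (w n) + K * cs * (\<Sum>k<n. DG (Suc k))"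
proof -
 have S: "L3 \<mu> (%x. \<Sum>k<n. (norm (e (Suc k) x))^2)" "n3 \<mu> (%x. \<Sum>k<n. (norm (e (Suc k) x))^2) <= (\<Sum>k<n. n3 \<mu> (%x. (norm (e (Suc k) x))^2))"
  using L3_sum[of "{..<n}" \<mu> "%k x. (norm (e (Suc k) x))^2"] L3_e(1) by auto
 note s = L3_add[OF L3_cmult(1)[OF L3_w(1)[of n], of K] L3_cmult(1)[OF S(1), of K]]
 have "AE x in \<mu>. \<bar>r n x\<bar> <= \<bar>K * w n x + K * (\<Sum>k<n. (norm (e (Suc k) x))^2)\<bar>"
  using r_deviation[of n] by eventually_elim simp
 note m = L3_mono[OF s(1) r_meas this]
 show "L3 \<mu> (r n)" by (rule m(1))
 have "(\<Sum>k<n. n3 \<mu> (%x. (norm (e (Suc k) x))^2)) <= cs * (\<Sum>k<n. DG (Suc k))"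
  unfolding sum_distrib_left by (intro sum_mono L3_e(2))
 then have "K * n3 \<mu> (%x. \<Sum>k<n. (norm (e (Suc k) x))^2) <= K * (cs * (\<Sum>k<n. DG (Suc k)))"
  using S(2) K by (intro mult_left_mono) auto
 then show "n3 \<mu> (r n) <= K * n3 \<mu> (w n) + K * cs * (\<Sum>k<n. DG (Suc k))"
  using m(2) s(2) L3_cmult(2)[OF L3_w(1)[of n], of K] L3_cmult(2)[OF S(1), of K] K by simp
qed

lemma L2_r: "L2_on U (r n)"
proof (rule ip_self_mono(1)[OF r_meas])
 show "integrable \<mu> (%x. 1 + \<bar>r n x\<bar>^3)" using L3_r(1)[of n] L3_1 unfolding L3_def by simp
 have "t^2 <= 1 + t^3" if "t >= 0" for t :: real
 proof (cases "t <= 1")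
  case True then show ?thesis using that power_le_one[of t 2] by (simp add: add_increasing2)
 next
  case False
  then have "t^2 <= t^3" by (intro power_increasing) auto
  then show ?thesis by linarith
 qed
 from this[of "\<bar>r n _\<bar>"] show "AE x in \<mu>. (norm (r n x))^2 <= 1 + \<bar>r n x\<bar>^3" by (intro AE_I2) simp
qed

section \<open>Bounds of the nonlinear term and of its increments\<close>

lemma P_sq: assumes "Q_tensor (Q n x)" shows "(norm (P n x))^2 <= K^2 * w n x"
 using power_mono[OF P_le[OF assms] norm_ge_zero, of 2] by (simp add: w_def power_mult_distrib)

lemma holder_ip:
 fixes v :: "real^'n => real^'n^'n"
 assumes v: "v \<in> borel_measurable \<mu>" and s: "s >= 0" "t >= 0"
  and l: "L3 \<mu> f1" "L3 \<mu> f2" "L3 \<mu> f3" "L3 \<mu> g1" "L3 \<mu> g2" "L3 \<mu> g3"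
  and le: "AE x in \<mu>. (norm (v x))^2 <= s * (f1 x * f2 x * f3 x) + t * (g1 x * g2 x * g3 x)"
 shows "L2_on U v" "sq v <= s * (n3 \<mu> f1 * n3 \<mu> f2 * n3 \<mu> f3) + t * (n3 \<mu> g1 * n3 \<mu> g2 * n3 \<mu> g3)"
proof -
 note h = holder3[OF l(1-3)] holder3[OF l(4-6)]
 have i: "integrable \<mu> (%x. s * (f1 x * f2 x * f3 x) + t * (g1 x * g2 x * g3 x))" using h(1,3) by simp
 show "L2_on U v" by (rule ip_self_mono(1)[OF v i le])
 have "(LINT x|\<mu>. f1 x * f2 x * f3 x) <= n3 \<mu> f1 * n3 \<mu> f2 * n3 \<mu> f3"
  "(LINT x|\<mu>. g1 x * g2 x * g3 x) <= n3 \<mu> g1 * n3 \<mu> g2 * n3 \<mu> g3"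
  using order_trans[OF integral_mono[OF h(1) integrable_abs[OF h(1)]] h(2)] order_trans[OF integral_mono[OF h(3) integrable_abs[OF h(3)]] h(4)] by auto
 then have "s * (LINT x|\<mu>. f1 x * f2 x * f3 x) + t * (LINT x|\<mu>. g1 x * g2 x * g3 x) <= s * (n3 \<mu> f1 * n3 \<mu> f2 * n3 \<mu> f3) + t * (n3 \<mu> g1 * n3 \<mu> g2 * n3 \<mu> g3)"
  using s by (intro add_mono mult_left_mono)
 then show "sq v <= s * (n3 \<mu> f1 * n3 \<mu> f2 * n3 \<mu> f3) + t * (n3 \<mu> g1 * n3 \<mu> g2 * n3 \<mu> g3)"
  using ip_self_mono(2)[OF v i le] h(1,3) by simp
qed

lemma norm_add_sq: "(norm (u + v))^2 <= 2 * (norm u)^2 + 2 * (norm v)^2" for u v :: "'z::real_normed_vector"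
proof -
 have "(norm (u + v))^2 <= (norm u + norm v)^2" by (intro power_mono norm_triangle_ineq) simp
 then show ?thesis using sum_squares_bound[of "norm u" "norm v"] by (simp add: power2_sum)
qed

lemma P_e_P: "Q_tensor (Q n x) ==> (norm ((P n x \<bullet> v) *R P n x))^2 <= K^4 * (w n x * w n x * (norm v)^2)"
proof -
 assume q: "Q_tensor (Q n x)"
 have "(norm ((P n x \<bullet> v) *R P n x))^2 <= (norm (P n x) * norm v * norm (P n x))^2"
  using Cauchy_Schwarz_ineq2[of "P n x" v] by (intro power_mono) (auto intro: mult_right_mono)
 also have "... = (norm (P n x))^2 * (norm (P n x))^2 * (norm v)^2" by (simp add: power_mult_distrib)
 also have "... <= (K^2 * w n x) * (K^2 * w n x) * (norm v)^2"
  using P_sq[OF q] by (intro mult_right_mono mult_mono) (auto simp: w_def)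
 finally show ?thesis by (simp add: eval_nat_numeral mult_ac)
qed

lemma N_meas [measurable]: "N n \<in> borel_measurable \<mu>"
 unfolding N_def[abs_def] by (intro borel_measurable_scaleR r_meas P_meas)

text \<open>The auxiliary variable at index m is rewritten as its predecessor plus P . e, because in
  the bootstrap its L^3 norm is known only up to index m - 1. The price is a term in |e|^2, which
  can be absorbed.\<close>

lemma N_bound:
 "L2_on U (N m)" "sq (N m) <= (2 * K^2) * (n3 \<mu> (r (m - 1)) * n3 \<mu> (r (m - 1)) * n3 \<mu> (w (m - 1))) +
   (2 * K^4) * (n3 \<mu> (w (m - 1)) * n3 \<mu> (w (m - 1)) * n3 \<mu> (%x. (norm (e m x))^2))"
proof -
 let ?k = "m - 1"
 have "AE x in \<mu>. (norm (N m x))^2 <= (2 * K^2) * (r ?k x * r ?k x * w ?k x) + (2 * K^4) * (w ?k x * w ?k x * (norm (e m x))^2)"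
  using scheme
 proof eventually_elim
  case (elim x)
  then have q: "Q_tensor (Q ?k x)" by blast
  have "r m x = r ?k x + P ?k x \<bullet> e m x"
  proof (cases m)
   case (Suc k)
   have "r (Suc k) x - r k x = P k x \<bullet> e (Suc k) x" using elim by blast
   then show ?thesis by (simp add: Suc)
  qed (simp add: e_0)
  then have "N m x = r ?k x *R P ?k x + (P ?k x \<bullet> e m x) *R P ?k x" by (simp add: N_def scaleR_add_left)
  then have "(norm (N m x))^2 <= 2 * (norm (r ?k x *R P ?k x))^2 + 2 * (norm ((P ?k x \<bullet> e m x) *R P ?k x))^2"
   using norm_add_sq by metis
  moreover have "(norm (r ?k x *R P ?k x))^2 <= K^2 * (r ?k x * r ?k x * w ?k x)"
   using mult_left_mono[OF P_sq[OF q], of "(r ?k x)^2"] by (simp add: power_mult_distrib) (simp add: power2_eq_square mult_ac)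
  ultimately show ?case using P_e_P[OF q, of "e m x"] by simp
 qed
 from holder_ip[OF N_meas _ _ L3_r(1) L3_r(1) L3_w(1) L3_w(1) L3_w(1) L3_e(1) this]
 show "L2_on U (N m)" "sq (N m) <= (2 * K^2) * (n3 \<mu> (r ?k) * n3 \<mu> (r ?k) * n3 \<mu> (w ?k)) +
   (2 * K^4) * (n3 \<mu> (w ?k) * n3 \<mu> (w ?k) * n3 \<mu> (%x. (norm (e m x))^2))" by simp_all
qed

text \<open>The increment splits into the change of r times P and r times the change of P. By the
  update rule and the Lipschitz bound both are linear in an increment of Q; at n = 0 the second one
  vanishes.\<close>

lemma dN_bound:
 "sq (%x. N (Suc n) x - N n x) <= (2 * K^4) * (n3 \<mu> (w n) * n3 \<mu> (w n) * n3 \<mu> (%x. (norm (e (Suc n) x))^2)) +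
   (2 * K^2) * (n3 \<mu> (r n) * n3 \<mu> (r n) * n3 \<mu> (%x. (norm (e n x))^2))"
proof -
 have ae: "AE x in \<mu>. (norm (N (Suc n) x - N n x))^2 <= (2 * K^4) * (w n x * w n x * (norm (e (Suc n) x))^2) + (2 * K^2) * (r n x * r n x * (norm (e n x))^2)"
  using scheme
 proof eventually_elim
  case (elim x)
  then have q: "Q_tensor (Q n x)" "Q_tensor (Q (n - 1) x)" by blast+
  have "r (Suc n) x - r n x = P n x \<bullet> e (Suc n) x" using elim by blast
  then have "r (Suc n) x = r n x + P n x \<bullet> e (Suc n) x" by simp
  then have "N (Suc n) x - N n x = (P n x \<bullet> e (Suc n) x) *R P n x + r n x *R (P n x - P (n - 1) x)"
   by (simp add: N_def scaleR_add_left scaleR_diff_right)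
  then have "(norm (N (Suc n) x - N n x))^2 <= 2 * (norm ((P n x \<bullet> e (Suc n) x) *R P n x))^2 + 2 * (norm (r n x *R (P n x - P (n - 1) x)))^2"
   using norm_add_sq by metis
  moreover have "(norm (r n x *R (P n x - P (n - 1) x)))^2 <= K^2 * (r n x * r n x * (norm (e n x))^2)"
  proof -
   have "(norm (P n x - P (n - 1) x))^2 <= (K * norm (e n x))^2" using P_lip[OF q] by (intro power_mono) (auto simp: e_def)
   from mult_left_mono[OF this, of "(r n x)^2"] show ?thesis by (simp add: power_mult_distrib power2_eq_square[of "r n x"] mult_ac)
  qed
  ultimately show ?case using P_e_P[OF q(1), of "e (Suc n) x"] by simp
 qed
 have "(%x. N (Suc n) x - N n x) \<in> borel_measurable \<mu>" by measurable
 from holder_ip(2)[OF this _ _ L3_w(1) L3_w(1) L3_e(1) L3_r(1) L3_r(1) L3_e(1) ae] show ?thesis by simp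
qed

section \<open>The energy law and its consequences\<close>

lemma scheme_ip:
 assumes v: "L2_on U v"
 shows "ip U (e (Suc n)) v = dt * M * (L * ip U (\<Lambda> (Suc n)) v - ip U (N (Suc n)) v)"
proof -
 have "ip U (e (Suc n)) v = ip U (%x. (dt * M) *R (L *R \<Lambda> (Suc n) x - N (Suc n) x)) v"
  by (rule ip_cong_AE[OF op]) (use scheme in \<open>eventually_elim, auto\<close>)
 also have "... = dt * M * (L * ip U (\<Lambda> (Suc n)) v - ip U (N (Suc n)) v)"
  by (simp add: ip_scale_left ip_diff_left L2_on_cscale L2_Q N_bound(1) v)
 finally show ?thesis .
qed

text \<open>Testing with the increment turns the nonlinear term into r times the increment of r, by
  the update rule of r. This and the gradient term are differences of squares up to nonnegative
  remainders.\<close>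

lemma energy_step:
 "sq (e (Suc n)) / (dt * M) + (L / 2 * sq (\<gamma> (Suc n)) + sq (r (Suc n)) / 2) <= L / 2 * sq (\<gamma> n) + sq (r n) / 2"
proof -
 have "ip U (N (Suc n)) (e (Suc n)) = ip U (r (Suc n)) (%x. r (Suc n) x - r n x)"
 proof (rule ip_cong_AE[OF op])
  show "AE x in \<mu>. N (Suc n) x \<bullet> e (Suc n) x = r (Suc n) x \<bullet> (r (Suc n) x - r n x)"
   using scheme
  proof eventually_elim
   case (elim x)
   then have "r (Suc n) x - r n x = P n x \<bullet> e (Suc n) x" by blast
   then show ?case by (simp add: N_def)
  qed
 qed
 then have "sq (e (Suc n)) = dt * M * (- (L * ip U (\<gamma> (Suc n)) (d\<gamma> (Suc n))) - ip U (r (Suc n)) (%x. r (Suc n) x - r n x))"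
  using scheme_ip[OF L2_Q(4), of n "Suc n"] by (simp add: green)
 then have "sq (e (Suc n)) / (dt * M) = - (L * ip U (\<gamma> (Suc n)) (d\<gamma> (Suc n))) - ip U (r (Suc n)) (%x. r (Suc n) x - r n x)"
  using dt M by simp
 moreover have "ip U (\<gamma> (Suc n)) (d\<gamma> (Suc n)) >= (sq (\<gamma> (Suc n)) - sq (\<gamma> n)) / 2"
  using ip_polarization[OF L2_Q(2) L2_Q(2), of "Suc n" n] ip_self_nonneg[of U "%x. \<gamma> (Suc n) x - \<gamma> n x"] by (simp add: d\<gamma>_def[abs_def])
 then have "L * ip U (\<gamma> (Suc n)) (d\<gamma> (Suc n)) >= L * ((sq (\<gamma> (Suc n)) - sq (\<gamma> n)) / 2)" using L by (intro mult_left_mono) auto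
 moreover have "ip U (r (Suc n)) (%x. r (Suc n) x - r n x) >= (sq (r (Suc n)) - sq (r n)) / 2"
  using ip_polarization[OF L2_r L2_r, of "Suc n" n] ip_self_nonneg[of U "%x. r (Suc n) x - r n x"] by simp
 ultimately show ?thesis by (simp add: field_simps)
qed

lemma energy: "(\<Sum>k<n. sq (e (Suc k))) / (dt * M) + (L / 2 * sq (\<gamma> n) + sq (r n) / 2) <= E"
proof (induction n)
 case (Suc n)
 then show ?case using energy_step[of n] by (simp add: add_divide_distrib)
qed (simp add: E_def)

lemma energy_consequences: "E >= 0" "(\<Sum>k<n. sq (e (Suc k))) <= dt * M * E" "sq (\<gamma> n) <= 2 * E / L"
proof -
 have nn: "0 <= (\<Sum>k<n. sq (e (Suc k))) / (dt * M)" "0 <= L / 2 * sq (\<gamma> n)" "0 <= sq (r n) / 2"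
  using dt M L by (auto intro!: divide_nonneg_pos mult_nonneg_nonneg sum_nonneg ip_self_nonneg)
 then show "E >= 0" using energy[of n] by linarith
 have "(\<Sum>k<n. sq (e (Suc k))) / (dt * M) <= E" using nn energy[of n] by linarith
 then show "(\<Sum>k<n. sq (e (Suc k))) <= dt * M * E" using dt M by (simp add: pos_divide_le_eq mult_ac)
 have "L / 2 * sq (\<gamma> n) <= E" using nn energy[of n] by linarith
 then show "sq (\<gamma> n) <= 2 * E / L" using L by (simp add: field_simps)
qed

text \<open>Cauchy-Schwarz for the n increments costs a factor n, while the sum of their squares is
  at most dt M E; n dt <= T bounds the product.\<close>

lemma Q_bound:
 assumes T: "real n * dt <= T" shows "sq (Q n) <= 2 * sq (Q 0) + 2 * (T * M * E)"
proof -
 have i: "integrable \<mu> (%x. (norm (u x))^2)" if "L2_on U u" for u :: "real^'n => real^'n^'n" using that unfolding L2_on_def by blast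
 have pt: "(norm (Q n x))^2 <= 2 * (norm (Q 0 x))^2 + 2 * (real n * (\<Sum>k<n. (norm (e (Suc k) x))^2))" for x
 proof -
  have "Q n x = Q 0 x + (\<Sum>k<n. e (Suc k) x)" by (induction n) (auto simp: e_def)
  then have "(norm (Q n x))^2 <= 2 * (norm (Q 0 x))^2 + 2 * (norm (\<Sum>k<n. e (Suc k) x))^2" using norm_add_sq by metis
  moreover have "(norm (\<Sum>k<n. e (Suc k) x))^2 <= (\<Sum>k<n. norm (e (Suc k) x))^2" by (intro power_mono norm_sum) simp
  moreover have "... <= (\<Sum>k<n. (norm (e (Suc k) x))^2) * real n"
   using sum_squared_le_sum_of_squares[of "%k. norm (e (Suc k) x)" "{..<n}"] by simp
  ultimately show ?thesis by (simp add: mult.commute)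
 qed
 have "sq (Q n) <= (LINT x|\<mu>. 2 * (norm (Q 0 x))^2 + 2 * (real n * (\<Sum>k<n. (norm (e (Suc k) x))^2)))"
  unfolding ip_self by (rule integral_mono[OF i[OF L2_Q(1)] _ pt]) (use i[OF L2_Q(1)] i[OF L2_Q(4)] in auto)
 also have "... = 2 * sq (Q 0) + 2 * (real n * (\<Sum>k<n. sq (e (Suc k))))"
  unfolding ip_self using i[OF L2_Q(1)] i[OF L2_Q(4)] by simp
 also have "real n * (\<Sum>k<n. sq (e (Suc k))) <= real n * (dt * M * E)" by (intro mult_left_mono energy_consequences(2)) simp
 also have "... <= T * M * E"
  using mult_right_mono[OF T, of "M * E"] M energy_consequences(1) by (simp add: mult_ac)
 finally show ?thesis by simp
qed

lemma w_bound:
 assumes T: "real n * dt <= T"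
 shows "n3 \<mu> (w n) <= 2 * n3 \<mu> (%x. 1) + 2 * cs * (2 * sq (Q 0) + 2 * (T * M * E) + 2 * E / L)"
proof -
 have "sq (Q n) + sq (\<gamma> n) <= 2 * sq (Q 0) + 2 * (T * M * E) + 2 * E / L"
  using Q_bound[OF T] energy_consequences(3)[of n] by linarith
 then have "2 * cs * (sq (Q n) + sq (\<gamma> n)) <= 2 * cs * (2 * sq (Q 0) + 2 * (T * M * E) + 2 * E / L)"
  using cs_nonneg by (intro mult_left_mono) auto
 then show ?thesis using L3_w(2)[of n] by linarith
qed

text \<open>By Green's formula, pairing the increment of Q with the increment of its Laplacian gives
  minus the squared gradient increment, which is the dissipative term of Y.\<close>

lemma test_step: "L / 2 * (sq (\<Lambda> (Suc n)) - sq (\<Lambda> n)) + sq (d\<gamma> (Suc n)) / (dt * M) <= ip U (N (Suc n)) (\<Lambda> (Suc n)) - ip U (N (Suc n)) (\<Lambda> n)"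
proof -
 let ?v = "%x. \<Lambda> (Suc n) x - \<Lambda> n x"
 have v: "L2_on U ?v" by (intro L2_on_diff L2_Q)
 have "ip U (e (Suc n)) ?v = ip U (\<Lambda> (Suc n)) (e (Suc n)) - ip U (\<Lambda> n) (e (Suc n))"
  by (simp add: ip_diff_right L2_Q ip_commute)
 also have "... = - (ip U (\<gamma> (Suc n)) (d\<gamma> (Suc n)) - ip U (\<gamma> n) (d\<gamma> (Suc n)))" by (simp add: green)
 also have "... = - sq (d\<gamma> (Suc n))"
  using ip_diff_left[OF L2_Q(2) L2_Q(2) L2_Q(5), of "Suc n" n "Suc n"] by (simp add: d\<gamma>_def[abs_def])
 finally have "- sq (d\<gamma> (Suc n)) = dt * M * (L * ip U (\<Lambda> (Suc n)) ?v - ip U (N (Suc n)) ?v)" using scheme_ip[OF v] by simp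
 then have "sq (d\<gamma> (Suc n)) / (dt * M) = ip U (N (Suc n)) ?v - L * ip U (\<Lambda> (Suc n)) ?v"
  using dt M by (simp add: field_simps)
 moreover have "ip U (\<Lambda> (Suc n)) ?v >= (sq (\<Lambda> (Suc n)) - sq (\<Lambda> n)) / 2"
  using ip_polarization[OF L2_Q(3) L2_Q(3), of "Suc n" n] ip_self_nonneg[of U ?v] by simp
 then have "L * ip U (\<Lambda> (Suc n)) ?v >= L * ((sq (\<Lambda> (Suc n)) - sq (\<Lambda> n)) / 2)" using L by (intro mult_left_mono) auto
 moreover have "ip U (N (Suc n)) ?v = ip U (N (Suc n)) (\<Lambda> (Suc n)) - ip U (N (Suc n)) (\<Lambda> n)"
  by (simp add: ip_diff_right L2_Q N_bound(1))
 ultimately show ?thesis by simp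
qed

text \<open>Summation by parts in time moves the difference from the Laplacian to the nonlinearity.\<close>

lemma test_sum:
 "Y m - ip U (N m) (\<Lambda> m) <= Y 0 - ip U (N 0) (\<Lambda> 0) + (\<Sum>n<m. \<bar>ip U (%x. N (Suc n) x - N n x) (\<Lambda> n)\<bar>)"
proof (induction m)
 case (Suc m)
 have "ip U (%x. N (Suc m) x - N m x) (\<Lambda> m) = ip U (N (Suc m)) (\<Lambda> m) - ip U (N m) (\<Lambda> m)"
  by (simp add: ip_diff_left L2_Q N_bound(1))
 moreover have "Y (Suc m) = Y m + (L / 2 * (sq (\<Lambda> (Suc m)) - sq (\<Lambda> m)) + sq (d\<gamma> (Suc m)) / (dt * M))"
  by (simp add: Y_def add_divide_distrib algebra_simps)
 ultimately show ?case using Suc test_step[of m] by simp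
qed simp

section \<open>Absorbing the nonlinear increments\<close>

lemma Y_facts: "0 <= Y m" "L / 2 * sq (\<Lambda> m) <= Y m" "(\<Sum>k<m. sq (d\<gamma> (Suc k))) <= dt * M * Y m"
proof -
 have 1: "0 <= (\<Sum>k<m. sq (d\<gamma> (Suc k))) / (dt * M)" "0 <= L / 2 * sq (\<Lambda> m)"
  using dt M L by (auto intro!: divide_nonneg_pos mult_nonneg_nonneg sum_nonneg ip_self_nonneg)
 then show "0 <= Y m" "L / 2 * sq (\<Lambda> m) <= Y m" unfolding Y_def by linarith+
 have "(\<Sum>k<m. sq (d\<gamma> (Suc k))) / (dt * M) <= Y m" using 1 unfolding Y_def by linarith
 then show "(\<Sum>k<m. sq (d\<gamma> (Suc k))) <= dt * M * Y m" using dt M by (simp add: pos_divide_le_eq mult_ac)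
qed

text \<open>The energy law controls the L^2 part of the increments and Y their gradients, both with
  a factor dt.\<close>

lemma DG_sum: "(\<Sum>k<m. DG (Suc k)) <= dt * M * (E + Y m)"
 using energy_consequences(2)[of m] Y_facts(3)[of m] by (simp add: DG_def sum.distrib distrib_left)

lemma DG_last: "DG m <= dt * M * (E + Y m)"
proof (cases m)
 case 0
 then show ?thesis using dt M Y_facts(1)[of m] energy_consequences(1) by (simp add: e_0)
next
 case (Suc k)
 have "DG (Suc k) <= (\<Sum>k<Suc k. DG (Suc k))" by (simp add: sum_nonneg DG_nonneg)
 then show ?thesis using DG_sum[of m] Suc by simp
qed

lemma DG_shift: "(\<Sum>k<m. DG k) <= (\<Sum>k<m. DG (Suc k))"
 using sum.lessThan_Suc_shift[of DG m] DG_nonneg[of m] by (simp add: e_0)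

text \<open>One Gronwall step. The boundary terms of the summation by parts and the sum of nonlinear
  increments are split by Young's inequality into shares of Y m that are absorbed, contributions of
  the data, and dt times the sum of the earlier Y k. The numbers \<kappa> and \<sigma> bound the L^3
  norms of w and r.\<close>

lemma Y_step:
 assumes T: "real m * dt <= T" and dt1: "dt <= 1" and small: "!!k. k < m ==> dt * Y k <= 1"
  and \<kappa>: "\<kappa> = 2 * n3 \<mu> (%x. 1) + 2 * cs * (2 * sq (Q 0) + 2 * (T * M * E) + 2 * E / L)"
  and \<sigma>: "\<sigma> = K * \<kappa> + K * cs * (M * (E + 1))"
  and \<eta>: "\<eta> > 0" "\<eta> * ((K^4 * \<kappa>^2 + K^2 * \<sigma>^2) * cs * M) <= 1/8" and dts: "dt * (4 / L * (K^4 * \<kappa>^2 * cs * M)) <= 1/8"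
 shows "Y m <= (5/2 * Y 0 + 4 * (4 / L * (K^2 * \<sigma>^2 * \<kappa>)) + E / 2) + (2 / (\<eta> * L)) * dt * (\<Sum>k<m. Y k)"
proof -
 have Tk: "real k * dt <= T" if "k <= m" for k
 proof -
  have "real k * dt <= real m * dt" using that dt by (intro mult_right_mono) auto
  then show ?thesis using T by linarith
 qed
 have wk: "n3 \<mu> (w k) <= \<kappa>" if "k <= m" for k unfolding \<kappa> by (rule w_bound[OF Tk[OF that]])
 have \<kappa>0: "\<kappa> >= 0" using wk[of 0] n3_nonneg[of \<mu> "w 0"] by simp
 have EM: "0 <= M * (E + 1)" using M energy_consequences(1) by simp
 have rk: "n3 \<mu> (r k) <= \<sigma>" if k: "k <= m - 1" for k
 proof -
  have "(\<Sum>j<k. DG (Suc j)) <= M * (E + 1)"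
  \<comment> \<open>For m = 0 the truncated m - 1 still admits k = 0, where \<open>small\<close>
    says nothing; the sum is then empty.\<close>
  proof (cases "k = 0")
   case False
   then have "dt * Y k <= 1" using k by (intro small) simp
   moreover have "dt * E <= E" using dt1 energy_consequences(1) dt by (simp add: mult_left_le_one_le)
   ultimately have "M * (dt * (E + Y k)) <= M * (E + 1)" using M by (intro mult_left_mono) (auto simp: distrib_left)
   then show ?thesis using DG_sum[of k] by (simp add: mult_ac)
  qed (use EM in simp)
  then have "K * cs * (\<Sum>j<k. DG (Suc j)) <= K * cs * (M * (E + 1))" using K cs_nonneg by (intro mult_left_mono) auto
  moreover have "K * n3 \<mu> (w k) <= K * \<kappa>" using wk[of k] k K by (intro mult_left_mono) auto
  ultimately show ?thesis using L3_r(2)[of k] unfolding \<sigma> by linarith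
 qed
 have \<sigma>0: "\<sigma> >= 0" using rk[of 0] n3_nonneg[of \<mu> "r 0"] by simp
 \<comment> \<open>X is the coefficient of the squared increments stemming from the update of r, and
   V the one stemming from the Lipschitz bound of P.\<close>
 define X where "X = K^4 * \<kappa>^2 * cs"
 define V where "V = K^2 * \<sigma>^2 * cs"
 define C0 where "C0 = 4 / L * (K^2 * \<sigma>^2 * \<kappa>)"
 have XV: "X >= 0" "V >= 0" using K cs_nonneg by (auto simp: X_def V_def)
 have wwe: "(2 * K^4) * (n3 \<mu> (w k) * n3 \<mu> (w k) * n3 \<mu> (%x. (norm (e j x))^2)) <= 2 * X * DG j" if "k <= m" for k j
 proof -
  have "n3 \<mu> (w k) * n3 \<mu> (w k) * n3 \<mu> (%x. (norm (e j x))^2) <= \<kappa> * \<kappa> * (cs * DG j)"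
   using wk[OF that] \<kappa>0 by (intro mult_mono L3_e(2) n3_nonneg mult_nonneg_nonneg) auto
  from mult_left_mono[OF this, of "2 * K^4"] show ?thesis using K by (simp add: X_def power2_eq_square mult_ac)
 qed
 have rre: "(2 * K^2) * (n3 \<mu> (r k) * n3 \<mu> (r k) * n3 \<mu> (%x. (norm (e j x))^2)) <= 2 * V * DG j" if "k <= m - 1" for k j
 proof -
  have "n3 \<mu> (r k) * n3 \<mu> (r k) * n3 \<mu> (%x. (norm (e j x))^2) <= \<sigma> * \<sigma> * (cs * DG j)"
   using rk[OF that] \<sigma>0 by (intro mult_mono L3_e(2) n3_nonneg mult_nonneg_nonneg) auto
  from mult_left_mono[OF this, of "2 * K^2"] show ?thesis using K by (simp add: V_def power2_eq_square mult_ac)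
 qed
 have rrw: "(2 * K^2) * (n3 \<mu> (r k) * n3 \<mu> (r k) * n3 \<mu> (w k)) <= L / 2 * C0" if "k <= m - 1" for k
 proof -
  have "n3 \<mu> (r k) * n3 \<mu> (r k) * n3 \<mu> (w k) <= \<sigma> * \<sigma> * \<kappa>"
   using rk[OF that] wk[of k] that \<sigma>0 by (intro mult_mono n3_nonneg mult_nonneg_nonneg) auto
  from mult_left_mono[OF this, of "2 * K^2"] show ?thesis using K L by (simp add: C0_def power2_eq_square mult_ac)
 qed
 have NL: "\<bar>ip U (N k) (\<Lambda> k)\<bar> <= C0 + 4 / L * X * DG k + Y k / 4" if "k <= m" for k
 proof -
  \<comment> \<open>The parameter 4 / L leaves L/8 times the squared Laplacian, which is at most a
    quarter of Y.\<close>
  have "\<bar>ip U (N k) (\<Lambda> k)\<bar> <= 4 / L / 2 * sq (N k) + 1 / (2 * (4 / L)) * sq (\<Lambda> k)"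
   by (rule ip_young[OF N_bound(1) L2_Q(3)]) (use L in simp)
  moreover have "1 / (2 * (4 / L)) * sq (\<Lambda> k) <= Y k / 4" using Y_facts(2)[of k] by simp
  moreover have "sq (N k) <= L / 2 * C0 + 2 * X * DG k"
   using N_bound(2)[of k] rrw[of "k - 1"] wwe[of "k - 1" k] that by linarith
  then have "4 / L / 2 * sq (N k) <= 4 / L / 2 * (L / 2 * C0 + 2 * X * DG k)" using L by (intro mult_left_mono) auto
  moreover have "4 / L / 2 * (L / 2 * C0 + 2 * X * DG k) = C0 + 4 / L * X * DG k" using L by (simp add: field_simps)
  ultimately show ?thesis by linarith
 qed
 have Nm: "\<bar>ip U (N m) (\<Lambda> m)\<bar> <= C0 + (E + Y m) / 8 + Y m / 4"
 proof -
  have "4 / L * X * DG m <= 4 / L * X * (dt * M * (E + Y m))" using L XV by (intro mult_left_mono DG_last) auto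
  also have "... = dt * (4 / L * (K^4 * \<kappa>^2 * cs * M)) * (E + Y m)" by (simp add: X_def)
  also have "... <= 1/8 * (E + Y m)" using energy_consequences(1) Y_facts(1)[of m] by (intro mult_right_mono dts) auto
  finally show ?thesis using NL[of m] by linarith
 qed
 have N0: "\<bar>ip U (N 0) (\<Lambda> 0)\<bar> <= C0 + Y 0 / 4" using NL[of 0] by (simp add: e_0)
 have "(\<Sum>n<m. \<bar>ip U (%x. N (Suc n) x - N n x) (\<Lambda> n)\<bar>) <= (\<Sum>n<m. \<eta> / dt * (X * DG (Suc n) + V * DG n) + dt / (\<eta> * L) * Y n)"
 proof (rule sum_mono)
  fix n assume "n \<in> {..<m}"
  then have n: "n <= m" "n <= m - 1" by auto
  \<comment> \<open>Young's parameter \<eta> / dt: its 1 / dt cancels against the factor dt of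
    \<open>DG_sum\<close>, and the other term acquires the factor dt needed for Gronwall's
    lemma.\<close>
  have "\<bar>ip U (%x. N (Suc n) x - N n x) (\<Lambda> n)\<bar> <= \<eta> / dt / 2 * sq (%x. N (Suc n) x - N n x) + 1 / (2 * (\<eta> / dt)) * sq (\<Lambda> n)"
   by (rule ip_young[OF L2_on_diff[OF N_bound(1) N_bound(1)] L2_Q(3)]) (use \<eta> dt in simp)
  moreover have "sq (%x. N (Suc n) x - N n x) <= 2 * X * DG (Suc n) + 2 * V * DG n"
   using dN_bound[of n] wwe[OF n(1), of "Suc n"] rre[OF n(2), of n] by linarith
  then have "\<eta> / dt / 2 * sq (%x. N (Suc n) x - N n x) <= \<eta> / dt / 2 * (2 * X * DG (Suc n) + 2 * V * DG n)"
   using \<eta> dt by (intro mult_left_mono) auto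
  moreover have "\<eta> / dt / 2 * (2 * X * DG (Suc n) + 2 * V * DG n) = \<eta> / dt * (X * DG (Suc n) + V * DG n)" by (simp add: algebra_simps)
  moreover have "1 / (2 * (\<eta> / dt)) * sq (\<Lambda> n) <= dt / (\<eta> * L) * Y n"
  proof -
   have "dt / (\<eta> * L) * (L / 2 * sq (\<Lambda> n)) <= dt / (\<eta> * L) * Y n" using \<eta> dt L by (intro mult_left_mono Y_facts(2)) auto
   then show ?thesis using L \<eta> dt by simp
  qed
  ultimately show "\<bar>ip U (%x. N (Suc n) x - N n x) (\<Lambda> n)\<bar> <= \<eta> / dt * (X * DG (Suc n) + V * DG n) + dt / (\<eta> * L) * Y n" by linarith
 qed
 also have "... = \<eta> / dt * (X * (\<Sum>n<m. DG (Suc n)) + V * (\<Sum>n<m. DG n)) + dt / (\<eta> * L) * (\<Sum>n<m. Y n)"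
  by (simp add: sum.distrib sum_distrib_left distrib_left)
 also have "... <= \<eta> / dt * ((X + V) * (dt * M * (E + Y m))) + dt / (\<eta> * L) * (\<Sum>n<m. Y n)"
 proof -
  have "X * (\<Sum>n<m. DG (Suc n)) + V * (\<Sum>n<m. DG n) <= (X + V) * (dt * M * (E + Y m))"
   unfolding distrib_right[of X V] using XV order_trans[OF DG_shift DG_sum, of m] by (intro add_mono mult_left_mono DG_sum)
  then show ?thesis using \<eta> dt by (intro add_right_mono mult_left_mono) auto
 qed
 also have "\<eta> / dt * ((X + V) * (dt * M * (E + Y m))) = \<eta> * ((K^4 * \<kappa>^2 + K^2 * \<sigma>^2) * cs * M) * (E + Y m)"
  using dt by (simp add: X_def V_def algebra_simps)
 also have "... <= 1/8 * (E + Y m)" using energy_consequences(1) Y_facts(1)[of m] by (intro mult_right_mono \<eta>(2)) auto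
 finally have S: "(\<Sum>n<m. \<bar>ip U (%x. N (Suc n) x - N n x) (\<Lambda> n)\<bar>) <= 1/8 * (E + Y m) + dt / (\<eta> * L) * (\<Sum>n<m. Y n)" by simp
 define Z where "Z = dt / (\<eta> * L) * (\<Sum>n<m. Y n)"
 have S': "(\<Sum>n<m. \<bar>ip U (%x. N (Suc n) x - N n x) (\<Lambda> n)\<bar>) <= 1/8 * (E + Y m) + Z" unfolding Z_def by (rule S)
 have "Y m <= Y 0 + \<bar>ip U (N m) (\<Lambda> m)\<bar> + \<bar>ip U (N 0) (\<Lambda> 0)\<bar> + (\<Sum>n<m. \<bar>ip U (%x. N (Suc n) x - N n x) (\<Lambda> n)\<bar>)"
  using test_sum[of m] by linarith
 \<comment> \<open>The shares of Y absorbed are 1/8 + 1/4 from the final term and 1/8 from the sum.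
   Half of Y remains on the left, so everything else is doubled.\<close>
 moreover have "y <= (5/2 * y0 + 4 * k + E / 2) + 2 * z"
  if "y <= y0 + p + q + s" "p <= k + (E + y) / 8 + y / 4" "q <= k + y0 / 4" "s <= 1/8 * (E + y) + z" for y y0 p q s k z :: real
  using that by (simp add: field_simps)
 ultimately have "Y m <= (5/2 * Y 0 + 4 * C0 + E / 2) + 2 * Z" using Nm N0 S' by blast
 moreover have "2 * Z = (2 / (\<eta> * L)) * dt * (\<Sum>k<m. Y k)" by (simp add: Z_def)
 ultimately show ?thesis unfolding C0_def by simp
qed

lemma W_le_Y: "W_quantity U M L dt Q n <= Y n"
proof -
 have n2: "(L2_norm U u)^2 = sq u" for u :: "real^'n => 'z::euclidean_space"
  unfolding L2_norm_def ip_self by (simp add: integral_nonneg_AE)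
 have "sq (%x. (1 / dt) *R (\<gamma> (Suc k) x - \<gamma> k x)) * dt = sq (d\<gamma> (Suc k)) / dt" for k
 proof -
  have "sq (%x. (1 / dt) *R (\<gamma> (Suc k) x - \<gamma> k x)) = (1 / dt)^2 * sq (d\<gamma> (Suc k))"
   unfolding ip_self d\<gamma>_def[abs_def] norm_scaleR power_mult_distrib by (simp add: power_divide)
  then show ?thesis using dt by (simp add: power2_eq_square)
 qed
 then have "W_quantity U M L dt Q n = L / 2 * sq (\<Lambda> n) + 1 / (2 * M) * (\<Sum>k<n. sq (d\<gamma> (Suc k)) / dt)"
  unfolding W_quantity_def n2 by simp
 also have "1 / (2 * M) * (\<Sum>k<n. sq (d\<gamma> (Suc k)) / dt) = (\<Sum>k<n. sq (d\<gamma> (Suc k))) / (dt * M) / 2"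
  by (simp add: sum_divide_distrib[symmetric])
 also have "... <= (\<Sum>k<n. sq (d\<gamma> (Suc k))) / (dt * M)"
 proof -
  have "0 <= (\<Sum>k<n. sq (d\<gamma> (Suc k))) / (dt * M)" using dt M by (auto intro!: divide_nonneg_pos sum_nonneg ip_self_nonneg)
  moreover have "t / 2 <= t" if "0 <= t" for t :: real using that by simp
  ultimately show ?thesis by blast
 qed
 finally show ?thesis by (simp add: Y_def)
qed

end

section \<open>Choice of the constants and conclusion\<close>

lemma scheme_bound:
 fixes U :: "(real^'n) set" and Q0 :: "real^'n => real^'n^'n"
 assumes card: "CARD('n) = 2 \<or> CARD('n) = 3" and op: "open U" and bd: "bounded U" and C2: "C2_boundary U"
  and M: "M > 0" and L: "L > 0" and c: "c > 0" and A0: "A0 > 0"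
  and pos: "\<forall>A :: real^'n^'n. Q_tensor A --> 2 * F_B a b c A + A0 > 0" and T: "T > 0"
 shows "\<exists>C \<tau>. \<tau> > 0 \<and> (\<forall>dt Q r H. 0 < dt \<and> dt <= \<tau> \<and> scheme_solution U bc M L a b c A0 Q0 dt Q r H -->
      (\<forall>n. int n <= \<lfloor>T / dt\<rfloor> --> W_quantity U M L dt Q n <= C))"
proof -
 obtain K where K: "K >= 0"
  "!!A :: real^'n^'n. Q_tensor A ==> norm (P_bulk a b c A0 A) <= K * (1 + norm A)"
  "!!A B :: real^'n^'n. Q_tensor A ==> Q_tensor B ==> norm (P_bulk a b c A0 A - P_bulk a b c A0 B) <= K * norm (A - B)"
  "!!A :: real^'n^'n. Q_tensor A ==> \<bar>r_aux a b c A0 A\<bar> <= K * (1 + norm A)^2"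
  "!!A B :: real^'n^'n. Q_tensor A ==> Q_tensor B ==> \<bar>r_aux a b c A0 B - r_aux a b c A0 A - P_bulk a b c A0 A \<bullet> (B - A)\<bar> <= K * (norm (B - A))^2"
  by (rule bulk_bounds[OF c A0 pos]) (rule that, blast+)
 obtain Cs where Cs: "Cs >= 0" and sob: "\<forall>(u :: real^'n => real^'n^'n) g. L2_on U u --> (\<forall>k. has_weak_pderiv U k u (g k)) --> (\<forall>k. L2_on U (g k)) -->
  integrable (lebesgue_on U) (%x. (norm (u x))^6) \<and>
  (LINT x|lebesgue_on U. (norm (u x))^6) <= Cs * ((LINT x|lebesgue_on U. (norm (u x))^2) + (\<Sum>k\<in>UNIV. LINT x|lebesgue_on U. (norm (g k x))^2))^3"
  by (rule sobolev_weak[OF card op bd C2]) (rule that)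
 let ?sq = "%u :: real^'n => real^'n^'n. ip U u u" and ?r0 = "%x. r_aux a b c A0 (Q0 x)" and ?cs = "root 3 Cs"
 \<comment> \<open>From here on the constants are built from \<open>Q0\<close>, \<open>T\<close> and
   the bounds above alone. Inside a run \<open>R.E\<close> and \<open>R.Y 0\<close> reduce to these
   values, so nothing depends on the time step.\<close>
 define E where "E = L / 2 * ip U (weak_grad U Q0) (weak_grad U Q0) + ip U ?r0 ?r0 / 2"
 define Y0 where "Y0 = L / 2 * ?sq (weak_laplacian U Q0)"
 define \<kappa> where "\<kappa> = 2 * n3 (lebesgue_on U) (%x. 1) + 2 * ?cs * (2 * ?sq Q0 + 2 * (T * M * E) + 2 * E / L)"
 define \<sigma> where "\<sigma> = K * \<kappa> + K * ?cs * (M * (E + 1))"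
 define B where "B = (K^4 * \<kappa>^2 + K^2 * \<sigma>^2) * ?cs * M"
 \<comment> \<open>Makes \<eta> B at most 1/8; adding 1 to B keeps the quotient meaningful when B =
   0.\<close>
 define \<eta> where "\<eta> = 1 / (8 * (B + 1))"
 define D where "D = 4 / L * (K^4 * \<kappa>^2 * ?cs * M)"
 define Ca where "Ca = 5/2 * Y0 + 4 * (4 / L * (K^2 * \<sigma>^2 * \<kappa>)) + E / 2"
 define Cb where "Cb = 2 / (\<eta> * L)"
 define S where "S = Ca * exp (Cb * T)"
 \<comment> \<open>The three entries ensure dt <= 1, dt D <= 1/8 for the absorption of the final
   term, and dt S <= 1 for the bootstrap.\<close>
 define \<tau> where "\<tau> = min 1 (min (1 / (8 * (D + 1))) (1 / (\<bar>S\<bar> + 1)))"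
 have nn: "?cs >= 0" "E >= 0" "Y0 >= 0" using Cs L by (auto simp: E_def Y0_def intro!: add_nonneg_nonneg mult_nonneg_nonneg ip_self_nonneg)
 then have \<kappa>0: "\<kappa> >= 0" unfolding \<kappa>_def using T M L
  by (intro add_nonneg_nonneg mult_nonneg_nonneg divide_nonneg_pos n3_nonneg ip_self_nonneg) auto
 have B: "B >= 0" and D: "D >= 0" using nn M L K(1) by (auto simp: B_def D_def)
 have \<eta>: "\<eta> > 0" "\<eta> * B <= 1/8" using B by (auto simp: \<eta>_def field_simps)
 have Ca: "Ca >= 0" unfolding Ca_def using nn \<kappa>0 L K(1) by (intro add_nonneg_nonneg mult_nonneg_nonneg) auto
 have Cb: "Cb >= 0" using \<eta> L by (simp add: Cb_def)
 have \<tau>: "\<tau> > 0" using D by (simp add: \<tau>_def)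
 have "W_quantity U M L dt Q n <= S"
  if dt: "0 < dt" "dt <= \<tau>" and sol: "scheme_solution U bc M L a b c A0 Q0 dt Q r H" and n: "int n <= \<lfloor>T / dt\<rfloor>" for dt Q r H n
 proof -
  interpret R: scheme_run U bc M L a b c A0 dt K Cs Q0 Q r H
  proof (unfold_locales, goal_cases)
   case 1 show ?case using card by auto
  next
   case (15 u g)
   show ?case by (rule sob[THEN spec, THEN spec, THEN mp, THEN mp, THEN mp, OF 15(1) 15(2) 15(3)])
  qed ((rule op bd C2 M L dt(1) sol K(1) Cs | (rule K; assumption))+)
  have Q0: "Q 0 = Q0" using sol unfolding scheme_solution_def by blast
  have "ip U (r 0) (r 0) = ip U ?r0 ?r0"
   by (rule ip_cong_AE[OF op]) (use R.scheme in \<open>eventually_elim, simp add: Q0\<close>)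
  then have E: "R.E = E" by (simp add: R.E_def E_def Q0)
  have Y0: "R.Y 0 = Y0" by (simp add: R.Y_def Y0_def Q0)
  have dt': "dt <= 1" "dt <= 1 / (8 * (D + 1))" "dt <= 1 / (\<bar>S\<bar> + 1)" using dt(2) by (auto simp: \<tau>_def)
  have "real n <= T / dt" using n by (simp add: le_floor_iff)
  then have nT: "real n * dt <= T" using dt(1) by (simp add: pos_le_divide_eq)
  have dD: "dt * D <= 1/8"
  proof -
   have "dt * D <= 1 / (8 * (D + 1)) * D" using dt'(2) D by (intro mult_right_mono) auto
   also have "... <= 1/8" using D by (simp add: field_simps)
   finally show ?thesis .
  qed
  have dS: "dt * S <= 1"
  proof -
   have "dt * S <= dt * (\<bar>S\<bar> + 1)" using dt(1) by (intro mult_left_mono) auto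
   also have "... <= 1" using dt'(3) by (simp add: pos_le_divide_eq)
   finally show ?thesis .
  qed
  have "R.Y n <= Ca * exp (Cb * T)"
  proof (rule discrete_gronwall[OF _ Ca Cb dt(1) nT dS[unfolded S_def] order_refl])
   fix m assume m: "m <= n" and small: "!!k. k < m ==> dt * R.Y k <= 1"
   have mT: "real m * dt <= T" using m nT dt(1) mult_right_mono[of "real m" "real n" dt] by linarith
   show "R.Y m <= Ca + Cb * dt * (\<Sum>k<m. R.Y k)"
    unfolding Ca_def Cb_def Y0[symmetric] E[symmetric]
    by (rule R.Y_step[OF mT dt'(1) small, where \<kappa> = \<kappa>])
     (use \<eta> dD in \<open>simp_all add: \<kappa>_def \<sigma>_def B_def D_def R.cs_def E Q0\<close>)
  qed
  then show ?thesis using R.W_le_Y[of n] unfolding S_def by linarith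
 qed
 then show ?thesis using \<tau> by blast
qed

theorem lemma3p2:
  fixes \<Omega> :: "(real^'n) set" and bc :: bdry_cond
    and M L a b c A0 :: real and Q0 :: "real^'n \<Rightarrow> real^'n^'n"
  assumes "CARD('n) = 2 \<or> CARD('n) = 3"
    and "open \<Omega>" and "bounded \<Omega>" and "C2_boundary \<Omega>"
    and "M > 0" and "L > 0" and "c > 0"
    and "A0 > 0" and "\<forall>A :: real^'n^'n. Q_tensor A \<longrightarrow> 2 * F_B a b c A + A0 > 0"
    and "H2 \<Omega> Q0" and "AE x in lebesgue_on \<Omega>. Q_tensor (Q0 x)" and "satisfies_bc \<Omega> bc Q0"
  shows "\<exists>C :: real \<Rightarrow> real \<Rightarrow> real. \<forall>T>0. \<exists>\<tau>>0. \<forall>dt Q r H.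
           0 < dt \<and> dt \<le> \<tau> \<and> scheme_solution \<Omega> bc M L a b c A0 Q0 dt Q r H \<longrightarrow>
           (\<forall>n. 1 \<le> n \<and> int n \<le> \<lfloor>T / dt\<rfloor> \<longrightarrow>
              W_quantity \<Omega> M L dt Q n \<le> C (W_quantity \<Omega> M L dt Q 0) T)"
  proof -
  have "\<forall>T. \<exists>C. T > 0 \<longrightarrow> (\<exists>\<tau>>0. \<forall>dt Q r H. 0 < dt \<and> dt \<le> \<tau> \<and> scheme_solution \<Omega> bc M L a b c A0 Q0 dt Q r H \<longrightarrow>
           (\<forall>n. int n \<le> \<lfloor>T / dt\<rfloor> \<longrightarrow> W_quantity \<Omega> M L dt Q n \<le> C))"
    using scheme_bound[OF assms(1-9)] by meson
  then obtain C where C: "\<forall>T. T > 0 \<longrightarrow> (\<exists>\<tau>>0. \<forall>dt Q r H. 0 < dt \<and> dt \<le> \<tau> \<and> scheme_solution \<Omega> bc M L a b c A0 Q0 dt Q r H \<longrightarrow>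
           (\<forall>n. int n \<le> \<lfloor>T / dt\<rfloor> \<longrightarrow> W_quantity \<Omega> M L dt Q n \<le> C T))"
    by (rule choice[THEN exE])
  show ?thesis
  \<comment> \<open>\<open>Q0\<close> is a fixed datum and determines W_0, so the bound obtained for
    it serves as a function constant in its first argument.\<close>
  proof (intro exI[of _ "\<lambda>_. C"] allI impI)
    fix T :: real assume "T > 0"
    from C[rule_format, OF this] obtain \<tau> where "\<tau> > 0" and t: "\<forall>dt Q r H. 0 < dt \<and> dt \<le> \<tau> \<and> scheme_solution \<Omega> bc M L a b c A0 Q0 dt Q r H \<longrightarrow>
           (\<forall>n. int n \<le> \<lfloor>T / dt\<rfloor> \<longrightarrow> W_quantity \<Omega> M L dt Q n \<le> C T)"
      by (elim exE conjE) (rule that)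
    show "\<exists>\<tau>>0. \<forall>dt Q r H. 0 < dt \<and> dt \<le> \<tau> \<and> scheme_solution \<Omega> bc M L a b c A0 Q0 dt Q r H \<longrightarrow>
        (\<forall>n. 1 \<le> n \<and> int n \<le> \<lfloor>T / dt\<rfloor> \<longrightarrow> W_quantity \<Omega> M L dt Q n \<le> C T)"
    proof (intro exI[of _ \<tau>] conjI allI impI)
      fix dt Q r H n
      assume "0 < dt \<and> dt \<le> \<tau> \<and> scheme_solution \<Omega> bc M L a b c A0 Q0 dt Q r H" "1 \<le> n \<and> int n \<le> \<lfloor>T / dt\<rfloor>"
      then show "W_quantity \<Omega> M L dt Q n \<le> C T" by (intro t[rule_format]) auto
    qed fact
  qed
qed


end
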